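(* Let $H$ and $K$ be arbitrary Hilbert spaces. Then: (i) the right contractive modules $L^{c}\otimes H$ and $L^{c}\mathbin{\dot\otimes}H$ are ESR-flat; (ii) the contractive bimodules $(L\otimes H)\otimes_p(L^{c}\otimes K)$, $(L\mathbin{\dot\otimes}H)\otimes_p(L^{c}\mathbin{\dot\otimes}K)$, and the completion $(L\mathbin{\dot\otimes}H)\mathbin{\widehat\otimes_p}(L^{c}\mathbin{\dot\otimes}K)$ of the latter, are ER-flat.
   Context: All spaces are complex; normed spaces need not be complete. $L$ is a fixed separable infinite-dimensional Hilbert space, $\mathcal B=\mathcal B(L)$ is the algebra of all bounded operators on $L$ with operator norm. "Left module", "right module", "bimodule" mean unital (bi)modules over $\mathcal B$; morphisms are $\mathcal B$-(bi)module morphisms. Module multiplications are denoted by a dot. A projection is a self-adjoint idempotent in $\mathcal B$. "Isometric" means norm-preserving (not necessarily surjective). A left (right) module that is a normed space is contractive if $\|a\cdot u\|\le\|a\|\|u\|$ (resp. $\|u\cdot a\|\le\|a\|\|u\|$) always; a bimodule is contractive if both hold. A left (right) support of $u$ is a projection $P$ with $P\cdot u=u$ (resp. $u\cdot P=u$); in a bimodule, a support of $u$ is a projection that is both a left and a right support. A left semi-Ruan module is a contractive left module such that $\|u+v\|\le(\|u\|^2+\|v\|^2)^{1/2}$ whenever $u,v$ have orthogonal left supports (i.e. admit left supports $P,Q$ respectively with $PQ=0$). A Ruan bimodule is a contractive bimodule such that $\|u+v\|=\max\{\|u\|,\|v\|\}$ whenever $u,v$ have orthogonal supports. $\otimes_p$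 is the non-completed projective tensor product of normed spaces. For a contractive right module $X$ and left module $Y$, $X\otimes_{\mathcal B}Y:=(X\otimes_pY)/N_1$ with $N_1$ the closure of $\mathrm{span}\{x\cdot a\otimes y-x\otimes a\cdot y\}$. For contractive bimodules $X,Y$, $X\otimes_{\mathcal B-\mathcal B}Y:=(X\otimes_pY)/N_2$ with $N_2$ the closure of $\mathrm{span}\{a\cdot x\otimes y-x\otimes y\cdot a,\ x\cdot a\otimes y-x\otimes a\cdot y\}$. Both carry quotient norms, and bounded (bi)module morphisms $\alpha,\beta$ induce bounded operators $\alpha\otimes_{\mathcal B}\beta$, $\alpha\otimes_{\mathcal B-\mathcal B}\beta$ acting on elementary tensors as $\alpha\otimes\beta$. A contractive right module $X$ is ESR-flat if for every isometric morphism $\alpha:Y\to Z$ of left semi-Ruan modules the operator $\mathbf 1_X\otimes_{\mathcal B}\alpha:X\otimes_{\mathcal B}Y\to X\otimes_{\mathcal B}Z$ is isometric. A contractive bimodule $X$ is ER-flat if for every isometric morphism $\alpha:Y\to Z$ of Ruan bimodules the operator $\alpha\otimes_{\mathcal B-\mathcal B}\mathbf 1_X:Y\otimes_{\mathcal B-\mathcal B}X\to Z\otimes_{\mathcal B-\mathcal B}X$ is isometric. $L^c$ is the complex conjugate Hilbert space of $L$; operators on $L$ are also linear operators on $L^c$. $\dot\otimes$ is the Hilbert (completed) tensor product of Hilbert spaces and operators. $L\mathbin{\dot\otimes}H$ is a contractive left module via $a\cdot\zeta=(a\mathbin{\dot\otimes}\mathbf 1_H)\zeta$, and $L^c\mathbin{\dot\otimes}H$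 is a contractive right module via $\zeta\cdot a=(a^*\mathbin{\dot\otimes}\mathbf 1_H)\zeta$. $L\otimes H$ and $L^c\otimes H$ (algebraic tensor products) are regarded as submodules of these with the induced norm. For a left contractive module $X$ and right contractive module $Y$, $X\otimes_pY$ is a contractive bimodule via $a\cdot(x\otimes y)=(a\cdot x)\otimes y$, $(x\otimes y)\cdot a=x\otimes(y\cdot a)$; its completion carries the extended bimodule structure. *)

theory Defs
  imports
    Complex_Main
    "HOL-Algebra.Module"
    "HOL-Algebra.AbelCoset"
    "HOL-Library.Poly_Mapping"
    "HOL-Library.FuncSet"
    "HOL-Library.Countable_Set"
begin

section \<open>Complex vector spaces, normed spaces, Hilbert spaces\<close>

text \<open>
  Complex vector spaces are the carrier-based modules of HOL-Algebra over the field of complex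
  numbers.  The \<open>module\<close> record has the components \<open>mult\<close> and \<open>one\<close>, which are
  irrelevant for modules and left \<open>undefined\<close> below.
\<close>

definition complex_ring :: "complex ring" where
  "complex_ring = \<lparr>carrier = UNIV, mult = (*), one = 1, zero = 0, add = (+)\<rparr>"

definition cspan :: "(complex, 'v, 'm) module_scheme \<Rightarrow> 'v set \<Rightarrow> 'v set" where
  "cspan V S = (\<lambda>W. submodule W complex_ring V) hull S"

definition clinear_on ::
  "(complex, 'v, 'm) module_scheme \<Rightarrow> (complex, 'w, 'n) module_scheme \<Rightarrow> ('v \<Rightarrow> 'w) \<Rightarrow> bool" where
  "clinear_on V W f \<longleftrightarrow> f \<in> carrier V \<rightarrow> carrier W \<and>
     (\<forall>x\<in>carrier V. \<forall>y\<in>carrier V. f (x \<oplus>\<^bsub>V\<^esub> y) = f x \<oplus>\<^bsub>W\<^esub> f y) \<and>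
     (\<forall>c. \<forall>x\<in>carrier V. f (c \<odot>\<^bsub>V\<^esub> x) = c \<odot>\<^bsub>W\<^esub> f x)"

record 'v cnormed_space = "(complex, 'v) module" +
  nrm :: "'v \<Rightarrow> real"

locale complex_normed_space = module complex_ring V
  for V :: "('v, 'm) cnormed_space_scheme" (structure) +
  assumes nrm_eq_0_iff: "x \<in> carrier V \<Longrightarrow> nrm V x = 0 \<longleftrightarrow> x = \<zero>"
    and nrm_triangle: "x \<in> carrier V \<Longrightarrow> y \<in> carrier V \<Longrightarrow> nrm V (x \<oplus> y) \<le> nrm V x + nrm V y"
    and nrm_smult: "x \<in> carrier V \<Longrightarrow> nrm V (c \<odot> x) = cmod c * nrm V x"

definition isometric_on ::
  "('v, 'm) cnormed_space_scheme \<Rightarrow> ('w, 'n) cnormed_space_scheme \<Rightarrow> ('v \<Rightarrow> 'w) \<Rightarrow> bool" where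
  "isometric_on V W f \<longleftrightarrow> (\<forall>u\<in>carrier V. nrm W (f u) = nrm V u)"

definition nclosure :: "('v, 'm) cnormed_space_scheme \<Rightarrow> 'v set \<Rightarrow> 'v set" where
  "nclosure V S = {v \<in> carrier V. \<forall>e>0. \<exists>s\<in>S. nrm V (v \<ominus>\<^bsub>V\<^esub> s) < e}"

definition cauchy_seqs :: "('v, 'm) cnormed_space_scheme \<Rightarrow> (nat \<Rightarrow> 'v) set" where
  "cauchy_seqs V = {s. range s \<subseteq> carrier V \<and>
     (\<forall>e>0. \<exists>M. \<forall>m\<ge>M. \<forall>n\<ge>M. nrm V (s m \<ominus>\<^bsub>V\<^esub> s n) < e)}"

definition complete_normed :: "('v, 'm) cnormed_space_scheme \<Rightarrow> bool" where
  "complete_normed V \<longleftrightarrow>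
     (\<forall>s\<in>cauchy_seqs V. \<exists>v\<in>carrier V. (\<lambda>n. nrm V (s n \<ominus>\<^bsub>V\<^esub> v)) \<longlonglongrightarrow> 0)"

definition separable_normed :: "('v, 'm) cnormed_space_scheme \<Rightarrow> bool" where
  "separable_normed V \<longleftrightarrow>
     (\<exists>D. countable D \<and> D \<subseteq> carrier V \<and> nclosure V D = carrier V)"

definition infinite_dimensional :: "(complex, 'v, 'm) module_scheme \<Rightarrow> bool" where
  "infinite_dimensional V \<longleftrightarrow>
     \<not> (\<exists>S. finite S \<and> S \<subseteq> carrier V \<and> cspan V S = carrier V)"

record 'v cinner_space = "(complex, 'v) module" +
  ip :: "'v \<Rightarrow> 'v \<Rightarrow> complex"

definition normed_of :: "'v cinner_space \<Rightarrow> 'v cnormed_space" where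
  "normed_of V = module.extend (module.truncate V)
     (cnormed_space.fields (\<lambda>x. sqrt (Re (ip V x x))))"

text \<open>Inner products are linear in the first argument.\<close>

locale hilbert_space = module complex_ring V
  for V :: "'v cinner_space" (structure) +
  assumes ip_add_left: "x \<in> carrier V \<Longrightarrow> y \<in> carrier V \<Longrightarrow> z \<in> carrier V \<Longrightarrow>
      ip V (x \<oplus> y) z = ip V x z + ip V y z"
    and ip_smult_left: "x \<in> carrier V \<Longrightarrow> y \<in> carrier V \<Longrightarrow> ip V (c \<odot> x) y = c * ip V x y"
    and ip_cnj: "x \<in> carrier V \<Longrightarrow> y \<in> carrier V \<Longrightarrow> ip V y x = cnj (ip V x y)"
    and ip_nonneg: "x \<in> carrier V \<Longrightarrow> 0 \<le> Re (ip V x x)"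
    and ip_definite: "x \<in> carrier V \<Longrightarrow> ip V x x = 0 \<Longrightarrow> x = \<zero>"
    and complete: "complete_normed (normed_of V)"

definition conj_space :: "'v cinner_space \<Rightarrow> 'v cinner_space" where
  "conj_space V = V\<lparr>smult := \<lambda>c. smult V (cnj c), ip := \<lambda>x y. ip V y x\<rparr>"


section \<open>Quotients and completions\<close>

text \<open>
  Quotients by a submodule \<open>N\<close> consist of cosets.  In the scalar multiplication \<open>N\<close> is
  added so that the formula is also correct for the scalar \<open>0\<close>.
\<close>

definition quotient_module ::
  "(complex, 'v, 'm) module_scheme \<Rightarrow> 'v set \<Rightarrow> (complex, 'v set) module" where
  "quotient_module V N = \<lparr>carrier = a_rcosets\<^bsub>V\<^esub> N, mult = undefined, one = undefined,
     zero = N, add = (\<lambda>A B. A <+>\<^bsub>V\<^esub> B), smult = (\<lambda>c A. (smult V c ` A) <+>\<^bsub>V\<^esub> N)\<rparr>"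

definition quotient_normed ::
  "('v, 'm) cnormed_space_scheme \<Rightarrow> 'v set \<Rightarrow> 'v set cnormed_space" where
  "quotient_normed V N = module.extend (quotient_module V N)
     (cnormed_space.fields (\<lambda>A. Inf (nrm V ` A)))"

text \<open>
  The map into a quotient of \<open>W\<close> by \<open>N\<close> induced by \<open>f\<close>: for a linear map \<open>f\<close> into \<open>W\<close>
  which maps a submodule \<open>M\<close> into \<open>N\<close>, the coset of \<open>v\<close> modulo \<open>M\<close> is sent to the
  coset of \<open>f v\<close> modulo \<open>N\<close>.
\<close>

definition quotient_map ::
  "(complex, 'w, 'm) module_scheme \<Rightarrow> 'w set \<Rightarrow> ('v \<Rightarrow> 'w) \<Rightarrow> 'v set \<Rightarrow> 'w set" where
  "quotient_map W N f A = (f ` A) <+>\<^bsub>W\<^esub> N"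

text \<open>
  The completion is the space of Cauchy sequences, seminormed by the limit of the norms, modulo
  the null sequences.
\<close>

definition cauchy_space ::
  "('v, 'm) cnormed_space_scheme \<Rightarrow> (nat \<Rightarrow> 'v) cnormed_space" where
  "cauchy_space V = \<lparr>carrier = cauchy_seqs V, mult = undefined, one = undefined,
     zero = (\<lambda>n. \<zero>\<^bsub>V\<^esub>), add = (\<lambda>s t n. s n \<oplus>\<^bsub>V\<^esub> t n),
     smult = (\<lambda>c s n. c \<odot>\<^bsub>V\<^esub> s n), nrm = (\<lambda>s. lim (\<lambda>n. nrm V (s n)))\<rparr>"

definition null_seqs :: "('v, 'm) cnormed_space_scheme \<Rightarrow> (nat \<Rightarrow> 'v) set" where
  "null_seqs V = {s \<in> cauchy_seqs V. (\<lambda>n. nrm V (s n)) \<longlonglongrightarrow> 0}"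

definition completion ::
  "('v, 'm) cnormed_space_scheme \<Rightarrow> (nat \<Rightarrow> 'v) set cnormed_space" where
  "completion V = quotient_normed (cauchy_space V) (null_seqs V)"

definition completion_embed ::
  "('v, 'm) cnormed_space_scheme \<Rightarrow> 'v \<Rightarrow> (nat \<Rightarrow> 'v) set" where
  "completion_embed V v = null_seqs V +>\<^bsub>cauchy_space V\<^esub> (\<lambda>n. v)"

text \<open>The extension by continuity of a bounded operator \<open>f\<close> on \<open>V\<close> to the completion.\<close>

definition completion_map ::
  "('v, 'm) cnormed_space_scheme \<Rightarrow> ('v \<Rightarrow> 'v) \<Rightarrow> (nat \<Rightarrow> 'v) set \<Rightarrow> (nat \<Rightarrow> 'v) set" where
  "completion_map V f = quotient_map (cauchy_space V) (null_seqs V) (\<lambda>s n. f (s n))"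


section \<open>Tensor products\<close>

text \<open>
  The algebraic tensor product is the free complex vector space on pairs modulo the bilinearity
  relations.
\<close>

definition free_module :: "'s set \<Rightarrow> (complex, 's \<Rightarrow>\<^sub>0 complex) module" where
  "free_module S = \<lparr>carrier = {f. Poly_Mapping.keys f \<subseteq> S}, mult = undefined, one = undefined,
     zero = 0, add = (+), smult = (\<lambda>c. Poly_Mapping.map ((*) c))\<rparr>"

definition bilinear_relations ::
  "(complex, 'x, 'm) module_scheme \<Rightarrow> (complex, 'y, 'n) module_scheme \<Rightarrow> ('x \<times> 'y \<Rightarrow>\<^sub>0 complex) set" where
  "bilinear_relations X Y =
     {Poly_Mapping.single (x \<oplus>\<^bsub>X\<^esub> x', y) 1 - Poly_Mapping.single (x, y) 1 - Poly_Mapping.single (x', y) 1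
        | x x' y. x \<in> carrier X \<and> x' \<in> carrier X \<and> y \<in> carrier Y} \<union>
     {Poly_Mapping.single (x, y \<oplus>\<^bsub>Y\<^esub> y') 1 - Poly_Mapping.single (x, y) 1 - Poly_Mapping.single (x, y') 1
        | x y y'. x \<in> carrier X \<and> y \<in> carrier Y \<and> y' \<in> carrier Y} \<union>
     {Poly_Mapping.single (c \<odot>\<^bsub>X\<^esub> x, y) 1 - Poly_Mapping.single (x, y) c
        | c x y. x \<in> carrier X \<and> y \<in> carrier Y} \<union>
     {Poly_Mapping.single (x, c \<odot>\<^bsub>Y\<^esub> y) 1 - Poly_Mapping.single (x, y) c
        | c x y. x \<in> carrier X \<and> y \<in> carrier Y}"

definition tensor_kernel ::
  "(complex, 'x, 'm) module_scheme \<Rightarrow> (complex, 'y, 'n) module_scheme \<Rightarrow> ('x \<times> 'y \<Rightarrow>\<^sub>0 complex) set" where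
  "tensor_kernel X Y = cspan (free_module (carrier X \<times> carrier Y)) (bilinear_relations X Y)"

definition alg_tensor ::
  "(complex, 'x, 'm) module_scheme \<Rightarrow> (complex, 'y, 'n) module_scheme \<Rightarrow>
    (complex, ('x \<times> 'y \<Rightarrow>\<^sub>0 complex) set) module" where
  "alg_tensor X Y = quotient_module (free_module (carrier X \<times> carrier Y)) (tensor_kernel X Y)"

definition elem_tensor ::
  "(complex, 'x, 'm) module_scheme \<Rightarrow> (complex, 'y, 'n) module_scheme \<Rightarrow> 'x \<Rightarrow> 'y \<Rightarrow>
    ('x \<times> 'y \<Rightarrow>\<^sub>0 complex) set" where
  "elem_tensor X Y x y =
     tensor_kernel X Y +>\<^bsub>free_module (carrier X \<times> carrier Y)\<^esub> Poly_Mapping.single (x, y) 1"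

text \<open>
  The operator \<open>f \<otimes> g\<close>; the parameters \<open>X\<close> and \<open>Y\<close> are the codomains of \<open>f\<close> and
  \<open>g\<close>.
\<close>

definition tensor_map ::
  "(complex, 'x, 'm) module_scheme \<Rightarrow> (complex, 'y, 'n) module_scheme \<Rightarrow> ('v \<Rightarrow> 'x) \<Rightarrow> ('w \<Rightarrow> 'y) \<Rightarrow>
    ('v \<times> 'w \<Rightarrow>\<^sub>0 complex) set \<Rightarrow> ('x \<times> 'y \<Rightarrow>\<^sub>0 complex) set" where
  "tensor_map X Y f g = quotient_map (free_module (carrier X \<times> carrier Y)) (tensor_kernel X Y)
     (\<lambda>p. \<Sum>k\<in>Poly_Mapping.keys p.
        Poly_Mapping.single (map_prod f g k) (Poly_Mapping.lookup p k))"

definition proj_norm ::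
  "('x, 'm) cnormed_space_scheme \<Rightarrow> ('y, 'n) cnormed_space_scheme \<Rightarrow>
    ('x \<times> 'y \<Rightarrow>\<^sub>0 complex) set \<Rightarrow> real" where
  "proj_norm X Y u = Inf {\<Sum>i<n. nrm X (x i) * nrm Y (y i) | (n::nat) x y.
     x \<in> {..<n} \<rightarrow> carrier X \<and> y \<in> {..<n} \<rightarrow> carrier Y \<and>
     u = (\<Oplus>\<^bsub>alg_tensor X Y\<^esub> i \<in> {..<n}. elem_tensor X Y (x i) (y i))}"

definition proj_tensor ::
  "('x, 'm) cnormed_space_scheme \<Rightarrow> ('y, 'n) cnormed_space_scheme \<Rightarrow>
    ('x \<times> 'y \<Rightarrow>\<^sub>0 complex) set cnormed_space" where
  "proj_tensor X Y = module.extend (alg_tensor X Y) (cnormed_space.fields (proj_norm X Y))"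

text \<open>
  The algebraic tensor product of Hilbert spaces with the inner product determined by
  \<open>\<langle>x \<otimes> y, x' \<otimes> y'\<rangle> = \<langle>x, x'\<rangle> \<langle>y, y'\<rangle>\<close>; it does not depend on the choice of the
  representatives \<open>p\<close> and \<open>q\<close> of the two cosets.
\<close>

definition inner_tensor ::
  "'x cinner_space \<Rightarrow> 'y cinner_space \<Rightarrow> ('x \<times> 'y \<Rightarrow>\<^sub>0 complex) set cinner_space" where
  "inner_tensor X Y = module.extend (alg_tensor X Y) (cinner_space.fields
     (\<lambda>A B. let p = (SOME p. p \<in> A); q = (SOME q. q \<in> B) in
        \<Sum>(x, y)\<in>Poly_Mapping.keys p. \<Sum>(x', y')\<in>Poly_Mapping.keys q.
          Poly_Mapping.lookup p (x, y) * cnj (Poly_Mapping.lookup q (x', y')) *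
          ip X x x' * ip Y y y'))"

text \<open>
  The Hilbert tensor product (of which only the normed space structure is needed), and the
  algebraic tensor product as a subspace of it.
\<close>

definition hilbert_tensor ::
  "'x cinner_space \<Rightarrow> 'y cinner_space \<Rightarrow> (nat \<Rightarrow> ('x \<times> 'y \<Rightarrow>\<^sub>0 complex) set) set cnormed_space" where
  "hilbert_tensor X Y = completion (normed_of (inner_tensor X Y))"

definition alg_hilbert_tensor ::
  "'x cinner_space \<Rightarrow> 'y cinner_space \<Rightarrow> (nat \<Rightarrow> ('x \<times> 'y \<Rightarrow>\<^sub>0 complex) set) set cnormed_space" where
  "alg_hilbert_tensor X Y = (hilbert_tensor X Y)
     \<lparr>carrier := completion_embed (normed_of (inner_tensor X Y)) ` carrier (alg_tensor X Y)\<rparr>"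

text \<open>The operator \<open>f \<otimes> 1\<close> on the Hilbert tensor product of \<open>X\<close> and \<open>Y\<close>.\<close>

definition ampliation ::
  "'x cinner_space \<Rightarrow> 'y cinner_space \<Rightarrow> ('x \<Rightarrow> 'x) \<Rightarrow>
    (nat \<Rightarrow> ('x \<times> 'y \<Rightarrow>\<^sub>0 complex) set) set \<Rightarrow> (nat \<Rightarrow> ('x \<times> 'y \<Rightarrow>\<^sub>0 complex) set) set" where
  "ampliation X Y f =
     completion_map (normed_of (inner_tensor X Y)) (tensor_map X Y f (\<lambda>y. y))"


section \<open>The algebra of bounded operators\<close>

text \<open>Operators are extensional functions, so that they are determined by their values on the carrier.\<close>

definition bounded_ops :: "'l cinner_space \<Rightarrow> ('l \<Rightarrow> 'l) set" where
  "bounded_ops L = {a \<in> extensional (carrier L). clinear_on L L a \<and>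
     (\<exists>C. \<forall>x\<in>carrier L. nrm (normed_of L) (a x) \<le> C * nrm (normed_of L) x)}"

definition op_norm :: "'l cinner_space \<Rightarrow> ('l \<Rightarrow> 'l) \<Rightarrow> real" where
  "op_norm L a = Sup {nrm (normed_of L) (a x) | x. x \<in> carrier L \<and> nrm (normed_of L) x \<le> 1}"

definition adjoint_op :: "'l cinner_space \<Rightarrow> ('l \<Rightarrow> 'l) \<Rightarrow> ('l \<Rightarrow> 'l)" where
  "adjoint_op L a = (THE b. b \<in> bounded_ops L \<and>
     (\<forall>x\<in>carrier L. \<forall>y\<in>carrier L. ip L (a x) y = ip L x (b y)))"

definition projections :: "'l cinner_space \<Rightarrow> ('l \<Rightarrow> 'l) set" where
  "projections L = {p \<in> bounded_ops L. compose (carrier L) p p = p \<and> adjoint_op L p = p}"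

definition orthogonal_ops :: "'l cinner_space \<Rightarrow> ('l \<Rightarrow> 'l) \<Rightarrow> ('l \<Rightarrow> 'l) \<Rightarrow> bool" where
  "orthogonal_ops L p q \<longleftrightarrow> compose (carrier L) p q = (\<lambda>x\<in>carrier L. \<zero>\<^bsub>L\<^esub>)"


section \<open>Modules over the algebra of bounded operators\<close>

text \<open>
  A left or right module is a normed space together with its outer multiplication; the values of
  the multiplication outside the carrier and for non-operators are irrelevant.
\<close>

locale contractive_left_module = complex_normed_space V
  for L :: "'l cinner_space" and V :: "'v cnormed_space" (structure)
    and l :: "('l \<Rightarrow> 'l) \<Rightarrow> 'v \<Rightarrow> 'v" +
  assumes lact_linear: "a \<in> bounded_ops L \<Longrightarrow> clinear_on V V (l a)"
    and lact_add: "a \<in> bounded_ops L \<Longrightarrow> b \<in> bounded_ops L \<Longrightarrow> u \<in> carrier V \<Longrightarrow>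
      l (\<lambda>x\<in>carrier L. a x \<oplus>\<^bsub>L\<^esub> b x) u = l a u \<oplus> l b u"
    and lact_smult: "a \<in> bounded_ops L \<Longrightarrow> u \<in> carrier V \<Longrightarrow>
      l (\<lambda>x\<in>carrier L. c \<odot>\<^bsub>L\<^esub> a x) u = c \<odot> l a u"
    and lact_compose: "a \<in> bounded_ops L \<Longrightarrow> b \<in> bounded_ops L \<Longrightarrow> u \<in> carrier V \<Longrightarrow>
      l (compose (carrier L) a b) u = l a (l b u)"
    and lact_one: "u \<in> carrier V \<Longrightarrow> l (\<lambda>x\<in>carrier L. x) u = u"
    and lact_contractive: "a \<in> bounded_ops L \<Longrightarrow> u \<in> carrier V \<Longrightarrow>
      nrm V (l a u) \<le> op_norm L a * nrm V u"

locale contractive_right_module = complex_normed_space V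
  for L :: "'l cinner_space" and V :: "'v cnormed_space" (structure)
    and r :: "'v \<Rightarrow> ('l \<Rightarrow> 'l) \<Rightarrow> 'v" +
  assumes ract_linear: "a \<in> bounded_ops L \<Longrightarrow> clinear_on V V (\<lambda>u. r u a)"
    and ract_add: "a \<in> bounded_ops L \<Longrightarrow> b \<in> bounded_ops L \<Longrightarrow> u \<in> carrier V \<Longrightarrow>
      r u (\<lambda>x\<in>carrier L. a x \<oplus>\<^bsub>L\<^esub> b x) = r u a \<oplus> r u b"
    and ract_smult: "a \<in> bounded_ops L \<Longrightarrow> u \<in> carrier V \<Longrightarrow>
      r u (\<lambda>x\<in>carrier L. c \<odot>\<^bsub>L\<^esub> a x) = c \<odot> r u a"
    and ract_compose: "a \<in> bounded_ops L \<Longrightarrow> b \<in> bounded_ops L \<Longrightarrow> u \<in> carrier V \<Longrightarrow>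
      r u (compose (carrier L) a b) = r (r u a) b"
    and ract_one: "u \<in> carrier V \<Longrightarrow> r u (\<lambda>x\<in>carrier L. x) = u"
    and ract_contractive: "a \<in> bounded_ops L \<Longrightarrow> u \<in> carrier V \<Longrightarrow>
      nrm V (r u a) \<le> nrm V u * op_norm L a"

locale contractive_bimodule =
  contractive_left_module L V l + contractive_right_module L V r
  for L :: "'l cinner_space" and V :: "'v cnormed_space" (structure)
    and l :: "('l \<Rightarrow> 'l) \<Rightarrow> 'v \<Rightarrow> 'v" and r :: "'v \<Rightarrow> ('l \<Rightarrow> 'l) \<Rightarrow> 'v" +
  assumes act_assoc: "a \<in> bounded_ops L \<Longrightarrow> b \<in> bounded_ops L \<Longrightarrow> u \<in> carrier V \<Longrightarrow>
      r (l a u) b = l a (r u b)"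

locale left_semi_ruan_module = contractive_left_module L V l
  for L :: "'l cinner_space" and V :: "'v cnormed_space" (structure)
    and l :: "('l \<Rightarrow> 'l) \<Rightarrow> 'v \<Rightarrow> 'v" +
  assumes semi_ruan: "u \<in> carrier V \<Longrightarrow> v \<in> carrier V \<Longrightarrow>
      p \<in> projections L \<Longrightarrow> q \<in> projections L \<Longrightarrow> orthogonal_ops L p q \<Longrightarrow>
      l p u = u \<Longrightarrow> l q v = v \<Longrightarrow>
      nrm V (u \<oplus> v) \<le> sqrt ((nrm V u)\<^sup>2 + (nrm V v)\<^sup>2)"

locale ruan_bimodule = contractive_bimodule L V l r
  for L :: "'l cinner_space" and V :: "'v cnormed_space" (structure)
    and l :: "('l \<Rightarrow> 'l) \<Rightarrow> 'v \<Rightarrow> 'v" and r :: "'v \<Rightarrow> ('l \<Rightarrow> 'l) \<Rightarrow> 'v" +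
  assumes ruan: "u \<in> carrier V \<Longrightarrow> v \<in> carrier V \<Longrightarrow>
      p \<in> projections L \<Longrightarrow> q \<in> projections L \<Longrightarrow> orthogonal_ops L p q \<Longrightarrow>
      l p u = u \<Longrightarrow> r u p = u \<Longrightarrow> l q v = v \<Longrightarrow> r v q = v \<Longrightarrow>
      nrm V (u \<oplus> v) = max (nrm V u) (nrm V v)"

definition left_morphism ::
  "'l cinner_space \<Rightarrow> 'v cnormed_space \<Rightarrow> (('l \<Rightarrow> 'l) \<Rightarrow> 'v \<Rightarrow> 'v) \<Rightarrow>
    'w cnormed_space \<Rightarrow> (('l \<Rightarrow> 'l) \<Rightarrow> 'w \<Rightarrow> 'w) \<Rightarrow> ('v \<Rightarrow> 'w) \<Rightarrow> bool" where
  "left_morphism L V lV W lW f \<longleftrightarrow> clinear_on V W f \<and>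
     (\<forall>a\<in>bounded_ops L. \<forall>u\<in>carrier V. f (lV a u) = lW a (f u))"

definition right_morphism ::
  "'l cinner_space \<Rightarrow> 'v cnormed_space \<Rightarrow> ('v \<Rightarrow> ('l \<Rightarrow> 'l) \<Rightarrow> 'v) \<Rightarrow>
    'w cnormed_space \<Rightarrow> ('w \<Rightarrow> ('l \<Rightarrow> 'l) \<Rightarrow> 'w) \<Rightarrow> ('v \<Rightarrow> 'w) \<Rightarrow> bool" where
  "right_morphism L V rV W rW f \<longleftrightarrow> clinear_on V W f \<and>
     (\<forall>a\<in>bounded_ops L. \<forall>u\<in>carrier V. f (rV u a) = rW (f u) a)"


section \<open>Tensor products over the algebra and flatness\<close>

definition balanced_kernel ::
  "'l cinner_space \<Rightarrow> 'x cnormed_space \<Rightarrow> ('x \<Rightarrow> ('l \<Rightarrow> 'l) \<Rightarrow> 'x) \<Rightarrow>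
    'y cnormed_space \<Rightarrow> (('l \<Rightarrow> 'l) \<Rightarrow> 'y \<Rightarrow> 'y) \<Rightarrow> ('x \<times> 'y \<Rightarrow>\<^sub>0 complex) set set" where
  "balanced_kernel L X rX Y lY = nclosure (proj_tensor X Y) (cspan (proj_tensor X Y)
     {elem_tensor X Y (rX x a) y \<ominus>\<^bsub>proj_tensor X Y\<^esub> elem_tensor X Y x (lY a y)
        | a x y. a \<in> bounded_ops L \<and> x \<in> carrier X \<and> y \<in> carrier Y})"

definition balanced_tensor ::
  "'l cinner_space \<Rightarrow> 'x cnormed_space \<Rightarrow> ('x \<Rightarrow> ('l \<Rightarrow> 'l) \<Rightarrow> 'x) \<Rightarrow>
    'y cnormed_space \<Rightarrow> (('l \<Rightarrow> 'l) \<Rightarrow> 'y \<Rightarrow> 'y) \<Rightarrow> ('x \<times> 'y \<Rightarrow>\<^sub>0 complex) set set cnormed_space" where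
  "balanced_tensor L X rX Y lY = quotient_normed (proj_tensor X Y) (balanced_kernel L X rX Y lY)"

definition bibalanced_kernel ::
  "'l cinner_space \<Rightarrow>
    'x cnormed_space \<Rightarrow> (('l \<Rightarrow> 'l) \<Rightarrow> 'x \<Rightarrow> 'x) \<Rightarrow> ('x \<Rightarrow> ('l \<Rightarrow> 'l) \<Rightarrow> 'x) \<Rightarrow>
    'y cnormed_space \<Rightarrow> (('l \<Rightarrow> 'l) \<Rightarrow> 'y \<Rightarrow> 'y) \<Rightarrow> ('y \<Rightarrow> ('l \<Rightarrow> 'l) \<Rightarrow> 'y) \<Rightarrow>
    ('x \<times> 'y \<Rightarrow>\<^sub>0 complex) set set" where
  "bibalanced_kernel L X lX rX Y lY rY = nclosure (proj_tensor X Y) (cspan (proj_tensor X Y)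
     ({elem_tensor X Y (lX a x) y \<ominus>\<^bsub>proj_tensor X Y\<^esub> elem_tensor X Y x (rY y a)
        | a x y. a \<in> bounded_ops L \<and> x \<in> carrier X \<and> y \<in> carrier Y} \<union>
      {elem_tensor X Y (rX x a) y \<ominus>\<^bsub>proj_tensor X Y\<^esub> elem_tensor X Y x (lY a y)
        | a x y. a \<in> bounded_ops L \<and> x \<in> carrier X \<and> y \<in> carrier Y}))"

definition bibalanced_tensor ::
  "'l cinner_space \<Rightarrow>
    'x cnormed_space \<Rightarrow> (('l \<Rightarrow> 'l) \<Rightarrow> 'x \<Rightarrow> 'x) \<Rightarrow> ('x \<Rightarrow> ('l \<Rightarrow> 'l) \<Rightarrow> 'x) \<Rightarrow>
    'y cnormed_space \<Rightarrow> (('l \<Rightarrow> 'l) \<Rightarrow> 'y \<Rightarrow> 'y) \<Rightarrow> ('y \<Rightarrow> ('l \<Rightarrow> 'l) \<Rightarrow> 'y) \<Rightarrow>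
    ('x \<times> 'y \<Rightarrow>\<^sub>0 complex) set set cnormed_space" where
  "bibalanced_tensor L X lX rX Y lY rY =
     quotient_normed (proj_tensor X Y) (bibalanced_kernel L X lX rX Y lY rY)"

text \<open>
  Flatness quantifies over all modules \<open>Y\<close> and \<open>Z\<close>.  As a definition cannot quantify over
  types, the types of the elements of \<open>Y\<close> and \<open>Z\<close> are parameters; statements about
  flatness are made for arbitrary \<open>'y\<close> and \<open>'z\<close>.
\<close>

definition ESR_flat ::
  "'l cinner_space \<Rightarrow> 'x cnormed_space \<Rightarrow> ('x \<Rightarrow> ('l \<Rightarrow> 'l) \<Rightarrow> 'x) \<Rightarrow>
    'y itself \<Rightarrow> 'z itself \<Rightarrow> bool" where
  "ESR_flat L X rX TY TZ \<longleftrightarrow> contractive_right_module L X rX \<and>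
     (\<forall>(Y :: 'y cnormed_space) lY (Z :: 'z cnormed_space) lZ \<alpha>.
        left_semi_ruan_module L Y lY \<longrightarrow> left_semi_ruan_module L Z lZ \<longrightarrow>
        left_morphism L Y lY Z lZ \<alpha> \<longrightarrow> isometric_on Y Z \<alpha> \<longrightarrow>
        isometric_on (balanced_tensor L X rX Y lY) (balanced_tensor L X rX Z lZ)
          (quotient_map (proj_tensor X Z) (balanced_kernel L X rX Z lZ)
            (tensor_map X Z (\<lambda>x. x) \<alpha>)))"

definition ER_flat ::
  "'l cinner_space \<Rightarrow>
    'x cnormed_space \<Rightarrow> (('l \<Rightarrow> 'l) \<Rightarrow> 'x \<Rightarrow> 'x) \<Rightarrow> ('x \<Rightarrow> ('l \<Rightarrow> 'l) \<Rightarrow> 'x) \<Rightarrow>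
    'y itself \<Rightarrow> 'z itself \<Rightarrow> bool" where
  "ER_flat L X lX rX TY TZ \<longleftrightarrow> contractive_bimodule L X lX rX \<and>
     (\<forall>(Y :: 'y cnormed_space) lY rY (Z :: 'z cnormed_space) lZ rZ \<alpha>.
        ruan_bimodule L Y lY rY \<longrightarrow> ruan_bimodule L Z lZ rZ \<longrightarrow>
        left_morphism L Y lY Z lZ \<alpha> \<longrightarrow> right_morphism L Y rY Z rZ \<alpha> \<longrightarrow>
        isometric_on Y Z \<alpha> \<longrightarrow>
        isometric_on (bibalanced_tensor L Y lY rY X lX rX) (bibalanced_tensor L Z lZ rZ X lX rX)
          (quotient_map (proj_tensor Z X) (bibalanced_kernel L Z lZ rZ X lX rX)
            (tensor_map Z X \<alpha> (\<lambda>x. x))))"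


section \<open>The modules under consideration\<close>

text \<open>
  The left multiplication of the Hilbert tensor product of \<open>L\<close> and \<open>H\<close> is
  \<open>ampliation L H\<close>.  The right multiplication of the Hilbert tensor product of the conjugate
  space of \<open>L\<close> and \<open>H\<close> uses the adjoint taken in \<open>L\<close>.
\<close>

definition hilbert_ract ::
  "'l cinner_space \<Rightarrow> 'h cinner_space \<Rightarrow> (nat \<Rightarrow> ('l \<times> 'h \<Rightarrow>\<^sub>0 complex) set) set \<Rightarrow>
    ('l \<Rightarrow> 'l) \<Rightarrow> (nat \<Rightarrow> ('l \<times> 'h \<Rightarrow>\<^sub>0 complex) set) set" where
  "hilbert_ract L H \<zeta> a = ampliation (conj_space L) H (adjoint_op L a) \<zeta>"

definition proj_lact ::
  "'x cnormed_space \<Rightarrow> (('l \<Rightarrow> 'l) \<Rightarrow> 'x \<Rightarrow> 'x) \<Rightarrow> 'y cnormed_space \<Rightarrow>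
    ('l \<Rightarrow> 'l) \<Rightarrow> ('x \<times> 'y \<Rightarrow>\<^sub>0 complex) set \<Rightarrow> ('x \<times> 'y \<Rightarrow>\<^sub>0 complex) set" where
  "proj_lact X lX Y a = tensor_map X Y (lX a) (\<lambda>y. y)"

definition proj_ract ::
  "'x cnormed_space \<Rightarrow> 'y cnormed_space \<Rightarrow> ('y \<Rightarrow> ('l \<Rightarrow> 'l) \<Rightarrow> 'y) \<Rightarrow>
    ('x \<times> 'y \<Rightarrow>\<^sub>0 complex) set \<Rightarrow> ('l \<Rightarrow> 'l) \<Rightarrow> ('x \<times> 'y \<Rightarrow>\<^sub>0 complex) set" where
  "proj_ract X Y rY u a = tensor_map X Y (\<lambda>x. x) (\<lambda>y. rY y a) u"

end

(*
  The norm of a balanced tensor product of X and Y is the quotient seminorm on the free vector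
  space over X x Y of the weighted l1-norm with weights |x| |y|, modulo the bilinear and balanced
  relations.  For flatness one has to show that a tensor p over Y, whose image over Z is represented
  with weight a, has weight at most a over Y.

  Let F be a finite orthonormal subset of H.  The compression of a vector x to F is T(x) zeta, with one
  fixed vector zeta and an operator T(x) of finite rank.  So, up to compression, which is arbitrarily
  close to the identity, p is the elementary tensor of zeta and w = sum T(x_i) y_i.  If w is also
  sum T(x_j) z_j over Z, partial isometries give the z_j orthogonal supports, and the (semi-)Ruan
  inequality merges the sum into a single T(x) z with |x| |z| <= sum |x_j| |z_j|.  Applying a
  pseudo-inverse of T(x) to w gives y in Y with w = T(x) y and |y| <= |z|, so that p is the
  elementary tensor of x and y.  For bimodules T(x) z is replaced by T2(x2) z T1(x1).  Flatness passes to
  completions by replacing elements of the completion by approximants, which satisfy the relations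
  in the limit.
*)
theory Submission
  imports Defs
begin

section \<open>Complex vector spaces and quotients\<close>

text \<open>The compression is chosen from \<open>p\<close> alone. For a fixed \<open>F\<close> the
  collecting map \<open>(x, z) -> T(x) z\<close> kills the relations exactly, so no error arises
  from the competing representation over \<open>Z\<close>, whatever it is; only the elements of
  \<open>p\<close> are approximated. Finite rank opens the way back to \<open>Y\<close>: its image
  need not be closed in \<open>Z\<close>, but a pseudo-inverse of \<open>T(x)\<close> is a bounded
  operator, and a submodule is stable under it. The merging loses nothing once the norms are
  balanced: with |x_j| = |z_j| the two square roots that come from orthogonality multiply to the sum
  of the |x_j| |z_j|. In a bimodule the middle factor is scaled to norm at most one, which the
  maximum in the Ruan axiom preserves. The infinite dimension of \<open>L\<close> provides room for
  a copy of \<open>F\<close> in \<open>L\<close> and for two orthogonal copies of any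
  finite-dimensional subspace. Closures of kernels do not enter the estimates, as the seminorm
  modulo a subspace equals that modulo its closure.\<close>

lemma complex_ring_sel [simp]:
 "carrier complex_ring = UNIV" "x \<otimes>\<^bsub>complex_ring\<^esub> y = x * y" "x \<oplus>\<^bsub>complex_ring\<^esub> y = x + y"
 "\<one>\<^bsub>complex_ring\<^esub> = 1" "\<zero>\<^bsub>complex_ring\<^esub> = 0" by (simp_all add: complex_ring_def)

lemma cring_complex_ring: "cring complex_ring" proof (intro cringI abelian_groupI comm_monoidI)
 fix x assume "x \<in> carrier complex_ring"
 show "\<exists>y\<in>carrier complex_ring. y \<oplus>\<^bsub>complex_ring\<^esub> x = \<zero>\<^bsub>complex_ring\<^esub>" by (rule bexI[of _ "- x"]) auto
qed (auto simp: algebra_simps)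

lemma complex_ring_minus [simp]: "\<ominus>\<^bsub>complex_ring\<^esub> x = - x" proof -
 interpret cring complex_ring by (rule cring_complex_ring) show ?thesis by (rule minus_equality) auto
qed

locale cvec = module complex_ring V for V :: "(complex, 'v, 'm) module_scheme" (structure)
begin

lemma smult_add_left: "x \<in> carrier V ==> (c + d) \<odot> x = c \<odot> x \<oplus> d \<odot> x" using smult_l_distr[of c d x] by simp

lemma smult_add_right: "x \<in> carrier V ==> y \<in> carrier V ==> c \<odot> (x \<oplus> y) = c \<odot> x \<oplus> c \<odot> y"
 using smult_r_distr[of c x y] by simp

lemma smult_smult: "x \<in> carrier V ==> c \<odot> (d \<odot> x) = (c * d) \<odot> x" using smult_assoc1[of c d x] by simp

lemma smult_carrier [simp, intro]: "x \<in> carrier V ==> c \<odot> x \<in> carrier V" using smult_closed[of c x] by simp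

lemma smult_1 [simp]: "x \<in> carrier V ==> 1 \<odot> x = x" using smult_one[of x] by simp

lemma smult_0_left [simp]: "x \<in> carrier V ==> 0 \<odot> x = \<zero>" using smult_l_null[of x] by simp

lemma smult_0_right [simp]: "c \<odot> \<zero> = \<zero>" using smult_r_null[of c] by simp

lemma neg_eq: "x \<in> carrier V ==> \<ominus> x = (-1) \<odot> x" using smult_l_minus[of 1 x] by simp

lemma vminus_eq: "x \<in> carrier V ==> y \<in> carrier V ==> x \<ominus> y = x \<oplus> (-1) \<odot> y" by (simp add: a_minus_def neg_eq)

lemma minus_self [simp]: "x \<in> carrier V ==> x \<ominus> x = \<zero>" by (simp add: M.r_neg a_minus_def)

lemma minus_zero_right [simp]: "x \<in> carrier V ==> x \<ominus> \<zero> = x" by (simp add: vminus_eq)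

lemma minus_add_cancel: "x \<in> carrier V ==> y \<in> carrier V ==> (x \<ominus> y) \<oplus> y = x" by (simp add: a_minus_def M.a_assoc M.l_neg)

lemma minus_eq_zero_iff: "x \<in> carrier V ==> y \<in> carrier V ==> x \<ominus> y = \<zero> \<longleftrightarrow> x = y"
 by (metis M.l_zero minus_add_cancel minus_self)

lemma add_minus_cancel': "x \<in> carrier V ==> y \<in> carrier V ==> y \<oplus> (x \<ominus> y) = x"
 using minus_add_cancel[of x y] M.a_comm[of y "x \<ominus> y"] by simp

lemma add_minus_cancel: "x \<in> carrier V ==> y \<in> carrier V ==> (x \<oplus> y) \<ominus> y = x" by (simp add: a_minus_def M.a_assoc M.r_neg)

lemma minus_commute: "x \<in> carrier V ==> y \<in> carrier V ==> x \<ominus> y = (-1) \<odot> (y \<ominus> x)"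
 by (simp add: vminus_eq smult_add_right smult_smult M.a_comm)

lemma add_minus_add: "x \<in> carrier V ==> y \<in> carrier V ==> x' \<in> carrier V ==> y' \<in> carrier V ==>
 (x \<oplus> y) \<ominus> (x' \<oplus> y') = (x \<ominus> x') \<oplus> (y \<ominus> y')" by (simp add: vminus_eq smult_add_right M.a_ac)

lemma smult_minus: "x \<in> carrier V ==> y \<in> carrier V ==> c \<odot> x \<ominus> c \<odot> y = c \<odot> (x \<ominus> y)"
 by (simp add: vminus_eq smult_add_right smult_smult)

lemma minus_minus_trans: "x \<in> carrier V ==> y \<in> carrier V ==> z \<in> carrier V ==>
 (x \<ominus> y) \<oplus> (y \<ominus> z) = x \<ominus> z" by (metis M.a_assoc M.minus_closed a_minus_def minus_add_cancel M.a_inv_closed)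

lemma finsum_smult: "finite A ==> f \<in> A \<rightarrow> carrier V ==> (\<Oplus>i\<in>A. c \<odot> f i) = c \<odot> (\<Oplus>i\<in>A. f i)"
proof (induction A rule: finite_induct)
 case (insert a A)
 then show ?case by (subst (1 2) M.finsum_insert) (auto simp: smult_add_right Pi_def intro!: M.finsum_closed)
qed simp

lemma finsum_insert': "finite A ==> a \<notin> A ==> f a \<in> carrier V ==> f \<in> A \<rightarrow> carrier V ==>
 finsum V f (insert a A) = f a \<oplus> finsum V f A" by (rule M.finsum_insert) auto

definition subsp :: "'v set => bool" where
 "subsp W \<longleftrightarrow> W <= carrier V & \<zero> \<in> W & (\<forall>x\<in>W. \<forall>y\<in>W. x \<oplus> y \<in> W) & (\<forall>c. \<forall>x\<in>W. c \<odot> x \<in> W)"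

lemma submodule_iff_subsp: "submodule W complex_ring V \<longleftrightarrow> subsp W" proof
 assume "submodule W complex_ring V"
 then interpret submodule W complex_ring V .
 show "subsp W" using subset m_closed one_closed smult_closed unfolding subsp_def by auto
next
 assume W: "subsp W"
 show "submodule W complex_ring V" proof (intro submodule.intro subgroup.intro submodule_axioms.intro)
  fix x assume "x \<in> W"
  then show "inv\<^bsub>add_monoid V\<^esub> x \<in> W" using W neg_eq[of x] by (auto simp: subsp_def a_inv_def)
 qed (use W in \<open>auto simp: subsp_def\<close>)
qed

lemma subspD:
 assumes "subsp W" shows "W <= carrier V" "\<zero> \<in> W" "x \<in> W ==> x \<in> carrier V"
  "x \<in> W ==> y \<in> W ==> x \<oplus> y \<in> W" "x \<in> W ==> c \<odot> x \<in> W"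
  "x \<in> W ==> y \<in> W ==> x \<ominus> y \<in> W" using assms vminus_eq unfolding subsp_def by (auto 0 3 simp: subset_iff)

lemma subsp_finsum: "finite A ==> subsp W ==> f \<in> A \<rightarrow> W ==> finsum V f A \<in> W"
proof (induction A rule: finite_induct)
 case (insert a A)
 then have "finsum V f (insert a A) = f a \<oplus> finsum V f A" by (intro finsum_insert') (auto dest: subspD(3))
 with insert show ?case by (auto intro: subspD(4))
qed (simp add: subspD(2))

lemma subsp_carrier: "subsp (carrier V)" by (auto simp: subsp_def)

text \<open>A hull is an intersection, here of subspaces. The condition on \<open>S\<close> puts
  \<open>carrier V\<close> into the family; an empty intersection would be the whole type.\<close>

lemma subsp_cspan:
 assumes "S <= carrier V" shows "subsp (cspan V S)" proof -
 have "subsp (subsp hull S)" using hull_minimal[of S "carrier V" subsp] subsp_carrier assms by (auto simp: hull_def subsp_def)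
 then show ?thesis by (simp add: cspan_def submodule_iff_subsp)
qed

lemma cspan_minimal: "S \<subseteq> W ==> subsp W ==> cspan V S \<subseteq> W" by (simp add: cspan_def submodule_iff_subsp hull_minimal)

lemma cspan_inc: "x \<in> S ==> x \<in> cspan V S" by (simp add: cspan_def hull_inc)

lemma cspan_mono: "S \<subseteq> T ==> cspan V S \<subseteq> cspan V T" by (simp add: cspan_def hull_mono)

end

lemma cvecI:
 fixes V (structure)
 assumes "!!x y. x \<in> carrier V ==> y \<in> carrier V ==> x \<oplus> y \<in> carrier V" and "\<zero> \<in> carrier V"
  and "!!x y z. x \<in> carrier V ==> y \<in> carrier V ==> z \<in> carrier V ==> (x \<oplus> y) \<oplus> z = x \<oplus> (y \<oplus> z)"
  and "!!x y. x \<in> carrier V ==> y \<in> carrier V ==> x \<oplus> y = y \<oplus> x"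
  and "!!x. x \<in> carrier V ==> \<zero> \<oplus> x = x" and "!!c x. x \<in> carrier V ==> c \<odot> x \<in> carrier V"
  and "!!c d x. x \<in> carrier V ==> (c + d) \<odot> x = c \<odot> x \<oplus> d \<odot> x"
  and "!!c x y. x \<in> carrier V ==> y \<in> carrier V ==> c \<odot> (x \<oplus> y) = c \<odot> x \<oplus> c \<odot> y"
  and "!!c d x. x \<in> carrier V ==> (c * d) \<odot> x = c \<odot> (d \<odot> x)" and "!!x. x \<in> carrier V ==> 1 \<odot> x = x"
  and "!!x. x \<in> carrier V ==> 0 \<odot> x = \<zero>" shows "cvec V" unfolding cvec_def proof (intro moduleI abelian_groupI cring_complex_ring)
 fix x assume x: "x \<in> carrier V"
 show "\<exists>y\<in>carrier V. y \<oplus> x = \<zero>" using x assms(7)[of x "-1" 1] by (intro bexI[of _ "(-1) \<odot> x"]) (auto simp: assms(6,10,11))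
qed (use assms in auto)

lemma clinear_onD:
 assumes "clinear_on V W f" shows "x \<in> carrier V ==> f x \<in> carrier W"
  "x \<in> carrier V ==> y \<in> carrier V ==> f (x \<oplus>\<^bsub>V\<^esub> y) = f x \<oplus>\<^bsub>W\<^esub> f y"
  "x \<in> carrier V ==> f (c \<odot>\<^bsub>V\<^esub> x) = c \<odot>\<^bsub>W\<^esub> f x" using assms by (auto simp: clinear_on_def)

lemma clinear_onI:
 assumes "!!x. x \<in> carrier V ==> f x \<in> carrier W"
  "!!x y. x \<in> carrier V ==> y \<in> carrier V ==> f (x \<oplus>\<^bsub>V\<^esub> y) = f x \<oplus>\<^bsub>W\<^esub> f y"
  "!!c x. x \<in> carrier V ==> f (c \<odot>\<^bsub>V\<^esub> x) = c \<odot>\<^bsub>W\<^esub> f x"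
 shows "clinear_on V W f" using assms by (auto simp: clinear_on_def)

lemma clinear_on_comp: "clinear_on V W f ==> clinear_on W U g ==> clinear_on V U (%x. g (f x))" by (auto simp: clinear_on_def Pi_iff)

lemma clinear_on_id: "clinear_on V V (%x. x)" by (auto simp: clinear_on_def)

lemma clinear_on_cong: "(!!x. x \<in> carrier V ==> f x = g x) ==> cvec V ==> clinear_on V W f ==> clinear_on V W g"
proof -
 assume a: "!!x. x \<in> carrier V ==> f x = g x" "cvec V" "clinear_on V W f"
 interpret cvec V by fact
 have e: "g x = f x" if "x \<in> carrier V" for x using a(1)[OF that] by simp show ?thesis by (rule clinear_onI) (simp_all add: e clinear_onD[OF a(3)])
qed

lemma clinear_on_zero:
 assumes "cvec V" "cvec W" "clinear_on V W f" shows "f \<zero>\<^bsub>V\<^esub> = \<zero>\<^bsub>W\<^esub>" proof -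
 interpret V: cvec V by fact
 interpret W: cvec W by fact
 have "f (0 \<odot>\<^bsub>V\<^esub> \<zero>\<^bsub>V\<^esub>) = 0 \<odot>\<^bsub>W\<^esub> f \<zero>\<^bsub>V\<^esub>" by (rule clinear_onD(3)[OF assms(3)]) simp
 then show ?thesis by (simp add: clinear_onD[OF assms(3)])
qed

lemma clinear_on_minus:
 assumes "cvec V" "cvec W" "clinear_on V W f" "x \<in> carrier V" "y \<in> carrier V" shows "f (x \<ominus>\<^bsub>V\<^esub> y) = f x \<ominus>\<^bsub>W\<^esub> f y" proof -
 interpret V: cvec V by fact
 interpret W: cvec W by fact show ?thesis using assms(4,5) by (simp add: V.vminus_eq W.vminus_eq clinear_onD[OF assms(3)])
qed

lemma clinear_on_finsum:
 assumes "cvec V" "cvec W" "clinear_on V W f" "finite A" "g \<in> A \<rightarrow> carrier V" shows "f (finsum V g A) = finsum W (%i. f (g i)) A" proof -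
 interpret V: cvec V by fact
 interpret W: cvec W by fact show ?thesis using assms(4,5) proof (induction A rule: finite_induct)
  case empty
  then show ?case by (simp add: clinear_on_zero[OF assms(1-3)])
 next
  case (insert a A)
  then show ?case by (subst V.finsum_insert', simp, simp, simp, simp, subst W.finsum_insert')
    (auto simp: clinear_onD[OF assms(3)] Pi_iff intro!: V.M.finsum_closed)
 qed
qed

lemma subsp_vimage:
 assumes "cvec V" "cvec W" "clinear_on V W f" "cvec.subsp W U" shows "cvec.subsp V {x \<in> carrier V. f x \<in> U}" proof -
 interpret V: cvec V by fact
 interpret W: cvec W by fact show ?thesis using clinear_on_zero[OF assms(1-3)] by (auto simp: V.subsp_def clinear_onD[OF assms(3)] W.subspD(2,4,5)[OF assms(4)])
qed

text \<open>Minimality of the span replaces induction on linear combinations: the preimage of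
  \<open>U\<close> is a subspace that contains \<open>S\<close>.\<close>

lemma cspan_image:
 assumes "cvec V" "cvec W" "clinear_on V W f" "cvec.subsp W U" "S <= carrier V" and "!!x. x \<in> S ==> f x \<in> U" and "x \<in> cspan V S"
 shows "f x \<in> U" using cvec.cspan_minimal[OF assms(1) _ subsp_vimage[OF assms(1-4)], of S] assms(5-7) by auto

lemma cspan_kernel:
 assumes "cvec V" "cvec W" "clinear_on V W f" "S <= carrier V" and "!!x. x \<in> S ==> f x = \<zero>\<^bsub>W\<^esub>" and "x \<in> cspan V S"
 shows "f x = \<zero>\<^bsub>W\<^esub>" proof -
 interpret W: cvec W by fact
 have "cvec.subsp W {\<zero>\<^bsub>W\<^esub>}" by (auto simp: W.subsp_def)
 from cspan_image[OF assms(1-3) this assms(4) _ assms(6)] assms(5) show ?thesis by auto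
qed

section \<open>Quotients by subspaces and induced maps\<close>

lemma quotient_module_sel [simp]:
 "carrier (quotient_module V N) = a_rcosets\<^bsub>V\<^esub> N"
 "\<zero>\<^bsub>quotient_module V N\<^esub> = N"
 "A \<oplus>\<^bsub>quotient_module V N\<^esub> B = A <+>\<^bsub>V\<^esub> B"
 "c \<odot>\<^bsub>quotient_module V N\<^esub> A = (smult V c ` A) <+>\<^bsub>V\<^esub> N" by (simp_all add: quotient_module_def)

context cvec
begin

lemma mem_coset:
 assumes "subsp N" "v \<in> carrier V" shows "w \<in> N +> v \<longleftrightarrow> w \<in> carrier V & w \<ominus> v \<in> N" proof
 assume "w \<in> N +> v"
 then obtain n where "n \<in> N" "w = n \<oplus> v" by (auto simp: a_r_coset_def')
 with assms(2) show "w \<in> carrier V & w \<ominus> v \<in> N" by (simp add: add_minus_cancel subspD(3)[OF assms(1)])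
next
 assume "w \<in> carrier V & w \<ominus> v \<in> N"
 with assms show "w \<in> N +> v" by (auto simp: a_r_coset_def' minus_add_cancel intro!: bexI[of _ "w \<ominus> v"])
qed

lemma coset_self: "subsp N ==> v \<in> carrier V ==> v \<in> N +> v" by (simp add: mem_coset subspD(2))

lemma coset_eq_iff:
 assumes "subsp N" "v \<in> carrier V" "w \<in> carrier V" shows "N +> v = N +> w \<longleftrightarrow> v \<ominus> w \<in> N" proof
 assume "N +> v = N +> w"
 then show "v \<ominus> w \<in> N" using coset_self[OF assms(1,2)] assms mem_coset by blast
next
 assume *: "v \<ominus> w \<in> N"
 then have **: "w \<ominus> v \<in> N" using assms subspD(5)[OF assms(1) *, of "-1"] minus_commute[of w v] by simp
 have sub: "N +> x \<subseteq> N +> y" if "x \<in> carrier V" "y \<in> carrier V" "x \<ominus> y \<in> N" for x y proof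
  fix u assume "u \<in> N +> x"
  then have u: "u \<in> carrier V" "u \<ominus> x \<in> N" using mem_coset[OF assms(1) that(1)] by blast+
  have "(u \<ominus> x) \<oplus> (x \<ominus> y) \<in> N" by (rule subspD(4)[OF assms(1) u(2) that(3)])
  then have "u \<ominus> y \<in> N" by (simp add: minus_minus_trans[OF u(1) that(1,2)])
  then show "u \<in> N +> y" using mem_coset[OF assms(1) that(2)] u by blast
 qed
 show "N +> v = N +> w" using sub[OF assms(2,3) *] sub[OF assms(3,2) **] by blast
qed

lemma coset_zero:
 assumes "subsp N" shows "N +> \<zero> = N" using subspD(1)[OF assms] by (auto simp: mem_coset[OF assms])

lemma coset_add:
 assumes "subsp N" "v \<in> carrier V" "w \<in> carrier V" shows "(N +> v) <+>\<^bsub>V\<^esub> (N +> w) = N +> (v \<oplus> w)" proof (intro equalityI subsetI)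
 fix u assume "u \<in> (N +> v) <+>\<^bsub>V\<^esub> (N +> w)"
 then obtain a b where "a \<in> N +> v" "b \<in> N +> w" "u = a \<oplus> b" by (auto simp: set_add_def')
 with assms(2,3) show "u \<in> N +> (v \<oplus> w)" by (simp add: mem_coset[OF assms(1)] add_minus_add subspD(4)[OF assms(1)])
next
 fix u assume u: "u \<in> N +> (v \<oplus> w)"
 with assms have "u \<ominus> w \<in> N +> v" by (auto simp: mem_coset vminus_eq smult_add_right M.a_ac)
 moreover have "u = (u \<ominus> w) \<oplus> w" using u assms by (simp add: mem_coset minus_add_cancel)
 ultimately show "u \<in> (N +> v) <+>\<^bsub>V\<^esub> (N +> w)" using assms coset_self unfolding set_add_def' by blast
qed

lemma coset_smult:
 assumes "subsp N" "v \<in> carrier V" shows "(smult V c ` (N +> v)) <+>\<^bsub>V\<^esub> N = N +> (c \<odot> v)" proof (intro equalityI subsetI)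
 fix u assume "u \<in> (smult V c ` (N +> v)) <+>\<^bsub>V\<^esub> N"
 then obtain a n where a: "a \<in> N +> v" "n \<in> N" "u = c \<odot> a \<oplus> n" by (auto simp: set_add_def')
 have "a \<in> carrier V" using a assms by (simp add: mem_coset)
 then have "u \<ominus> c \<odot> v = (c \<odot> a \<ominus> c \<odot> v) \<oplus> n"
  using a(2,3) assms(2) by (simp add: vminus_eq M.a_ac smult_add_right subspD(3)[OF assms(1)])
 with a assms(2) \<open>a \<in> carrier V\<close> show "u \<in> N +> (c \<odot> v)" by (simp add: mem_coset[OF assms(1)] smult_minus subspD(3-5)[OF assms(1)])
next
 fix u assume u: "u \<in> N +> (c \<odot> v)"
 then have "u = c \<odot> v \<oplus> (u \<ominus> c \<odot> v)" "u \<ominus> c \<odot> v \<in> N" using assms by (auto simp: mem_coset add_minus_cancel')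
 then show "u \<in> (smult V c ` (N +> v)) <+>\<^bsub>V\<^esub> N" using coset_self[OF assms] unfolding set_add_def' by blast
qed

lemma coset_add_self: "subsp N ==> v \<in> carrier V ==> N <+>\<^bsub>V\<^esub> (N +> v) = N +> v"
 using coset_add[of N \<zero> v] by (simp add: coset_zero)

lemma rcosets_eq: "a_rcosets N = (%v. N +> v) ` carrier V" by (auto simp: A_RCOSETS_def')

lemma cvec_quotient_module:
 assumes N: "subsp N" shows "cvec (quotient_module V N)" proof (rule cvecI)
 show "\<zero>\<^bsub>quotient_module V N\<^esub> \<in> carrier (quotient_module V N)" using coset_zero[OF N] by (auto simp: rcosets_eq image_iff)
qed (auto simp: N rcosets_eq coset_add coset_smult smult_add_left smult_add_right smult_smult M.a_ac
    coset_zero coset_add_self)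

lemma clinear_on_coset:
 assumes "subsp N" shows "clinear_on V (quotient_module V N) (%v. N +> v)" using assms by (intro clinear_onI) (auto simp: rcosets_eq coset_add coset_smult)

end

text \<open>\<open>f\<close> maps a coset of \<open>M\<close> into a coset of \<open>N\<close>, in
  general not onto it; the summand \<open>N\<close> in \<open>quotient_map\<close> fills it
  up.\<close>

lemma quotient_map_coset:
 assumes "cvec V" "cvec W" "cvec.subsp V M" "cvec.subsp W N" "clinear_on V W f"
  "!!x. x \<in> M ==> f x \<in> N" "v \<in> carrier V"
 shows "quotient_map W N f (M +>\<^bsub>V\<^esub> v) = N +>\<^bsub>W\<^esub> f v" proof -
 interpret V: cvec V by fact
 interpret W: cvec W by fact
 note fD = clinear_onD[OF assms(5)]
 have fv: "f v \<in> carrier W" using assms by (simp add: fD) show ?thesis unfolding quotient_map_def proof (intro equalityI subsetI)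
  fix u assume "u \<in> f ` (M +>\<^bsub>V\<^esub> v) <+>\<^bsub>W\<^esub> N"
  then obtain a n where a: "a \<in> M +>\<^bsub>V\<^esub> v" "n \<in> N" "u = f a \<oplus>\<^bsub>W\<^esub> n" by (auto simp: set_add_def')
  have ac: "a \<in> carrier V" "f (a \<ominus>\<^bsub>V\<^esub> v) \<in> N" "f a \<in> carrier W" using a assms(3,6,7) by (auto simp: V.mem_coset fD)
  then have "f a \<ominus>\<^bsub>W\<^esub> f v \<in> N" using assms clinear_on_minus[OF assms(1,2,5)] by simp
  moreover have "u \<ominus>\<^bsub>W\<^esub> f v = (f a \<ominus>\<^bsub>W\<^esub> f v) \<oplus>\<^bsub>W\<^esub> n"
   using a ac fv by (simp add: W.vminus_eq W.M.a_ac W.subspD(3)[OF assms(4)])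
  ultimately show "u \<in> N +>\<^bsub>W\<^esub> f v" using a ac fv by (simp add: W.mem_coset[OF assms(4)] W.subspD(3,4)[OF assms(4)])
 next
  fix u assume u: "u \<in> N +>\<^bsub>W\<^esub> f v"
  then have "u = f v \<oplus>\<^bsub>W\<^esub> (u \<ominus>\<^bsub>W\<^esub> f v)" "u \<ominus>\<^bsub>W\<^esub> f v \<in> N"
   using assms(4) fv by (auto simp: W.mem_coset W.add_minus_cancel')
  then show "u \<in> f ` (M +>\<^bsub>V\<^esub> v) <+>\<^bsub>W\<^esub> N" using V.coset_self[OF assms(3,7)] unfolding set_add_def' by blast
 qed
qed

section \<open>Free vector spaces and the associated seminorms\<close>

abbreviation psc :: "complex => ('s \<Rightarrow>\<^sub>0 complex) => ('s \<Rightarrow>\<^sub>0 complex)" where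
 "psc c == Poly_Mapping.map ((*) c)"

abbreviation "pkeys == Poly_Mapping.keys"
abbreviation "pat == Poly_Mapping.lookup"
abbreviation "sng == Poly_Mapping.single"

lemma lookup_psc [simp]: "pat (psc c p) k = c * pat p k" by (simp add: Poly_Mapping.map.rep_eq when_def)

lemma psc_single [simp]: "psc c (sng k d) = sng k (c * d)" by (rule poly_mapping_eqI) (simp add: lookup_single when_def)

lemma pkeys_psc: "pkeys (psc c p) \<subseteq> pkeys p" by (auto simp: in_keys_iff)

lemma psc_simps [simp]: "psc 1 p = p" "psc 0 p = 0" "psc c 0 = 0" "psc c (psc d p) = psc (c * d) p"
 "psc (-1) p = - p" by (rule poly_mapping_eqI; simp)+

lemma psc_add: "psc c (p + q) = psc c p + psc c q" "psc (c + d) p = psc c p + psc d p"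
 "psc c (p - q) = psc c p - psc c q" by (rule poly_mapping_eqI; simp add: lookup_add lookup_minus algebra_simps)+

lemma free_module_sel [simp]:
 "carrier (free_module S) = {p. pkeys p <= S}" "\<zero>\<^bsub>free_module S\<^esub> = 0"
 "p \<oplus>\<^bsub>free_module S\<^esub> q = p + q" "c \<odot>\<^bsub>free_module S\<^esub> p = psc c p" by (simp_all add: free_module_def)

lemma pkeys_add_subset: "pkeys p <= S ==> pkeys q <= S ==> pkeys (p + q) \<subseteq> S" using keys_add[of p q] by blast

lemma pkeys_diff_subset: "pkeys p <= S ==> pkeys q <= S ==> pkeys (p - q) \<subseteq> S" using keys_diff[of p q] by blast

lemma pkeys_psc_subset: "pkeys p <= S ==> pkeys (psc c p) \<subseteq> S" using pkeys_psc[of c p] by blast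

lemma pkeys_sng_subset: "s \<in> S ==> pkeys (sng s c) \<subseteq> S" by simp

lemmas pkeys_subset = pkeys_add_subset pkeys_diff_subset pkeys_psc_subset pkeys_sng_subset

lemma cvec_free_module: "cvec (free_module S)" by (rule cvecI) (simp_all add: psc_add pkeys_subset add_ac)

interpretation FM: cvec "free_module S" for S :: "'s set" by (rule cvec_free_module)

lemma FM_minus: "pkeys p <= S ==> pkeys q <= S ==> p \<ominus>\<^bsub>free_module S\<^esub> q = p - q" by (simp add: FM.vminus_eq)

text \<open>The added key is fresh, so that weights are exactly additive in the induction step
  (\<open>wsum_add_disjoint\<close>).\<close>

lemma free_induct [consumes 1, case_names zero add]:
 assumes "pkeys p <= S" and "P 0"
  and "!!k c p. k \<in> S ==> pkeys p <= S ==> k \<notin> pkeys p ==> P p ==> P (sng k c + p)" shows "P p"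
 using assms(1) proof (induction p rule: update_induct)
 case const
 then show ?case using assms(2) by simp
next
 case (update f a b)
 have "Poly_Mapping.update a b f = sng a b + f" using update by (intro poly_mapping_eqI) (auto simp: lookup_update lookup_add lookup_single when_def in_keys_iff)
 moreover have "a \<in> S" "pkeys f <= S" using update by (auto simp: keys_update split: if_splits)
 ultimately show ?case using update assms(3)[of a f b] by simp
qed

text \<open>The universal property of the free vector space. All maps out of tensor products, and
  all ways of collecting a formal sum into one element, are of this form.\<close>

definition flift :: "(complex, 'v, 'm) module_scheme => ('s => 'v) => ('s \<Rightarrow>\<^sub>0 complex) => 'v" where
 "flift V f p = (\<Oplus>\<^bsub>V\<^esub>k\<in>pkeys p. pat p k \<odot>\<^bsub>V\<^esub> f k)"

lemma flift_superset:
 assumes "cvec V" "finite A" "pkeys p <= A" "f \<in> A \<rightarrow> carrier V"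
 shows "flift V f p = (\<Oplus>\<^bsub>V\<^esub>k\<in>A. pat p k \<odot>\<^bsub>V\<^esub> f k)" proof -
 interpret cvec V by fact show ?thesis unfolding flift_def using assms by (intro M.add.finprod_mono_neutral_cong_left) (auto simp: in_keys_iff Pi_iff)
qed

lemma flift_closed: "cvec V ==> pkeys p <= S ==> f \<in> S \<rightarrow> carrier V ==> flift V f p \<in> carrier V"
 unfolding flift_def cvec_def by (rule abelian_monoid.finsum_closed)
  (auto simp: module.smult_closed Pi_iff subset_iff abelian_group.axioms module.axioms(2))

lemma clinear_flift:
 assumes "cvec V" "f \<in> S \<rightarrow> carrier V" shows "clinear_on (free_module S) V (flift V f)" proof -
 interpret cvec V by fact show ?thesis proof (rule clinear_onI)
  fix p q assume p: "p \<in> carrier (free_module S)" and q: "q \<in> carrier (free_module S)"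
  define A where "A = pkeys p \<union> pkeys q"
  have A: "finite A" "pkeys p <= A" "pkeys q <= A" "pkeys (p + q) \<subseteq> A" "f \<in> A \<rightarrow> carrier V"
   using p q assms keys_add[of p q] by (auto simp: A_def)
  have [simp]: "k \<in> A ==> f k \<in> carrier V" for k using A by auto
  have "flift V f (p + q) = (\<Oplus>\<^bsub>V\<^esub>k\<in>A. pat p k \<odot>\<^bsub>V\<^esub> f k \<oplus>\<^bsub>V\<^esub> pat q k \<odot>\<^bsub>V\<^esub> f k)"
   unfolding flift_superset[OF assms(1) A(1,4,5)] by (rule M.finsum_cong) (auto simp: lookup_add smult_add_left simp_implies_def)
  then show "flift V f (p \<oplus>\<^bsub>free_module S\<^esub> q) = flift V f p \<oplus>\<^bsub>V\<^esub> flift V f q"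
   unfolding flift_superset[OF assms(1) A(1,2,5)] flift_superset[OF assms(1) A(1,3,5)] by (simp add: M.finsum_addf Pi_iff)
 next
  fix c p assume p: "p \<in> carrier (free_module S)"
  have [simp]: "k \<in> pkeys p ==> f k \<in> carrier V" for k using p assms by auto
  have "flift V f (psc c p) = (\<Oplus>\<^bsub>V\<^esub>k\<in>pkeys p. c \<odot>\<^bsub>V\<^esub> (pat p k \<odot>\<^bsub>V\<^esub> f k))" using p assms pkeys_psc[of c p]
   by (subst flift_superset[where A="pkeys p"]) (auto simp: smult_smult assms intro!: M.finsum_cong)
  then show "flift V f (c \<odot>\<^bsub>free_module S\<^esub> p) = c \<odot>\<^bsub>V\<^esub> flift V f p" by (simp add: flift_def finsum_smult Pi_iff)
 qed (use assms flift_closed in auto)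
qed

lemma flift_add: "cvec V ==> f \<in> S \<rightarrow> carrier V ==> pkeys p <= S ==> pkeys q <= S ==>
 flift V f (p + q) = flift V f p \<oplus>\<^bsub>V\<^esub> flift V f q" using clinear_onD(2)[OF clinear_flift, of V f S p q] by simp

lemma flift_diff: "cvec V ==> f \<in> S \<rightarrow> carrier V ==> pkeys p <= S ==> pkeys q <= S ==>
 flift V f (p - q) = flift V f p \<ominus>\<^bsub>V\<^esub> flift V f q" using clinear_on_minus[OF cvec_free_module _ clinear_flift, of V f S p q] by (simp add: FM_minus)

lemma flift_psc: "cvec V ==> f \<in> S \<rightarrow> carrier V ==> pkeys p <= S ==>
 flift V f (psc c p) = c \<odot>\<^bsub>V\<^esub> flift V f p" using clinear_onD(3)[OF clinear_flift, of V f S p c] by simp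

lemma flift_zero [simp]:
 assumes "cvec V" shows "flift V f 0 = \<zero>\<^bsub>V\<^esub>" proof -
 interpret cvec V by fact show ?thesis by (simp add: flift_def)
qed

lemma flift_single:
 assumes V: "cvec V" and fk: "f k \<in> carrier V" shows "flift V f (sng k c) = c \<odot>\<^bsub>V\<^esub> f k" proof -
 interpret cvec V by (rule V)
 have 1: "flift V f (sng k c) = (\<Oplus>\<^bsub>V\<^esub>j\<in>{k}. pat (sng k c) j \<odot>\<^bsub>V\<^esub> f j)" proof (rule flift_superset[OF V])
  show "pkeys (sng k c) \<subseteq> {k}" by simp
  show "f \<in> {k} \<rightarrow> carrier V" by (rule Pi_I) (simp add: fk)
 qed simp
 have 2: "... = pat (sng k c) k \<odot>\<^bsub>V\<^esub> f k \<oplus>\<^bsub>V\<^esub> \<zero>\<^bsub>V\<^esub>"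
  by (subst finsum_insert') (simp_all only: fk finite.emptyI empty_iff M.finsum_empty smult_carrier Pi_empty UNIV_I not_False_eq_True)
 show ?thesis unfolding 1 2 using fk by simp
qed

text \<open>The usual way to identify a linear map on formal sums: by its values on the
  generators.\<close>

lemma flift_unique:
 assumes "cvec V" "clinear_on (free_module S) V h" "pkeys p <= S" and "!!s. s \<in> S ==> h (sng s 1) = f s" shows "h p = flift V f p" proof -
 interpret cvec V by fact
 have f: "f \<in> S \<rightarrow> carrier V" using clinear_onD(1)[OF assms(2), of "sng s 1" for s] by (intro Pi_I) (simp flip: assms(4)) show ?thesis using assms(3)
 proof (induction rule: free_induct)
  case zero
  then show ?case using clinear_on_zero[OF cvec_free_module assms(1,2)] by (simp add: assms(1))
 next
  case (add k c p)
  have "h (sng k c) = c \<odot>\<^bsub>V\<^esub> h (sng k 1)" using clinear_onD(3)[OF assms(2), of "sng k 1" c] add by simp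
  moreover have "h (sng k c + p) = h (sng k c) \<oplus>\<^bsub>V\<^esub> h p" using clinear_onD(2)[OF assms(2), of "sng k c" p] add by simp
  moreover have "flift V f (sng k c + p) = flift V f (sng k c) \<oplus>\<^bsub>V\<^esub> flift V f p" using add by (intro flift_add[OF assms(1) f]) auto
  moreover have "flift V f (sng k c) = c \<odot>\<^bsub>V\<^esub> f k" using f add by (intro flift_single assms(1)) auto
  ultimately show ?case using add assms(4) by simp
 qed
qed

lemma flift_comp:
 assumes "cvec V" "cvec W" "clinear_on V W h" "f \<in> S \<rightarrow> carrier V" "pkeys p <= S" shows "h (flift V f p) = flift W (%s. h (f s)) p"
proof (rule flift_unique[OF assms(2) clinear_on_comp[OF clinear_flift[OF assms(1,4)] assms(3)] assms(5)])
 fix s assume "s \<in> S"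
 then have "f s \<in> carrier V" using assms by auto
 then show "h (flift V f (sng s 1)) = h (f s)" using assms(1) by (simp add: flift_single cvec.smult_1)
qed

lemma flift_cong: "(!!s. s \<in> pkeys p ==> f s = g s) ==> f \<in> pkeys p \<rightarrow> carrier V ==> cvec V ==> flift V f p = flift V g p"
proof -
 assume a: "!!s. s \<in> pkeys p ==> f s = g s" "f \<in> pkeys p \<rightarrow> carrier V" "cvec V"
 interpret cvec V by fact show ?thesis unfolding flift_def using a by (intro M.finsum_cong') (auto simp: Pi_iff)
qed

text \<open>The body repeats the one in \<open>tensor_map\<close>, so that \<open>tensor_map\<close>
  is the \<open>quotient_map\<close> of some \<open>fmap\<close>. No carrier occurs in it, which
  makes \<open>fmap_add\<close> and its companions free of side conditions.\<close>

definition fmap :: "('s => 't) => ('s \<Rightarrow>\<^sub>0 complex) => ('t \<Rightarrow>\<^sub>0 complex)" where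
 "fmap f p = (\<Sum>k\<in>pkeys p. sng (f k) (pat p k))"

lemma FM_finsum: "finite A ==> g \<in> A \<rightarrow> {p. pkeys p <= S} ==> finsum (free_module S) g A = sum g A"
proof (induction A rule: finite_induct)
 case (insert a A)
 then show ?case by (subst FM.finsum_insert') auto
qed simp

lemma fmap_eq_flift: "f \<in> pkeys p \<rightarrow> T ==> fmap f p = flift (free_module T) (%s. sng (f s) 1) p"
 unfolding fmap_def flift_def by (subst FM_finsum) (auto simp: Pi_iff)

lemma clinear_fmap:
 assumes "f \<in> S \<rightarrow> T" shows "clinear_on (free_module S) (free_module T) (fmap f)"
proof (rule clinear_on_cong[OF _ cvec_free_module clinear_flift[OF cvec_free_module]])
 fix p :: "'a \<Rightarrow>\<^sub>0 complex" assume "p \<in> carrier (free_module S)"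
 then show "flift (free_module T) (%s. sng (f s) 1) p = fmap f p" using assms by (subst fmap_eq_flift[of f p T]) auto
qed (use assms in auto)

lemma fmap_single [simp]: "fmap f (sng k c) = sng (f k) c" by (simp add: fmap_def)

lemma fmap_zero [simp]: "fmap f 0 = 0" by (simp add: fmap_def)

lemma fmap_add: "fmap f (p + q) = fmap f p + fmap f q" using clinear_onD(2)[OF clinear_fmap[of f UNIV UNIV], of p q] by simp

lemma fmap_psc: "fmap f (psc c p) = psc c (fmap f p)" using clinear_onD(3)[OF clinear_fmap[of f UNIV UNIV], of p c] by simp

lemma fmap_diff: "fmap f (p - q) = fmap f p - fmap f q" using clinear_on_minus[OF cvec_free_module cvec_free_module clinear_fmap[of f UNIV UNIV], of p q] by (simp add: FM_minus)

lemma fmap_keys: "f \<in> S \<rightarrow> T ==> pkeys p <= S ==> pkeys (fmap f p) \<subseteq> T"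
 using clinear_onD(1)[OF clinear_fmap[of f S T], of p] by simp

lemma flift_fmap:
 assumes "cvec V" "f \<in> S \<rightarrow> T" "g \<in> T \<rightarrow> carrier V" "pkeys p <= S" shows "flift V g (fmap f p) = flift V (%s. g (f s)) p"
proof (rule flift_unique[OF assms(1) clinear_on_comp[OF clinear_fmap[OF assms(2)] clinear_flift[OF assms(1,3)]] assms(4)])
 fix s assume "s \<in> S"
 then have "g (f s) \<in> carrier V" using assms by auto
 then show "flift V g (fmap f (sng s 1)) = g (f s)" using assms(1) by (simp add: flift_single cvec.smult_1)
qed

section \<open>Weighted l1-norms and their quotient seminorms\<close>

definition wsum :: "('s => real) => ('s \<Rightarrow>\<^sub>0 complex) => real" where
 "wsum w p = (\<Sum>k\<in>pkeys p. cmod (pat p k) * w k)"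

lemma wsum_superset: "finite A ==> pkeys p <= A ==> wsum w p = (\<Sum>k\<in>A. cmod (pat p k) * w k)"
 unfolding wsum_def by (rule sum.mono_neutral_left) (auto simp: in_keys_iff)

lemma wsum_zero [simp]: "wsum w 0 = 0" by (simp add: wsum_def)

lemma wsum_single [simp]: "wsum w (sng k c) = cmod c * w k" by (subst wsum_superset[of "{k}"]) auto

lemma wsum_nonneg: "(!!k. k \<in> pkeys p ==> 0 <= w k) ==> 0 <= wsum w p" unfolding wsum_def by (intro sum_nonneg) auto

lemma wsum_add:
 assumes "!!k. k \<in> S ==> 0 <= w k" "pkeys p <= S" "pkeys q <= S" shows "wsum w (p + q) <= wsum w p + wsum w q" proof -
 define A where "A = pkeys p \<union> pkeys q"
 have A: "finite A" "pkeys p <= A" "pkeys q <= A" "pkeys (p + q) \<subseteq> A" using keys_add[of p q] by (auto simp: A_def)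
 have "wsum w (p + q) <= (\<Sum>k\<in>A. cmod (pat p k) * w k + cmod (pat q k) * w k)" unfolding wsum_superset[OF A(1,4)] using assms by (intro sum_mono)
   (auto simp: lookup_add A_def norm_triangle_ineq mult_right_mono subset_iff simp flip: distrib_right)
 then show ?thesis unfolding wsum_superset[OF A(1,2)] wsum_superset[OF A(1,3)] by (simp add: sum.distrib)
qed

lemma wsum_add_disjoint:
 assumes "pkeys p \<inter> pkeys q = {}" shows "wsum w (p + q) = wsum w p + wsum w q" proof -
 have "wsum w (p + q) = (\<Sum>k\<in>pkeys p \<union> pkeys q. cmod (pat (p + q) k) * w k)" using keys_add[of p q] by (intro wsum_superset) auto
 also have "... = (\<Sum>k\<in>pkeys p. cmod (pat (p + q) k) * w k) + (\<Sum>k\<in>pkeys q. cmod (pat (p + q) k) * w k)" using assms by (intro sum.union_disjoint) auto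
 also have "... = wsum w p + wsum w q" proof -
  have "k \<in> pkeys p ==> pat q k = 0" "k \<in> pkeys q ==> pat p k = 0" for k using assms by (auto simp: in_keys_iff)
  then show ?thesis unfolding wsum_def by (intro arg_cong2[where f="(+)"] sum.cong) (simp_all add: lookup_add)
 qed
 finally show ?thesis .
qed

lemma wsum_psc: "wsum w (psc c p) = cmod c * wsum w p" using pkeys_psc[of c p] by (subst wsum_superset[of "pkeys p"]) (auto simp: wsum_def sum_distrib_left norm_mult mult.assoc)

lemma wsum_fmap:
 assumes "pkeys p <= S" "f \<in> S \<rightarrow> T" "!!t. t \<in> T ==> 0 <= w' t" "!!s. s \<in> S ==> w' (f s) <= C * w s"
 shows "wsum w' (fmap f p) <= C * wsum w p" using assms(1) proof (induction rule: free_induct)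
 case (add k c p)
 have "wsum w' (fmap f (sng k c + p)) <= wsum w' (sng (f k) c) + wsum w' (fmap f p)" unfolding fmap_add fmap_single using add assms(2,3) fmap_keys[OF assms(2)]
  by (intro wsum_add[of T]) auto
 also have "... <= C * (cmod c * w k) + C * wsum w p" using add assms(4)[of k] mult_left_mono[of "w' (f k)" "C * w k" "cmod c"] by (auto simp: mult_ac)
 also have "... = C * wsum w (sng k c + p)" using add by (subst wsum_add_disjoint) (auto simp: algebra_simps)
 finally show ?case .
qed simp

text \<open>Evaluated at representatives instead of cosets. Tensor products modulo several layers of
  relations are thereby compared among formal sums, without iterated quotients.\<close>

definition pnorm :: "'s set => ('s => real) => ('s \<Rightarrow>\<^sub>0 complex) set => ('s \<Rightarrow>\<^sub>0 complex) => real" where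
 "pnorm S w K p = Inf {wsum w q | q. pkeys q <= S & q - p \<in> K}"

locale weighted_relations =
 fixes S :: "'s set" and w :: "'s => real" and K :: "('s \<Rightarrow>\<^sub>0 complex) set" assumes weight_nonneg: "s \<in> S ==> 0 <= w s"
  and subsp_K: "FM.subsp S K"
begin

abbreviation "pn == pnorm S w K"

lemma K_add: "p \<in> K ==> q \<in> K ==> p + q \<in> K"
 and K_psc: "p \<in> K ==> psc c p \<in> K" and K_zero: "0 \<in> K" and K_keys: "p \<in> K ==> pkeys p <= S"
 using FM.subspD[OF subsp_K] by auto

lemma K_diff: "p \<in> K ==> q \<in> K ==> p - q \<in> K" using K_add[of p "psc (-1) q"] K_psc[of q "-1"] by simp

lemma K_uminus: "p - q \<in> K ==> q - p \<in> K" using K_psc[of "p - q" "-1"] by simp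

lemma wsum_nonneg': "pkeys p <= S ==> 0 <= wsum w p" using weight_nonneg by (intro wsum_nonneg) auto

lemma pn_le: "pkeys q <= S ==> q - p \<in> K ==> pn p <= wsum w q" unfolding pnorm_def using wsum_nonneg'
 by (intro cInf_lower) (auto intro!: bdd_belowI[of _ 0])

lemma pn_le_wsum: "pkeys p <= S ==> pn p <= wsum w p" using pn_le[of p p] K_zero by simp

lemma pn_greatest:
 assumes "pkeys p <= S" "!!q. pkeys q <= S ==> q - p \<in> K ==> a <= wsum w q" shows "a <= pn p"
 unfolding pnorm_def using assms K_zero by (intro cInf_greatest) (auto intro!: exI[of _ p])

lemma pn_approx:
 assumes "pkeys p <= S" "e > 0" obtains q where "pkeys q <= S" "q - p \<in> K" "wsum w q < pn p + e" proof (rule ccontr)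
 assume "\<not> thesis"
 then have "pn p + e <= pn p" using that by (intro pn_greatest assms) force
 with assms show False by simp
qed

lemma pn_nonneg: "pkeys p <= S ==> 0 <= pn p" by (intro pn_greatest wsum_nonneg') auto

lemma pn_cong: "p - p' \<in> K ==> pn p = pn p'" proof -
 assume a: "p - p' \<in> K"
 have "q - p \<in> K \<longleftrightarrow> q - p' \<in> K" for q using K_add[of "q - p" "p - p'"] K_diff[of "q - p'" "p - p'"] a by auto
 then show ?thesis by (simp add: pnorm_def)
qed

lemma pn_add:
 assumes "pkeys p <= S" "pkeys q <= S" shows "pn (p + q) <= pn p + pn q" proof (rule field_le_epsilon)
 fix e :: real assume "e > 0"
 then have e: "e / 2 > 0" by simp
 obtain p' where p': "pkeys p' <= S" "p' - p \<in> K" "wsum w p' < pn p + e / 2" using pn_approx[OF assms(1) e] .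
 obtain q' where q': "pkeys q' <= S" "q' - q \<in> K" "wsum w q' < pn q + e / 2" using pn_approx[OF assms(2) e] .
 have "pn (p + q) <= wsum w (p' + q')" using p' q' K_add[of "p' - p" "q' - q"] by (intro pn_le pkeys_subset) (auto simp: algebra_simps)
 also have "... <= wsum w p' + wsum w q'" using p' q' weight_nonneg by (intro wsum_add) auto
 finally show "pn (p + q) <= pn p + pn q + e" using p' q' by simp
qed

lemma pn_psc_le: "pkeys p <= S ==> pn (psc c p) <= cmod c * pn p" proof (cases "c = 0")
 case True
 then show ?thesis using pn_le_wsum[of 0] by simp
next
 case False
 assume p: "pkeys p <= S" show ?thesis proof (rule field_le_epsilon)
  fix e :: real assume "e > 0"
  then have e: "e / cmod c > 0" using False by simp
  obtain p' where p': "pkeys p' <= S" "p' - p \<in> K" "wsum w p' < pn p + e / cmod c" using pn_approx[OF p e] .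
  have "pn (psc c p) <= wsum w (psc c p')" using p' K_psc[of "p' - p" c] by (intro pn_le pkeys_subset) (auto simp: psc_add)
  also have "... <= cmod c * (pn p + e / cmod c)" unfolding wsum_psc using p' by (intro mult_left_mono) auto
  finally show "pn (psc c p) <= cmod c * pn p + e" using False by (simp add: algebra_simps)
 qed
qed

lemma pn_psc:
 assumes "pkeys p <= S" shows "pn (psc c p) = cmod c * pn p" proof (cases "c = 0")
 case True
 then show ?thesis using pn_psc_le[OF assms, of c] pn_nonneg[of "psc c p"] by simp
next
 case False
 have "pn p <= cmod (inverse c) * pn (psc c p)" using pn_psc_le[of "psc c p" "inverse c"] assms False by (simp add: pkeys_subset)
 then have "cmod c * pn p <= pn (psc c p)" using False by (simp add: norm_inverse norm_divide field_simps)
 with pn_psc_le[OF assms, of c] show ?thesis by simp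
qed

lemma pn_K: "p \<in> K ==> pn p = 0" using pn_cong[of p 0] pn_psc[of 0 0] by simp

lemma pn_triangle: "pkeys p <= S ==> pkeys q <= S ==> pn p <= pn q + pn (p - q)"
 using pn_add[of q "p - q"] by (simp add: pkeys_subset)

lemma pn_minus_commute: "pkeys p <= S ==> pkeys q <= S ==> pn (p - q) = pn (q - p)"
 using pn_psc[of "p - q" "-1"] by (simp add: pkeys_subset)

end

text \<open>Subadditivity carries the bound from generators to the weight of a formal sum, and since
  \<open>f\<close> respects the relations every representative of \<open>p\<close> may be used. The
  case \<open>C = 0\<close> is separate because the argument divides by \<open>C\<close>.\<close>

lemma pnorm_map_le:
 assumes "weighted_relations S w K" "weighted_relations T w' K'" and "clinear_on (free_module S) (free_module T) f"
  and "!!k. k \<in> K ==> f k \<in> K'" and "0 <= C" and "!!s. s \<in> S ==> pnorm T w' K' (f (sng s 1)) <= C * w s"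
  and "pkeys p <= S" shows "pnorm T w' K' (f p) <= C * pnorm S w K p" proof -
 interpret A: weighted_relations S w K by fact
 interpret B: weighted_relations T w' K' by fact
 note f = clinear_onD[OF assms(3), simplified]
 have *: "B.pn (f q) <= C * wsum w q" if "pkeys q <= S" for q using that proof (induction rule: free_induct)
  case zero
  show ?case using clinear_on_zero[OF cvec_free_module cvec_free_module assms(3)] B.pn_K[OF B.K_zero] by simp
 next
  case (add k c q)
  have 1: "f (sng k c) = psc c (f (sng k 1))" using f(3)[of "sng k 1" c] add by simp
  have "B.pn (f (sng k c + q)) <= B.pn (f (sng k c)) + B.pn (f q)" using f(1)[of "sng k c", OF pkeys_sng_subset[OF add(1)]] f(1)[OF add(2)]
    f(2)[OF pkeys_sng_subset[OF add(1)] add(2), of c] by (simp add: B.pn_add)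
  also have "B.pn (f (sng k c)) <= C * (cmod c * w k)" proof -
   have "pkeys (f (sng k 1)) \<subseteq> T" by (rule f(1)) (simp add: add)
   then have "B.pn (f (sng k c)) = cmod c * B.pn (f (sng k 1))" unfolding 1 by (rule B.pn_psc)
   also have "... <= cmod c * (C * w k)" by (intro mult_left_mono assms(6) add) simp
   finally show ?thesis by (simp only: mult.left_commute)
  qed
  also have "C * (cmod c * w k) + B.pn (f q) <= C * wsum w (sng k c + q)" using add by (subst wsum_add_disjoint) (auto simp: distrib_left)
  finally show ?case by simp
 qed show ?thesis proof (cases "C = 0")
  case True show ?thesis using *[OF assms(7)] True by simp
 next
  case False
  have "B.pn (f p) / C <= A.pn p" proof (rule A.pn_greatest[OF assms(7)])
   fix q assume q: "pkeys q <= S" "q - p \<in> K"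
   have "f q - f p \<in> K'" using assms(4)[OF q(2)] clinear_on_minus[OF cvec_free_module cvec_free_module assms(3), of q p] q assms(7)
     f(1)[of p] f(1)[of q] by (simp add: FM_minus)
   then have "B.pn (f p) = B.pn (f q)" by (intro B.pn_cong) (rule B.K_uminus)
   with *[OF q(1)] False assms(5) show "B.pn (f p) / C <= wsum w q" by (simp add: field_simps)
  qed
  then show ?thesis using False assms(5) by (simp add: field_simps)
 qed
qed

section \<open>Inner product spaces\<close>

lemma normed_of_sel [simp]:
 "carrier (normed_of V) = carrier V" "\<zero>\<^bsub>normed_of V\<^esub> = \<zero>\<^bsub>V\<^esub>"
 "add (normed_of V) = add V" "smult (normed_of V) = smult V"
 "nrm (normed_of V) x = sqrt (Re (ip V x x))" by (simp_all add: normed_of_def module.defs cnormed_space.defs)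

lemma normed_of_minus [simp]: "x \<ominus>\<^bsub>normed_of V\<^esub> y = x \<ominus>\<^bsub>V\<^esub> y" by (simp add: a_minus_def a_inv_def m_inv_def)

lemma cvec_normed_of: "cvec V ==> cvec (normed_of V)" proof -
 assume "cvec V"
 then interpret cvec V . show ?thesis by (rule cvecI) (auto simp: smult_add_left smult_add_right smult_smult M.a_ac)
qed

text \<open>Hilbert spaces without completeness. Algebraic tensor products of Hilbert spaces are of
  this kind, so all geometry that does not involve limits is developed here.\<close>

locale inner_space = cvec V for V :: "'v cinner_space" (structure) +
 assumes inner_add_left: "x \<in> carrier V ==> y \<in> carrier V ==> z \<in> carrier V ==>
   ip V (x \<oplus> y) z = ip V x z + ip V y z"
  and inner_smult_left: "x \<in> carrier V ==> y \<in> carrier V ==> ip V (c \<odot> x) y = c * ip V x y"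
  and inner_cnj: "x \<in> carrier V ==> y \<in> carrier V ==> ip V y x = cnj (ip V x y)"
  and inner_nonneg: "x \<in> carrier V ==> 0 <= Re (ip V x x)"
  and inner_definite: "x \<in> carrier V ==> ip V x x = 0 ==> x = \<zero>"

sublocale hilbert_space \<subseteq> inner_space proof (intro inner_space.intro inner_space_axioms.intro)
 show "cvec V" by unfold_locales
qed (fact ip_add_left ip_smult_left ip_cnj ip_nonneg ip_definite)+

sublocale complex_normed_space \<subseteq> cvec by unfold_locales

context inner_space
begin

abbreviation "N == nrm (normed_of V)"

declare normed_of_sel(5) [simp del]

lemma inner_zero_left [simp]: "y \<in> carrier V ==> ip V \<zero> y = 0" using inner_smult_left[of \<zero> y 0] by simp

lemma inner_add_right: "x \<in> carrier V ==> y \<in> carrier V ==> z \<in> carrier V ==>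
  ip V z (x \<oplus> y) = ip V z x + ip V z y" using inner_cnj[of "x \<oplus> y" z] inner_cnj[of x z] inner_cnj[of y z] by (simp add: inner_add_left)

lemma inner_smult_right: "x \<in> carrier V ==> y \<in> carrier V ==> ip V x (c \<odot> y) = cnj c * ip V x y"
 using inner_cnj[of "c \<odot> y" x] inner_cnj[of y x] by (simp add: inner_smult_left)

lemma inner_zero_right [simp]: "y \<in> carrier V ==> ip V y \<zero> = 0" using inner_smult_right[of y \<zero> 0] by simp

lemma inner_minus_left: "x \<in> carrier V ==> y \<in> carrier V ==> z \<in> carrier V ==>
  ip V (x \<ominus> y) z = ip V x z - ip V y z" by (simp add: vminus_eq inner_add_left inner_smult_left)

lemma inner_minus_right: "x \<in> carrier V ==> y \<in> carrier V ==> z \<in> carrier V ==>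
  ip V z (x \<ominus> y) = ip V z x - ip V z y" by (simp add: vminus_eq inner_add_right inner_smult_right)

lemma inner_finsum_left: "finite A ==> f \<in> A \<rightarrow> carrier V ==> y \<in> carrier V ==>
  ip V (\<Oplus>i\<in>A. f i) y = (\<Sum>i\<in>A. ip V (f i) y)" proof (induction A rule: finite_induct)
 case (insert a A)
 then have "finsum V f (insert a A) = f a \<oplus> finsum V f A" "finsum V f A \<in> carrier V" by (auto intro!: finsum_insert' M.finsum_closed)
 with insert show ?case by (simp add: inner_add_left)
qed simp

lemma inner_finsum_right: "finite A ==> f \<in> A \<rightarrow> carrier V ==> y \<in> carrier V ==>
  ip V y (\<Oplus>i\<in>A. f i) = (\<Sum>i\<in>A. ip V y (f i))" proof (induction A rule: finite_induct)
 case (insert a A)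
 then have "finsum V f (insert a A) = f a \<oplus> finsum V f A" "finsum V f A \<in> carrier V" by (auto intro!: finsum_insert' M.finsum_closed)
 with insert show ?case by (simp add: inner_add_right)
qed simp

lemma N_sq: "x \<in> carrier V ==> (N x)\<^sup>2 = Re (ip V x x)" by (simp add: normed_of_sel(5) inner_nonneg)

lemma N_nonneg [simp]: "x \<in> carrier V ==> 0 <= N x" by (simp add: normed_of_sel(5) inner_nonneg)

lemma inner_self: "x \<in> carrier V ==> ip V x x = complex_of_real ((N x)\<^sup>2)" using inner_cnj[of x x] by (simp add: N_sq complex_eq_iff)

lemma N_eq_0_iff: "x \<in> carrier V ==> N x = 0 \<longleftrightarrow> x = \<zero>" using inner_self[of x] inner_definite[of x] inner_self[of \<zero>] by auto

lemma inner_eqI: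
 assumes "x \<in> carrier V" "y \<in> carrier V" "!!z. z \<in> carrier V ==> ip V x z = ip V y z" shows "x = y"
 using inner_definite[of "x \<ominus> y"] assms minus_eq_zero_iff[of x y] by (simp add: inner_minus_left)

lemma N_smult: "x \<in> carrier V ==> N (c \<odot> x) = cmod c * N x" proof -
 assume x: "x \<in> carrier V"
 have "ip V (c \<odot> x) (c \<odot> x) = (c * cnj c) * ip V x x" using x by (simp add: inner_smult_left inner_smult_right)
 then have "complex_of_real ((N (c \<odot> x))\<^sup>2) = (c * cnj c) * complex_of_real ((N x)\<^sup>2)" by (simp only: inner_self x smult_carrier)
 also have "... = complex_of_real ((cmod c * N x)\<^sup>2)" by (simp only: complex_norm_square[symmetric] power_mult_distrib of_real_mult)
 finally show ?thesis using x by (simp only: of_real_eq_iff power2_eq_iff_nonneg[OF N_nonneg[OF smult_carrier[OF x]] mult_nonneg_nonneg[OF norm_ge_zero N_nonneg[OF x]]])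
qed

lemma N_add_sq: "x \<in> carrier V ==> y \<in> carrier V ==> (N (x \<oplus> y))\<^sup>2 = (N x)\<^sup>2 + (N y)\<^sup>2 + 2 * Re (ip V x y)"
 using inner_cnj[of x y] by (simp add: N_sq inner_add_left inner_add_right)

lemma N_minus_sq: "x \<in> carrier V ==> y \<in> carrier V ==> (N (x \<ominus> y))\<^sup>2 = (N x)\<^sup>2 + (N y)\<^sup>2 - 2 * Re (ip V x y)"
 using inner_cnj[of x y] by (simp add: N_sq inner_minus_left inner_minus_right)

lemma Cauchy_Schwarz:
 assumes x: "x \<in> carrier V" and y: "y \<in> carrier V" shows "cmod (ip V x y) <= N x * N y" proof (cases "y = \<zero>")
 case True
 then show ?thesis using x by simp
next
 case False
 then have Ny: "N y > 0" using N_eq_0_iff[OF y] N_nonneg[OF y] by linarith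
 \<comment> \<open>The coefficient of the orthogonal projection of \<open>x\<close> to the line
   through \<open>y\<close>; it makes the residual as short as possible.\<close>
 define c where "c = ip V x y / complex_of_real ((N y)\<^sup>2)"
 have 1: "ip V x (c \<odot> y) = complex_of_real ((cmod (ip V x y))\<^sup>2 / (N y)\<^sup>2)" unfolding inner_smult_right[OF x y] c_def
  using complex_norm_square[of "ip V x y"] by (simp add: mult.commute)
 have "0 <= (N (x \<ominus> c \<odot> y))\<^sup>2" by simp
 also have "... = (N x)\<^sup>2 + (cmod c * N y)\<^sup>2 - 2 * ((cmod (ip V x y))\<^sup>2 / (N y)\<^sup>2)" using x y by (simp add: N_minus_sq N_smult 1)
 also have "(cmod c * N y)\<^sup>2 = (cmod (ip V x y))\<^sup>2 / (N y)\<^sup>2" proof -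
  have "cmod c = cmod (ip V x y) / (N y)\<^sup>2" by (simp add: c_def norm_divide norm_power)
  then show ?thesis using Ny by (simp add: power2_eq_square field_simps)
 qed
 finally have "(cmod (ip V x y))\<^sup>2 / (N y)\<^sup>2 <= (N x)\<^sup>2" by simp
 then have "(cmod (ip V x y))\<^sup>2 <= (N x * N y)\<^sup>2" using Ny by (simp add: pos_divide_le_eq power_mult_distrib)
 then show ?thesis by (rule power2_le_imp_le) (simp add: x y)
qed

lemma N_triangle: "x \<in> carrier V ==> y \<in> carrier V ==> N (x \<oplus> y) <= N x + N y" proof -
 assume x: "x \<in> carrier V" and y: "y \<in> carrier V"
 have "(N (x \<oplus> y))\<^sup>2 <= (N x + N y)\<^sup>2" using Cauchy_Schwarz[OF x y] complex_Re_le_cmod[of "ip V x y"] N_add_sq[OF x y] by (simp add: power2_sum)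
 then show ?thesis by (rule power2_le_imp_le) (simp add: x y)
qed

lemma normed: "complex_normed_space (normed_of V)" using cvec_normed_of[OF cvec_axioms] by (intro complex_normed_space.intro complex_normed_space_axioms.intro)
  (auto simp: cvec_def N_eq_0_iff N_triangle N_smult)

text \<open>Orthonormal families are indexed so that one index set can serve in two spaces: a finite
  orthonormal subset \<open>F\<close> of \<open>H\<close> is written \<open>onf F (%h. h)\<close>,
  and a copy of it in \<open>L\<close> is some \<open>e\<close> with \<open>onf F e\<close>.\<close>

definition onf :: "'i set => ('i => 'v) => bool" where
 "onf I f \<longleftrightarrow> finite I & f \<in> I \<rightarrow> carrier V & (\<forall>i\<in>I. \<forall>j\<in>I. ip V (f i) (f j) = (if i = j then 1 else 0))"

lemma onfD:
 assumes "onf I f" shows "finite I" "f \<in> I \<rightarrow> carrier V" "i \<in> I ==> f i \<in> carrier V"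
  "i \<in> I ==> j \<in> I ==> ip V (f i) (f j) = (if i = j then 1 else 0)" using assms by (auto simp: onf_def)

definition ocomb :: "'i set => ('i => complex) => ('i => 'v) => 'v" where
 "ocomb I c f = (\<Oplus>i\<in>I. c i \<odot> f i)"

lemma ocomb_closed [intro]: "f \<in> I \<rightarrow> carrier V ==> ocomb I c f \<in> carrier V" unfolding ocomb_def by (intro M.finsum_closed) auto

lemma inner_ocomb_left: "finite I ==> f \<in> I \<rightarrow> carrier V ==> y \<in> carrier V ==>
  ip V (ocomb I c f) y = (\<Sum>i\<in>I. c i * ip V (f i) y)" unfolding ocomb_def by (subst inner_finsum_left) (auto simp: inner_smult_left Pi_iff)

lemma inner_ocomb_right: "finite I ==> f \<in> I \<rightarrow> carrier V ==> y \<in> carrier V ==>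
  ip V y (ocomb I c f) = (\<Sum>i\<in>I. cnj (c i) * ip V y (f i))" unfolding ocomb_def by (subst inner_finsum_right) (auto simp: inner_smult_right Pi_iff)

lemma inner_ocomb_onf: "onf I f ==> j \<in> I ==> ip V (ocomb I c f) (f j) = c j" using onfD(1)[of I f]
 by (subst inner_ocomb_left) (auto simp: onfD if_distrib cong: if_cong)

lemma N_ocomb: "onf I f ==> (N (ocomb I c f))\<^sup>2 = (\<Sum>i\<in>I. (cmod (c i))\<^sup>2)" proof -
 assume f: "onf I f"
 have c: "ocomb I c f \<in> carrier V" using onfD(2)[OF f] by auto
 have "ip V (ocomb I c f) (ocomb I c f) = (\<Sum>i\<in>I. cnj (c i) * c i)" using onfD(1,2)[OF f] c by (subst inner_ocomb_right) (auto simp: inner_ocomb_onf[OF f])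
 also have "... = complex_of_real (\<Sum>i\<in>I. (cmod (c i))\<^sup>2)" by (simp add: complex_norm_square mult.commute del: of_real_power)
 finally show ?thesis using c by (simp add: N_sq)
qed

text \<open>For an orthonormal family this is the orthogonal projection to its span, and
  \<open>opr I f x = x\<close> is used to say that \<open>x\<close> lies in the span.\<close>

definition opr :: "'i set => ('i => 'v) => 'v => 'v" where
 "opr I f x = ocomb I (%i. ip V x (f i)) f"

lemma opr_closed: "onf I f ==> opr I f x \<in> carrier V" unfolding opr_def using onfD(2) by auto

lemma inner_opr: "onf I f ==> j \<in> I ==> ip V (opr I f x) (f j) = ip V x (f j)" by (simp add: opr_def inner_ocomb_onf)

lemma opr_residual: "onf I f ==> x \<in> carrier V ==> j \<in> I ==> ip V (x \<ominus> opr I f x) (f j) = 0"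
 by (simp add: inner_minus_left opr_closed inner_opr onfD)

lemma N_residual:
 assumes f: "onf I f" and x: "x \<in> carrier V" shows "(N (x \<ominus> opr I f x))\<^sup>2 = (N x)\<^sup>2 - (\<Sum>i\<in>I. (cmod (ip V x (f i)))\<^sup>2)" proof -
 have "ip V x (opr I f x) = (\<Sum>i\<in>I. cnj (ip V x (f i)) * ip V x (f i))" unfolding opr_def using onfD(1,2)[OF f] x by (subst inner_ocomb_right) auto
 also have "... = complex_of_real (\<Sum>i\<in>I. (cmod (ip V x (f i)))\<^sup>2)" by (simp add: complex_norm_square mult.commute del: of_real_power)
 finally show ?thesis using N_ocomb[OF f, of "%i. ip V x (f i)"] by (simp add: N_minus_sq x opr_closed[OF f] flip: opr_def)
qed

lemma Bessel: "onf I f ==> x \<in> carrier V ==> (\<Sum>i\<in>I. (cmod (ip V x (f i)))\<^sup>2) <= (N x)\<^sup>2"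
 using N_residual[of I f x] zero_le_power2[of "N (x \<ominus> opr I f x)"] by linarith

lemma ocomb_mem_subsp: "subsp W ==> finite I ==> f \<in> I \<rightarrow> W ==> ocomb I c f \<in> W"
 unfolding ocomb_def by (rule subsp_finsum) (auto intro: subspD(5))

text \<open>One step of the Gram-Schmidt process: the residual of \<open>x\<close> is normalised.
  The last conclusion keeps the new vector within the span of the given ones, which
  \<open>pseudo_inverse\<close> depends on.\<close>

lemma onf_extend:
 assumes G: "onf G (%x. x)" and x: "x \<in> carrier V" and ne: "opr G (%x. x) x ~= x"
 obtains g where "g \<notin> G" "onf (insert g G) (%x. x)" "opr (insert g G) (%x. x) x = x"
  "!!y. y \<in> carrier V ==> opr G (%x. x) y = y ==> opr (insert g G) (%x. x) y = y"
  "g \<in> cspan V (insert x G)" proof -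
 let ?p = "opr G (%x. x) x"
 define r where "r = x \<ominus> ?p"
 have p: "?p \<in> carrier V" and Gc: "G <= carrier V" and fG: "finite G" using opr_closed[OF G] onfD(1,3)[OF G] by auto
 have r: "r \<in> carrier V" using p x by (simp add: r_def)
 have "r ~= \<zero>" using ne minus_eq_zero_iff[OF x p] by (auto simp: r_def)
 then have Nr: "N r > 0" using N_eq_0_iff[OF r] N_nonneg[OF r] by linarith
 define g where "g = complex_of_real (1 / N r) \<odot> r"
 have g: "g \<in> carrier V" using r by (simp add: g_def)
 have gG: "ip V g h = 0" if "h \<in> G" for h using opr_residual[OF G x that] r that Gc by (auto simp: g_def r_def inner_smult_left)
 have Gg: "ip V h g = 0" if "h \<in> G" for h using gG[OF that] inner_cnj[of g h] g that Gc by auto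
 have gg: "ip V g g = 1" proof -
  have "N g = 1" unfolding g_def N_smult[OF r] norm_of_real using Nr by simp
  then show ?thesis using inner_self[OF g] by simp
 qed
 have notin: "g \<notin> G" using gG[of g] gg by auto
 have on: "onf (insert g G) (%x. x)" using G g gg gG Gg notin by (auto simp: onf_def)
 have ins: "opr (insert g G) (%x. x) y = ip V y g \<odot> g \<oplus> opr G (%x. x) y" for y
  unfolding opr_def ocomb_def using fG notin g Gc by (intro finsum_insert') auto
 have a: "opr (insert g G) (%x. x) y = y" if y: "y \<in> carrier V" "opr G (%x. x) y = y" for y proof -
  have "ip V y g = ip V (ocomb G (%i. ip V y i) (%x. x)) g" using y(2) unfolding opr_def by simp
  also have "... = 0" using fG Gc g Gg by (subst inner_ocomb_left) auto
  finally show ?thesis unfolding ins using y g by simp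
 qed
 have pg: "ip V ?p g = 0" unfolding opr_def using fG Gc g Gg by (subst inner_ocomb_left) auto
 have "ip V x g = ip V r g" unfolding r_def using x p g pg by (simp add: inner_minus_left)
 also have "... = complex_of_real (N r)" using inner_self[OF r] Nr r by (simp add: g_def inner_smult_right power2_eq_square)
 finally have "ip V x g \<odot> g = r" using r Nr by (simp add: g_def smult_smult)
 then have b: "opr (insert g G) (%x. x) x = x" unfolding ins using x p by (simp add: r_def minus_add_cancel)
 let ?S = "cspan V (insert x G)"
 have S: "subsp ?S" using Gc x by (intro subsp_cspan) auto
 have "?p \<in> ?S" unfolding opr_def by (rule ocomb_mem_subsp[OF S fG]) (auto intro: cspan_inc)
 then have "r \<in> ?S" unfolding r_def by (intro subspD(6)[OF S]) (auto intro: cspan_inc)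
 then have "g \<in> ?S" unfolding g_def by (intro subspD(5)[OF S])
 with notin on b a show ?thesis by (intro that[of g]) auto
qed

lemma Gram_Schmidt:
 assumes "finite S" "S <= carrier V"
 obtains G where "onf G (%x. x)" "!!x. x \<in> S ==> opr G (%x. x) x = x" "G \<subseteq> cspan V S" proof -
 have "\<exists>G. onf G (%x. x) & (\<forall>x\<in>S. opr G (%x. x) x = x) & G \<subseteq> cspan V S" using assms
 proof (induction S rule: finite_induct)
  case empty
  show ?case by (rule exI[of _ "{}"]) (auto simp: onf_def)
 next
  case (insert x S)
  then obtain G where G: "onf G (%x. x)" "\<forall>y\<in>S. opr G (%x. x) y = y" "G \<subseteq> cspan V S" by auto
  have mono: "cspan V S \<subseteq> cspan V (insert x S)" by (rule cspan_mono) auto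
  have sub: "subsp (cspan V (insert x S))" using insert by (intro subsp_cspan) auto
  show ?case proof (cases "opr G (%x. x) x = x")
   case True
   with G mono show ?thesis by (intro exI[of _ G]) auto
  next
   case False
   obtain g where g: "g \<notin> G" "onf (insert g G) (%x. x)" "opr (insert g G) (%x. x) x = x"
    "!!y. y \<in> carrier V ==> opr G (%x. x) y = y ==> opr (insert g G) (%x. x) y = y"
    "g \<in> cspan V (insert x G)" using onf_extend[OF G(1) _ False] insert by auto
   have "insert x G \<subseteq> cspan V (insert x S)" using G(3) mono cspan_inc[of x "insert x S"] by auto
   then have "cspan V (insert x G) \<subseteq> cspan V (insert x S)" by (rule cspan_minimal[OF _ sub])
   with g G mono insert show ?thesis by (intro exI[of _ "insert g G"]) auto
  qed
 qed
 then show ?thesis using that by blast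
qed

text \<open>The coefficients are attached to indices and not to vectors, because \<open>x\<close>
  may repeat vectors and the same coefficients are later applied to another family.\<close>

lemma cspan_finite_comb:
 assumes "finite I" "x \<in> I \<rightarrow> carrier V" "y \<in> cspan V (x ` I)" obtains c where "y = ocomb I c x" proof -
 let ?W = "{y. \<exists>c. y = ocomb I c x}"
 have "subsp ?W" unfolding subsp_def proof (intro conjI ballI allI subsetI)
  have "\<zero> = ocomb I (%_. 0) x" unfolding ocomb_def using assms(1,2) by (intro sym[OF M.add.finprod_one_eqI]) (auto simp: Pi_iff)
  then show "\<zero> \<in> ?W" by blast
  fix u v assume "u \<in> ?W" "v \<in> ?W"
  then obtain c d where "u = ocomb I c x" "v = ocomb I d x" by blast
  moreover have "ocomb I (%i. c i + d i) x = ocomb I c x \<oplus> ocomb I d x" proof -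
   have "ocomb I (%i. c i + d i) x = (\<Oplus>i\<in>I. c i \<odot> x i \<oplus> d i \<odot> x i)"
    unfolding ocomb_def using assms(2) by (intro M.finsum_cong') (auto simp: smult_add_left Pi_iff)
   also have "... = ocomb I c x \<oplus> ocomb I d x" unfolding ocomb_def using assms(2) by (intro M.finsum_addf) auto
   finally show ?thesis .
  qed
  ultimately show "u \<oplus> v \<in> ?W" by (metis (mono_tags, lifting) mem_Collect_eq)
 next
  fix a u assume "u \<in> ?W"
  then obtain c where "u = ocomb I c x" by blast
  moreover have "a \<odot> ocomb I c x = ocomb I (%i. a * c i) x" unfolding ocomb_def using assms(1,2)
   by (subst finsum_smult[symmetric]) (auto simp: smult_smult Pi_iff intro!: M.finsum_cong')
  ultimately show "a \<odot> u \<in> ?W" by blast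
 qed (use assms in auto)
 moreover have "x ` I \<subseteq> ?W" proof
  fix u assume "u \<in> x ` I"
  then obtain j where j: "j \<in> I" "u = x j" by auto
  have I: "I = insert j (I - {j})" using j by auto
  have "ocomb I (%i. if i = j then 1 else 0) x
    = (if j = j then 1 else 0) \<odot> x j \<oplus> (\<Oplus>i\<in>I - {j}. (if i = j then 1 else 0) \<odot> x i)"
   unfolding ocomb_def by (subst I, rule finsum_insert') (use assms j in auto)
  also have "(\<Oplus>i\<in>I - {j}. (if i = j then 1 else 0) \<odot> x i) = \<zero>" using assms by (intro M.add.finprod_one_eqI) (auto simp: Pi_iff)
  also have "(if j = j then 1 else 0) \<odot> x j \<oplus> \<zero> = u" using j assms(2) by (simp add: Pi_iff)
  finally show "u \<in> ?W" by (auto intro!: exI[of _ "%i. if i = j then 1 else 0"])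
 qed
 ultimately have "cspan V (x ` I) \<subseteq> ?W" by (intro cspan_minimal)
 with assms(3) that show ?thesis by blast
qed

text \<open>A finite orthonormal set never spans, and any vector outside its span extends
  it.\<close>

lemma exists_onf:
 assumes "infinite_dimensional V" obtains G where "onf G (%x. x)" "card G = n" proof -
 have "\<exists>G. onf G (%x. x) & card G = n" proof (induction n)
  case 0
  show ?case by (rule exI[of _ "{}"]) (auto simp: onf_def)
 next
  case (Suc n)
  then obtain G where G: "onf G (%x. x)" "card G = n" by auto
  have Gc: "G <= carrier V" "finite G" using onfD(1,3)[OF G(1)] by auto
  then obtain x where x: "x \<in> carrier V" "x \<notin> cspan V G" using assms subspD(1)[OF subsp_cspan[OF Gc(1)]] unfolding infinite_dimensional_def by blast
  have "opr G (%x. x) x \<in> cspan V G" unfolding opr_def by (rule ocomb_mem_subsp[OF subsp_cspan[OF Gc(1)] Gc(2)]) (auto intro: cspan_inc)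
  then have "opr G (%x. x) x ~= x" using x by metis
  from onf_extend[OF G(1) x(1) this] obtain g where "g \<notin> G" "onf (insert g G) (%x. x)" by metis
  then show ?case using G Gc by (intro exI[of _ "insert g G"]) auto
 qed
 then show ?thesis using that by blast
qed

lemma exists_onf_family:
 assumes "infinite_dimensional V" "finite I" obtains f where "onf I f" proof -
 obtain G where G: "onf G (%x. x)" "card G = card I" using exists_onf[OF assms(1)] .
 then obtain f where "bij_betw f I G" using assms(2) onfD(1)[OF G(1)] by (metis finite_same_card_bij)
 then have "onf I f" using G(1) assms(2) unfolding onf_def bij_betw_def by (auto simp: inj_on_def Pi_iff)
 then show ?thesis by (rule that)
qed

end

section \<open>Bounded operators and adjoints\<close>

lemma (in complex_normed_space) nrm_zero [simp]: "nrm V \<zero> = 0" by (simp add: nrm_eq_0_iff)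

lemma (in complex_normed_space) nrm_nonneg [simp]: "x \<in> carrier V ==> 0 <= nrm V x" proof -
 assume x: "x \<in> carrier V"
 then have "x \<oplus> (-1) \<odot> x = \<zero>" by (simp flip: vminus_eq)
 with x show ?thesis using nrm_triangle[of x "(-1) \<odot> x"] nrm_smult[of x "-1"] by simp
qed

lemma (in complex_normed_space) nrm_minus_commute:
 "x \<in> carrier V ==> y \<in> carrier V ==> nrm V (x \<ominus> y) = nrm V (y \<ominus> x)"
 using nrm_smult[of "y \<ominus> x" "-1"] minus_commute[of x y] by simp

lemma (in complex_normed_space) nrm_le_add_minus:
 "x \<in> carrier V ==> y \<in> carrier V ==> nrm V x <= nrm V y + nrm V (x \<ominus> y)"
 using nrm_triangle[of y "x \<ominus> y"] by (simp add: add_minus_cancel')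

lemma (in complex_normed_space) nrm_diff_abs:
 "x \<in> carrier V ==> y \<in> carrier V ==> \<bar>nrm V x - nrm V y\<bar> <= nrm V (x \<ominus> y)"
 using nrm_le_add_minus[of x y] nrm_le_add_minus[of y x] nrm_minus_commute[of x y] by linarith

lemma (in complex_normed_space) nrm_minus_triangle:
 "x \<in> carrier V ==> y \<in> carrier V ==> z \<in> carrier V ==> nrm V (x \<ominus> z) <= nrm V (x \<ominus> y) + nrm V (y \<ominus> z)"
 using nrm_triangle[of "x \<ominus> y" "y \<ominus> z"] by (simp add: minus_minus_trans)

lemma (in complex_normed_space) nrm_finsum_le:
 "finite A ==> f \<in> A \<rightarrow> carrier V ==> nrm V (finsum V f A) <= (\<Sum>i\<in>A. nrm V (f i))" proof (induction A rule: finite_induct)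
 case (insert a A)
 then have "finsum V f (insert a A) = f a \<oplus> finsum V f A" "finsum V f A \<in> carrier V" "f a \<in> carrier V" by (auto intro!: finsum_insert' M.finsum_closed)
 with insert show ?case using nrm_triangle[of "f a" "finsum V f A"] by simp
qed simp

context inner_space
begin

lemma bounded_opsD:
 assumes "a \<in> bounded_ops V" shows "clinear_on V V a" "a \<in> extensional (carrier V)" "x \<in> carrier V ==> a x \<in> carrier V"
 using assms by (auto simp: bounded_ops_def clinear_on_def)

lemma bounded_opsI:
 assumes "clinear_on V V a" "a \<in> extensional (carrier V)" "!!x. x \<in> carrier V ==> N (a x) <= C * N x" shows "a \<in> bounded_ops V"
 using assms by (auto simp: bounded_ops_def)

lemma bounded_ops_eqI:
 "a \<in> bounded_ops V ==> b \<in> bounded_ops V ==> (!!x. x \<in> carrier V ==> a x = b x) ==> a = b"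
 by (rule extensionalityI[OF bounded_opsD(2) bounded_opsD(2)])

lemma op_norm_bound:
 assumes a: "a \<in> bounded_ops V" and x: "x \<in> carrier V" shows "N (a x) <= op_norm V a * N x" proof (cases "x = \<zero>")
 case True
 have "a \<zero> = \<zero>" by (rule clinear_on_zero[OF cvec_axioms cvec_axioms bounded_opsD(1)[OF a]])
 then show ?thesis using True N_eq_0_iff[of \<zero>] by simp
next
 case False
 then have Nx: "N x > 0" using N_eq_0_iff[OF x] N_nonneg[OF x] by linarith
 define y where "y = complex_of_real (1 / N x) \<odot> x"
 have y: "y \<in> carrier V" using x by (simp add: y_def)
 have Ny: "N y = 1" unfolding y_def N_smult[OF x] norm_of_real using Nx by simp
 obtain C where C: "!!x. x \<in> carrier V ==> N (a x) <= C * N x" using a by (auto simp: bounded_ops_def)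
 have "N (a u) <= \<bar>C\<bar>" if "u \<in> carrier V" "N u <= 1" for u proof -
  have "N (a u) <= C * N u" by (rule C[OF that(1)])
  also have "... <= \<bar>C\<bar> * 1" using that by (intro mult_mono) auto
  finally show ?thesis by simp
 qed
 then have "N (a y) <= op_norm V a" unfolding op_norm_def using y Ny by (intro cSup_upper) (auto intro!: bdd_aboveI[of _ "\<bar>C\<bar>"])
 moreover have "a y = complex_of_real (1 / N x) \<odot> a x" unfolding y_def by (rule clinear_onD(3)[OF bounded_opsD(1)[OF a] x])
 then have "N (a y) = N (a x) / N x" using N_smult[OF bounded_opsD(3)[OF a x], of "complex_of_real (1 / N x)"] Nx unfolding norm_of_real by simp
 ultimately show ?thesis using Nx by (simp add: field_simps)
qed

lemma op_norm_le:
 assumes a: "a \<in> bounded_ops V" and C: "0 <= C" "!!x. x \<in> carrier V ==> N (a x) <= C * N x" shows "op_norm V a <= C" unfolding op_norm_def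
proof (rule cSup_least)
 show "{N (a x) |x. x \<in> carrier V & N x <= 1} ~= {}" using N_eq_0_iff[of \<zero>] by force
 fix r assume "r \<in> {N (a x) |x. x \<in> carrier V & N x <= 1}"
 then obtain x where x: "x \<in> carrier V" "N x <= 1" "r = N (a x)" by auto
 have "N (a x) <= C * N x" by (rule C(2)[OF x(1)])
 also have "... <= C * 1" using x C by (intro mult_left_mono) auto
 finally show "r <= C" using x by simp
qed

lemma op_norm_nonneg: "a \<in> bounded_ops V ==> 0 <= op_norm V a" proof -
 assume a: "a \<in> bounded_ops V"
 obtain C where C: "!!x. x \<in> carrier V ==> N (a x) <= C * N x" using a by (auto simp: bounded_ops_def)
 have "a \<zero> = \<zero>" by (rule clinear_on_zero[OF cvec_axioms cvec_axioms bounded_opsD(1)[OF a]])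
 \<comment> \<open>In the trivial space \<open>C\<close> may be negative; its absolute value bounds
   the set under the supremum in every case.\<close>
 have "N (a u) <= \<bar>C\<bar>" if "u \<in> carrier V" "N u <= 1" for u proof -
  have "N (a u) <= C * N u" by (rule C[OF that(1)])
  also have "... <= \<bar>C\<bar> * 1" using that by (intro mult_mono) auto
  finally show ?thesis by simp
 qed
 then have "N (a \<zero>) <= op_norm V a" unfolding op_norm_def using N_eq_0_iff[of \<zero>] by (intro cSup_upper) (auto intro!: bdd_aboveI[of _ "\<bar>C\<bar>"])
 then show ?thesis using \<open>a \<zero> = \<zero>\<close> N_eq_0_iff[of \<zero>] by simp
qed

lemma bounded_ops_compose:
 assumes a: "a \<in> bounded_ops V" and b: "b \<in> bounded_ops V" shows "compose (carrier V) a b \<in> bounded_ops V" proof (rule bounded_opsI)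
 show "clinear_on V V (compose (carrier V) a b)" by (rule clinear_on_cong[OF _ cvec_axioms clinear_on_comp[OF bounded_opsD(1)[OF b] bounded_opsD(1)[OF a]]])
   (simp add: compose_def)
 fix x assume x: "x \<in> carrier V"
 have "N (a (b x)) <= op_norm V a * N (b x)" by (rule op_norm_bound[OF a bounded_opsD(3)[OF b x]])
 also have "... <= op_norm V a * (op_norm V b * N x)" by (intro mult_left_mono op_norm_bound[OF b x] op_norm_nonneg[OF a])
 finally show "N (compose (carrier V) a b x) <= (op_norm V a * op_norm V b) * N x" using x by (simp add: compose_def mult.assoc)
qed (simp add: compose_def)

lemma bounded_ops_add:
 assumes a: "a \<in> bounded_ops V" and b: "b \<in> bounded_ops V" shows "(\<lambda>x\<in>carrier V. a x \<oplus> b x) \<in> bounded_ops V" proof (rule bounded_opsI)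
 note aD = clinear_onD[OF bounded_opsD(1)[OF a]] and bD = clinear_onD[OF bounded_opsD(1)[OF b]]
 show "clinear_on V V (\<lambda>x\<in>carrier V. a x \<oplus> b x)" by (rule clinear_onI) (simp_all add: aD bD smult_add_right M.a_ac)
 fix x assume x: "x \<in> carrier V"
 show "N ((\<lambda>x\<in>carrier V. a x \<oplus> b x) x) <= (op_norm V a + op_norm V b) * N x"
  using N_triangle[OF aD(1)[OF x] bD(1)[OF x]] op_norm_bound[OF a x] op_norm_bound[OF b x] x by (simp add: distrib_right)
qed simp

lemma bounded_ops_smult:
 assumes a: "a \<in> bounded_ops V" shows "(\<lambda>x\<in>carrier V. c \<odot> a x) \<in> bounded_ops V" proof (rule bounded_opsI)
 note aD = clinear_onD[OF bounded_opsD(1)[OF a]]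
 show "clinear_on V V (\<lambda>x\<in>carrier V. c \<odot> a x)" by (rule clinear_onI) (simp_all add: aD smult_add_right smult_smult mult.commute)
 fix x assume x: "x \<in> carrier V"
 show "N ((\<lambda>x\<in>carrier V. c \<odot> a x) x) <= (cmod c * op_norm V a) * N x" using mult_left_mono[OF op_norm_bound[OF a x], of "cmod c"] x
  by (simp add: N_smult aD mult.assoc)
qed simp

lemma bounded_ops_id: "(\<lambda>x\<in>carrier V. x) \<in> bounded_ops V" by (rule bounded_opsI[where C=1]) (auto intro!: clinear_onI)

end

section \<open>The Riesz representation theorem and adjoints\<close>

context hilbert_space
begin

lemma Cauchy_converges:
 assumes s: "!!n. s n \<in> carrier V" and c: "!!e. e > 0 ==> \<exists>M. \<forall>m\<ge>M. \<forall>n\<ge>M. N (s m \<ominus> s n) < e"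
 obtains v where "v \<in> carrier V" "(%n. N (s n \<ominus> v)) \<longlonglongrightarrow> 0" proof -
 have "s \<in> cauchy_seqs (normed_of V)" using s c by (auto simp: cauchy_seqs_def)
 then show ?thesis using complete that unfolding complete_normed_def by auto
qed

text \<open>A variational proof, which bypasses closed subspaces and orthogonal complements: the
  vector representing \<open>f\<close> is the minimiser of \<open>J\<close>, found as the limit of a
  minimising sequence.\<close>

theorem Riesz_representation:
 fixes f :: "'v => complex" assumes add: "!!x y. x \<in> carrier V ==> y \<in> carrier V ==> f (x \<oplus> y) = f x + f y"
  and smult: "!!c x. x \<in> carrier V ==> f (c \<odot> x) = c * f x" and bound: "!!x. x \<in> carrier V ==> cmod (f x) <= C * N x"
 obtains y where "y \<in> carrier V" "!!x. x \<in> carrier V ==> f x = ip V x y" proof -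
 define J where "J x = (N x)\<^sup>2 - 2 * Re (f x)" for x
 have lower: "- (C\<^sup>2) <= J x" if x: "x \<in> carrier V" for x proof -
  have "Re (f x) <= C * N x" using bound[OF x] complex_Re_le_cmod[of "f x"] by linarith
  moreover have "0 <= (N x - C)\<^sup>2" by simp
  ultimately show ?thesis unfolding J_def power2_diff by (simp add: mult.commute)
 qed
 define m where "m = Inf (J ` carrier V)"
 have bdd: "bdd_below (J ` carrier V)" using lower by (intro bdd_belowI[of _ "- (C\<^sup>2)"]) auto
 have mle: "m <= J x" if "x \<in> carrier V" for x unfolding m_def using that bdd by (intro cInf_lower) auto
 have "\<exists>x. x \<in> carrier V & J x < m + 1 / real (Suc n)" for n using cInf_lessD[of "J ` carrier V" "m + 1 / real (Suc n)"] by (auto simp: m_def)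
 then obtain s where s: "!!n. s n \<in> carrier V" "!!n. J (s n) < m + 1 / real (Suc n)" by metis
 \<comment> \<open>The parallelogram law: \<open>J\<close> at the midpoint \<open>?h\<close> is at
   least \<open>m\<close>, which bounds the distance of two almost minimal points. Minimising
   sequences are therefore Cauchy.\<close>
 have par: "(N (x \<ominus> y))\<^sup>2 / 2 <= J x + J y - 2 * m" if x: "x \<in> carrier V" and y: "y \<in> carrier V" for x y proof -
  let ?h = "(1/2) \<odot> (x \<oplus> y)"
  have "N ?h = N (x \<oplus> y) / 2" using N_smult[of "x \<oplus> y" "1/2"] x y by (simp add: norm_divide)
  then have "(N ?h)\<^sup>2 = (N (x \<oplus> y))\<^sup>2 / 4" by (simp only: power_divide) simp
  moreover have "Re (f ?h) = Re (f x + f y) / 2" using x y by (simp add: smult add)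
  ultimately have "2 * J ?h = (N (x \<oplus> y))\<^sup>2 / 2 - 2 * Re (f x + f y)" unfolding J_def by simp
  moreover have "2 * m <= 2 * J ?h" using mle[of ?h] x y by simp
  ultimately have "2 * m <= ((N x)\<^sup>2 + (N y)\<^sup>2 + 2 * Re (ip V x y)) / 2 - 2 * (Re (f x) + Re (f y))" by (simp add: N_add_sq x y)
  moreover have "2 * m <= (a + b + 2 * r) / 2 - 2 * (u + v) ==>
    (a + b - 2 * r) / 2 <= (a - 2 * u) + (b - 2 * v) - 2 * m" for a b r u v :: real by (simp add: field_simps)
  ultimately show ?thesis unfolding J_def N_minus_sq[OF x y] by blast
 qed
 have cau: "\<exists>M. \<forall>p\<ge>M. \<forall>q\<ge>M. N (s p \<ominus> s q) < e" if e: "e > 0" for e proof -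
  obtain M where M: "1 / real (Suc M) < e\<^sup>2 / 4" using nat_approx_posE[of "e\<^sup>2/4"] e by auto
  have "N (s p \<ominus> s q) < e" if "p \<ge> M" "q \<ge> M" for p q proof -
   have "1 / real (Suc p) <= 1 / real (Suc M)" "1 / real (Suc q) <= 1 / real (Suc M)" using that by (auto intro!: divide_left_mono)
   then have "(N (s p \<ominus> s q))\<^sup>2 / 2 < e\<^sup>2 / 2" using par[OF s(1)[of p] s(1)[of q]] s(2)[of p] s(2)[of q] M by linarith
   then have "(N (s p \<ominus> s q))\<^sup>2 < e\<^sup>2" by simp
   then show ?thesis using e by (intro power_less_imp_less_base[of _ 2 e]) auto
  qed
  then show ?thesis by blast
 qed
 obtain y where y: "y \<in> carrier V" and lim: "(%n. N (s n \<ominus> y)) \<longlonglongrightarrow> 0" using Cauchy_converges[OF s(1) cau] by blast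
 have "f z = ip V z y" if z: "z \<in> carrier V" for z proof -
  define d where "d = ip V z y - f z"
  have limd: "(%n. ip V z (s n)) \<longlonglongrightarrow> ip V z y" proof -
   have "cmod (ip V z (s n) - ip V z y) <= N z * N (s n \<ominus> y)" for n using Cauchy_Schwarz[OF z, of "s n \<ominus> y"] s(1) y by (simp add: inner_minus_right z)
   then have "(%n. ip V z (s n) - ip V z y) \<longlonglongrightarrow> 0"
    by (intro tendsto_0_le[OF lim, of _ "N z"]) (auto simp: mult.commute s(1) y intro!: always_eventually)
   then show ?thesis by (simp add: LIM_zero_iff)
  qed
  \<comment> \<open>The variation of \<open>J\<close> in the direction \<open>c z\<close>: it is
    almost nonnegative at \<open>s n\<close>, and the limit removes the defect
    \<open>1 / (n + 1)\<close>.\<close>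
  have ge: "0 <= (cmod c)\<^sup>2 * (N z)\<^sup>2 + 2 * Re (c * d)" for c proof -
   have "0 <= 1 / real (Suc n) + (cmod c)\<^sup>2 * (N z)\<^sup>2 + 2 * Re (c * (ip V z (s n) - f z))" for n proof -
    have cz: "c \<odot> z \<in> carrier V" using z by simp
    have "J (s n \<oplus> c \<odot> z) = J (s n) + (cmod c)\<^sup>2 * (N z)\<^sup>2 + 2 * Re (ip V (c \<odot> z) (s n)) - 2 * Re (c * f z)"
     unfolding J_def using N_add_sq[OF cz s(1)[of n]] M.a_comm[OF cz s(1)[of n]] z s(1)[of n] by (simp add: add smult N_smult power_mult_distrib)
    moreover have "m <= J (s n \<oplus> c \<odot> z)" using s(1) cz by (intro mle) simp
    ultimately show ?thesis using s(2)[of n] z s(1)[of n] by (simp add: inner_smult_left algebra_simps)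
   qed
   moreover have "(%n. 1 / real (Suc n) + (cmod c)\<^sup>2 * (N z)\<^sup>2 + 2 * Re (c * (ip V z (s n) - f z)))
     \<longlonglongrightarrow> 0 + (cmod c)\<^sup>2 * (N z)\<^sup>2 + 2 * Re (c * (ip V z y - f z))" by (intro tendsto_intros limd LIMSEQ_Suc[OF lim_1_over_n])
   ultimately have "0 <= 0 + (cmod c)\<^sup>2 * (N z)\<^sup>2 + 2 * Re (c * (ip V z y - f z))" by (intro LIMSEQ_le_const) auto
   then show ?thesis by (simp add: d_def)
  qed
  have "d = 0" proof (rule ccontr)
   assume "d ~= 0"
   then have dp: "0 < (cmod d)\<^sup>2" by simp
   \<comment> \<open>With \<open>c\<close> equal to \<open>-t\<close> times the conjugate of
     \<open>d\<close>, the linear term in \<open>ge\<close> is \<open>-2 t |d|^2\<close>; this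
     \<open>t\<close> keeps the quadratic term below \<open>t |d|^2\<close>.\<close>
   define t where "t = 1 / (1 + (N z)\<^sup>2)"
   have t: "t > 0" by (simp add: t_def add_pos_nonneg)
   have tz: "t * (N z)\<^sup>2 < 1" unfolding t_def by (simp add: add_pos_nonneg)
   define c where "c = - complex_of_real t * cnj d"
   have "Re (c * d) = - (t * (cmod d)\<^sup>2)" unfolding c_def cmod_power2 by (simp add: power2_eq_square algebra_simps)
   moreover have "(cmod c)\<^sup>2 = t\<^sup>2 * (cmod d)\<^sup>2" unfolding c_def using t by (simp add: norm_mult power_mult_distrib)
   ultimately have "0 <= t\<^sup>2 * (cmod d)\<^sup>2 * (N z)\<^sup>2 - 2 * (t * (cmod d)\<^sup>2)" using ge[of c] by simp
   also have "... = (t * (cmod d)\<^sup>2) * (t * (N z)\<^sup>2 - 2)" by (simp add: power2_eq_square algebra_simps)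
   finally have le: "0 <= (t * (cmod d)\<^sup>2) * (t * (N z)\<^sup>2 - 2)" .
   have "(t * (cmod d)\<^sup>2) * (t * (N z)\<^sup>2 - 2) < 0" by (rule mult_pos_neg[OF mult_pos_pos[OF t dp]]) (use tz in linarith)
   with le show False by linarith
  qed
  then show ?thesis by (simp add: d_def)
 qed
 with y show ?thesis by (rule that)
qed

text \<open>By Cauchy-Schwarz \<open>x -> <a x, y>\<close> is a bounded functional, so Riesz gives
  the value at \<open>y\<close>. It is restricted to the carrier because operators are extensional;
  its bound comes from |b x|^2 = <x, a b x>.\<close>

lemma adjoint_ex:
 assumes a: "a \<in> bounded_ops V" shows "\<exists>b. b \<in> bounded_ops V & (\<forall>x\<in>carrier V. \<forall>y\<in>carrier V. ip V (a x) y = ip V x (b y))" proof -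
 note aD = clinear_onD[OF bounded_opsD(1)[OF a]]
 have "\<exists>z. z \<in> carrier V & (\<forall>x\<in>carrier V. ip V (a x) y = ip V x z)" if y: "y \<in> carrier V" for y proof -
  have b: "cmod (ip V (a x) y) <= (op_norm V a * N y) * N x" if x: "x \<in> carrier V" for x proof -
   have "cmod (ip V (a x) y) <= N (a x) * N y" by (rule Cauchy_Schwarz[OF aD(1)[OF x] y])
   also have "... <= (op_norm V a * N x) * N y" by (intro mult_right_mono op_norm_bound[OF a x] N_nonneg[OF y])
   finally show ?thesis by (simp only: mult_ac)
  qed show ?thesis by (rule Riesz_representation[of "%x. ip V (a x) y", OF _ _ b])
    (auto simp: aD y inner_add_left inner_smult_left)
 qed
 then obtain b0 where b0: "!!y. y \<in> carrier V ==> b0 y \<in> carrier V"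
  "!!x y. x \<in> carrier V ==> y \<in> carrier V ==> ip V (a x) y = ip V x (b0 y)" by metis
 define b where "b = restrict b0 (carrier V)"
 have bb: "b y \<in> carrier V" "!!x. x \<in> carrier V ==> ip V (a x) y = ip V x (b y)" if "y \<in> carrier V" for y using b0 that by (auto simp: b_def)
 have bb': "ip V (b y) x = ip V y (a x)" if "x \<in> carrier V" "y \<in> carrier V" for x y
  using bb(2)[OF that(2,1)] inner_cnj[of x "b y"] inner_cnj[of "a x" y] that aD(1)[of x] bb(1)[of y] by simp
 have "b \<in> bounded_ops V" proof (rule bounded_opsI)
  show "clinear_on V V b" proof (rule clinear_onI)
   fix x y assume "x \<in> carrier V" "y \<in> carrier V"
   then show "b (x \<oplus> y) = b x \<oplus> b y" by (intro inner_eqI) (auto simp: bb bb' inner_add_left aD)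
  next
   fix c x assume "x \<in> carrier V"
   then show "b (c \<odot> x) = c \<odot> b x" by (intro inner_eqI) (auto simp: bb bb' inner_smult_left aD)
  qed (rule bb)
  fix x assume x: "x \<in> carrier V"
  have "N (b x) * N (b x) = cmod (ip V (b x) (b x))" using inner_self[OF bb(1)[OF x]] by (simp add: power2_eq_square norm_mult)
  also have "... = cmod (ip V x (a (b x)))" by (simp add: bb'[OF bb(1)[OF x] x])
  also have "... <= N x * N (a (b x))" by (rule Cauchy_Schwarz[OF x aD(1)[OF bb(1)[OF x]]])
  also have "... <= N x * (op_norm V a * N (b x))" by (intro mult_left_mono op_norm_bound[OF a bb(1)[OF x]] N_nonneg[OF x])
  finally have "N (b x) * N (b x) <= (op_norm V a * N x) * N (b x)" by (simp only: mult_ac)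
  then show "N (b x) <= op_norm V a * N x" using op_norm_nonneg[OF a] x bb(1)[OF x] N_nonneg[OF bb(1)[OF x]] by (cases "N (b x) = 0") (simp_all add: mult_le_cancel_right)
 qed (simp add: b_def)
 then show ?thesis using bb by blast
qed

lemma adjoint_unique:
 assumes "b \<in> bounded_ops V" "b' \<in> bounded_ops V"
  "!!x y. x \<in> carrier V ==> y \<in> carrier V ==> ip V x (b y) = ip V x (b' y)"
 shows "b = b'" proof (rule bounded_ops_eqI[OF assms(1,2)])
 fix x assume x: "x \<in> carrier V"
 note c = bounded_opsD(3)[OF assms(1) x] bounded_opsD(3)[OF assms(2) x]
 show "b x = b' x" proof (rule inner_eqI[OF c])
  fix z assume z: "z \<in> carrier V"
  show "ip V (b x) z = ip V (b' x) z" using assms(3)[OF z x] inner_cnj[OF z c(1)] inner_cnj[OF z c(2)] by simp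
 qed
qed

lemma adjoint_eqI:
 assumes "a \<in> bounded_ops V" "b \<in> bounded_ops V"
  "!!x y. x \<in> carrier V ==> y \<in> carrier V ==> ip V (a x) y = ip V x (b y)"
 shows "adjoint_op V a = b" unfolding adjoint_op_def proof (rule the_equality)
 fix b' assume "b' \<in> bounded_ops V & (\<forall>x\<in>carrier V. \<forall>y\<in>carrier V. ip V (a x) y = ip V x (b' y))"
 with assms show "b' = b" by (intro adjoint_unique) auto
qed (use assms in blast)

lemma adjoint_props:
 assumes "a \<in> bounded_ops V" shows adjoint_bounded: "adjoint_op V a \<in> bounded_ops V"
  and inner_adjoint: "x \<in> carrier V ==> y \<in> carrier V ==> ip V (a x) y = ip V x (adjoint_op V a y)" proof -
 obtain b where b: "b \<in> bounded_ops V" "\<forall>x\<in>carrier V. \<forall>y\<in>carrier V. ip V (a x) y = ip V x (b y)" using adjoint_ex[OF assms] by blast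
 then have "adjoint_op V a = b" using assms by (intro adjoint_eqI) auto
 with b show "adjoint_op V a \<in> bounded_ops V"
  "x \<in> carrier V ==> y \<in> carrier V ==> ip V (a x) y = ip V x (adjoint_op V a y)" by auto
qed

lemma inner_adjoint_left:
 assumes "a \<in> bounded_ops V" "x \<in> carrier V" "y \<in> carrier V" shows "ip V (adjoint_op V a x) y = ip V x (a y)"
 using inner_adjoint[OF assms(1,3,2)] inner_cnj[of y "adjoint_op V a x"] inner_cnj[of "a y" x]
  bounded_opsD(3)[OF adjoint_bounded[OF assms(1)] assms(2)] bounded_opsD(3)[OF assms(1,3)] assms by simp

lemma adjoint_adjoint: "a \<in> bounded_ops V ==> adjoint_op V (adjoint_op V a) = a" by (rule adjoint_eqI) (auto simp: adjoint_bounded inner_adjoint_left)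

lemma adjoint_compose:
 assumes a: "a \<in> bounded_ops V" and b: "b \<in> bounded_ops V" shows "adjoint_op V (compose (carrier V) a b) = compose (carrier V) (adjoint_op V b) (adjoint_op V a)"
proof (rule adjoint_eqI)
 fix x y assume x: "x \<in> carrier V" and y: "y \<in> carrier V"
 show "ip V (compose (carrier V) a b x) y = ip V x (compose (carrier V) (adjoint_op V b) (adjoint_op V a) y)" using x y inner_adjoint[OF a bounded_opsD(3)[OF b x] y]
   inner_adjoint[OF b x bounded_opsD(3)[OF adjoint_bounded[OF a] y]] by (simp add: compose_def)
qed (intro bounded_ops_compose adjoint_bounded a b)+

lemma adjoint_add:
 assumes "a \<in> bounded_ops V" "b \<in> bounded_ops V"
 shows "adjoint_op V (\<lambda>x\<in>carrier V. a x \<oplus> b x) = (\<lambda>x\<in>carrier V. adjoint_op V a x \<oplus> adjoint_op V b x)" by (rule adjoint_eqI)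
  (simp_all add: assms bounded_ops_add adjoint_bounded inner_adjoint bounded_opsD(3)
   bounded_opsD(3)[OF adjoint_bounded] inner_add_left inner_add_right)

lemma adjoint_smult:
 assumes "a \<in> bounded_ops V" shows "adjoint_op V (\<lambda>x\<in>carrier V. c \<odot> a x) = (\<lambda>x\<in>carrier V. cnj c \<odot> adjoint_op V a x)"
 by (rule adjoint_eqI)
  (simp_all add: assms bounded_ops_smult adjoint_bounded inner_adjoint bounded_opsD(3)
   bounded_opsD(3)[OF adjoint_bounded] inner_smult_left inner_smult_right)

lemma adjoint_id: "adjoint_op V (\<lambda>x\<in>carrier V. x) = (\<lambda>x\<in>carrier V. x)" by (rule adjoint_eqI) (auto simp: bounded_ops_id)

lemma op_norm_adjoint_le: "a \<in> bounded_ops V ==> op_norm V (adjoint_op V a) <= op_norm V a" proof -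
 assume a: "a \<in> bounded_ops V"
 let ?b = "adjoint_op V a"
 note b = adjoint_bounded[OF a] show ?thesis proof (rule op_norm_le[OF b op_norm_nonneg[OF a]])
  fix x assume x: "x \<in> carrier V"
  note bx = bounded_opsD(3)[OF b x]
  have "N (?b x) * N (?b x) = cmod (ip V (?b x) (?b x))" using inner_self[OF bx] by (simp add: power2_eq_square norm_mult)
  also have "... = cmod (ip V x (a (?b x)))" by (simp add: inner_adjoint_left[OF a x bx])
  also have "... <= N x * N (a (?b x))" by (rule Cauchy_Schwarz[OF x bounded_opsD(3)[OF a bx]])
  also have "... <= N x * (op_norm V a * N (?b x))" by (intro mult_left_mono op_norm_bound[OF a bx] N_nonneg[OF x])
  finally have "N (?b x) * N (?b x) <= (op_norm V a * N x) * N (?b x)" by (simp only: mult_ac)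
  then show "N (?b x) <= op_norm V a * N x" using op_norm_nonneg[OF a] x N_nonneg[OF bx] by (cases "N (?b x) = 0") (simp_all add: mult_le_cancel_right)
 qed
qed

end

section \<open>Operators of finite rank\<close>

context inner_space
begin

text \<open>The operator \<open>\<Sum>i\<in>I. |u i\<rangle>\<langle>v i|\<close>.\<close>

definition fro :: "'i set => ('i => 'v) => ('i => 'v) => 'v => 'v" where
 "fro I u v = (\<lambda>x\<in>carrier V. ocomb I (%i. ip V x (v i)) u)"

lemma fro_apply: "x \<in> carrier V ==> fro I u v x = ocomb I (%i. ip V x (v i)) u" by (simp add: fro_def)

lemma fro_bounded:
 assumes "finite I" "u \<in> I \<rightarrow> carrier V" "v \<in> I \<rightarrow> carrier V" shows "fro I u v \<in> bounded_ops V" proof (rule bounded_opsI)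
 have c: "x \<in> carrier V ==> fro I u v x \<in> carrier V" for x using assms(2) by (auto simp: fro_apply)
 show "clinear_on V V (fro I u v)" proof (rule clinear_onI)
  fix x y assume xy: "x \<in> carrier V" "y \<in> carrier V"
  show "fro I u v (x \<oplus> y) = fro I u v x \<oplus> fro I u v y" proof (rule inner_eqI)
   fix z assume z: "z \<in> carrier V"
   show "ip V (fro I u v (x \<oplus> y)) z = ip V (fro I u v x \<oplus> fro I u v y) z"
    using xy z c assms by (simp add: inner_add_left fro_apply inner_ocomb_left Pi_iff algebra_simps sum.distrib)
  qed (use xy c in auto)
 next
  fix a x assume x: "x \<in> carrier V"
  show "fro I u v (a \<odot> x) = a \<odot> fro I u v x" proof (rule inner_eqI)
   fix z assume z: "z \<in> carrier V"
   show "ip V (fro I u v (a \<odot> x)) z = ip V (a \<odot> fro I u v x) z"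
    using x z c assms by (simp add: inner_smult_left fro_apply inner_ocomb_left Pi_iff sum_distrib_left mult.assoc)
  qed (use x c in auto)
 qed (rule c)
 fix x assume x: "x \<in> carrier V"
 interpret n: complex_normed_space "normed_of V" by (rule normed)
 have fs: "finsum V f A = finsum (normed_of V) f A" for f :: "'i => 'v" and A by (simp add: finsum_def finprod_def)
 have "N (fro I u v x) <= (\<Sum>i\<in>I. N (ip V x (v i) \<odot> u i))" using n.nrm_finsum_le[of I "%i. ip V x (v i) \<odot> u i"] x assms
  by (simp add: fro_apply ocomb_def fs Pi_iff)
 also have "... <= (\<Sum>i\<in>I. (N (v i) * N (u i)) * N x)" proof (rule sum_mono)
  fix i assume "i \<in> I"
  then have ui: "u i \<in> carrier V" and vi: "v i \<in> carrier V" using assms by auto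
  have "cmod (ip V x (v i)) * N (u i) <= (N x * N (v i)) * N (u i)" by (intro mult_right_mono Cauchy_Schwarz x vi N_nonneg ui)
  then show "N (ip V x (v i) \<odot> u i) <= (N (v i) * N (u i)) * N x" by (simp add: N_smult ui mult_ac)
 qed
 finally show "N (fro I u v x) <= (\<Sum>i\<in>I. N (v i) * N (u i)) * N x" by (simp add: sum_distrib_right)
qed (simp add: fro_def)

text \<open>On the orthonormal vectors \<open>v j\<close> the operator takes the prescribed values
  \<open>u j\<close>.\<close>

lemma fro_onf: "onf I v ==> u \<in> I \<rightarrow> carrier V ==> j \<in> I ==> fro I u v (v j) = u j" proof -
 assume v: "onf I v" and u: "u \<in> I \<rightarrow> carrier V" and j: "j \<in> I"
 note vD = onfD[OF v]
 have uj: "u j \<in> carrier V" using u j by auto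
 have c: "fro I u v (v j) \<in> carrier V" using u by (auto simp: fro_apply vD(3)[OF j]) show ?thesis proof (rule inner_eqI[OF c uj])
  fix z assume z: "z \<in> carrier V"
  have "ip V (fro I u v (v j)) z = (\<Sum>i\<in>I. (if j = i then 1 else 0) * ip V (u i) z)" using u z vD(1) by (simp add: fro_apply vD(3)[OF j] inner_ocomb_left vD(4) j)
  also have "... = (\<Sum>i\<in>I. if j = i then ip V (u i) z else 0)" by (intro sum.cong) auto
  also have "... = ip V (u j) z" using vD(1) j by simp
  finally show "ip V (fro I u v (v j)) z = ip V (u j) z" .
 qed
qed

lemma ocomb_cong: "(!!i. i \<in> I ==> c i = d i) ==> (!!i. i \<in> I ==> f i = g i) ==> g \<in> I \<rightarrow> carrier V ==>
  ocomb I c f = ocomb I d g" unfolding ocomb_def by (intro M.finsum_cong') (auto simp: Pi_iff)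

lemma fro_cong: "(!!i. i \<in> I ==> u i = u' i) ==> (!!i. i \<in> I ==> v i = v' i) ==> u' \<in> I \<rightarrow> carrier V ==>
  fro I u v = fro I u' v'" unfolding fro_def by (intro restrict_ext ocomb_cong) auto

lemma ocomb_zero: "(!!i. i \<in> I ==> c i = 0 \<or> f i = \<zero>) ==> f \<in> I \<rightarrow> carrier V ==> ocomb I c f = \<zero>"
 unfolding ocomb_def by (rule M.add.finprod_one_eqI) (metis PiE smult_0_left smult_0_right)

lemma clinear_ocomb: "clinear_on V V a ==> finite I ==> f \<in> I \<rightarrow> carrier V ==>
  a (ocomb I c f) = ocomb I c (%i. a (f i))" proof -
 assume a: "clinear_on V V a" and I: "finite I" and f: "f \<in> I \<rightarrow> carrier V"
 note aD = clinear_onD[OF a]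
 have "a (ocomb I c f) = (\<Oplus>i\<in>I. a (c i \<odot> f i))" unfolding ocomb_def using f by (intro clinear_on_finsum[OF cvec_axioms cvec_axioms a I]) auto
 also have "... = ocomb I c (%i. a (f i))" unfolding ocomb_def using f by (intro M.finsum_cong') (auto simp: Pi_iff aD)
 finally show ?thesis .
qed

lemma compose_fro_left:
 assumes "a \<in> bounded_ops V" "finite I" "u \<in> I \<rightarrow> carrier V" "v \<in> I \<rightarrow> carrier V"
 shows "compose (carrier V) a (fro I u v) = fro I (%i. a (u i)) v" unfolding compose_def fro_def
 by (intro restrict_ext) (simp add: clinear_ocomb[OF bounded_opsD(1)[OF assms(1)] assms(2,3)])

lemma opr_eq_fro: "x \<in> carrier V ==> opr I f x = fro I f f x" by (simp add: opr_def fro_apply)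

end

section \<open>Pseudo-inverses and partial isometries of finite rank\<close>

context hilbert_space
begin

text \<open>In bra-ket notation |u><v| a = |u><a^* v|. With \<open>compose_fro_left\<close> this
  reduces products of finite-rank operators to applications to vectors.\<close>

lemma compose_fro_right:
 assumes "a \<in> bounded_ops V" "finite I" "u \<in> I \<rightarrow> carrier V" "v \<in> I \<rightarrow> carrier V"
 shows "compose (carrier V) (fro I u v) a = fro I u (%i. adjoint_op V a (v i))" unfolding compose_def proof (rule extensionalityI[where A="carrier V"])
 fix x assume x: "x \<in> carrier V"
 show "(\<lambda>x\<in>carrier V. fro I u v (a x)) x = fro I u (%i. adjoint_op V a (v i)) x" using x assms bounded_opsD(3)[OF assms(1) x]
  by (simp add: fro_apply) (intro ocomb_cong, auto simp: Pi_iff inner_adjoint)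
qed (auto simp: fro_def)

lemma adjoint_fro:
 assumes "finite I" "u \<in> I \<rightarrow> carrier V" "v \<in> I \<rightarrow> carrier V" shows "adjoint_op V (fro I u v) = fro I v u" proof (rule adjoint_eqI)
 fix x y assume xy: "x \<in> carrier V" "y \<in> carrier V"
 have cj: "cnj (ip V y (u i)) = ip V (u i) y" if "i \<in> I" for i using inner_cnj[of y "u i"] that assms(2) xy by (auto simp: Pi_iff)
 show "ip V (fro I u v x) y = ip V x (fro I v u y)" using xy assms by (simp add: fro_apply inner_ocomb_left inner_ocomb_right cj mult.commute)
qed (use assms in \<open>auto intro: fro_bounded\<close>)

lemma fro_projection:
 assumes "onf I f" shows "fro I f f \<in> projections V" proof -
 note fD = onfD[OF assms]
 have "compose (carrier V) (fro I f f) (fro I f f) = fro I (%i. fro I f f (f i)) f" by (rule compose_fro_left[OF fro_bounded]) (use fD in auto)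
 also have "... = fro I f f" by (rule fro_cong) (auto simp: fro_onf[OF assms fD(2)] fD(3))
 finally show ?thesis using fD by (auto simp: projections_def adjoint_fro fro_bounded)
qed

lemma projection_bounded: "p \<in> projections V ==> p \<in> bounded_ops V" by (simp add: projections_def)

lemma projection_contr:
 assumes p: "p \<in> projections V" shows "op_norm V p <= 1" proof (rule op_norm_le[OF projection_bounded[OF p]])
 fix x assume x: "x \<in> carrier V"
 have px: "p x \<in> carrier V" using bounded_opsD(3)[OF projection_bounded[OF p] x] .
 have pp: "p (p x) = p x" proof -
  have "compose (carrier V) p p x = p x" using p by (simp add: projections_def)
  then show ?thesis using x by (simp add: compose_def)
 qed
 have "N (p x) * N (p x) = cmod (ip V (p x) (p x))" using inner_self[OF px] by (simp add: power2_eq_square norm_mult)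
 also have "ip V (p x) (p x) = ip V x (p x)" using inner_adjoint[OF projection_bounded[OF p] x px] p pp by (simp add: projections_def)
 also have "cmod ... <= N x * N (p x)" by (rule Cauchy_Schwarz[OF x px])
 finally show "N (p x) <= 1 * N x" using N_nonneg[OF px] N_nonneg[OF x] by (cases "N (p x) = 0") (simp_all add: mult_le_cancel_right)
qed simp

text \<open>The operator has finite rank, so its inverse from its range to the orthogonal complement
  of its kernel is bounded. \<open>p\<close> projects to the span of the vectors \<open>x i\<close>,
  with orthonormal basis \<open>G\<close>.\<close>

lemma pseudo_inverse:
 assumes e: "onf I e" and x: "x \<in> I \<rightarrow> carrier V" obtains s p where "s \<in> bounded_ops V" "p \<in> projections V"
  "compose (carrier V) s (fro I e x) = p" "compose (carrier V) (fro I e x) p = fro I e x" proof -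
 note eD = onfD[OF e]
 obtain G where G: "onf G (%x. x)" "!!y. y \<in> x ` I ==> opr G (%x. x) y = y" "G \<subseteq> cspan V (x ` I)"
  using Gram_Schmidt[of "x ` I"] eD(1) x by blast
 note GD = onfD[OF G(1)]
 have "\<exists>c. g = ocomb I c x" if "g \<in> G" for g using cspan_finite_comb[OF eD(1) x, of g] G(3) that by blast
 then obtain c where c: "!!g. g \<in> G ==> g = ocomb I (c g) x" by metis
 \<comment> \<open>As \<open>g\<close> is the combination of the \<open>x i\<close> with
   coefficients \<open>c g\<close>, the same combination of the \<open>e i\<close> recovers its
   coefficient: the image of \<open>y\<close> has inner product <y, g> with
   \<open>v g\<close>.\<close>
 define v where "v g = ocomb I (c g) e" for g
 have v: "v \<in> G \<rightarrow> carrier V" using eD(2) by (auto simp: v_def)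
 define s where "s = fro G (%g. g) v"
 define p where "p = fro G (%g. g) (%g. g)"
 have s: "s \<in> bounded_ops V" unfolding s_def using GD v by (intro fro_bounded) auto
 have p: "p \<in> projections V" unfolding p_def by (rule fro_projection[OF G(1)])
 have px: "p (x i) = x i" if "i \<in> I" for i using G(2)[of "x i"] that x by (auto simp: p_def opr_eq_fro Pi_iff)
 have "compose (carrier V) s (fro I e x) = p" proof (rule bounded_ops_eqI)
  fix y assume y: "y \<in> carrier V"
  define z where "z = fro I e x y"
  have z: "z = ocomb I (%i. ip V y (x i)) e" and zc: "z \<in> carrier V" unfolding z_def fro_apply[OF y] using eD(2) by auto
  have "ip V z (v g) = ip V y g" if g: "g \<in> G" for g proof -
   have "ip V z (v g) = (\<Sum>i\<in>I. cnj (c g i) * ip V z (e i))" unfolding v_def using eD zc by (intro inner_ocomb_right) auto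
   also have "... = (\<Sum>i\<in>I. cnj (c g i) * ip V y (x i))" unfolding z by (intro sum.cong) (simp_all add: inner_ocomb_onf[OF e])
   also have "... = ip V y (ocomb I (c g) x)" using eD x y by (intro inner_ocomb_right[symmetric]) auto
   finally show ?thesis using c[OF g] by simp
  qed
  then have "s z = p y" unfolding s_def p_def fro_apply[OF zc] fro_apply[OF y] by (intro ocomb_cong) (use GD in auto)
  then show "compose (carrier V) s (fro I e x) y = p y" using y by (simp add: compose_def z_def)
 qed (intro bounded_ops_compose s fro_bounded eD(1,2) x projection_bounded[OF p])+
 moreover have "compose (carrier V) (fro I e x) p = fro I e x" proof -
  have "compose (carrier V) (fro I e x) p = fro I e (%i. adjoint_op V p (x i))"
   by (rule compose_fro_right) (use p eD x in \<open>auto intro: projection_bounded\<close>)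
  also have "... = fro I e x" using p px eD by (intro fro_cong) (auto simp: projections_def)
  finally show ?thesis .
 qed
 ultimately show ?thesis using s p by (intro that) 
qed

text \<open>Two partial isometries with a common initial projection \<open>p\<close>, which fixes
  \<open>A\<close>, and orthogonal final projections. The identities are recorded as products of
  operators, since this is the form in which they act on module elements.\<close>

definition splitting :: "'v set => ('v => 'v) => ('v => 'v) => ('v => 'v) => bool" where
 "splitting A s t p \<longleftrightarrow> s \<in> bounded_ops V & t \<in> bounded_ops V & p \<in> bounded_ops V &
  (\<forall>x\<in>A. p x = x) & adjoint_op V p = p &
  compose (carrier V) (adjoint_op V s) s = p & compose (carrier V) (adjoint_op V t) t = p &
  compose (carrier V) (adjoint_op V s) t = (\<lambda>x\<in>carrier V. \<zero>) &
  compose (carrier V) (adjoint_op V t) s = (\<lambda>x\<in>carrier V. \<zero>) &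
  compose (carrier V) s (adjoint_op V s) \<in> projections V &
  compose (carrier V) t (adjoint_op V t) \<in> projections V &
  orthogonal_ops V (compose (carrier V) s (adjoint_op V s)) (compose (carrier V) t (adjoint_op V t)) &
  compose (carrier V) (compose (carrier V) s (adjoint_op V s)) s = s &
  compose (carrier V) (compose (carrier V) t (adjoint_op V t)) t = t &
  op_norm V s <= 1 & op_norm V t <= 1"

text \<open>\<open>p\<close> is the projection to the span of \<open>A\<close>, with orthonormal
  basis \<open>G\<close>; \<open>s\<close> and \<open>t\<close> carry \<open>G\<close> to two
  mutually orthogonal copies, for which the infinite dimension leaves room.\<close>

lemma splitting_exists:
 assumes inf: "infinite_dimensional V" and A: "finite A" "A <= carrier V" obtains s t p where "splitting A s t p" proof -
 obtain G where G: "onf G (%x. x)" "!!y. y \<in> A ==> opr G (%x. x) y = y" using Gram_Schmidt[OF A] by blast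
 note GD = onfD[OF G(1)]
 \<comment> \<open>One orthonormal family indexed by two copies of \<open>G\<close> yields
   \<open>f1\<close> and \<open>f2\<close> together with their mutual orthogonality.\<close>
 obtain f where f: "onf (G \<times> (UNIV :: bool set)) f" by (rule exists_onf_family[OF inf, of "G \<times> (UNIV :: bool set)"]) (use GD(1) in auto)
 note fD = onfD[OF f]
 define f1 where "f1 g = f (g, True)" for g
 define f2 where "f2 g = f (g, False)" for g
 have f12: "onf G f1" "onf G f2" using fD GD(1) by (auto simp: onf_def f1_def f2_def)
 have orth: "ip V (f1 g) (f2 h) = 0" "ip V (f2 g) (f1 h) = 0" if "g \<in> G" "h \<in> G" for g h
  using that fD(4)[of "(g, True)" "(h, False)"] fD(4)[of "(g, False)" "(h, True)"] by (auto simp: f1_def f2_def)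
 let ?i = "%g::'v. g"
 have gen: "fro G u ?i \<in> bounded_ops V & adjoint_op V (fro G u ?i) = fro G ?i u &
   compose (carrier V) (fro G ?i u) (fro G u ?i) = fro G ?i ?i &
   compose (carrier V) (fro G u ?i) (fro G ?i u) = fro G u u &
   fro G u u \<in> projections V & compose (carrier V) (fro G u u) (fro G u ?i) = fro G u ?i &
   op_norm V (fro G u ?i) <= 1" if u: "onf G u" for u proof -
  note uD = onfD[OF u]
  have b: "fro G u ?i \<in> bounded_ops V" "fro G ?i u \<in> bounded_ops V" "fro G u u \<in> bounded_ops V" using GD uD by (auto intro!: fro_bounded)
  have "compose (carrier V) (fro G ?i u) (fro G u ?i) = fro G (%g. fro G ?i u (u g)) ?i" by (rule compose_fro_left[OF b(2)]) (use GD uD in auto)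
  also have "... = fro G ?i ?i" by (rule fro_cong) (use fro_onf[OF u GD(2)] GD in auto)
  finally have 1: "compose (carrier V) (fro G ?i u) (fro G u ?i) = fro G ?i ?i" .
  have "compose (carrier V) (fro G u ?i) (fro G ?i u) = fro G (%g. fro G u ?i g) u" by (rule compose_fro_left[OF b(1)]) (use GD uD in auto)
  also have "... = fro G u u" by (rule fro_cong) (use fro_onf[OF G(1) uD(2)] uD in auto)
  finally have 2: "compose (carrier V) (fro G u ?i) (fro G ?i u) = fro G u u" .
  have "compose (carrier V) (fro G u u) (fro G u ?i) = fro G (%g. fro G u u (u g)) ?i" by (rule compose_fro_left[OF b(3)]) (use GD uD in auto)
  also have "... = fro G u ?i" by (rule fro_cong) (use fro_onf[OF u uD(2)] uD in auto)
  finally have 3: "compose (carrier V) (fro G u u) (fro G u ?i) = fro G u ?i" .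
  \<comment> \<open>The coefficients of \<open>x\<close> with respect to \<open>G\<close> become the
    coefficients with respect to \<open>u\<close>, so Bessel's inequality bounds the image.\<close>
  have 4: "op_norm V (fro G u ?i) <= 1" proof (rule op_norm_le[OF b(1)])
   fix x assume x: "x \<in> carrier V"
   have "(N (fro G u ?i x))\<^sup>2 <= (N x)\<^sup>2" unfolding fro_apply[OF x] N_ocomb[OF u] by (rule Bessel[OF G(1) x])
   then show "N (fro G u ?i x) <= 1 * N x" using x by (simp add: power2_le_iff_abs_le abs_le_square_iff[symmetric] bounded_opsD(3)[OF b(1)])
  qed simp show ?thesis using b(1) adjoint_fro[of G u ?i] GD uD fro_projection[OF u] 1 2 3 4 by auto
 qed
 have ort: "compose (carrier V) (fro G ?i u) (fro G u' ?i) = (\<lambda>x\<in>carrier V. \<zero>)"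
  if u: "onf G u" "onf G u'" and o: "!!g h. g \<in> G ==> h \<in> G ==> ip V (u' g) (u h) = 0" for u u' proof -
  note uD = onfD[OF u(1)] and u'D = onfD[OF u(2)]
  have "compose (carrier V) (fro G ?i u) (fro G u' ?i) = fro G (%g. fro G ?i u (u' g)) ?i"
   by (rule compose_fro_left) (use GD uD u'D in \<open>auto intro: fro_bounded\<close>)
  also have "... = fro G (%g. \<zero>) ?i" by (rule fro_cong) (auto simp: fro_apply u'D(3) o GD intro!: ocomb_zero)
  also have "... = (\<lambda>x\<in>carrier V. \<zero>)" unfolding fro_def by (intro restrict_ext ocomb_zero) auto
  finally show ?thesis .
 qed
 have orp: "orthogonal_ops V (fro G f1 f1) (fro G f2 f2)" proof -
  note uD = onfD[OF f12(1)] and u'D = onfD[OF f12(2)]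
  have "compose (carrier V) (fro G f1 f1) (fro G f2 f2) = fro G (%g. fro G f1 f1 (f2 g)) f2"
   by (rule compose_fro_left) (use GD uD u'D in \<open>auto intro: fro_bounded\<close>)
  also have "... = fro G (%g. \<zero>) f2" by (rule fro_cong) (auto simp: fro_apply u'D(3) orth uD intro!: ocomb_zero)
  also have "... = (\<lambda>x\<in>carrier V. \<zero>)" unfolding fro_def by (intro restrict_ext ocomb_zero) auto
  finally show ?thesis unfolding orthogonal_ops_def .
 qed
 have p: "fro G ?i ?i \<in> projections V" by (rule fro_projection[OF G(1)])
 have pA: "\<forall>x\<in>A. fro G ?i ?i x = x" using G(2) A(2) by (auto simp flip: opr_eq_fro)
 have "splitting A (fro G f1 ?i) (fro G f2 ?i) (fro G ?i ?i)" unfolding splitting_def using gen[OF f12(1)] gen[OF f12(2)] ort[OF f12 orth(2)] ort[OF f12(2,1) orth(1)] orp p pA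
  by (simp add: projections_def)
 then show ?thesis by (rule that)
qed

text \<open>\<open>s\<close> and \<open>t\<close> preserve the norm on \<open>A\<close> and have
  orthogonal ranges, so this is the theorem of Pythagoras.\<close>

lemma splitting_N:
 assumes sp: "splitting A s t p" and x: "x \<in> A" "x \<in> carrier V" and y: "y \<in> A" "y \<in> carrier V"
 shows "(N (s x \<oplus> t y))\<^sup>2 = (N x)\<^sup>2 + (N y)\<^sup>2" proof -
 have b: "s \<in> bounded_ops V" "t \<in> bounded_ops V" using sp by (auto simp: splitting_def)
 have sx: "s x \<in> carrier V" and ty: "t y \<in> carrier V" using b bounded_opsD(3) x y by auto
 have "adjoint_op V s (s x) = x" "adjoint_op V t (t y) = y" "adjoint_op V s (t y) = \<zero>" proof -
  have "compose (carrier V) (adjoint_op V s) s x = x" "compose (carrier V) (adjoint_op V t) t y = y"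
   "compose (carrier V) (adjoint_op V s) t y = \<zero>" using sp x y by (auto simp: splitting_def)
  then show "adjoint_op V s (s x) = x" "adjoint_op V t (t y) = y" "adjoint_op V s (t y) = \<zero>" using x y by (auto simp: compose_def)
 qed
 then have "ip V (s x) (s x) = ip V x x" "ip V (t y) (t y) = ip V y y" "ip V (s x) (t y) = 0"
  using inner_adjoint[OF b(1) x(2) sx] inner_adjoint[OF b(2) y(2) ty] inner_adjoint[OF b(1) x(2) ty] x by auto
 then show ?thesis using N_add_sq[OF sx ty] by (simp add: N_sq sx ty x y)
qed

end

section \<open>The conjugate space\<close>

lemma conj_space_sel [simp]:
 "carrier (conj_space V) = carrier V" "\<zero>\<^bsub>conj_space V\<^esub> = \<zero>\<^bsub>V\<^esub>" "add (conj_space V) = add V"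
 "c \<odot>\<^bsub>conj_space V\<^esub> x = cnj c \<odot>\<^bsub>V\<^esub> x" "ip (conj_space V) x y = ip V y x" by (simp_all add: conj_space_def)

lemma conj_space_minus [simp]: "x \<ominus>\<^bsub>conj_space V\<^esub> y = x \<ominus>\<^bsub>V\<^esub> y" by (simp add: a_minus_def a_inv_def m_inv_def)

lemma nrm_conj_space [simp]: "nrm (normed_of (conj_space V)) = nrm (normed_of V)" by (rule ext) simp

lemma finsum_conj_space [simp]: "finsum (conj_space V) = finsum V" by (intro ext) (simp add: finsum_def finprod_def)

lemma inner_space_conj_space:
 assumes "inner_space V" shows "inner_space (conj_space V)" proof -
 interpret inner_space V by fact
 have "cvec (conj_space V)" by (rule cvecI) (auto simp: smult_add_left smult_add_right smult_smult M.a_ac)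
 then show ?thesis by (intro inner_space.intro inner_space_axioms.intro)
   (auto simp: inner_add_right inner_smult_right inner_nonneg inner_cnj[symmetric] intro: inner_definite)
qed

lemma hilbert_space_conj_space:
 assumes "hilbert_space V" shows "hilbert_space (conj_space V)" proof -
 interpret hilbert_space V by fact
 interpret c: inner_space "conj_space V" by (rule inner_space_conj_space[OF inner_space_axioms])
 have "cauchy_seqs (normed_of (conj_space V)) = cauchy_seqs (normed_of V)" unfolding cauchy_seqs_def nrm_conj_space by simp
 then have "complete_normed (normed_of (conj_space V))" using complete unfolding complete_normed_def nrm_conj_space by simp show ?thesis
 proof (intro hilbert_space.intro hilbert_space_axioms.intro)
  show "module complex_ring (conj_space V)" by (rule c.module_axioms)
  show "complete_normed (normed_of (conj_space V))" by fact
 qed (fact c.inner_add_left c.inner_smult_left c.inner_cnj c.inner_nonneg c.inner_definite)+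
qed

text \<open>Homogeneity for all conjugated scalars is homogeneity for all scalars, and the norms
  coincide.\<close>

lemma bounded_ops_conj_space: "inner_space V ==> bounded_ops (conj_space V) = bounded_ops V" proof -
 have "clinear_on (conj_space V) (conj_space V) a \<longleftrightarrow> clinear_on V V a" for a unfolding clinear_on_def by simp (metis complex_cnj_cnj)
 then show ?thesis unfolding bounded_ops_def nrm_conj_space by simp
qed

lemma op_norm_conj_space: "op_norm (conj_space V) = op_norm V" unfolding op_norm_def nrm_conj_space by simp

section \<open>Projective tensor products\<close>

lemma pkeys_sum_subset: "(!!i. i \<in> I ==> pkeys (f i) \<subseteq> S) ==> pkeys (sum f I) \<subseteq> S" using keys_sum[of f I] by blast

text \<open>\<open>alg_tensor\<close>, \<open>proj_tensor\<close> and \<open>inner_tensor\<close>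
  are different records over the same vector space; the structure is established once and carried
  over.\<close>

lemma cvec_transfer:
 assumes "cvec V" "carrier W = carrier V" "add W = add V" "\<zero>\<^bsub>W\<^esub> = \<zero>\<^bsub>V\<^esub>" "smult W = smult V" shows "cvec W" proof -
 interpret cvec V by fact show ?thesis by (rule cvecI) (simp_all add: assms(2-5) smult_add_left smult_add_right smult_smult M.a_ac)
qed

lemma minus_transfer:
 assumes "carrier W = carrier V" "add W = add V" "\<zero>\<^bsub>W\<^esub> = \<zero>\<^bsub>V\<^esub>" shows "x \<ominus>\<^bsub>W\<^esub> y = x \<ominus>\<^bsub>V\<^esub> y"
 by (simp add: a_minus_def a_inv_def m_inv_def assms)

lemma quotient_normed_sel [simp]:
 "carrier (quotient_normed V N) = carrier (quotient_module V N)"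
 "\<zero>\<^bsub>quotient_normed V N\<^esub> = \<zero>\<^bsub>quotient_module V N\<^esub>"
 "add (quotient_normed V N) = add (quotient_module V N)"
 "smult (quotient_normed V N) = smult (quotient_module V N)"
 "nrm (quotient_normed V N) A = Inf (nrm V ` A)" by (simp_all add: quotient_normed_def module.defs cnormed_space.defs)

lemma proj_tensor_sel [simp]:
 "carrier (proj_tensor X Y) = carrier (alg_tensor X Y)"
 "\<zero>\<^bsub>proj_tensor X Y\<^esub> = \<zero>\<^bsub>alg_tensor X Y\<^esub>"
 "add (proj_tensor X Y) = add (alg_tensor X Y)"
 "smult (proj_tensor X Y) = smult (alg_tensor X Y)"
 "nrm (proj_tensor X Y) = proj_norm X Y" by (simp_all add: proj_tensor_def module.defs cnormed_space.defs)

abbreviation "fmod X Y == free_module (carrier X \<times> carrier Y)"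

abbreviation "tcls X Y p == tensor_kernel X Y +>\<^bsub>fmod X Y\<^esub> p"

lemma bilinear_relationsE:
 assumes "r \<in> bilinear_relations X Y" obtains (a) x x' y where "x \<in> carrier X" "x' \<in> carrier X" "y \<in> carrier Y"
    "r = sng (x \<oplus>\<^bsub>X\<^esub> x', y) 1 - sng (x, y) 1 - sng (x', y) 1"
  | (b) x y y' where "x \<in> carrier X" "y \<in> carrier Y" "y' \<in> carrier Y"
    "r = sng (x, y \<oplus>\<^bsub>Y\<^esub> y') 1 - sng (x, y) 1 - sng (x, y') 1"
  | (c) c x y where "x \<in> carrier X" "y \<in> carrier Y" "r = sng (c \<odot>\<^bsub>X\<^esub> x, y) 1 - sng (x, y) c"
  | (d) c x y where "x \<in> carrier X" "y \<in> carrier Y" "r = sng (x, c \<odot>\<^bsub>Y\<^esub> y) 1 - sng (x, y) c" proof -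
 note a = that(1) and b = that(2) and c = that(3) and d = that(4) show ?thesis using assms unfolding bilinear_relations_def
  apply (elim UnE CollectE exE conjE)
   apply (rule a; assumption)
   apply (rule b; assumption)
  apply (rule c; assumption)
  apply (rule d; assumption)
  done
qed

definition bilinear_on ::
 "(complex, 'x, 'm) module_scheme => (complex, 'y, 'n) module_scheme => (complex, 'v, 'k) module_scheme =>
  ('x \<times> 'y => 'v) => bool" where
 "bilinear_on X Y V b \<longleftrightarrow> (\<forall>y\<in>carrier Y. clinear_on X V (%x. b (x, y))) &
  (\<forall>x\<in>carrier X. clinear_on Y V (%y. b (x, y)))"

lemma bilinear_onI:
 assumes "!!y. y \<in> carrier Y ==> clinear_on X V (%x. b (x, y))"
  "!!x. x \<in> carrier X ==> clinear_on Y V (%y. b (x, y))"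
 shows "bilinear_on X Y V b" using assms by (simp add: bilinear_on_def)

locale cvec_pair = X: cvec X + Y: cvec Y
 for X :: "(complex, 'x, 'm) module_scheme" and Y :: "(complex, 'y, 'n) module_scheme"
begin

abbreviation "S == carrier X \<times> carrier Y"
abbreviation "AT == alg_tensor X Y"

lemma bilinear_relations_subset: "bilinear_relations X Y <= carrier (fmod X Y)" unfolding bilinear_relations_def
 by (intro subsetI, elim UnE CollectE exE conjE; hypsubst; simp only: free_module_sel mem_Collect_eq;
   intro pkeys_subset; simp)

lemma subsp_tensor_kernel: "FM.subsp S (tensor_kernel X Y)" unfolding tensor_kernel_def by (rule FM.subsp_cspan[OF bilinear_relations_subset])

lemma bilinear_relation_mem:
 "x \<in> carrier X ==> x' \<in> carrier X ==> y \<in> carrier Y ==>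
  sng (x \<oplus>\<^bsub>X\<^esub> x', y) 1 - sng (x, y) 1 - sng (x', y) 1 \<in> bilinear_relations X Y"
 "x \<in> carrier X ==> y \<in> carrier Y ==> y' \<in> carrier Y ==>
  sng (x, y \<oplus>\<^bsub>Y\<^esub> y') 1 - sng (x, y) 1 - sng (x, y') 1 \<in> bilinear_relations X Y"
 "x \<in> carrier X ==> y \<in> carrier Y ==> sng (c \<odot>\<^bsub>X\<^esub> x, y) 1 - sng (x, y) c \<in> bilinear_relations X Y"
 "x \<in> carrier X ==> y \<in> carrier Y ==> sng (x, c \<odot>\<^bsub>Y\<^esub> y) 1 - sng (x, y) c \<in> bilinear_relations X Y"
 unfolding bilinear_relations_def by blast+

lemma alg_tensor_carrier: "carrier AT = (%p. tcls X Y p) ` carrier (fmod X Y)" unfolding alg_tensor_def by (simp only: quotient_module_sel FM.rcosets_eq)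

lemma cvec_alg_tensor: "cvec AT" unfolding alg_tensor_def by (rule FM.cvec_quotient_module[OF subsp_tensor_kernel])

lemma clinear_tcls: "clinear_on (fmod X Y) AT (tcls X Y)" unfolding alg_tensor_def by (rule FM.clinear_on_coset[OF subsp_tensor_kernel])

lemma tcls_closed: "pkeys p <= S ==> tcls X Y p \<in> carrier AT" using clinear_onD(1)[OF clinear_tcls, of p] by simp

lemma tcls_add: "pkeys p <= S ==> pkeys q <= S ==>
  tcls X Y (p + q) = tcls X Y p \<oplus>\<^bsub>AT\<^esub> tcls X Y q" using clinear_onD(2)[OF clinear_tcls, of p q] by simp

lemma tcls_psc: "pkeys p <= S ==> tcls X Y (psc c p) = c \<odot>\<^bsub>AT\<^esub> tcls X Y p" using clinear_onD(3)[OF clinear_tcls, of p c] by simp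

lemma tcls_diff: "pkeys p <= S ==> pkeys q <= S ==>
  tcls X Y (p - q) = tcls X Y p \<ominus>\<^bsub>AT\<^esub> tcls X Y q" using clinear_on_minus[OF cvec_free_module cvec_alg_tensor clinear_tcls, of p q] by (simp add: FM_minus)

lemma tcls_eq_iff: "pkeys p <= S ==> pkeys q <= S ==> tcls X Y p = tcls X Y q \<longleftrightarrow> p - q \<in> tensor_kernel X Y"
 using FM.coset_eq_iff[OF subsp_tensor_kernel, of p q] by (simp add: FM_minus)

lemma alg_tensor_cases:
 assumes "u \<in> carrier AT" obtains p where "pkeys p <= S" "u = tcls X Y p" using assms unfolding alg_tensor_carrier by auto

lemma alg_tensor_zero: "\<zero>\<^bsub>AT\<^esub> = tcls X Y 0" unfolding alg_tensor_def using FM.coset_zero[OF subsp_tensor_kernel] by simp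

lemma tcls_mem: "pkeys p <= S ==> q \<in> tcls X Y p \<longleftrightarrow> pkeys q <= S & q - p \<in> tensor_kernel X Y"
 using FM.mem_coset[OF subsp_tensor_kernel, of p q] by (auto simp: FM_minus)

lemma flift_bilinear_relations:
 assumes V: "cvec V" and b: "bilinear_on X Y V b" and r: "r \<in> bilinear_relations X Y" shows "flift V b r = \<zero>\<^bsub>V\<^esub>" proof -
 interpret V: cvec V by fact
 have bS: "b \<in> S \<rightarrow> carrier V" using b by (auto simp: bilinear_on_def clinear_on_def)
 have b1: "clinear_on X V (%x. b (x, y))" if "y \<in> carrier Y" for y using b that by (simp add: bilinear_on_def)
 have b2: "clinear_on Y V (%y. b (x, y))" if "x \<in> carrier X" for x using b that by (simp add: bilinear_on_def)
 have bc: "b (x, y) \<in> carrier V" if "x \<in> carrier X" "y \<in> carrier Y" for x y using bS that by auto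
 have df: "flift V b (p - q) = flift V b p \<ominus>\<^bsub>V\<^esub> flift V b q" if "pkeys p <= S" "pkeys q <= S" for p q
  using that by (rule flift_diff[OF V bS])
 have sg: "flift V b (sng (x, y) c) = c \<odot>\<^bsub>V\<^esub> b (x, y)" if "x \<in> carrier X" "y \<in> carrier Y" for x y c
  by (rule flift_single[OF V]) (use bc that in auto)
 from r show ?thesis proof (cases rule: bilinear_relationsE)
  case (a x x' y)
  have "flift V b r = (b (x \<oplus>\<^bsub>X\<^esub> x', y) \<ominus>\<^bsub>V\<^esub> b (x, y)) \<ominus>\<^bsub>V\<^esub> b (x', y)"
   unfolding a(4) using a(1-3) by (simp add: df pkeys_subset sg bc)
  also have "... = \<zero>\<^bsub>V\<^esub>" using a(1-3) clinear_onD(2)[OF b1[OF a(3)] a(1,2)] V.add_minus_cancel[of "b (x', y)" "b (x, y)"] bc by (simp add: V.M.a_comm)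
  finally show ?thesis .
 next
  case (b x y y')
  have "flift V b r = (b (x, y \<oplus>\<^bsub>Y\<^esub> y') \<ominus>\<^bsub>V\<^esub> b (x, y)) \<ominus>\<^bsub>V\<^esub> b (x, y')"
   unfolding b(4) using b(1-3) by (simp add: df pkeys_subset sg bc)
  also have "... = \<zero>\<^bsub>V\<^esub>" using b(1-3) clinear_onD(2)[OF b2[OF b(1)] b(2,3)] V.add_minus_cancel[of "b (x, y')" "b (x, y)"] bc by (simp add: V.M.a_comm)
  finally show ?thesis .
 next
  case (c c x y)
  then show ?thesis using clinear_onD(3)[OF b1[OF c(2)] c(1), of c] by (simp add: df pkeys_subset sg bc)
 next
  case (d c x y) show ?thesis unfolding d(3) using clinear_onD(3)[OF b2[OF d(1)] d(2), of c] d(1,2) by (simp add: df pkeys_subset sg bc)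
 qed
qed

lemma bilinear_on_closed: "bilinear_on X Y V b ==> b \<in> S \<rightarrow> carrier V" by (auto simp: bilinear_on_def clinear_on_def)

text \<open>The extra set \<open>R\<close> serves two purposes: when empty it makes
  \<open>tlift\<close> well defined, and as the set of balanced relations it shows that the
  collecting maps of the flatness proofs vanish on all relations.\<close>

lemma flift_cspan_relations:
 assumes V: "cvec V" and b: "bilinear_on X Y V b" and R: "R <= carrier (fmod X Y)"
  and Rz: "!!r. r \<in> R ==> flift V b r = \<zero>\<^bsub>V\<^esub>" and r: "r \<in> cspan (fmod X Y) (bilinear_relations X Y \<union> R)"
 shows "flift V b r = \<zero>\<^bsub>V\<^esub>" by (rule cspan_kernel[OF cvec_free_module V clinear_flift[OF V bilinear_on_closed[OF b]] _ _ r])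
  (use R bilinear_relations_subset Rz flift_bilinear_relations[OF V b] in auto)

lemma flift_tensor_kernel:
 assumes V: "cvec V" and b: "bilinear_on X Y V b" and r: "r \<in> tensor_kernel X Y" shows "flift V b r = \<zero>\<^bsub>V\<^esub>"
 using flift_cspan_relations[OF V b, of "{}" r] r by (simp add: tensor_kernel_def)

lemma flift_tcls_cong:
 assumes V: "cvec V" and b: "bilinear_on X Y V b" and pq: "pkeys p <= S" "pkeys q <= S" "tcls X Y p = tcls X Y q" shows "flift V b p = flift V b q" proof -
 interpret V: cvec V by fact
 have "flift V b (p - q) = \<zero>\<^bsub>V\<^esub>" using pq tcls_eq_iff flift_tensor_kernel[OF V b] by simp
 then have "flift V b p \<ominus>\<^bsub>V\<^esub> flift V b q = \<zero>\<^bsub>V\<^esub>" using flift_diff[OF V bilinear_on_closed[OF b] pq(1,2)] by simp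
 then show ?thesis using V.minus_eq_zero_iff flift_closed[OF V _ bilinear_on_closed[OF b]] pq by simp
qed

definition tlift :: "(complex, 'v, 'k) module_scheme => ('x \<times> 'y => 'v) => ('x \<times> 'y \<Rightarrow>\<^sub>0 complex) set => 'v" where
 "tlift V b u = flift V b (SOME p. pkeys p <= S & u = tcls X Y p)"

lemma tlift_tcls:
 assumes V: "cvec V" and b: "bilinear_on X Y V b" and p: "pkeys p <= S" shows "tlift V b (tcls X Y p) = flift V b p" proof -
 let ?q = "SOME q. pkeys q <= S & tcls X Y p = tcls X Y q"
 have "pkeys ?q \<subseteq> S & tcls X Y p = tcls X Y ?q" by (rule someI_ex) (use p in blast)
 then show ?thesis unfolding tlift_def using flift_tcls_cong[OF V b p, of ?q] by simp
qed

lemma clinear_tlift: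
 assumes V: "cvec V" and b: "bilinear_on X Y V b" shows "clinear_on AT V (tlift V b)" proof (rule clinear_onI)
 note bS = bilinear_on_closed[OF b]
 fix u assume "u \<in> carrier AT"
 then obtain p where p: "pkeys p <= S" "u = tcls X Y p" by (rule alg_tensor_cases)
 then show "tlift V b u \<in> carrier V" using tlift_tcls[OF V b p(1)] flift_closed[OF V p(1) bS] by simp
 show "tlift V b (c \<odot>\<^bsub>AT\<^esub> u) = c \<odot>\<^bsub>V\<^esub> tlift V b u" for c
  using p tlift_tcls[OF V b pkeys_psc_subset[OF p(1)], of c] tlift_tcls[OF V b p(1)] flift_psc[OF V bS p(1)] by (simp add: tcls_psc)
 fix v assume "v \<in> carrier AT"
 then obtain q where q: "pkeys q <= S" "v = tcls X Y q" by (rule alg_tensor_cases)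
 show "tlift V b (u \<oplus>\<^bsub>AT\<^esub> v) = tlift V b u \<oplus>\<^bsub>V\<^esub> tlift V b v"
  using p q tlift_tcls[OF V b pkeys_add_subset[OF p(1) q(1)]] tlift_tcls[OF V b p(1)] tlift_tcls[OF V b q(1)]
   flift_add[OF V bS p(1) q(1)] by (simp add: tcls_add)
qed

lemma elem_tensor_eq: "elem_tensor X Y x y = tcls X Y (sng (x, y) 1)" by (simp add: elem_tensor_def)

end

section \<open>Functoriality of the tensor product\<close>

lemma fmap_bilinear_relations:
 assumes "clinear_on X X' f" "clinear_on Y Y' g" "r \<in> bilinear_relations X Y" shows "fmap (map_prod f g) r \<in> bilinear_relations X' Y'" proof -
 note fD = clinear_onD[OF assms(1)] and gD = clinear_onD[OF assms(2)]
 from assms(3) show ?thesis proof (cases rule: bilinear_relationsE)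
  case (a x x' y)
  have "fmap (map_prod f g) r = sng (f x \<oplus>\<^bsub>X'\<^esub> f x', g y) 1 - sng (f x, g y) 1 - sng (f x', g y) 1"
   unfolding a(4) fmap_diff fmap_single by (simp add: fD(2)[OF a(1,2)])
  then show ?thesis unfolding bilinear_relations_def using fD(1)[OF a(1)] fD(1)[OF a(2)] gD(1)[OF a(3)] by blast
 next
  case (b x y y')
  have "fmap (map_prod f g) r = sng (f x, g y \<oplus>\<^bsub>Y'\<^esub> g y') 1 - sng (f x, g y) 1 - sng (f x, g y') 1"
   unfolding b(4) fmap_diff fmap_single by (simp add: gD(2)[OF b(2,3)])
  then show ?thesis unfolding bilinear_relations_def using fD(1)[OF b(1)] gD(1)[OF b(2)] gD(1)[OF b(3)] by blast
 next
  case (c c x y)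
  have "fmap (map_prod f g) r = sng (c \<odot>\<^bsub>X'\<^esub> f x, g y) 1 - sng (f x, g y) c" unfolding c(3) fmap_diff fmap_single by (simp add: fD(3)[OF c(1)])
  then show ?thesis unfolding bilinear_relations_def using fD(1)[OF c(1)] gD(1)[OF c(2)] by blast
 next
  case (d c x y)
  have "fmap (map_prod f g) r = sng (f x, c \<odot>\<^bsub>Y'\<^esub> g y) 1 - sng (f x, g y) c" unfolding d(3) fmap_diff fmap_single by (simp add: gD(3)[OF d(2)])
  then show ?thesis unfolding bilinear_relations_def using fD(1)[OF d(1)] gD(1)[OF d(2)] by blast
 qed
qed

lemma map_prod_closed: "clinear_on X X' f ==> clinear_on Y Y' g ==>
  map_prod f g \<in> carrier X \<times> carrier Y \<rightarrow> carrier X' \<times> carrier Y'" by (auto simp: clinear_on_def)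

lemma fmap_cspan_relations:
 assumes "cvec X" "cvec Y" "cvec X'" "cvec Y'" "clinear_on X X' f" "clinear_on Y Y' g" and "R <= carrier (fmod X Y)" "R' <= carrier (fmod X' Y')"
  and "!!r. r \<in> R ==> fmap (map_prod f g) r \<in> cspan (fmod X' Y') (bilinear_relations X' Y' \<union> R')"
  and r: "r \<in> cspan (fmod X Y) (bilinear_relations X Y \<union> R)" shows "fmap (map_prod f g) r \<in> cspan (fmod X' Y') (bilinear_relations X' Y' \<union> R')" proof -
 interpret A: cvec_pair X Y using assms by (simp add: cvec_pair_def)
 interpret B: cvec_pair X' Y' using assms by (simp add: cvec_pair_def) show ?thesis
 proof (rule cspan_image[OF cvec_free_module cvec_free_module clinear_fmap[OF map_prod_closed[OF assms(5,6)]] _ _ _ r])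
  show "FM.subsp (carrier X' \<times> carrier Y') (cspan (fmod X' Y') (bilinear_relations X' Y' \<union> R'))"
   using assms(8) B.bilinear_relations_subset by (intro FM.subsp_cspan) auto
  show "bilinear_relations X Y \<union> R <= carrier (fmod X Y)" using assms(7) A.bilinear_relations_subset by auto
  show "fmap (map_prod f g) x \<in> cspan (fmod X' Y') (bilinear_relations X' Y' \<union> R')"
   if "x \<in> bilinear_relations X Y \<union> R" for x using that assms(9) fmap_bilinear_relations[OF assms(5,6), of x]
    FM.cspan_inc[of "fmap (map_prod f g) x" "bilinear_relations X' Y' \<union> R'"] by blast
 qed
qed

lemma fmap_tensor_kernel:
 assumes "cvec X" "cvec Y" "cvec X'" "cvec Y'" "clinear_on X X' f" "clinear_on Y Y' g" and "r \<in> tensor_kernel X Y" shows "fmap (map_prod f g) r \<in> tensor_kernel X' Y'"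
 using fmap_cspan_relations[OF assms(1-6), of "{}" "{}" r] assms(7) by (simp add: tensor_kernel_def)

lemma tensor_map_tcls:
 assumes "cvec X" "cvec Y" "cvec X'" "cvec Y'" "clinear_on X X' f" "clinear_on Y Y' g" and "pkeys p <= carrier X \<times> carrier Y"
 shows "tensor_map X' Y' f g (tcls X Y p) = tcls X' Y' (fmap (map_prod f g) p)" proof -
 interpret A: cvec_pair X Y using assms by (simp add: cvec_pair_def)
 interpret B: cvec_pair X' Y' using assms by (simp add: cvec_pair_def)
 have "tensor_map X' Y' f g = quotient_map (fmod X' Y') (tensor_kernel X' Y') (fmap (map_prod f g))" by (rule ext) (simp add: tensor_map_def fmap_def[abs_def])
 then show ?thesis using quotient_map_coset[OF cvec_free_module cvec_free_module A.subsp_tensor_kernel B.subsp_tensor_kernel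
    clinear_fmap[OF map_prod_closed[OF assms(5,6)]] fmap_tensor_kernel[OF assms(1-6)], of p] assms(7) by simp
qed

lemma clinear_tensor_map:
 assumes "cvec X" "cvec Y" "cvec X'" "cvec Y'" "clinear_on X X' f" "clinear_on Y Y' g" shows "clinear_on (alg_tensor X Y) (alg_tensor X' Y') (tensor_map X' Y' f g)" proof -
 interpret A: cvec_pair X Y using assms by (simp add: cvec_pair_def)
 interpret B: cvec_pair X' Y' using assms by (simp add: cvec_pair_def)
 note t = tensor_map_tcls[OF assms]
 note k = fmap_keys[OF map_prod_closed[OF assms(5,6)]] show ?thesis proof (rule clinear_onI)
  fix u assume "u \<in> carrier (alg_tensor X Y)"
  then obtain p where p: "pkeys p <= A.S" "u = tcls X Y p" by (rule A.alg_tensor_cases)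
  show "tensor_map X' Y' f g u \<in> carrier (alg_tensor X' Y')" using p by (simp add: t B.tcls_closed k)
  show "tensor_map X' Y' f g (c \<odot>\<^bsub>alg_tensor X Y\<^esub> u) = c \<odot>\<^bsub>alg_tensor X' Y'\<^esub> tensor_map X' Y' f g u" for c
   using p A.tcls_psc[OF p(1), of c, symmetric] t[OF pkeys_psc_subset[OF p(1)], of c] by (simp add: t B.tcls_psc k fmap_psc)
  fix v assume "v \<in> carrier (alg_tensor X Y)"
  then obtain q where q: "pkeys q <= A.S" "v = tcls X Y q" by (rule A.alg_tensor_cases)
  show "tensor_map X' Y' f g (u \<oplus>\<^bsub>alg_tensor X Y\<^esub> v) =
    tensor_map X' Y' f g u \<oplus>\<^bsub>alg_tensor X' Y'\<^esub> tensor_map X' Y' f g v" using p q A.tcls_add[OF p(1) q(1), symmetric] t[OF pkeys_add_subset[OF p(1) q(1)]]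
   by (simp add: t B.tcls_add k fmap_add)
 qed
qed

section \<open>The projective norm as a quotient seminorm\<close>

locale normed_pair = X: complex_normed_space X + Y: complex_normed_space Y
 for X :: "('x, 'm) cnormed_space_scheme" and Y :: "('y, 'n) cnormed_space_scheme"
begin

sublocale cvec_pair X Y by unfold_locales

abbreviation "PT == proj_tensor X Y"
abbreviation w :: "'x \<times> 'y => real" where
 "w k == nrm X (fst k) * nrm Y (snd k)"

sublocale T: weighted_relations S w "tensor_kernel X Y" by unfold_locales (auto simp: subsp_tensor_kernel)

lemma finsum_tcls:
 assumes "finite I" "!!i. i \<in> I ==> pkeys (p i) \<subseteq> S" shows "(\<Oplus>\<^bsub>AT\<^esub>i\<in>I. tcls X Y (p i)) = tcls X Y (\<Sum>i\<in>I. p i)"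
 using clinear_on_finsum[OF cvec_free_module cvec_alg_tensor clinear_tcls assms(1), of p] assms by (simp add: FM_finsum Pi_iff)

text \<open>\<open>?A\<close> consists of the weights of finite sequences of pairs,
  \<open>?B\<close> of the weights of formal sums. The sets differ, because a formal sum has
  coefficients and a sequence has repetitions, but their infima agree.\<close>

lemma proj_norm_tcls:
 assumes p: "pkeys p <= S" shows "proj_norm X Y (tcls X Y p) = T.pn p" proof -
 let ?A = "{\<Sum>i<n. nrm X (x i) * nrm Y (y i) | (n::nat) x y.
  x \<in> {..<n} \<rightarrow> carrier X & y \<in> {..<n} \<rightarrow> carrier Y &
  tcls X Y p = (\<Oplus>\<^bsub>AT\<^esub> i \<in> {..<n}. elem_tensor X Y (x i) (y i))}"
 let ?B = "{wsum w q | q. pkeys q <= S & q - p \<in> tensor_kernel X Y}"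
 have BA: "?B \<subseteq> ?A" proof
  fix b assume "b \<in> ?B"
  then obtain q where q: "pkeys q <= S" "q - p \<in> tensor_kernel X Y" "b = wsum w q" by auto
  obtain h where h: "bij_betw h {..<card (pkeys q)} (pkeys q)" using ex_bij_betw_nat_finite[OF finite_keys[of q]] by (auto simp: atLeast0LessThan)
  define n where "n = card (pkeys q)"
  have hS: "h i \<in> S" if "i < n" for i using h that q(1) unfolding n_def bij_betw_def by auto
  \<comment> \<open>The coefficient is absorbed into the first factor, which leaves the weight
    unchanged and turns a formal sum into a sequence.\<close>
  define x where "x i = pat q (h i) \<odot>\<^bsub>X\<^esub> fst (h i)" for i
  define y where "y i = snd (h i)" for i
  have xy: "x i \<in> carrier X" "y i \<in> carrier Y" if "i < n" for i using hS[OF that] by (auto simp: x_def y_def)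
  have "b = (\<Sum>k\<in>pkeys q. cmod (pat q k) * w k)" by (simp add: q wsum_def)
  also have "... = (\<Sum>i<n. cmod (pat q (h i)) * w (h i))" using sum.reindex_bij_betw[OF h, of "%k. cmod (pat q k) * w k"] by (simp add: n_def)
  also have "... = (\<Sum>i<n. nrm X (x i) * nrm Y (y i))" using hS by (intro sum.cong) (auto simp: x_def y_def X.nrm_smult mem_Times_iff)
  finally have b: "b = (\<Sum>i<n. nrm X (x i) * nrm Y (y i))" .
  have "(\<Sum>i<n. sng (x i, y i) 1) - q \<in> tensor_kernel X Y" proof -
   have "q = (\<Sum>k\<in>pkeys q. sng k (pat q k))" by (rule poly_mapping_eqI) (simp add: lookup_sum lookup_single when_def in_keys_iff)
   also have "... = (\<Sum>i<n. sng (h i) (pat q (h i)))" using sum.reindex_bij_betw[OF h, of "%k. sng k (pat q k)"] by (simp add: n_def)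
   finally have "(\<Sum>i<n. sng (x i, y i) 1) - q = (\<Sum>i<n. sng (x i, y i) 1 - sng (h i) (pat q (h i)))" by (simp add: sum_subtractf)
   also have "... = (\<Oplus>\<^bsub>fmod X Y\<^esub>i\<in>{..<n}. sng (x i, y i) 1 - sng (h i) (pat q (h i)))"
    by (rule FM_finsum[symmetric], simp, rule Pi_I, simp only: mem_Collect_eq, intro pkeys_subset)
     (use xy hS in auto)
   also have "... \<in> tensor_kernel X Y" proof (rule FM.subsp_finsum[OF _ subsp_tensor_kernel])
    show "(%i. sng (x i, y i) 1 - sng (h i) (pat q (h i))) \<in> {..<n} \<rightarrow> tensor_kernel X Y" proof
     fix i assume i: "i \<in> {..<n}"
     then have "fst (h i) \<in> carrier X" "snd (h i) \<in> carrier Y" using hS[of i] by auto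
     from bilinear_relation_mem(3)[OF this, of "pat q (h i)"]
     show "sng (x i, y i) 1 - sng (h i) (pat q (h i)) \<in> tensor_kernel X Y" unfolding tensor_kernel_def x_def y_def by (auto intro: FM.cspan_inc)
    qed
   qed simp
   finally show ?thesis .
  qed
  then have "(\<Sum>i<n. sng (x i, y i) 1) - p \<in> tensor_kernel X Y" using T.K_add[OF _ q(2)] by fastforce
  moreover have "pkeys (\<Sum>i<n. sng (x i, y i) (1::complex)) \<subseteq> S" by (rule pkeys_sum_subset) (use xy in auto)
  ultimately have "tcls X Y p = tcls X Y (\<Sum>i<n. sng (x i, y i) 1)" using p by (subst eq_commute) (simp add: tcls_eq_iff)
  also have "... = (\<Oplus>\<^bsub>AT\<^esub> i \<in> {..<n}. elem_tensor X Y (x i) (y i))" unfolding elem_tensor_eq using xy by (intro finsum_tcls[symmetric]) auto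
  finally show "b \<in> ?A" using b xy by blast
 qed
 \<comment> \<open>In a formal sum equal pairs of the sequence are merged and may cancel, hence the
   inequality.\<close>
 have AB: "\<exists>b\<in>?B. b <= a" if "a \<in> ?A" for a proof -
  obtain n :: nat and x y where a: "x \<in> {..<n} \<rightarrow> carrier X" "y \<in> {..<n} \<rightarrow> carrier Y"
   "tcls X Y p = (\<Oplus>\<^bsub>AT\<^esub> i \<in> {..<n}. elem_tensor X Y (x i) (y i))"
   "a = (\<Sum>i<n. nrm X (x i) * nrm Y (y i))" using \<open>a \<in> ?A\<close> by blast
  define q where "q m = (\<Sum>i<m. sng (x i, y i) (1::complex))" for m
  have q: "pkeys (q m) \<subseteq> S & wsum w (q m) <= (\<Sum>i<m. nrm X (x i) * nrm Y (y i))" if "m <= n" for m using that proof (induction m)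
   case (Suc m)
   then have xy: "x m \<in> carrier X" "y m \<in> carrier Y" using a(1,2) by auto
   have 1: "pkeys (q m) \<subseteq> S" "pkeys (sng (x m, y m) (1::complex)) \<subseteq> S" using Suc xy by auto
   have "wsum w (q m + sng (x m, y m) 1) <= wsum w (q m) + wsum w (sng (x m, y m) 1)" by (rule wsum_add[OF T.weight_nonneg 1])
   with Suc 1 show ?case by (simp add: q_def pkeys_add_subset)
  qed (simp add: q_def)
  have "tcls X Y (q n) = tcls X Y p" unfolding a(3) elem_tensor_eq q_def using a(1,2) by (intro finsum_tcls[symmetric]) auto
  then have "q n - p \<in> tensor_kernel X Y" using q[of n] p by (simp add: tcls_eq_iff)
  with q[of n] show ?thesis unfolding a(4) by blast
 qed
 have pB: "wsum w p \<in> ?B" using p T.K_zero by (intro CollectI exI[of _ p]) simp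
 have B0: "0 <= b" if "b \<in> ?B" for b using that by (elim CollectE exE conjE) (simp add: T.wsum_nonneg')
 have A0: "0 <= a" if "a \<in> ?A" for a using AB[OF that] B0 by (meson order_trans)
 have "Inf ?A = Inf ?B" proof (rule antisym)
  show "Inf ?A <= Inf ?B" by (rule cInf_superset_mono[OF _ bdd_belowI[of _ 0, OF A0] BA]) (use pB in blast)
  show "Inf ?B <= Inf ?A" proof (rule cInf_mono[OF _ bdd_belowI[of _ 0, OF B0] AB])
   show "?A ~= {}" proof
    assume e: "?A = {}"
    show False using subsetD[OF BA pB] unfolding e by (rule emptyE)
   qed
  qed
 qed
 then show ?thesis unfolding proj_norm_def pnorm_def .
qed

lemma cvec_proj_tensor: "cvec PT" by (rule cvec_transfer[OF cvec_alg_tensor]) simp_all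

lemma proj_minus: "u \<ominus>\<^bsub>PT\<^esub> v = u \<ominus>\<^bsub>AT\<^esub> v" by (rule minus_transfer) simp_all

end

section \<open>Quotients of the projective tensor product by closed relations\<close>

context normed_pair
begin

sublocale P: cvec "PT" by (rule cvec_proj_tensor)

lemma proj_norm_triangle:
 assumes "u \<in> carrier AT" "v \<in> carrier AT" shows "proj_norm X Y (u \<oplus>\<^bsub>AT\<^esub> v) <= proj_norm X Y u + proj_norm X Y v" using assms(1)
proof (rule alg_tensor_cases)
 fix p assume p: "pkeys p <= S" "u = tcls X Y p" show ?thesis using assms(2) proof (rule alg_tensor_cases)
  fix q assume q: "pkeys q <= S" "v = tcls X Y q" show ?thesis unfolding p(2) q(2)
   using p(1) q(1) by (simp flip: tcls_add add: proj_norm_tcls pkeys_add_subset T.pn_add)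
 qed
qed

lemma proj_norm_smult:
 assumes "u \<in> carrier AT" shows "proj_norm X Y (c \<odot>\<^bsub>AT\<^esub> u) = cmod c * proj_norm X Y u" using assms proof (rule alg_tensor_cases)
 fix p assume p: "pkeys p <= S" "u = tcls X Y p" show ?thesis unfolding p(2) using p(1) by (simp flip: tcls_psc add: proj_norm_tcls pkeys_psc_subset T.pn_psc)
qed

lemma proj_norm_nonneg: "u \<in> carrier AT ==> 0 <= proj_norm X Y u" by (erule alg_tensor_cases) (simp add: proj_norm_tcls T.pn_nonneg)

lemma proj_norm_elem_le: "x \<in> carrier X ==> y \<in> carrier Y ==> proj_norm X Y (tcls X Y (sng (x, y) 1)) <= nrm X x * nrm Y y"
 using T.pn_le_wsum[of "sng (x, y) 1"] by (simp add: proj_norm_tcls)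

text \<open>\<open>rspan R\<close> lives among formal sums and includes the bilinear relations;
  \<open>rker R\<close> is a closed subspace of the projective tensor product, the form in which
  \<open>balanced_kernel\<close> and \<open>bibalanced_kernel\<close> are given. The following
  lemmas translate between the two levels.\<close>

abbreviation "rspan R == cspan (fmod X Y) (bilinear_relations X Y \<union> R)"

abbreviation "rker R == nclosure PT (cspan PT (tcls X Y ` R))"

lemma subsp_rspan: "R <= carrier (fmod X Y) ==> FM.subsp S (rspan R)" using bilinear_relations_subset by (intro FM.subsp_cspan) auto

lemma tensor_kernel_rspan: "tensor_kernel X Y \<subseteq> rspan R" unfolding tensor_kernel_def by (rule FM.cspan_mono) auto

lemma weighted_rspan: "R <= carrier (fmod X Y) ==> weighted_relations S w (rspan R)" by unfold_locales (auto simp: T.weight_nonneg subsp_rspan)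

lemma clinear_tcls': "clinear_on (fmod X Y) PT (tcls X Y)" using clinear_tcls unfolding clinear_on_def by simp

lemma cspan_tcls:
 assumes R: "R <= carrier (fmod X Y)" shows "cspan PT (tcls X Y ` R) = tcls X Y ` rspan R" proof
 note sub = subsp_rspan[OF R]
 have k: "k \<in> rspan R ==> pkeys k <= S" for k using FM.subspD(3)[OF sub] by auto
 show "cspan PT (tcls X Y ` R) \<subseteq> tcls X Y ` rspan R" proof (rule P.cspan_minimal)
  show "tcls X Y ` R \<subseteq> tcls X Y ` rspan R" by (auto intro: FM.cspan_inc)
  show "P.subsp (tcls X Y ` rspan R)" unfolding P.subsp_def proof (intro conjI ballI allI)
   show "tcls X Y ` rspan R <= carrier PT" using k by (auto intro: tcls_closed)
   show "\<zero>\<^bsub>PT\<^esub> \<in> tcls X Y ` rspan R" using FM.subspD(2)[OF sub] by (auto simp: alg_tensor_zero)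
  next
   fix u v assume "u \<in> tcls X Y ` rspan R" "v \<in> tcls X Y ` rspan R"
   then show "u \<oplus>\<^bsub>PT\<^esub> v \<in> tcls X Y ` rspan R" using FM.subspD(4)[OF sub] k by (auto simp flip: tcls_add)
  next
   fix c u assume "u \<in> tcls X Y ` rspan R"
   then show "c \<odot>\<^bsub>PT\<^esub> u \<in> tcls X Y ` rspan R" using FM.subspD(5)[OF sub] k by (auto simp flip: tcls_psc)
  qed
 qed
 have subC: "P.subsp (cspan PT (tcls X Y ` R))" using R by (intro P.subsp_cspan) (auto intro!: tcls_closed)
 show "tcls X Y ` rspan R \<subseteq> cspan PT (tcls X Y ` R)" proof
  fix u assume "u \<in> tcls X Y ` rspan R"
  then obtain k where k: "k \<in> rspan R" "u = tcls X Y k" by auto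
  have "tcls X Y k \<in> cspan PT (tcls X Y ` R)" proof (rule cspan_image[OF cvec_free_module P.cvec_axioms clinear_tcls' subC _ _ k(1)])
   show "bilinear_relations X Y \<union> R <= carrier (fmod X Y)" using R bilinear_relations_subset by auto
   fix r assume "r \<in> bilinear_relations X Y \<union> R"
   then show "tcls X Y r \<in> cspan PT (tcls X Y ` R)" proof
    assume r: "r \<in> bilinear_relations X Y"
    then have "r \<in> tensor_kernel X Y" unfolding tensor_kernel_def by (rule FM.cspan_inc)
    then have "tcls X Y r = \<zero>\<^bsub>PT\<^esub>" using r bilinear_relations_subset tcls_eq_iff[of r 0] by (auto simp: alg_tensor_zero)
    then show ?thesis using P.subspD(2)[OF subC] by simp
   qed (auto intro: P.cspan_inc)
  qed
  with k show "u \<in> cspan PT (tcls X Y ` R)" by simp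
 qed
qed

lemma tcls_diff': "pkeys p <= S ==> pkeys q <= S ==>
  tcls X Y p \<ominus>\<^bsub>PT\<^esub> tcls X Y q = tcls X Y (p - q)" by (simp add: tcls_diff proj_minus)

text \<open>The closure pulled back to formal sums, where the projective norm of a class is
  \<open>T.pn\<close>.\<close>

lemma rker_tcls:
 assumes R: "R <= carrier (fmod X Y)" and p: "pkeys p <= S"
 shows "tcls X Y p \<in> rker R \<longleftrightarrow> (\<forall>e>0. \<exists>k\<in>rspan R. T.pn (p - k) < e)" proof -
 have "k \<in> rspan R ==> pkeys k <= S" for k using FM.subspD(3)[OF subsp_rspan[OF R]] by auto
 then show ?thesis unfolding nclosure_def cspan_tcls[OF R] using p tcls_closed[OF p] by (auto simp: tcls_diff' proj_norm_tcls pkeys_diff_subset)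
qed

lemma subsp_rker:
 assumes R: "R <= carrier (fmod X Y)" shows "P.subsp (rker R)" proof -
 interpret K: weighted_relations S w "rspan R" by (rule weighted_rspan[OF R]) show ?thesis unfolding P.subsp_def proof (intro conjI ballI allI)
  show "rker R <= carrier PT" by (auto simp: nclosure_def)
  have "T.pn (0 - 0) < e" if "e > 0" for e using that T.pn_K[OF T.K_zero] by simp
  then show "\<zero>\<^bsub>PT\<^esub> \<in> rker R" unfolding proj_tensor_sel alg_tensor_zero using rker_tcls[OF R, of 0] K.K_zero by (auto intro!: bexI[of _ 0])
 next
  fix u v assume uv: "u \<in> rker R" "v \<in> rker R"
  then have "u \<in> carrier AT" "v \<in> carrier AT" by (auto simp: nclosure_def)
  then obtain p q where p: "pkeys p <= S" "u = tcls X Y p" and q: "pkeys q <= S" "v = tcls X Y q" by (elim alg_tensor_cases)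
  have "\<exists>k\<in>rspan R. T.pn ((p + q) - k) < e" if e: "e > 0" for e proof -
   obtain k where k: "k \<in> rspan R" "T.pn (p - k) < e / 2" using uv(1) e unfolding p(2) rker_tcls[OF R p(1)] by (meson half_gt_zero)
   obtain l where l: "l \<in> rspan R" "T.pn (q - l) < e / 2" using uv(2) e unfolding q(2) rker_tcls[OF R q(1)] by (meson half_gt_zero)
   have "T.pn ((p - k) + (q - l)) <= T.pn (p - k) + T.pn (q - l)" using k l p q by (intro T.pn_add pkeys_diff_subset) (auto dest: K.K_keys)
   also have "(p - k) + (q - l) = (p + q) - (k + l)" by simp
   finally show ?thesis using k l K.K_add[OF k(1) l(1)] by (intro bexI[of _ "k + l"]) auto
  qed
  then have "tcls X Y (p + q) \<in> rker R" using p q by (simp add: rker_tcls[OF R] pkeys_add_subset)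
  then show "u \<oplus>\<^bsub>PT\<^esub> v \<in> rker R" using p q by (simp add: tcls_add)
 next
  fix c u assume u: "u \<in> rker R"
  then have "u \<in> carrier AT" by (auto simp: nclosure_def)
  then obtain p where p: "pkeys p <= S" "u = tcls X Y p" by (elim alg_tensor_cases)
  have "\<exists>k\<in>rspan R. T.pn (psc c p - k) < e" if e: "e > 0" for e proof -
   have "e / (cmod c + 1) > 0" using e by (simp add: add_nonneg_pos)
   then obtain k where k: "k \<in> rspan R" "T.pn (p - k) < e / (cmod c + 1)" using u unfolding p(2) rker_tcls[OF R p(1)] by meson
   have pk: "pkeys (p - k) \<subseteq> S" using p K.K_keys[OF k(1)] by (simp add: pkeys_diff_subset)
   have "T.pn (psc c p - psc c k) = cmod c * T.pn (p - k)" using T.pn_psc[OF pk, of c] by (simp add: psc_add)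
   also have "... <= (cmod c + 1) * T.pn (p - k)" using T.pn_nonneg[OF pk] by (intro mult_right_mono) auto
   also have "... < (cmod c + 1) * (e / (cmod c + 1))" by (intro mult_strict_left_mono k(2)) (simp add: add_nonneg_pos)
   also have "... = e" using add_nonneg_pos[OF norm_ge_zero[of c] zero_less_one] by simp
   finally show ?thesis using K.K_psc[OF k(1)] by blast
  qed
  then have "tcls X Y (psc c p) \<in> rker R" using p by (simp add: rker_tcls[OF R] pkeys_psc_subset)
  then show "c \<odot>\<^bsub>PT\<^esub> u \<in> rker R" using p by (simp add: tcls_psc)
 qed
qed

lemma tcls_rspan_rker:
 assumes R: "R <= carrier (fmod X Y)" and k: "k \<in> rspan R" shows "tcls X Y k \<in> rker R" proof -
 have "pkeys k <= S" using FM.subspD(3)[OF subsp_rspan[OF R] k] by simp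
 then show ?thesis using k T.pn_K[OF T.K_zero] by (auto simp: rker_tcls[OF R] intro!: bexI[of _ k])
qed

text \<open>Passing first to tensors and then to the quotient by the closed kernel gives the same
  seminorm as dividing out all relations at once, because the distance to a subspace equals the
  distance to its closure.\<close>

lemma quotient_proj_norm:
 assumes R: "R <= carrier (fmod X Y)" and p: "pkeys p <= S"
 shows "nrm (quotient_normed PT (rker R)) (rker R +>\<^bsub>PT\<^esub> tcls X Y p) = pnorm S w (rspan R) p" proof -
 interpret K: weighted_relations S w "rspan R" by (rule weighted_rspan[OF R])
 let ?C = "rker R +>\<^bsub>PT\<^esub> tcls X Y p"
 have mem: "tcls X Y q \<in> ?C \<longleftrightarrow> tcls X Y (q - p) \<in> rker R" if "pkeys q <= S" for q
  using P.mem_coset[OF subsp_rker[OF R], of "tcls X Y p" "tcls X Y q"] that p by (simp add: tcls_closed tcls_diff')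
 have carr: "u \<in> ?C ==> u \<in> carrier AT" for u using P.mem_coset[OF subsp_rker[OF R], of "tcls X Y p" u] tcls_closed[OF p] by simp
 have bdd: "bdd_below (proj_norm X Y ` ?C)" by (rule bdd_belowI[of _ 0]) (auto dest!: carr intro: proj_norm_nonneg)
 have "Inf (proj_norm X Y ` ?C) = K.pn p" proof (rule antisym)
  show "Inf (proj_norm X Y ` ?C) <= K.pn p" proof (rule K.pn_greatest[OF p])
   fix q assume q: "pkeys q <= S" "q - p \<in> rspan R"
   have "Inf (proj_norm X Y ` ?C) <= proj_norm X Y (tcls X Y q)" using mem[OF q(1)] tcls_rspan_rker[OF R q(2)] bdd by (intro cInf_lower) auto
   also have "... <= wsum w q" using q by (simp add: proj_norm_tcls T.pn_le_wsum)
   finally show "Inf (proj_norm X Y ` ?C) <= wsum w q" .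
  qed
  \<comment> \<open>More relations mean more representatives and hence a smaller infimum.\<close>
  have T_ge: "K.pn q <= T.pn q" if "pkeys q <= S" for q by (rule T.pn_greatest[OF that]) (use tensor_kernel_rspan in \<open>auto intro: K.pn_le\<close>)
  show "K.pn p <= Inf (proj_norm X Y ` ?C)" proof (rule cInf_greatest)
   have "tcls X Y p \<in> ?C" by (rule P.coset_self[OF subsp_rker[OF R]]) (simp add: tcls_closed p)
   then show "proj_norm X Y ` ?C ~= {}" by auto
   fix a assume "a \<in> proj_norm X Y ` ?C"
   then obtain u where u: "u \<in> ?C" "a = proj_norm X Y u" by auto
   obtain q where q: "pkeys q <= S" "u = tcls X Y q" using carr[OF u(1)] by (rule alg_tensor_cases)
   have qp: "tcls X Y (q - p) \<in> rker R" using u q mem by simp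
   show "K.pn p <= a" proof (rule field_le_epsilon)
    fix e :: real assume "e > 0"
    then obtain k where k: "k \<in> rspan R" "T.pn ((q - p) - k) < e" using qp rker_tcls[OF R pkeys_diff_subset[OF q(1) p]] by auto
    note kk = K.K_keys[OF k(1)]
    \<comment> \<open>\<open>k\<close> is the relation that accounts for \<open>q - p\<close> up to
      \<open>e\<close>; adding it to \<open>p\<close> costs nothing modulo \<open>rspan R\<close>
      and leaves a remainder that is small in the projective norm.\<close>
    have "K.pn p = K.pn (p + k)" using K.K_uminus[of "p + k" p] k by (intro K.pn_cong) simp
    also have "... <= K.pn q + K.pn ((p + k) - q)" using p q kk by (intro K.pn_triangle pkeys_subset) auto
    also have "K.pn ((p + k) - q) = K.pn (q - (p + k))" using p q kk by (intro K.pn_minus_commute pkeys_subset) auto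
    also have "... <= T.pn (q - (p + k))" using p q kk by (intro T_ge pkeys_subset) auto
    also have "q - (p + k) = (q - p) - k" by simp
    also have "K.pn q <= T.pn q" by (rule T_ge[OF q(1)])
    finally show "K.pn p <= a + e" using k u q by (simp add: proj_norm_tcls)
   qed
  qed
 qed
 then show ?thesis by simp
qed

lemma quotient_proj_cases:
 assumes "u \<in> carrier (quotient_normed PT (rker R))" obtains p where "pkeys p <= S" "u = rker R +>\<^bsub>PT\<^esub> tcls X Y p" proof -
 obtain v where v: "v \<in> carrier AT" "u = rker R +>\<^bsub>PT\<^esub> v" using assms by (auto simp: P.rcosets_eq)
 show ?thesis using v(1) by (rule alg_tensor_cases) (use v(2) that in auto)
qed

end

lemma proj_norm_tensor_map_le:
 assumes "normed_pair X Y" "normed_pair X' Y'" "clinear_on X X' f" "clinear_on Y Y' g" and f: "!!x. x \<in> carrier X ==> nrm X' (f x) <= C * nrm X x"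
  and g: "!!y. y \<in> carrier Y ==> nrm Y' (g y) <= D * nrm Y y" and CD: "0 <= C" "0 <= D" and u: "u \<in> carrier (alg_tensor X Y)"
 shows "proj_norm X' Y' (tensor_map X' Y' f g u) <= C * D * proj_norm X Y u" proof -
 interpret A: normed_pair X Y by fact
 interpret B: normed_pair X' Y' by fact
 note cv = A.X.cvec_axioms A.Y.cvec_axioms B.X.cvec_axioms B.Y.cvec_axioms assms(3,4)
 obtain p where p: "pkeys p <= A.S" "u = tcls X Y p" using u by (rule A.alg_tensor_cases)
 note k = fmap_keys[OF map_prod_closed[OF assms(3,4)]]
 have "B.T.pn (fmap (map_prod f g) p) <= (C * D) * A.T.pn p" proof (rule pnorm_map_le[OF A.T.weighted_relations_axioms B.T.weighted_relations_axioms
    clinear_fmap[OF map_prod_closed[OF assms(3,4)]] fmap_tensor_kernel[OF cv]])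
  fix s assume s: "s \<in> A.S"
  then have fs: "f (fst s) \<in> carrier X'" "g (snd s) \<in> carrier Y'" using clinear_onD(1)[OF assms(3)] clinear_onD(1)[OF assms(4)] by auto
  have "B.T.pn (fmap (map_prod f g) (sng s 1)) <= nrm X' (f (fst s)) * nrm Y' (g (snd s))"
   using B.T.pn_le_wsum[of "sng (map_prod f g s) 1"] fs by (simp add: map_prod_def split_beta)
  also have "... <= (C * nrm X (fst s)) * (D * nrm Y (snd s))" using s f g CD fs by (intro mult_mono) auto
  finally show "B.T.pn (fmap (map_prod f g) (sng s 1)) <= C * D * A.w s" by (simp add: mult_ac)
 qed (use p CD in auto)
 then show ?thesis unfolding p(2) tensor_map_tcls[OF cv p(1)] using p by (simp add: A.proj_norm_tcls B.proj_norm_tcls k)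
qed

text \<open>The induced map is contractive and compatible with the kernels because \<open>f\<close>
  and \<open>g\<close> preserve norms. What remains of the isometry is the inequality
  \<open>le\<close> between seminorms of formal sums, and every flatness proof below ends
  there.\<close>

lemma isometric_on_quotient_proj:
 assumes AB: "normed_pair X Y" "normed_pair X' Y'" and fg: "clinear_on X X' f" "clinear_on Y Y' g" and f: "!!x. x \<in> carrier X ==> nrm X' (f x) = nrm X x"
  and g: "!!y. y \<in> carrier Y ==> nrm Y' (g y) = nrm Y y" and R: "R <= carrier (fmod X Y)" and R': "R' <= carrier (fmod X' Y')"
  and RR': "!!r. r \<in> R ==> fmap (map_prod f g) r \<in> R'" and le: "!!p. pkeys p <= carrier X \<times> carrier Y ==>
   pnorm (carrier X \<times> carrier Y) (%k. nrm X (fst k) * nrm Y (snd k)) (cspan (fmod X Y) (bilinear_relations X Y \<union> R)) p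
   <= pnorm (carrier X' \<times> carrier Y') (%k. nrm X' (fst k) * nrm Y' (snd k))
     (cspan (fmod X' Y') (bilinear_relations X' Y' \<union> R')) (fmap (map_prod f g) p)"
 defines "N == nclosure (proj_tensor X Y) (cspan (proj_tensor X Y) (tcls X Y ` R))"
  and "N' == nclosure (proj_tensor X' Y') (cspan (proj_tensor X' Y') (tcls X' Y' ` R'))"
 shows "isometric_on (quotient_normed (proj_tensor X Y) N) (quotient_normed (proj_tensor X' Y') N')
  (quotient_map (proj_tensor X' Y') N' (tensor_map X' Y' f g))" unfolding isometric_on_def proof
 interpret A: normed_pair X Y by fact
 interpret B: normed_pair X' Y' by fact
 note cv = A.X.cvec_axioms A.Y.cvec_axioms B.X.cvec_axioms B.Y.cvec_axioms fg
 note k = fmap_keys[OF map_prod_closed[OF fg]]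
 interpret KA: weighted_relations A.S A.w "A.rspan R" by (rule A.weighted_rspan[OF R])
 interpret KB: weighted_relations B.S B.w "B.rspan R'" by (rule B.weighted_rspan[OF R'])
 have incl: "fmap (map_prod f g) r \<in> B.rspan R'" if "r \<in> A.rspan R" for r by (rule fmap_cspan_relations[OF cv R R' _ that]) (auto intro!: FM.cspan_inc RR')
 have tm: "clinear_on (proj_tensor X Y) (proj_tensor X' Y') (tensor_map X' Y' f g)" using clinear_tensor_map[OF cv] by (simp add: clinear_on_def)
 \<comment> \<open>Relations are mapped to relations exactly; the closure follows since the tensor
   map is contractive for the projective norm.\<close>
 have ker: "tensor_map X' Y' f g u \<in> N'" if u: "u \<in> N" for u proof -
  have "u \<in> carrier (alg_tensor X Y)" using u by (auto simp: N_def nclosure_def)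
  then obtain p where p: "pkeys p <= A.S" "u = tcls X Y p" by (rule A.alg_tensor_cases)
  have "\<exists>k'\<in>B.rspan R'. B.T.pn (fmap (map_prod f g) p - k') < e" if e: "e > 0" for e proof -
   obtain r where r: "r \<in> A.rspan R" "A.T.pn (p - r) < e" using u e unfolding N_def p(2) A.rker_tcls[OF R p(1)] by auto
   have pr: "pkeys (p - r) \<subseteq> A.S" using p KA.K_keys[OF r(1)] by (simp add: pkeys_diff_subset)
   have "proj_norm X' Y' (tensor_map X' Y' f g (tcls X Y (p - r))) <= 1 * 1 * proj_norm X Y (tcls X Y (p - r))"
    by (rule proj_norm_tensor_map_le[OF AB fg]) (use f g pr in \<open>auto intro: A.tcls_closed\<close>)
   then have "B.T.pn (fmap (map_prod f g) p - fmap (map_prod f g) r) < e" using r pr k[OF pr] by (simp add: tensor_map_tcls[OF cv] A.proj_norm_tcls B.proj_norm_tcls fmap_diff)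
   then show ?thesis using incl[OF r(1)] by blast
  qed
  then show ?thesis unfolding p(2) tensor_map_tcls[OF cv p(1)] N'_def B.rker_tcls[OF R' k[OF p(1)]] by blast
 qed
 fix u assume "u \<in> carrier (quotient_normed (proj_tensor X Y) N)"
 then obtain p where p: "pkeys p <= A.S" "u = N +>\<^bsub>proj_tensor X Y\<^esub> tcls X Y p" unfolding N_def by (rule A.quotient_proj_cases)
 have "quotient_map (proj_tensor X' Y') N' (tensor_map X' Y' f g) u = N' +>\<^bsub>proj_tensor X' Y'\<^esub> tcls X' Y' (fmap (map_prod f g) p)" unfolding p(2) using ker
  by (subst quotient_map_coset[OF A.P.cvec_axioms B.P.cvec_axioms A.subsp_rker[OF R, folded N_def] B.subsp_rker[OF R', folded N'_def] tm])
   (simp_all add: A.tcls_closed p tensor_map_tcls[OF cv])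
 moreover have "KB.pn (fmap (map_prod f g) p) <= 1 * KA.pn p" proof (rule pnorm_map_le[OF KA.weighted_relations_axioms KB.weighted_relations_axioms
    clinear_fmap[OF map_prod_closed[OF fg]] incl])
  fix s assume s: "s \<in> A.S"
  then show "KB.pn (fmap (map_prod f g) (sng s 1)) <= 1 * A.w s"
   using KB.pn_le_wsum[of "sng (map_prod f g s) 1"] f g clinear_onD(1)[OF fg(1)] clinear_onD(1)[OF fg(2)] by auto
 qed (use p in auto)
 ultimately show "nrm (quotient_normed (proj_tensor X' Y') N') (quotient_map (proj_tensor X' Y') N' (tensor_map X' Y' f g) u)
   = nrm (quotient_normed (proj_tensor X Y) N) u" unfolding p(2) N_def N'_def using A.quotient_proj_norm[OF R p(1)] B.quotient_proj_norm[OF R' k[OF p(1)]] le[OF p(1)] by simp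
qed

section \<open>Scalar-valued bilinear maps and definiteness of the projective norm\<close>

definition cscalars :: "(complex, complex) module" where
 "cscalars = \<lparr>carrier = UNIV, mult = undefined, one = undefined, zero = 0, add = (+), smult = (*)\<rparr>"

lemma cscalars_sel [simp]:
 "carrier cscalars = UNIV" "\<zero>\<^bsub>cscalars\<^esub> = 0" "x \<oplus>\<^bsub>cscalars\<^esub> y = x + y" "c \<odot>\<^bsub>cscalars\<^esub> x = c * x"
 by (simp_all add: cscalars_def)

lemma cvec_cscalars: "cvec cscalars" by (rule cvecI) (auto simp: algebra_simps)

interpretation CS: cvec cscalars by (rule cvec_cscalars)

lemma finsum_cscalars: "finite I ==> finsum cscalars f I = sum f I" by (induction I rule: finite_induct) (simp_all add: CS.finsum_insert')

lemma flift_cscalars: "flift cscalars b p = (\<Sum>k\<in>pkeys p. pat p k * b k)" by (simp add: flift_def finsum_cscalars)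

lemma (in cvec_pair) bilinear_elem: "bilinear_on X Y AT (%k. tcls X Y (sng k 1))" proof (intro bilinear_onI clinear_onI)
 have mem0: "r \<in> tensor_kernel X Y" if "r \<in> bilinear_relations X Y" for r unfolding tensor_kernel_def using that by (rule FM.cspan_inc)
 note mem = bilinear_relation_mem[THEN mem0]
 fix x y assume xy: "x \<in> carrier X" "y \<in> carrier Y"
 then show "tcls X Y (sng (x, y) 1) \<in> carrier (alg_tensor X Y)"
  "tcls X Y (sng (x, y) 1) \<in> carrier (alg_tensor X Y)" by (simp_all add: tcls_closed)
 have s: "pkeys (sng (x, y) (1::complex)) \<subseteq> S" using xy by simp
 show "tcls X Y (sng (c \<odot>\<^bsub>X\<^esub> x, y) 1) = c \<odot>\<^bsub>alg_tensor X Y\<^esub> tcls X Y (sng (x, y) 1)" for c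
  unfolding tcls_psc[OF s, symmetric] using mem(3)[OF xy, of c] xy by (subst tcls_eq_iff) auto
 show "tcls X Y (sng (x, c \<odot>\<^bsub>Y\<^esub> y) 1) = c \<odot>\<^bsub>alg_tensor X Y\<^esub> tcls X Y (sng (x, y) 1)" for c
  unfolding tcls_psc[OF s, symmetric] using mem(4)[OF xy, of c] xy by (subst tcls_eq_iff) auto
 show "tcls X Y (sng (x \<oplus>\<^bsub>X\<^esub> x', y) 1) = tcls X Y (sng (x, y) 1) \<oplus>\<^bsub>alg_tensor X Y\<^esub> tcls X Y (sng (x', y) 1)"
  if x': "x' \<in> carrier X" for x' proof -
  have s': "pkeys (sng (x', y) (1::complex)) \<subseteq> S" using xy x' by simp show ?thesis unfolding tcls_add[OF s s', symmetric]
   using mem(1)[OF xy(1) x' xy(2)] pkeys_add_subset[OF s s'] xy x' by (subst tcls_eq_iff) (auto simp: diff_diff_eq)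
 qed
 show "tcls X Y (sng (x, y \<oplus>\<^bsub>Y\<^esub> y') 1) = tcls X Y (sng (x, y) 1) \<oplus>\<^bsub>alg_tensor X Y\<^esub> tcls X Y (sng (x, y') 1)"
  if y': "y' \<in> carrier Y" for y' proof -
  have s': "pkeys (sng (x, y') (1::complex)) \<subseteq> S" using xy y' by simp show ?thesis unfolding tcls_add[OF s s', symmetric]
   using mem(2)[OF xy y'] pkeys_add_subset[OF s s'] xy y' by (subst tcls_eq_iff) (auto simp: diff_diff_eq)
 qed
qed

lemma (in cvec_pair) tcls_eq_flift: "pkeys p <= S ==> tcls X Y p = flift AT (%k. tcls X Y (sng k 1)) p"
 by (rule flift_unique[OF cvec_alg_tensor clinear_tcls]) auto

text \<open>If some functional does not vanish on \<open>x n\<close>, then the hypothesis expresses \<open>y n\<close> by the other \<open>y i\<close>,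
 and \<open>\<Sum>i. x i \<otimes> y i\<close> is a sum with one term less.\<close>

lemma (in cvec_pair) separating_tensor_zero:
 assumes sepX: "!!x. x \<in> carrier X ==> (!!f. f \<in> FX ==> f x = 0) ==> x = \<zero>\<^bsub>X\<^esub>"
  and sepY: "!!y. y \<in> carrier Y ==> (!!g. g \<in> FY ==> g y = 0) ==> y = \<zero>\<^bsub>Y\<^esub>"
  and FX: "!!f. f \<in> FX ==> clinear_on X cscalars f" and FY: "!!f. f \<in> FY ==> clinear_on Y cscalars f"
  and "finite I" "x \<in> I \<rightarrow> carrier X" "y \<in> I \<rightarrow> carrier Y"
  and "!!f g. f \<in> FX ==> g \<in> FY ==> (\<Sum>i\<in>I. f (x i) * g (y i)) = 0"
 shows "(\<Oplus>\<^bsub>alg_tensor X Y\<^esub>i\<in>I. tcls X Y (sng (x i, y i) 1)) = \<zero>\<^bsub>alg_tensor X Y\<^esub>" using assms(5-8)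
proof (induction I arbitrary: x rule: finite_induct)
 case empty
 interpret A: cvec "alg_tensor X Y" by (rule cvec_alg_tensor)
 show ?case by simp
next
 case (insert n I)
 interpret A: cvec "alg_tensor X Y" by (rule cvec_alg_tensor)
 let ?t = "%x y. tcls X Y (sng (x, y) 1)"
 have t1: "clinear_on X (alg_tensor X Y) (%x. ?t x y)" if "y \<in> carrier Y" for y using bilinear_elem that by (simp add: bilinear_on_def)
 have t2: "clinear_on Y (alg_tensor X Y) (%y. ?t x y)" if "x \<in> carrier X" for x using bilinear_elem that by (simp add: bilinear_on_def)
 have tc: "?t x y \<in> carrier (alg_tensor X Y)" if "x \<in> carrier X" "y \<in> carrier Y" for x y using that by (simp add: tcls_closed)
 have xn: "x n \<in> carrier X" and yn: "y n \<in> carrier Y" and xI: "x \<in> I \<rightarrow> carrier X" and yI: "y \<in> I \<rightarrow> carrier Y" using insert.prems by auto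
 have split: "(\<Oplus>\<^bsub>alg_tensor X Y\<^esub>i\<in>insert n I. ?t (x i) (y i)) = ?t (x n) (y n) \<oplus>\<^bsub>alg_tensor X Y\<^esub> (\<Oplus>\<^bsub>alg_tensor X Y\<^esub>i\<in>I. ?t (x i) (y i))"
  using xn yn xI yI tc insert.hyps by (intro A.finsum_insert') (auto simp: Pi_iff)
 show ?case proof (cases "\<forall>f\<in>FX. f (x n) = 0")
  case True
  then have "x n = \<zero>\<^bsub>X\<^esub>" using sepX xn by blast
  then have "?t (x n) (y n) = \<zero>\<^bsub>alg_tensor X Y\<^esub>" using clinear_on_zero[OF X.cvec_axioms cvec_alg_tensor t1[OF yn]] by simp
  moreover have "(\<Oplus>\<^bsub>alg_tensor X Y\<^esub>i\<in>I. ?t (x i) (y i)) = \<zero>\<^bsub>alg_tensor X Y\<^esub>" proof (rule insert.IH[OF xI yI])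
   fix f g assume "f \<in> FX" "g \<in> FY"
   from insert.prems(3)[OF this] bspec[OF True \<open>f \<in> FX\<close>] show "(\<Sum>i\<in>I. f (x i) * g (y i)) = 0" using insert.hyps by simp
  qed
  ultimately show ?thesis unfolding split by simp
 next
  case False
  then obtain f where f: "f \<in> FX" "f (x n) ~= 0" by blast
  define a where "a i = - f (x i) / f (x n)" for i
  have ay: "(%i. a i \<odot>\<^bsub>Y\<^esub> y i) \<in> I \<rightarrow> carrier Y" using yI by auto
  have gy: "g (y n) = (\<Sum>i\<in>I. a i * g (y i))" if g: "g \<in> FY" for g proof -
   have "f (x n) * g (y n) + (\<Sum>i\<in>I. f (x i) * g (y i)) = 0" using insert.prems(3)[OF f(1) g] insert.hyps by simp
   then have "f (x n) * g (y n) = f (x n) * (\<Sum>i\<in>I. a i * g (y i))" using f(2) by (simp add: a_def sum_distrib_left sum_negf eq_neg_iff_add_eq_0)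
   then show ?thesis using f(2) by simp
  qed
  let ?s = "\<Oplus>\<^bsub>Y\<^esub>i\<in>I. a i \<odot>\<^bsub>Y\<^esub> y i"
  have sc: "?s \<in> carrier Y" using ay by (rule Y.M.finsum_closed)
  have gs: "g ?s = (\<Sum>i\<in>I. a i * g (y i))" if g: "g \<in> FY" for g proof -
   have "g ?s = (\<Oplus>\<^bsub>cscalars\<^esub>i\<in>I. g (a i \<odot>\<^bsub>Y\<^esub> y i))"
    by (rule clinear_on_finsum[OF Y.cvec_axioms cvec_cscalars FY[OF g] insert.hyps(1) ay])
   also have "... = (\<Sum>i\<in>I. a i * g (y i))" unfolding finsum_cscalars[OF insert.hyps(1)]
    using yI clinear_onD(3)[OF FY[OF g]] by (intro sum.cong) (auto simp: Pi_iff)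
   finally show ?thesis .
  qed
  have "y n \<ominus>\<^bsub>Y\<^esub> ?s = \<zero>\<^bsub>Y\<^esub>" proof (rule sepY)
   fix g assume g: "g \<in> FY"
   have "g (y n \<ominus>\<^bsub>Y\<^esub> ?s) = g (y n) \<ominus>\<^bsub>cscalars\<^esub> g ?s" by (rule clinear_on_minus[OF Y.cvec_axioms cvec_cscalars FY[OF g] yn sc])
   then show "g (y n \<ominus>\<^bsub>Y\<^esub> ?s) = 0" using gy[OF g] gs[OF g] CS.minus_self by simp
  qed (use yn sc in simp)
  then have yns: "y n = ?s" using Y.minus_eq_zero_iff[OF yn sc] by simp
  \<comment> \<open>A scalar moves across the tensor sign, so the term of \<open>n\<close> is
    distributed over the others by changing their first factors; the induction therefore varies
    \<open>x\<close>.\<close>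
  define x' where "x' i = x i \<oplus>\<^bsub>X\<^esub> a i \<odot>\<^bsub>X\<^esub> x n" for i
  have x': "x' \<in> I \<rightarrow> carrier X" using xI xn by (auto simp: x'_def Pi_iff)
  have "?t (x n) (y n) = (\<Oplus>\<^bsub>alg_tensor X Y\<^esub>i\<in>I. ?t (x n) (a i \<odot>\<^bsub>Y\<^esub> y i))"
   unfolding yns by (rule clinear_on_finsum[OF Y.cvec_axioms cvec_alg_tensor t2[OF xn] insert.hyps(1) ay])
  also have "... = (\<Oplus>\<^bsub>alg_tensor X Y\<^esub>i\<in>I. ?t (a i \<odot>\<^bsub>X\<^esub> x n) (y i))" proof (rule A.M.finsum_cong')
   fix i assume i: "i \<in> I"
   then have yi: "y i \<in> carrier Y" using yI by auto
   show "?t (x n) (a i \<odot>\<^bsub>Y\<^esub> y i) = ?t (a i \<odot>\<^bsub>X\<^esub> x n) (y i)"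
    using clinear_onD(3)[OF t1[OF yi] xn] clinear_onD(3)[OF t2[OF xn] yi] by simp
  qed (use xn yI tc in \<open>auto simp: Pi_iff\<close>)
  also have "... \<oplus>\<^bsub>alg_tensor X Y\<^esub> (\<Oplus>\<^bsub>alg_tensor X Y\<^esub>i\<in>I. ?t (x i) (y i))
    = (\<Oplus>\<^bsub>alg_tensor X Y\<^esub>i\<in>I. ?t (a i \<odot>\<^bsub>X\<^esub> x n) (y i) \<oplus>\<^bsub>alg_tensor X Y\<^esub> ?t (x i) (y i))"
   by (rule A.M.finsum_addf[symmetric]) (use xn xI yI tc in \<open>auto simp: Pi_iff\<close>)
  also have "... = (\<Oplus>\<^bsub>alg_tensor X Y\<^esub>i\<in>I. ?t (x' i) (y i))" proof (rule A.M.finsum_cong')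
   fix i assume i: "i \<in> I"
   then have yi: "y i \<in> carrier Y" and xi: "x i \<in> carrier X" using xI yI by auto
   show "?t (a i \<odot>\<^bsub>X\<^esub> x n) (y i) \<oplus>\<^bsub>alg_tensor X Y\<^esub> ?t (x i) (y i) = ?t (x' i) (y i)"
    unfolding x'_def using clinear_onD(2)[OF t1[OF yi] xi X.smult_carrier[OF xn], of "a i"] tc xi yi xn by (simp add: A.M.a_comm)
  qed (use x' yI tc in \<open>auto simp: Pi_iff\<close>)
  also have "... = \<zero>\<^bsub>alg_tensor X Y\<^esub>" proof (rule insert.IH[OF x' yI])
   fix h g assume h: "h \<in> FX" and g: "g \<in> FY"
   have "(\<Sum>i\<in>I. h (x' i) * g (y i)) = (\<Sum>i\<in>I. h (x i) * g (y i) + h (x n) * (a i * g (y i)))" using xI xn clinear_onD(2,3)[OF FX[OF h]]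
    by (intro sum.cong) (auto simp: x'_def Pi_iff algebra_simps)
   also have "... = (\<Sum>i\<in>I. h (x i) * g (y i)) + h (x n) * g (y n)" by (simp add: gy[OF g] sum.distrib sum_distrib_left)
   also have "... = 0" using insert.prems(3)[OF h g] insert.hyps by (simp add: add.commute)
   finally show "(\<Sum>i\<in>I. h (x' i) * g (y i)) = 0" .
  qed
  finally show ?thesis unfolding split .
 qed
qed

text \<open>If \<open>f\<close> and \<open>g\<close> are bounded, their product is bounded for the
  projective norm and vanishes on a tensor of norm zero. As the functionals separate points,
  \<open>separating_tensor_zero\<close> shows that the tensor is zero.\<close>

lemma (in normed_pair) proj_tensor_normed:
 assumes sepX: "!!x. x \<in> carrier X ==> (!!f. f \<in> FX ==> f x = 0) ==> x = \<zero>\<^bsub>X\<^esub>"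
  and sepY: "!!y. y \<in> carrier Y ==> (!!g. g \<in> FY ==> g y = 0) ==> y = \<zero>\<^bsub>Y\<^esub>"
  and FX: "!!f. f \<in> FX ==> clinear_on X cscalars f" and FY: "!!f. f \<in> FY ==> clinear_on Y cscalars f"
  and bX: "!!f. f \<in> FX ==> \<exists>C\<ge>0. \<forall>x\<in>carrier X. cmod (f x) <= C * nrm X x"
  and bY: "!!f. f \<in> FY ==> \<exists>C\<ge>0. \<forall>x\<in>carrier Y. cmod (f x) <= C * nrm Y x" shows "complex_normed_space (proj_tensor X Y)"
proof -
 have zero: "tcls X Y p = \<zero>\<^bsub>alg_tensor X Y\<^esub>"
  if p: "pkeys p <= S" "proj_norm X Y (tcls X Y p) = 0" for p proof -
  interpret A: cvec "alg_tensor X Y" by (rule cvec_alg_tensor)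
  let ?x = "%k. pat p k \<odot>\<^bsub>X\<^esub> fst k"
  have pS: "fst k \<in> carrier X" "snd k \<in> carrier Y" if "k \<in> pkeys p" for k using p(1) that by auto
  have "tcls X Y p = (\<Oplus>\<^bsub>alg_tensor X Y\<^esub>k\<in>pkeys p. tcls X Y (sng (?x k, snd k) 1))" unfolding tcls_eq_flift[OF p(1)] flift_def
  proof (rule A.M.finsum_cong')
   fix k assume k: "k \<in> pkeys p"
   have "clinear_on X (alg_tensor X Y) (%x. tcls X Y (sng (x, snd k) 1))" using bilinear_elem pS(2)[OF k] by (simp add: bilinear_on_def)
   from clinear_onD(3)[OF this pS(1)[OF k]]
   show "pat p k \<odot>\<^bsub>alg_tensor X Y\<^esub> tcls X Y (sng k 1) = tcls X Y (sng (?x k, snd k) 1)" by simp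
  qed (use pS in \<open>auto intro!: tcls_closed\<close>)
  also have "... = \<zero>\<^bsub>alg_tensor X Y\<^esub>" proof (rule separating_tensor_zero[OF sepX sepY FX FY])
   fix f g assume fg: "f \<in> FX" "g \<in> FY"
   obtain B where B: "B \<ge> 0" "!!x. x \<in> carrier X ==> cmod (f x) <= B * nrm X x" using bX[OF fg(1)] by blast
   obtain D where D: "D \<ge> 0" "!!x. x \<in> carrier Y ==> cmod (g x) <= D * nrm Y x" using bY[OF fg(2)] by blast
   have bil: "bilinear_on X Y cscalars (%k. f (fst k) * g (snd k))" using clinear_onD(2,3)[OF FX[OF fg(1)]] clinear_onD(2,3)[OF FY[OF fg(2)]]
    by (intro bilinear_onI clinear_onI) (auto simp: algebra_simps)
   let ?h = "flift cscalars (%k. f (fst k) * g (snd k))"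
   have "cmod (?h p) <= 0 + e" if e: "e > 0" for e proof -
    \<comment> \<open>The summand 1 permits the division by the bound also when \<open>B * D\<close>
      is zero.\<close>
    have BD: "B * D + 1 > 0" using B D by (simp add: add_nonneg_pos)
    obtain q where q: "pkeys q <= S" "q - p \<in> tensor_kernel X Y" "wsum w q < T.pn p + e / (B * D + 1)"
     using T.pn_approx[OF p(1) divide_pos_pos[OF e BD]] by blast
    have qp: "?h p = ?h q" using flift_tcls_cong[OF cvec_cscalars bil p(1) q(1)] tcls_eq_iff[OF q(1) p(1)] q(2) by simp
    have "cmod (?h q) <= (\<Sum>k\<in>pkeys q. cmod (pat q k) * ((B * D) * w k))" unfolding flift_cscalars proof (rule order_trans[OF norm_sum sum_mono])
     fix k assume "k \<in> pkeys q"
     then have k: "fst k \<in> carrier X" "snd k \<in> carrier Y" using q(1) by auto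
     have "cmod (f (fst k)) * cmod (g (snd k)) <= (B * nrm X (fst k)) * (D * nrm Y (snd k))" using B D k by (intro mult_mono) auto
     then have "cmod (pat q k) * (cmod (f (fst k)) * cmod (g (snd k))) <= cmod (pat q k) * ((B * D) * w k)" by (intro mult_left_mono) (auto simp: mult_ac)
     then show "cmod (pat q k * (f (fst k) * g (snd k))) <= cmod (pat q k) * ((B * D) * w k)" by (simp only: norm_mult)
    qed
    also have "... = (B * D) * wsum w q" by (simp add: wsum_def sum_distrib_left mult_ac)
    also have "... <= (B * D + 1) * wsum w q" using T.wsum_nonneg'[OF q(1)] by (intro mult_right_mono) auto
    also have "... <= (B * D + 1) * (e / (B * D + 1))" using q p BD by (intro mult_left_mono) (simp_all add: proj_norm_tcls)
    also have "... = e" using BD by simp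
    finally show ?thesis using qp by simp
   qed
   then have "cmod (?h p) <= 0" by (rule field_le_epsilon)
   then have "?h p = 0" by simp
   also have "?h p = (\<Sum>k\<in>pkeys p. f (?x k) * g (snd k))" unfolding flift_cscalars using pS clinear_onD(3)[OF FX[OF fg(1)]] by (intro sum.cong) (auto simp: mult.assoc)
   finally show "(\<Sum>k\<in>pkeys p. f (?x k) * g (snd k)) = 0" .
  qed (use pS in auto)
  finally show ?thesis .
 qed
 have z0: "proj_norm X Y \<zero>\<^bsub>alg_tensor X Y\<^esub> = 0" unfolding alg_tensor_zero using T.pn_K[OF T.K_zero] by (simp add: proj_norm_tcls) show ?thesis
 proof (intro complex_normed_space.intro complex_normed_space_axioms.intro)
  show "module complex_ring (proj_tensor X Y)" using cvec_proj_tensor by (simp add: cvec_def)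
  fix u assume u: "u \<in> carrier (proj_tensor X Y)"
  then obtain p where p: "pkeys p <= S" "u = tcls X Y p" by (auto elim: alg_tensor_cases)
  show "nrm (proj_tensor X Y) u = 0 \<longleftrightarrow> u = \<zero>\<^bsub>proj_tensor X Y\<^esub>" using zero[OF p(1)] z0 p(2) by auto
  show "nrm (proj_tensor X Y) (c \<odot>\<^bsub>proj_tensor X Y\<^esub> u) = cmod c * nrm (proj_tensor X Y) u" for c using u by (simp add: proj_norm_smult)
  show "nrm (proj_tensor X Y) (u \<oplus>\<^bsub>proj_tensor X Y\<^esub> v) <= nrm (proj_tensor X Y) u + nrm (proj_tensor X Y) v"
   if "v \<in> carrier (proj_tensor X Y)" for v using u that by (simp add: proj_norm_triangle)
 qed
qed

section \<open>Completions\<close>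

lemma real_tendsto_0_iff_nonneg_bound:
 fixes f :: "nat => real" assumes "g \<longlonglongrightarrow> 0" "!!n. 0 <= f n" "!!n. f n <= g n" shows "f \<longlonglongrightarrow> 0"
 by (rule tendsto_sandwich[OF _ _ tendsto_const assms(1)]) (use assms in \<open>auto intro!: always_eventually\<close>)

text \<open>The constant is kept explicit because extensions to completions inherit it.\<close>

definition bounded_map :: "('v, 'm) cnormed_space_scheme => ('w, 'n) cnormed_space_scheme => ('v => 'w) => real => bool" where
 "bounded_map V W f C \<longleftrightarrow> clinear_on V W f & 0 <= C & (\<forall>x\<in>carrier V. nrm W (f x) <= C * nrm V x)"

lemma bounded_mapD:
 assumes "bounded_map V W f C" shows "clinear_on V W f" "0 <= C" "x \<in> carrier V ==> nrm W (f x) <= C * nrm V x"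
  "x \<in> carrier V ==> f x \<in> carrier W" using assms by (auto simp: bounded_map_def clinear_on_def)

lemma bounded_map_comp:
 assumes f: "bounded_map V W f C" and g: "bounded_map W U g D" shows "bounded_map V U (%x. g (f x)) (D * C)" proof -
 have "nrm U (g (f x)) <= (D * C) * nrm V x" if x: "x \<in> carrier V" for x using bounded_mapD(3)[OF g bounded_mapD(4)[OF f x]]
   mult_left_mono[OF bounded_mapD(3)[OF f x] bounded_mapD(2)[OF g]] by (simp add: mult.assoc)
 then show ?thesis using bounded_mapD(1,2)[OF f] bounded_mapD(1,2)[OF g] by (auto simp: bounded_map_def intro: clinear_on_comp)
qed

lemma bounded_map_eq_dense:
 assumes V: "complex_normed_space V" and W: "complex_normed_space W" and f: "bounded_map V W f C" and g: "bounded_map V W g C'"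
  and D: "D <= carrier V" "!!x e. x \<in> carrier V ==> e > 0 ==> \<exists>d\<in>D. nrm V (x \<ominus>\<^bsub>V\<^esub> d) < e"
  and eq: "!!d. d \<in> D ==> f d = g d" and x: "x \<in> carrier V" shows "f x = g x" proof -
 interpret V: complex_normed_space V by fact
 interpret W: complex_normed_space W by fact
 note fc = bounded_mapD(4)[OF f] and gc = bounded_mapD(4)[OF g]
 have CC: "C + C' + 1 > 0" using bounded_mapD(2)[OF f] bounded_mapD(2)[OF g] by simp
 have "nrm W (f x \<ominus>\<^bsub>W\<^esub> g x) <= 0 + e" if e: "e > 0" for e proof -
  obtain d where d: "d \<in> D" "nrm V (x \<ominus>\<^bsub>V\<^esub> d) < e / (C + C' + 1)" using D(2)[OF x divide_pos_pos[OF e CC]] by blast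
  have dc: "d \<in> carrier V" using d D by auto
  have xd: "x \<ominus>\<^bsub>V\<^esub> d \<in> carrier V" using x dc by simp
  have "nrm W (f x \<ominus>\<^bsub>W\<^esub> g x) <= nrm W (f x \<ominus>\<^bsub>W\<^esub> f d) + nrm W (f d \<ominus>\<^bsub>W\<^esub> g x)"
   by (rule W.nrm_minus_triangle) (use fc gc x dc in auto)
  also have "f x \<ominus>\<^bsub>W\<^esub> f d = f (x \<ominus>\<^bsub>V\<^esub> d)"
   by (rule clinear_on_minus[OF V.cvec_axioms W.cvec_axioms bounded_mapD(1)[OF f] x dc, symmetric])
  also have "nrm W (f d \<ominus>\<^bsub>W\<^esub> g x) = nrm W (g (x \<ominus>\<^bsub>V\<^esub> d))"
   unfolding clinear_on_minus[OF V.cvec_axioms W.cvec_axioms bounded_mapD(1)[OF g] x dc] eq[OF d(1)] by (rule W.nrm_minus_commute) (use gc x dc in auto)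
  finally have "nrm W (f x \<ominus>\<^bsub>W\<^esub> g x) <= C * nrm V (x \<ominus>\<^bsub>V\<^esub> d) + C' * nrm V (x \<ominus>\<^bsub>V\<^esub> d)"
   using bounded_mapD(3)[OF f xd] bounded_mapD(3)[OF g xd] by linarith
  also have "... <= (C + C' + 1) * nrm V (x \<ominus>\<^bsub>V\<^esub> d)" using xd by (simp add: distrib_right)
  also have "... <= (C + C' + 1) * (e / (C + C' + 1))" using d CC by (intro mult_left_mono) auto
  finally show ?thesis using CC by simp
 qed
 then have "nrm W (f x \<ominus>\<^bsub>W\<^esub> g x) <= 0" by (rule field_le_epsilon)
 then have "nrm W (f x \<ominus>\<^bsub>W\<^esub> g x) = 0" by (rule antisym) (use fc[OF x] gc[OF x] in simp)
 then show ?thesis using fc[OF x] gc[OF x] W.nrm_eq_0_iff W.minus_eq_zero_iff by simp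
qed

lemma cauchy_space_sel [simp]:
 "carrier (cauchy_space V) = cauchy_seqs V" "\<zero>\<^bsub>cauchy_space V\<^esub> = (%n. \<zero>\<^bsub>V\<^esub>)"
 "s \<oplus>\<^bsub>cauchy_space V\<^esub> t = (%n. s n \<oplus>\<^bsub>V\<^esub> t n)" "c \<odot>\<^bsub>cauchy_space V\<^esub> s = (%n. c \<odot>\<^bsub>V\<^esub> s n)"
 "nrm (cauchy_space V) s = lim (%n. nrm V (s n))" by (simp_all add: cauchy_space_def)

section \<open>Cauchy sequences, their classes, and extension by continuity\<close>

context complex_normed_space
begin

lemma cauchy_seqsD:
 assumes "s \<in> cauchy_seqs V" shows "s n \<in> carrier V" "e > 0 ==> \<exists>M. \<forall>m\<ge>M. \<forall>n\<ge>M. nrm V (s m \<ominus> s n) < e"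
 using assms by (auto simp: cauchy_seqs_def)

lemma cauchy_seqsI:
 "(!!n. s n \<in> carrier V) ==> (!!e. e > 0 ==> \<exists>M. \<forall>m\<ge>M. \<forall>n\<ge>M. nrm V (s m \<ominus> s n) < e) ==> s \<in> cauchy_seqs V"
 by (auto simp: cauchy_seqs_def)

lemma cauchy_const: "v \<in> carrier V ==> (%n. v) \<in> cauchy_seqs V" by (rule cauchy_seqsI) auto

lemma cauchy_map:
 assumes W: "complex_normed_space W" and f: "bounded_map V W f C" and s: "s \<in> cauchy_seqs V" shows "(%n. f (s n)) \<in> cauchy_seqs W" proof -
 interpret W: complex_normed_space W by fact
 note sc = cauchy_seqsD(1)[OF s] show ?thesis proof (rule W.cauchy_seqsI)
  fix e :: real assume e: "e > 0"
  have C1: "C + 1 > 0" using bounded_mapD(2)[OF f] by simp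
  obtain M where M: "\<forall>m\<ge>M. \<forall>n\<ge>M. nrm V (s m \<ominus> s n) < e / (C + 1)" using cauchy_seqsD(2)[OF s divide_pos_pos[OF e C1]] by blast
  have "nrm W (f (s m) \<ominus>\<^bsub>W\<^esub> f (s n)) < e" if "m \<ge> M" "n \<ge> M" for m n proof -
   have "nrm W (f (s m) \<ominus>\<^bsub>W\<^esub> f (s n)) = nrm W (f (s m \<ominus> s n))"
    by (simp add: clinear_on_minus[OF cvec_axioms W.cvec_axioms bounded_mapD(1)[OF f] sc sc])
   also have "... <= C * nrm V (s m \<ominus> s n)" using sc by (intro bounded_mapD(3)[OF f]) auto
   also have "... <= (C + 1) * nrm V (s m \<ominus> s n)" using sc by (intro mult_right_mono) auto
   also have "... < (C + 1) * (e / (C + 1))" using M that C1 by (intro mult_strict_left_mono) auto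
   finally show ?thesis using C1 by simp
  qed
  then show "\<exists>M. \<forall>m\<ge>M. \<forall>n\<ge>M. nrm W (f (s m) \<ominus>\<^bsub>W\<^esub> f (s n)) < e" by blast
 qed (use sc bounded_mapD(4)[OF f] in auto)
qed

lemma bounded_map_smult: "bounded_map V V (%x. c \<odot> x) (cmod c)" unfolding bounded_map_def
 by (auto intro!: clinear_onI simp: smult_add_right smult_smult mult.commute nrm_smult)

lemma cauchy_add:
 assumes s: "s \<in> cauchy_seqs V" and t: "t \<in> cauchy_seqs V" shows "(%n. s n \<oplus> t n) \<in> cauchy_seqs V" proof (rule cauchy_seqsI)
 note sc = cauchy_seqsD(1)[OF s] and tc = cauchy_seqsD(1)[OF t]
 fix e :: real assume e: "e > 0"
 obtain M where M: "\<forall>m\<ge>M. \<forall>n\<ge>M. nrm V (s m \<ominus> s n) < e / 2" using cauchy_seqsD(2)[OF s, of "e/2"] e by auto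
 obtain K where K: "\<forall>m\<ge>K. \<forall>n\<ge>K. nrm V (t m \<ominus> t n) < e / 2" using cauchy_seqsD(2)[OF t, of "e/2"] e by auto
 have "nrm V ((s m \<oplus> t m) \<ominus> (s n \<oplus> t n)) < e" if mn: "m \<ge> max M K" "n \<ge> max M K" for m n proof -
  have "nrm V ((s m \<oplus> t m) \<ominus> (s n \<oplus> t n)) <= nrm V (s m \<ominus> s n) + nrm V (t m \<ominus> t n)"
   unfolding add_minus_add[OF sc tc sc tc] using sc tc by (intro nrm_triangle) auto
  moreover have "nrm V (s m \<ominus> s n) < e / 2" "nrm V (t m \<ominus> t n) < e / 2" using M K mn by auto
  ultimately show ?thesis by linarith
 qed
 then show "\<exists>M. \<forall>m\<ge>M. \<forall>n\<ge>M. nrm V ((s m \<oplus> t m) \<ominus> (s n \<oplus> t n)) < e" by blast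
qed (use cauchy_seqsD(1)[OF s] cauchy_seqsD(1)[OF t] in auto)

lemma cauchy_smult: "s \<in> cauchy_seqs V ==> (%n. c \<odot> s n) \<in> cauchy_seqs V"
 by (rule cauchy_map[OF complex_normed_space_axioms bounded_map_smult])

lemma cvec_cauchy_space: "cvec (cauchy_space V)" by (rule cvecI)
  (auto simp: cauchy_add cauchy_smult cauchy_const smult_add_left smult_add_right smult_smult M.a_ac
   cauchy_seqsD(1) intro!: ext)

sublocale Q: cvec "cauchy_space V" by (rule cvec_cauchy_space)

lemma cauchy_minus: "s \<in> cauchy_seqs V ==> t \<in> cauchy_seqs V ==> s \<ominus>\<^bsub>cauchy_space V\<^esub> t = (%n. s n \<ominus> t n)"
 using cauchy_seqsD(1)[of s] cauchy_seqsD(1)[of t] by (simp add: Q.vminus_eq vminus_eq)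

text \<open>The norms of a Cauchy sequence are a Cauchy sequence of reals, so that the
  \<open>lim\<close> in \<open>cauchy_space\<close> is a genuine limit.\<close>

lemma cauchy_nrm_tendsto:
 assumes s: "s \<in> cauchy_seqs V" shows "(%n. nrm V (s n)) \<longlonglongrightarrow> nrm (cauchy_space V) s" proof -
 note sc = cauchy_seqsD(1)[OF s]
 have "Cauchy (%n. nrm V (s n))" proof (rule metric_CauchyI)
  fix e :: real assume "e > 0"
  then obtain M where "\<forall>m\<ge>M. \<forall>n\<ge>M. nrm V (s m \<ominus> s n) < e" using cauchy_seqsD(2)[OF s] by blast
  then show "\<exists>M. \<forall>m\<ge>M. \<forall>n\<ge>M. dist (nrm V (s m)) (nrm V (s n)) < e" using nrm_diff_abs[OF sc sc] unfolding dist_real_def by (meson le_less_trans)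
 qed
 then show ?thesis by (simp add: Cauchy_convergent_iff convergent_LIMSEQ_iff)
qed

lemma null_seqs_iff: "s \<in> null_seqs V \<longleftrightarrow> s \<in> cauchy_seqs V & nrm (cauchy_space V) s = 0"
 using cauchy_nrm_tendsto[of s] LIMSEQ_unique unfolding null_seqs_def by auto

lemma cauchy_nrm_nonneg: "s \<in> cauchy_seqs V ==> 0 <= nrm (cauchy_space V) s"
 using LIMSEQ_le_const[OF cauchy_nrm_tendsto, of s 0] cauchy_seqsD(1)[of s] by auto

lemma cauchy_nrm_add:
 assumes "s \<in> cauchy_seqs V" "t \<in> cauchy_seqs V" shows "nrm (cauchy_space V) (%n. s n \<oplus> t n) <= nrm (cauchy_space V) s + nrm (cauchy_space V) t"
 by (rule LIMSEQ_le[OF cauchy_nrm_tendsto[OF cauchy_add[OF assms]] tendsto_add[OF cauchy_nrm_tendsto[OF assms(1)] cauchy_nrm_tendsto[OF assms(2)]]])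
  (use assms in \<open>auto intro!: nrm_triangle dest: cauchy_seqsD(1)\<close>)

lemma cauchy_nrm_map_le:
 assumes "complex_normed_space W" "bounded_map V W f C" "s \<in> cauchy_seqs V" shows "nrm (cauchy_space W) (%n. f (s n)) <= C * nrm (cauchy_space V) s"
 by (rule LIMSEQ_le[OF complex_normed_space.cauchy_nrm_tendsto[OF assms(1) cauchy_map[OF assms]] tendsto_mult_left[OF cauchy_nrm_tendsto[OF assms(3)]]])
  (use bounded_mapD(3)[OF assms(2)] cauchy_seqsD(1)[OF assms(3)] in auto)

lemma cauchy_nrm_smult:
 assumes s: "s \<in> cauchy_seqs V" shows "nrm (cauchy_space V) (%n. c \<odot> s n) = cmod c * nrm (cauchy_space V) s" proof -
 have "(%n. nrm V (c \<odot> s n)) = (%n. cmod c * nrm V (s n))" using cauchy_seqsD(1)[OF s] by (simp add: nrm_smult)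
 then show ?thesis using LIMSEQ_unique[OF cauchy_nrm_tendsto[OF cauchy_smult[OF s, of c]]] tendsto_mult_left[OF cauchy_nrm_tendsto[OF s], of "cmod c"] by simp
qed

lemma subsp_null_seqs: "Q.subsp (null_seqs V)" unfolding Q.subsp_def proof (intro conjI ballI allI)
 show "null_seqs V <= carrier (cauchy_space V)" by (auto simp: null_seqs_iff)
 show "\<zero>\<^bsub>cauchy_space V\<^esub> \<in> null_seqs V" by (simp add: null_seqs_def cauchy_const)
next
 fix s t assume "s \<in> null_seqs V" "t \<in> null_seqs V"
 then show "s \<oplus>\<^bsub>cauchy_space V\<^esub> t \<in> null_seqs V" using cauchy_nrm_add[of s t] cauchy_nrm_nonneg[OF cauchy_add, of s t]
  by (simp add: null_seqs_iff cauchy_add del: cauchy_space_sel(5))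
next
 fix c s assume "s \<in> null_seqs V"
 then show "c \<odot>\<^bsub>cauchy_space V\<^esub> s \<in> null_seqs V" by (simp add: null_seqs_iff cauchy_smult cauchy_nrm_smult del: cauchy_space_sel(5))
qed

abbreviation ccls :: "(nat => 'v) => (nat => 'v) set" where
 "ccls s == null_seqs V +>\<^bsub>cauchy_space V\<^esub> s"

lemma completion_cases:
 assumes "A \<in> carrier (completion V)" obtains s where "s \<in> cauchy_seqs V" "A = ccls s" using assms by (auto simp: completion_def Q.rcosets_eq)

lemma ccls_closed: "s \<in> cauchy_seqs V ==> ccls s \<in> carrier (completion V)" by (auto simp: completion_def Q.rcosets_eq)

lemma ccls_add: "s \<in> cauchy_seqs V ==> t \<in> cauchy_seqs V ==>
  ccls s \<oplus>\<^bsub>completion V\<^esub> ccls t = ccls (%n. s n \<oplus> t n)" using Q.coset_add[OF subsp_null_seqs, of s t] by (simp add: completion_def)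

lemma ccls_smult: "s \<in> cauchy_seqs V ==> c \<odot>\<^bsub>completion V\<^esub> ccls s = ccls (%n. c \<odot> s n)"
 using Q.coset_smult[OF subsp_null_seqs, of s c] by (simp add: completion_def)

lemma ccls_mem: "s \<in> cauchy_seqs V ==> t \<in> ccls s \<longleftrightarrow> t \<in> cauchy_seqs V & (%n. t n \<ominus> s n) \<in> null_seqs V"
 using Q.mem_coset[OF subsp_null_seqs, of s t] by (auto simp: cauchy_minus)

lemma ccls_eq_iff: "s \<in> cauchy_seqs V ==> t \<in> cauchy_seqs V ==> ccls s = ccls t \<longleftrightarrow> (%n. s n \<ominus> t n) \<in> null_seqs V"
 using Q.coset_eq_iff[OF subsp_null_seqs, of s t] by (simp add: cauchy_minus)

lemma ccls_self: "s \<in> cauchy_seqs V ==> s \<in> ccls s" using Q.coset_self[OF subsp_null_seqs, of s] by simp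

lemma cauchy_diff: "s \<in> cauchy_seqs V ==> t \<in> cauchy_seqs V ==> (%n. t n \<ominus> s n) \<in> cauchy_seqs V"
 using Q.M.minus_closed[of t s] by (simp add: cauchy_minus)

text \<open>The limit of the norms is constant on a class modulo null sequences, so the infimum in
  \<open>quotient_normed\<close> is taken over a single value.\<close>

lemma nrm_ccls:
 assumes s: "s \<in> cauchy_seqs V" shows "nrm (completion V) (ccls s) = nrm (cauchy_space V) s" proof -
 have "nrm (cauchy_space V) t = nrm (cauchy_space V) s" if "t \<in> ccls s" for t proof -
  have t: "t \<in> cauchy_seqs V" "(%n. nrm V (t n \<ominus> s n)) \<longlonglongrightarrow> 0" using that ccls_mem[OF s] by (auto simp: null_seqs_def)
  have "(%n. nrm V (t n) - nrm V (s n)) \<longlonglongrightarrow> 0" by (rule tendsto_0_le[OF t(2), of _ 1])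
    (use nrm_diff_abs[OF cauchy_seqsD(1)[OF t(1)] cauchy_seqsD(1)[OF s]] in \<open>auto intro!: always_eventually intro: order_trans[OF _ abs_ge_self]\<close>)
  moreover have "(%n. nrm V (t n) - nrm V (s n)) \<longlonglongrightarrow> nrm (cauchy_space V) t - nrm (cauchy_space V) s"
   by (rule tendsto_diff[OF cauchy_nrm_tendsto[OF t(1)] cauchy_nrm_tendsto[OF s]])
  ultimately show ?thesis using LIMSEQ_unique by fastforce
 qed
 then have "nrm (cauchy_space V) ` ccls s = {nrm (cauchy_space V) s}" using ccls_self[OF s] by blast
 then show ?thesis by (simp add: completion_def del: cauchy_space_sel(5))
qed

lemma completion_zero: "\<zero>\<^bsub>completion V\<^esub> = ccls (%n. \<zero>)" using Q.coset_zero[OF subsp_null_seqs] by (simp add: completion_def)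

lemma completion_normed: "complex_normed_space (completion V)" proof -
 have cv: "cvec (completion V)" unfolding completion_def by (rule cvec_transfer[OF Q.cvec_quotient_module[OF subsp_null_seqs]]) simp_all show ?thesis
 proof (intro complex_normed_space.intro complex_normed_space_axioms.intro)
  show "module complex_ring (completion V)" using cv by (simp add: cvec_def)
  fix A assume "A \<in> carrier (completion V)"
  then obtain s where s: "s \<in> cauchy_seqs V" "A = ccls s" by (rule completion_cases)
  show "nrm (completion V) A = 0 \<longleftrightarrow> A = \<zero>\<^bsub>completion V\<^esub>"
   unfolding s(2) completion_zero nrm_ccls[OF s(1)] ccls_eq_iff[OF s(1) cauchy_const[OF M.zero_closed]]
   using s(1) cauchy_seqsD(1)[OF s(1)] by (simp add: null_seqs_iff del: cauchy_space_sel(5))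
  show "nrm (completion V) (c \<odot>\<^bsub>completion V\<^esub> A) = cmod c * nrm (completion V) A" for c
   unfolding s(2) ccls_smult[OF s(1)] nrm_ccls[OF s(1)] nrm_ccls[OF cauchy_smult[OF s(1)]] by (rule cauchy_nrm_smult[OF s(1)])
  fix B assume "B \<in> carrier (completion V)"
  then obtain t where t: "t \<in> cauchy_seqs V" "B = ccls t" by (rule completion_cases)
  show "nrm (completion V) (A \<oplus>\<^bsub>completion V\<^esub> B) <= nrm (completion V) A + nrm (completion V) B"
   unfolding s(2) t(2) ccls_add[OF s(1) t(1)] nrm_ccls[OF s(1)] nrm_ccls[OF t(1)] nrm_ccls[OF cauchy_add[OF s(1) t(1)]] by (rule cauchy_nrm_add[OF s(1) t(1)])
 qed
qed

lemma completion_embed_eq: "completion_embed V v = ccls (%n. v)" by (simp add: completion_embed_def)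

lemma completion_embed_closed: "v \<in> carrier V ==> completion_embed V v \<in> carrier (completion V)" by (simp add: completion_embed_eq ccls_closed cauchy_const)

lemma clinear_completion_embed: "clinear_on V (completion V) (completion_embed V)" by (rule clinear_onI, rule completion_embed_closed)
  (simp_all add: completion_embed_eq ccls_add ccls_smult cauchy_const)

lemma nrm_completion_embed: "v \<in> carrier V ==> nrm (completion V) (completion_embed V v) = nrm V v" by (simp add: completion_embed_eq nrm_ccls cauchy_const)

lemma nrm_ccls_minus_embed:
 assumes s: "s \<in> cauchy_seqs V" and v: "v \<in> carrier V"
 shows "nrm (completion V) (ccls s \<ominus>\<^bsub>completion V\<^esub> completion_embed V v) = lim (%n. nrm V (s n \<ominus> v))" proof -
 interpret C: complex_normed_space "completion V" by (rule completion_normed)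
 have "ccls s \<ominus>\<^bsub>completion V\<^esub> completion_embed V v = ccls (%n. s n \<oplus> (-1) \<odot> v)"
  by (simp add: C.vminus_eq ccls_closed s completion_embed_closed v)
   (simp add: completion_embed_eq ccls_smult ccls_add s v cauchy_const)
 moreover have "(%n. s n \<oplus> (-1) \<odot> v) = (%n. s n \<ominus> v)" using cauchy_seqsD(1)[OF s] v by (simp add: vminus_eq)
 ultimately show ?thesis using nrm_ccls[OF cauchy_diff[OF cauchy_const[OF v] s]] by simp
qed

lemma completion_approx:
 assumes s: "s \<in> cauchy_seqs V" shows "(%n. nrm (completion V) (ccls s \<ominus>\<^bsub>completion V\<^esub> completion_embed V (s n))) \<longlonglongrightarrow> 0"
proof (rule LIMSEQ_I)
 note sc = cauchy_seqsD(1)[OF s]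
 fix e :: real assume e: "e > 0"
 obtain M where M: "\<forall>m\<ge>M. \<forall>n\<ge>M. nrm V (s m \<ominus> s n) < e / 2" using cauchy_seqsD(2)[OF s, of "e/2"] e by auto
 have "norm (nrm (completion V) (ccls s \<ominus>\<^bsub>completion V\<^esub> completion_embed V (s n)) - 0) < e" if "n \<ge> M" for n proof -
  have d: "(%k. s k \<ominus> s n) \<in> cauchy_seqs V" by (rule cauchy_diff[OF cauchy_const[OF sc] s])
  \<comment> \<open>A strict inequality becomes a weak one in the limit, hence the margin
    \<open>e / 2\<close>.\<close>
  have "lim (%k. nrm V (s k \<ominus> s n)) <= e / 2"
   using cauchy_nrm_tendsto[OF d] M that by (intro LIMSEQ_le_const2[of "%k. nrm V (s k \<ominus> s n)"]) (auto intro!: less_imp_le)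
  moreover have "0 <= lim (%k. nrm V (s k \<ominus> s n))" using cauchy_nrm_nonneg[OF d] by simp
  ultimately show ?thesis unfolding nrm_ccls_minus_embed[OF s sc] using e by simp
 qed
 then show "\<exists>M. \<forall>n\<ge>M. norm (nrm (completion V) (ccls s \<ominus>\<^bsub>completion V\<^esub> completion_embed V (s n)) - 0) < e" by blast
qed

lemma completion_dense:
 assumes A: "A \<in> carrier (completion V)" and e: "e > 0"
 shows "\<exists>d\<in>completion_embed V ` carrier V. nrm (completion V) (A \<ominus>\<^bsub>completion V\<^esub> d) < e" proof -
 obtain s where s: "s \<in> cauchy_seqs V" "A = ccls s" using A by (rule completion_cases)
 obtain n where "norm (nrm (completion V) (ccls s \<ominus>\<^bsub>completion V\<^esub> completion_embed V (s n)) - 0) < e"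
  using LIMSEQ_D[OF completion_approx[OF s(1)] e] by blast
 then show ?thesis using s cauchy_seqsD(1)[OF s(1)] by (intro bexI[of _ "completion_embed V (s n)"]) auto
qed

lemma completion_map_ccls:
 assumes f: "bounded_map V V f C" and s: "s \<in> cauchy_seqs V" shows "completion_map V f (ccls s) = ccls (%n. f (s n))" proof -
 have cm: "(%n. f (t n)) \<in> cauchy_seqs V" if "t \<in> cauchy_seqs V" for t by (rule cauchy_map[OF complex_normed_space_axioms f that])
 have "clinear_on (cauchy_space V) (cauchy_space V) (%s n. f (s n))" by (rule clinear_onI) (simp_all add: cm clinear_onD(2,3)[OF bounded_mapD(1)[OF f]] cauchy_seqsD(1))
 moreover have "(%n. f (t n)) \<in> null_seqs V" if "t \<in> null_seqs V" for t
  using that cm cauchy_nrm_map_le[OF complex_normed_space_axioms f, of t] cauchy_nrm_nonneg[OF cm, of t] by (simp add: null_seqs_iff del: cauchy_space_sel(5))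
 ultimately show ?thesis unfolding completion_map_def
  using quotient_map_coset[OF Q.cvec_axioms Q.cvec_axioms subsp_null_seqs subsp_null_seqs, of "%s n. f (s n)" s] s by simp
qed

lemma bounded_completion_map:
 assumes f: "bounded_map V V f C" shows "bounded_map (completion V) (completion V) (completion_map V f) C"
  and "v \<in> carrier V ==> completion_map V f (completion_embed V v) = completion_embed V (f v)" proof -
 note m = completion_map_ccls[OF f]
 have cm: "(%n. f (t n)) \<in> cauchy_seqs V" if "t \<in> cauchy_seqs V" for t by (rule cauchy_map[OF complex_normed_space_axioms f that])
 show "bounded_map (completion V) (completion V) (completion_map V f) C" unfolding bounded_map_def proof (intro conjI ballI clinear_onI)
  fix A assume "A \<in> carrier (completion V)"
  then obtain s where s: "s \<in> cauchy_seqs V" "A = ccls s" by (rule completion_cases)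
  show "completion_map V f A \<in> carrier (completion V)" unfolding s(2) m[OF s(1)] by (rule ccls_closed[OF cm[OF s(1)]])
  show "nrm (completion V) (completion_map V f A) <= C * nrm (completion V) A" unfolding s(2) m[OF s(1)] nrm_ccls[OF s(1)] nrm_ccls[OF cm[OF s(1)]]
   by (rule cauchy_nrm_map_le[OF complex_normed_space_axioms f s(1)])
  show "completion_map V f (c \<odot>\<^bsub>completion V\<^esub> A) = c \<odot>\<^bsub>completion V\<^esub> completion_map V f A" for c
   unfolding s(2) ccls_smult[OF s(1)] m[OF s(1)] m[OF cauchy_smult[OF s(1)]] ccls_smult[OF cm[OF s(1)]]
   by (simp add: clinear_onD(3)[OF bounded_mapD(1)[OF f]] cauchy_seqsD(1)[OF s(1)])
  fix B assume "B \<in> carrier (completion V)"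
  then obtain t where t: "t \<in> cauchy_seqs V" "B = ccls t" by (rule completion_cases)
  show "completion_map V f (A \<oplus>\<^bsub>completion V\<^esub> B) = completion_map V f A \<oplus>\<^bsub>completion V\<^esub> completion_map V f B"
   unfolding s(2) t(2) ccls_add[OF s(1) t(1)] m[OF s(1)] m[OF t(1)] m[OF cauchy_add[OF s(1) t(1)]] ccls_add[OF cm[OF s(1)] cm[OF t(1)]]
   by (simp add: clinear_onD(2)[OF bounded_mapD(1)[OF f]] cauchy_seqsD(1)[OF s(1)] cauchy_seqsD(1)[OF t(1)])
 qed (rule bounded_mapD(2)[OF f])
 show "v \<in> carrier V ==> completion_map V f (completion_embed V v) = completion_embed V (f v)" unfolding completion_embed_eq by (rule m[OF cauchy_const])
qed

text \<open>The extension of \<open>f\<close> by continuity into a complete space. The choice asks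
  for a limit along some sequence of the class; \<open>completion_ext_props\<close> shows that it is
  the limit along all of them.\<close>

definition completion_ext :: "('w, 'n) cnormed_space_scheme => ('v => 'w) => (nat => 'v) set => 'w" where
 "completion_ext W f A = (SOME x. x \<in> carrier W & (\<exists>s\<in>A. (%n. nrm W (f (s n) \<ominus>\<^bsub>W\<^esub> x)) \<longlonglongrightarrow> 0))"

lemma completion_ext_props:
 assumes W: "complex_normed_space W" "complete_normed W" and f: "bounded_map V W f C" shows "bounded_map (completion V) W (completion_ext W f) C"
  and "v \<in> carrier V ==> completion_ext W f (completion_embed V v) = f v" proof -
 interpret W: complex_normed_space W by fact
 have conv: "completion_ext W f (ccls s) \<in> carrier W &
   (%n. nrm W (f (s n) \<ominus>\<^bsub>W\<^esub> completion_ext W f (ccls s))) \<longlonglongrightarrow> 0" if s: "s \<in> cauchy_seqs V" for s proof -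
  let ?x = "completion_ext W f (ccls s)"
  obtain x where x: "x \<in> carrier W" "(%n. nrm W (f (s n) \<ominus>\<^bsub>W\<^esub> x)) \<longlonglongrightarrow> 0"
   using bspec[OF W(2)[unfolded complete_normed_def] cauchy_map[OF W(1) f s]] by auto
  have "?x \<in> carrier W & (\<exists>t\<in>ccls s. (%n. nrm W (f (t n) \<ominus>\<^bsub>W\<^esub> ?x)) \<longlonglongrightarrow> 0)"
   unfolding completion_ext_def by (rule someI_ex) (rule exI[of _ x], rule conjI[OF x(1)], rule bexI[OF _ ccls_self[OF s]], rule x(2))
  then obtain t where t: "?x \<in> carrier W" "t \<in> ccls s" "(%n. nrm W (f (t n) \<ominus>\<^bsub>W\<^esub> ?x)) \<longlonglongrightarrow> 0" by blast
  have tc: "t \<in> cauchy_seqs V" and ts: "(%n. nrm V (t n \<ominus> s n)) \<longlonglongrightarrow> 0" using t(2) ccls_mem[OF s] by (auto simp: null_seqs_def)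
  note c = cauchy_seqsD(1)[OF tc] cauchy_seqsD(1)[OF s] bounded_mapD(4)[OF f]
  have "(%n. nrm W (f (s n) \<ominus>\<^bsub>W\<^esub> ?x)) \<longlonglongrightarrow> 0" proof (rule real_tendsto_0_iff_nonneg_bound)
   show "(%n. C * nrm V (t n \<ominus> s n) + nrm W (f (t n) \<ominus>\<^bsub>W\<^esub> ?x)) \<longlonglongrightarrow> 0"
    using tendsto_add[OF tendsto_mult_right_zero[OF ts, of C] t(3)] by simp
   fix n
   show "0 <= nrm W (f (s n) \<ominus>\<^bsub>W\<^esub> ?x)" using c t(1) by simp
   have "nrm W (f (s n) \<ominus>\<^bsub>W\<^esub> f (t n)) = nrm W (f (t n \<ominus> s n))"
    unfolding clinear_on_minus[OF cvec_axioms W.cvec_axioms bounded_mapD(1)[OF f] c(1,2)] by (rule W.nrm_minus_commute) (use c in auto)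
   also have "... <= C * nrm V (t n \<ominus> s n)" by (rule bounded_mapD(3)[OF f]) (use c in auto)
   finally show "nrm W (f (s n) \<ominus>\<^bsub>W\<^esub> ?x) <= C * nrm V (t n \<ominus> s n) + nrm W (f (t n) \<ominus>\<^bsub>W\<^esub> ?x)"
    using W.nrm_minus_triangle[of "f (s n)" "f (t n)" ?x] c t(1) by simp
  qed
  with t(1) show ?thesis by simp
 qed
 have uniq: "x = completion_ext W f (ccls s)"
  if s: "s \<in> cauchy_seqs V" and x: "x \<in> carrier W" "(%n. nrm W (f (s n) \<ominus>\<^bsub>W\<^esub> x)) \<longlonglongrightarrow> 0" for s x proof -
  let ?x = "completion_ext W f (ccls s)"
  note c = cauchy_seqsD(1)[OF s] bounded_mapD(4)[OF f]
  have "(%n. nrm W (x \<ominus>\<^bsub>W\<^esub> ?x)) \<longlonglongrightarrow> 0" proof (rule real_tendsto_0_iff_nonneg_bound)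
   show "(%n. nrm W (f (s n) \<ominus>\<^bsub>W\<^esub> x) + nrm W (f (s n) \<ominus>\<^bsub>W\<^esub> ?x)) \<longlonglongrightarrow> 0"
    using tendsto_add[OF x(2) conjunct2[OF conv[OF s]]] by simp
   show "0 <= nrm W (x \<ominus>\<^bsub>W\<^esub> ?x)" using x conv[OF s] by simp
   show "nrm W (x \<ominus>\<^bsub>W\<^esub> ?x) <= nrm W (f (s n) \<ominus>\<^bsub>W\<^esub> x) + nrm W (f (s n) \<ominus>\<^bsub>W\<^esub> ?x)" for n
    using W.nrm_minus_triangle[of x "f (s n)" ?x] W.nrm_minus_commute[of x "f (s n)"] x(1) conv[OF s] c by simp
  qed
  then have "nrm W (x \<ominus>\<^bsub>W\<^esub> ?x) = 0" by (simp add: LIMSEQ_const_iff)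
  then show ?thesis using x conv[OF s] W.nrm_eq_0_iff W.minus_eq_zero_iff by simp
 qed
 show "bounded_map (completion V) W (completion_ext W f) C" unfolding bounded_map_def proof (intro conjI ballI clinear_onI)
  fix A assume "A \<in> carrier (completion V)"
  then obtain s where s: "s \<in> cauchy_seqs V" "A = ccls s" by (rule completion_cases)
  let ?x = "completion_ext W f (ccls s)"
  have x: "?x \<in> carrier W" "(%n. nrm W (f (s n) \<ominus>\<^bsub>W\<^esub> ?x)) \<longlonglongrightarrow> 0" using conv[OF s(1)] by auto
  note sc = cauchy_seqsD(1)[OF s(1)] and fc = bounded_mapD(4)[OF f cauchy_seqsD(1)[OF s(1)]]
  show "completion_ext W f A \<in> carrier W" using x s by simp
  show "nrm W (completion_ext W f A) <= C * nrm (completion V) A" unfolding s(2) nrm_ccls[OF s(1)] proof (rule LIMSEQ_le_const)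
   show "(%n. C * nrm V (s n) + nrm W (f (s n) \<ominus>\<^bsub>W\<^esub> ?x)) \<longlonglongrightarrow> C * nrm (cauchy_space V) s"
    using tendsto_add[OF tendsto_mult_left[OF cauchy_nrm_tendsto[OF s(1)], of C] x(2)] by simp
   have "nrm W ?x <= C * nrm V (s n) + nrm W (f (s n) \<ominus>\<^bsub>W\<^esub> ?x)" for n using W.nrm_le_add_minus[OF x(1) fc, of n] W.nrm_minus_commute[OF x(1) fc, of n]
     bounded_mapD(3)[OF f sc, of n] by simp
   then show "\<exists>M. \<forall>n\<ge>M. nrm W ?x <= C * nrm V (s n) + nrm W (f (s n) \<ominus>\<^bsub>W\<^esub> ?x)" by blast
  qed
  show "completion_ext W f (c \<odot>\<^bsub>completion V\<^esub> A) = c \<odot>\<^bsub>W\<^esub> completion_ext W f A" for c unfolding s(2) ccls_smult[OF s(1)]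
  proof (rule uniq[OF cauchy_smult[OF s(1)], symmetric])
   have "(%n. nrm W (f (c \<odot> s n) \<ominus>\<^bsub>W\<^esub> c \<odot>\<^bsub>W\<^esub> ?x)) = (%n. cmod c * nrm W (f (s n) \<ominus>\<^bsub>W\<^esub> ?x))"
    using x(1) fc sc by (simp add: clinear_onD(3)[OF bounded_mapD(1)[OF f]] W.smult_minus W.nrm_smult)
   then show "(%n. nrm W (f (c \<odot> s n) \<ominus>\<^bsub>W\<^esub> c \<odot>\<^bsub>W\<^esub> ?x)) \<longlonglongrightarrow> 0"
    using tendsto_mult_right_zero[OF x(2), of "cmod c"] by simp
  qed (use x in simp)
  fix B assume "B \<in> carrier (completion V)"
  then obtain t where t: "t \<in> cauchy_seqs V" "B = ccls t" by (rule completion_cases)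
  let ?y = "completion_ext W f (ccls t)"
  have y: "?y \<in> carrier W" "(%n. nrm W (f (t n) \<ominus>\<^bsub>W\<^esub> ?y)) \<longlonglongrightarrow> 0" using conv[OF t(1)] by auto
  note tc = cauchy_seqsD(1)[OF t(1)] and ftc = bounded_mapD(4)[OF f cauchy_seqsD(1)[OF t(1)]]
  show "completion_ext W f (A \<oplus>\<^bsub>completion V\<^esub> B) = completion_ext W f A \<oplus>\<^bsub>W\<^esub> completion_ext W f B"
   unfolding s(2) t(2) ccls_add[OF s(1) t(1)] proof (rule uniq[OF cauchy_add[OF s(1) t(1)], symmetric])
   show "(%n. nrm W (f (s n \<oplus> t n) \<ominus>\<^bsub>W\<^esub> (?x \<oplus>\<^bsub>W\<^esub> ?y))) \<longlonglongrightarrow> 0"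
   proof (rule real_tendsto_0_iff_nonneg_bound)
    show "(%n. nrm W (f (s n) \<ominus>\<^bsub>W\<^esub> ?x) + nrm W (f (t n) \<ominus>\<^bsub>W\<^esub> ?y)) \<longlonglongrightarrow> 0"
     using tendsto_add[OF x(2) y(2)] by simp
    fix n
    have e: "f (s n \<oplus> t n) \<ominus>\<^bsub>W\<^esub> (?x \<oplus>\<^bsub>W\<^esub> ?y) = (f (s n) \<ominus>\<^bsub>W\<^esub> ?x) \<oplus>\<^bsub>W\<^esub> (f (t n) \<ominus>\<^bsub>W\<^esub> ?y)"
     unfolding clinear_onD(2)[OF bounded_mapD(1)[OF f] sc tc] by (rule W.add_minus_add[OF fc ftc x(1) y(1)])
    show "0 <= nrm W (f (s n \<oplus> t n) \<ominus>\<^bsub>W\<^esub> (?x \<oplus>\<^bsub>W\<^esub> ?y))" unfolding e using fc ftc x y by simp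
    show "nrm W (f (s n \<oplus> t n) \<ominus>\<^bsub>W\<^esub> (?x \<oplus>\<^bsub>W\<^esub> ?y)) <= nrm W (f (s n) \<ominus>\<^bsub>W\<^esub> ?x) + nrm W (f (t n) \<ominus>\<^bsub>W\<^esub> ?y)"
     unfolding e using fc ftc x y by (intro W.nrm_triangle) auto
   qed
  qed (use x y in simp)
 qed (rule bounded_mapD(2)[OF f])
 show "completion_ext W f (completion_embed V v) = f v" if v: "v \<in> carrier V" unfolding completion_embed_eq
  by (rule uniq[OF cauchy_const[OF v], symmetric]) (use bounded_mapD(4)[OF f v] in auto)
qed

end

section \<open>Hilbert tensor products\<close>

lemma inner_tensor_sel [simp]:
 "carrier (inner_tensor X Y) = carrier (alg_tensor X Y)"
 "\<zero>\<^bsub>inner_tensor X Y\<^esub> = \<zero>\<^bsub>alg_tensor X Y\<^esub>"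
 "add (inner_tensor X Y) = add (alg_tensor X Y)"
 "smult (inner_tensor X Y) = smult (alg_tensor X Y)" by (simp_all add: inner_tensor_def module.defs cinner_space.defs)

locale inner_pair = X: inner_space X + Y: inner_space Y
 for X :: "'x cinner_space" and Y :: "'y cinner_space"
begin

sublocale cvec_pair X Y by unfold_locales

sublocale A: cvec "AT" by (rule cvec_alg_tensor)

definition form :: "('x \<times> 'y \<Rightarrow>\<^sub>0 complex) => ('x \<times> 'y \<Rightarrow>\<^sub>0 complex) => complex" where
 "form p q = (\<Sum>k\<in>pkeys p. \<Sum>l\<in>pkeys q.
  pat p k * cnj (pat q l) * ip X (fst k) (fst l) * ip Y (snd k) (snd l))"

lemma form_flift: "form p q = flift cscalars (%k. \<Sum>l\<in>pkeys q. cnj (pat q l) * ip X (fst k) (fst l) * ip Y (snd k) (snd l)) p"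
 by (simp add: form_def flift_cscalars sum_distrib_left mult.assoc)

lemma form_bilinear:
 assumes q: "pkeys q <= S" shows "bilinear_on X Y cscalars (%k. \<Sum>l\<in>pkeys q. cnj (pat q l) * ip X (fst k) (fst l) * ip Y (snd k) (snd l))" proof -
 have l: "fst l \<in> carrier X" "snd l \<in> carrier Y" if "l \<in> pkeys q" for l using q that by auto show ?thesis by (intro bilinear_onI clinear_onI)
   (auto simp: l X.inner_add_left Y.inner_add_left X.inner_smult_left Y.inner_smult_left
    algebra_simps sum.distrib[symmetric] sum_distrib_left intro!: sum.cong)
qed

lemma form_cnj:
 assumes "pkeys p <= S" "pkeys q <= S" shows "form q p = cnj (form p q)" proof -
 have "form q p = (\<Sum>l\<in>pkeys q. \<Sum>k\<in>pkeys p. cnj (pat p k * cnj (pat q l) * ip X (fst k) (fst l) * ip Y (snd k) (snd l)))" unfolding form_def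
 proof (intro sum.cong refl)
  fix k l assume "k \<in> pkeys p" "l \<in> pkeys q"
  then have "fst k \<in> carrier X" "snd k \<in> carrier Y" "fst l \<in> carrier X" "snd l \<in> carrier Y" using assms by auto
  then show "pat q l * cnj (pat p k) * ip X (fst l) (fst k) * ip Y (snd l) (snd k)
    = cnj (pat p k * cnj (pat q l) * ip X (fst k) (fst l) * ip Y (snd k) (snd l))" using X.inner_cnj[of "fst k" "fst l"] Y.inner_cnj[of "snd k" "snd l"] by simp
 qed
 then show ?thesis unfolding form_def by (simp add: sum.swap[of _ "pkeys q"])
qed

text \<open>Independence of the chosen representatives: by \<open>form_flift\<close> the form is a
  linear lift in its first argument, which depends only on the class; conjugate symmetry gives the
  second argument.\<close>

lemma inner_tensor_tcls:
 assumes p: "pkeys p <= S" and q: "pkeys q <= S" shows "ip (inner_tensor X Y) (tcls X Y p) (tcls X Y q) = form p q" proof -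
 let ?p = "SOME p'. p' \<in> tcls X Y p" and ?q = "SOME q'. q' \<in> tcls X Y q"
 have rep: "pkeys (SOME r'. r' \<in> tcls X Y r) \<subseteq> S & tcls X Y r = tcls X Y (SOME r'. r' \<in> tcls X Y r)"
  if r: "pkeys r <= S" for r proof -
  have "r \<in> tcls X Y r" unfolding tcls_mem[OF r] using r FM.subspD(2)[OF subsp_tensor_kernel] by simp
  then have "(SOME r'. r' \<in> tcls X Y r) \<in> tcls X Y r" by (rule someI)
  then show ?thesis unfolding tcls_mem[OF r, of "SOME r'. r' \<in> tcls X Y r"] using tcls_eq_iff[OF _ r, of "SOME r'. r' \<in> tcls X Y r"] by blast
 qed
 note pq = conjunct1[OF rep[OF p]] conjunct1[OF rep[OF q]] conjunct2[OF rep[OF p]] conjunct2[OF rep[OF q]]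
 have "ip (inner_tensor X Y) (tcls X Y p) (tcls X Y q) = form ?p ?q" by (simp add: inner_tensor_def module.defs cinner_space.defs form_def Let_def split_beta)
 also have "... = form p ?q" unfolding form_flift[of _ ?q] by (rule flift_tcls_cong[OF cvec_cscalars form_bilinear[OF pq(2)] pq(1) p pq(3)[symmetric]])
 also have "... = cnj (form ?q p)" using form_cnj[OF pq(2) p] .
 also have "form ?q p = form q p" unfolding form_flift[of _ p] by (rule flift_tcls_cong[OF cvec_cscalars form_bilinear[OF p] pq(2) q pq(4)[symmetric]])
 also have "cnj (form q p) = form p q" using form_cnj[OF q p] by simp
 finally show ?thesis .
qed

text \<open>The component along \<open>h\<close>, that is, the identity tensored with <., h>.
  \<open>temb h\<close> sends \<open>x\<close> to its tensor with \<open>h\<close> and is adjoint to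
  \<open>tcomp h\<close> by \<open>ip_temb_right\<close>; \<open>tproj G\<close> projects to the
  tensors whose second factors lie in the span of the orthonormal set \<open>G\<close>.\<close>

definition tcomp :: "'y => ('x \<times> 'y \<Rightarrow>\<^sub>0 complex) set => 'x" where
 "tcomp h = tlift X (%k. ip Y (snd k) h \<odot>\<^bsub>X\<^esub> fst k)"

definition temb :: "'y => 'x => ('x \<times> 'y \<Rightarrow>\<^sub>0 complex) set" where
 "temb h x = tcls X Y (sng (x, h) 1)"

definition tproj :: "'y set => ('x \<times> 'y \<Rightarrow>\<^sub>0 complex) set => ('x \<times> 'y \<Rightarrow>\<^sub>0 complex) set" where
 "tproj G u = (\<Oplus>\<^bsub>AT\<^esub>g\<in>G. temb g (tcomp g u))"

lemma tcomp_bilinear: "h \<in> carrier Y ==> bilinear_on X Y X (%k. ip Y (snd k) h \<odot>\<^bsub>X\<^esub> fst k)" by (intro bilinear_onI clinear_onI)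
  (simp_all add: X.smult_add_right X.smult_smult Y.inner_add_left X.smult_add_left Y.inner_smult_left mult.commute)

lemma clinear_tcomp: "h \<in> carrier Y ==> clinear_on AT X (tcomp h)" unfolding tcomp_def by (rule clinear_tlift[OF X.cvec_axioms tcomp_bilinear])

lemmas tcomp_closed = clinear_onD(1)[OF clinear_tcomp]

lemma temb_linear:
 "h \<in> carrier Y ==> clinear_on X AT (temb h)"
 "x \<in> carrier X ==> clinear_on Y AT (%h. temb h x)" using bilinear_elem by (simp_all add: bilinear_on_def temb_def[abs_def])

lemma temb_closed: "h \<in> carrier Y ==> x \<in> carrier X ==> temb h x \<in> carrier AT" by (rule clinear_onD(1)[OF temb_linear(1)])

lemma tcomp_temb: "h \<in> carrier Y ==> g \<in> carrier Y ==> x \<in> carrier X ==> tcomp h (temb g x) = ip Y g h \<odot>\<^bsub>X\<^esub> x"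
 unfolding temb_def tcomp_def by (subst tlift_tcls[OF X.cvec_axioms tcomp_bilinear]) (simp_all add: flift_single[OF X.cvec_axioms])

lemma clinear_tproj:
 assumes "Y.onf G (%g. g)" shows "clinear_on AT AT (tproj G)" proof (rule clinear_onI)
 note GD = Y.onfD[OF assms]
 have c: "temb g (tcomp g u) \<in> carrier AT" if "g \<in> G" "u \<in> carrier AT" for g u using that GD by (intro temb_closed tcomp_closed)
 fix u assume u: "u \<in> carrier AT"
 show "tproj G u \<in> carrier AT" unfolding tproj_def using c u by (intro A.M.finsum_closed) auto
 show "tproj G (a \<odot>\<^bsub>AT\<^esub> u) = a \<odot>\<^bsub>AT\<^esub> tproj G u" for a unfolding tproj_def proof (subst A.finsum_smult[symmetric])
  show "(\<Oplus>\<^bsub>AT\<^esub>g\<in>G. temb g (tcomp g (a \<odot>\<^bsub>AT\<^esub> u)))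
    = (\<Oplus>\<^bsub>AT\<^esub>g\<in>G. a \<odot>\<^bsub>AT\<^esub> temb g (tcomp g u))" by (rule A.M.finsum_cong')
    (simp_all add: GD u c clinear_onD(3)[OF clinear_tcomp] clinear_onD(3)[OF temb_linear(1)] tcomp_closed)
 qed (use GD u c in auto)
 fix v assume v: "v \<in> carrier AT"
 show "tproj G (u \<oplus>\<^bsub>AT\<^esub> v) = tproj G u \<oplus>\<^bsub>AT\<^esub> tproj G v" unfolding tproj_def proof (subst A.M.finsum_addf[symmetric])
  show "(\<Oplus>\<^bsub>AT\<^esub>g\<in>G. temb g (tcomp g (u \<oplus>\<^bsub>AT\<^esub> v)))
    = (\<Oplus>\<^bsub>AT\<^esub>g\<in>G. temb g (tcomp g u) \<oplus>\<^bsub>AT\<^esub> temb g (tcomp g v))" by (rule A.M.finsum_cong')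
    (simp_all add: GD u v c clinear_onD(2)[OF clinear_tcomp] clinear_onD(2)[OF temb_linear(1)] tcomp_closed)
 qed (use GD u v c in auto)
qed

lemma tproj_temb:
 assumes G: "Y.onf G (%g. g)" and x: "x \<in> carrier X" and y: "y \<in> carrier Y" "Y.opr G (%g. g) y = y" shows "tproj G (temb y x) = temb y x" proof -
 note GD = Y.onfD[OF G]
 have "temb y x = temb (\<Oplus>\<^bsub>Y\<^esub>g\<in>G. ip Y y g \<odot>\<^bsub>Y\<^esub> g) x" using y(2) by (simp add: Y.opr_def Y.ocomb_def)
 also have "... = (\<Oplus>\<^bsub>AT\<^esub>g\<in>G. temb (ip Y y g \<odot>\<^bsub>Y\<^esub> g) x)"
  by (rule clinear_on_finsum[OF Y.cvec_axioms A.cvec_axioms temb_linear(2)[OF x]]) (use GD in auto)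
 also have "... = (\<Oplus>\<^bsub>AT\<^esub>g\<in>G. temb g (tcomp g (temb y x)))" using GD x y clinear_onD(3)[OF temb_linear(1)] clinear_onD(3)[OF temb_linear(2)]
  by (intro A.M.finsum_cong') (auto simp: tcomp_temb temb_closed)
 finally show ?thesis unfolding tproj_def ..
qed

text \<open>Finitely many tensors involve finitely many vectors of \<open>Y\<close>, and
  Gram-Schmidt applies to these. Questions about such tensors thus take place in a finite orthogonal
  sum of copies of \<open>X\<close>.\<close>

lemma finite_tproj:
 assumes "finite U" "U <= carrier AT" obtains G where "Y.onf G (%g. g)" "!!u. u \<in> U ==> tproj G u = u" proof -
 have "\<forall>u\<in>U. \<exists>p. pkeys p <= S & u = tcls X Y p" using assms(2) alg_tensor_cases by blast
 then obtain P where P: "!!u. u \<in> U ==> pkeys (P u) \<subseteq> S & u = tcls X Y (P u)" by metis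
 have "finite (\<Union>u\<in>U. snd ` pkeys (P u))" "(\<Union>u\<in>U. snd ` pkeys (P u)) <= carrier Y" using assms(1) P by fastforce+
 then obtain G where G: "Y.onf G (%g. g)" "!!y. y \<in> (\<Union>u\<in>U. snd ` pkeys (P u)) ==> Y.opr G (%g. g) y = y"
  using Y.Gram_Schmidt by metis
 have "tproj G u = u" if u: "u \<in> U" for u proof -
  have p: "pkeys (P u) \<subseteq> S" and e: "u = tcls X Y (P u)" using P[OF u] by auto
  have el: "tcls X Y (sng k 1) = temb (snd k) (fst k)" for k by (simp add: temb_def)
  have "u = flift AT (%k. temb (snd k) (fst k)) (P u)" using tcls_eq_flift[OF p] e unfolding el by simp
  moreover have "tproj G (flift AT (%k. temb (snd k) (fst k)) (P u))
    = flift AT (%k. tproj G (temb (snd k) (fst k))) (P u)" by (rule flift_comp[OF A.cvec_axioms A.cvec_axioms clinear_tproj[OF G(1)] _ p]) (auto simp: temb_closed)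
  moreover have "... = flift AT (%k. temb (snd k) (fst k)) (P u)" proof (rule flift_cong[OF _ _ A.cvec_axioms])
   fix k assume k: "k \<in> pkeys (P u)"
   then have "fst k \<in> carrier X" "snd k \<in> carrier Y" using p by auto
   then show e: "tproj G (temb (snd k) (fst k)) = temb (snd k) (fst k)" using G(2)[of "snd k"] u k by (intro tproj_temb[OF G(1)]) auto
  next
   show "(%k. tproj G (temb (snd k) (fst k))) \<in> pkeys (P u) \<rightarrow> carrier AT"
    using p by (auto intro!: clinear_onD(1)[OF clinear_tproj[OF G(1)]] temb_closed)
  qed
  ultimately show ?thesis by simp
 qed
 with G(1) show ?thesis by (rule that)
qed

lemma ip_temb_right:
 assumes u: "u \<in> carrier AT" and h: "h \<in> carrier Y" and x: "x \<in> carrier X" shows "ip (inner_tensor X Y) u (temb h x) = ip X (tcomp h u) x" using u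
proof (rule alg_tensor_cases)
 fix p assume p: "pkeys p <= S" "u = tcls X Y p"
 have pk: "fst k \<in> carrier X" "snd k \<in> carrier Y" if "k \<in> pkeys p" for k using p(1) that by auto
 have "tcomp h u = (\<Oplus>\<^bsub>X\<^esub>k\<in>pkeys p. pat p k \<odot>\<^bsub>X\<^esub> (ip Y (snd k) h \<odot>\<^bsub>X\<^esub> fst k))"
  unfolding p(2) tcomp_def tlift_tcls[OF X.cvec_axioms tcomp_bilinear[OF h] p(1)] flift_def ..
 then have "ip X (tcomp h u) x = (\<Sum>k\<in>pkeys p. ip X (pat p k \<odot>\<^bsub>X\<^esub> (ip Y (snd k) h \<odot>\<^bsub>X\<^esub> fst k)) x)"
  using pk x by (simp add: X.inner_finsum_left Pi_iff)
 also have "... = form p (sng (x, h) 1)" unfolding form_def using pk x by (intro sum.cong) (auto simp: X.inner_smult_left)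
 finally show ?thesis unfolding temb_def p(2) using inner_tensor_tcls[OF p(1), of "sng (x, h) 1"] x h by simp
qed

lemma inner_tensor_linear:
 assumes "u \<in> carrier AT" "v \<in> carrier AT" "z \<in> carrier AT"
 shows "ip (inner_tensor X Y) (u \<oplus>\<^bsub>AT\<^esub> v) z = ip (inner_tensor X Y) u z + ip (inner_tensor X Y) v z"
  and "ip (inner_tensor X Y) (c \<odot>\<^bsub>AT\<^esub> u) z = c * ip (inner_tensor X Y) u z" and "ip (inner_tensor X Y) z u = cnj (ip (inner_tensor X Y) u z)" proof -
 obtain p where p: "pkeys p <= S" "u = tcls X Y p" using assms(1) by (rule alg_tensor_cases)
 obtain q where q: "pkeys q <= S" "v = tcls X Y q" using assms(2) by (rule alg_tensor_cases)
 obtain r where r: "pkeys r <= S" "z = tcls X Y r" using assms(3) by (rule alg_tensor_cases)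
 note b = bilinear_on_closed[OF form_bilinear[OF r(1)]]
 show "ip (inner_tensor X Y) (u \<oplus>\<^bsub>AT\<^esub> v) z = ip (inner_tensor X Y) u z + ip (inner_tensor X Y) v z"
  unfolding p(2) q(2) r(2) tcls_add[OF p(1) q(1), symmetric] using p q r flift_add[OF cvec_cscalars b p(1) q(1)]
  by (simp add: inner_tensor_tcls pkeys_add_subset form_flift[of _ r])
 show "ip (inner_tensor X Y) (c \<odot>\<^bsub>AT\<^esub> u) z = c * ip (inner_tensor X Y) u z" unfolding p(2) r(2) tcls_psc[OF p(1), symmetric]
  using p r flift_psc[OF cvec_cscalars b p(1), of c] by (simp add: inner_tensor_tcls pkeys_psc_subset form_flift[of _ r])
 show "ip (inner_tensor X Y) z u = cnj (ip (inner_tensor X Y) u z)" unfolding p(2) r(2) using form_cnj[OF p(1) r(1)] p r by (simp add: inner_tensor_tcls)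
qed

lemma ip_tproj:
 assumes G: "Y.onf G (%g. g)" and u: "u \<in> carrier AT" and v: "v \<in> carrier AT"
 shows "ip (inner_tensor X Y) u (tproj G v) = (\<Sum>g\<in>G. ip X (tcomp g u) (tcomp g v))" proof -
 note GD = Y.onfD[OF G]
 have fin: "finite G" by (rule GD(1))
 have c: "temb g (tcomp g v) \<in> carrier AT" if "g \<in> G" for g using that GD v by (intro temb_closed tcomp_closed)
 have cl: "clinear_on AT cscalars (%w. ip (inner_tensor X Y) w u)"
  by (rule clinear_onI) (simp_all add: inner_tensor_linear(1,2)[OF _ _ u] inner_tensor_linear(2)[OF _ u u])
 have "ip (inner_tensor X Y) (tproj G v) u = (\<Oplus>\<^bsub>cscalars\<^esub>g\<in>G. ip (inner_tensor X Y) (temb g (tcomp g v)) u)"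
  unfolding tproj_def by (rule clinear_on_finsum[OF A.cvec_axioms cvec_cscalars cl fin]) (use c in auto)
 then have "cnj (ip (inner_tensor X Y) (tproj G v) u) = (\<Sum>g\<in>G. cnj (ip (inner_tensor X Y) (temb g (tcomp g v)) u))" by (simp add: finsum_cscalars[OF fin])
 then show ?thesis using inner_tensor_linear(3)[OF clinear_onD(1)[OF clinear_tproj[OF G] v] u u]
   inner_tensor_linear(3)[OF c u u] ip_temb_right[OF u _ tcomp_closed[OF _ v]] GD by simp
qed

text \<open>Positivity and definiteness become visible in a \<open>G\<close> adapted to
  \<open>u\<close>, where <u, u> is the sum of the squared norms of the components.\<close>

lemma inner_space_inner_tensor: "inner_space (inner_tensor X Y)" proof (intro inner_space.intro inner_space_axioms.intro)
 show "cvec (inner_tensor X Y)" by (rule cvec_transfer[OF A.cvec_axioms]) simp_all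
 fix u assume "u \<in> carrier (inner_tensor X Y)"
 then have u: "u \<in> carrier AT" by simp
 obtain G where G: "Y.onf G (%g. g)" "tproj G u = u" using finite_tproj[of "{u}"] u by auto
 note GD = Y.onfD[OF G(1)]
 have e: "ip (inner_tensor X Y) u u = complex_of_real (\<Sum>g\<in>G. (X.N (tcomp g u))\<^sup>2)"
  using ip_tproj[OF G(1) u u] G(2) GD u by (simp add: X.inner_self tcomp_closed del: of_real_power)
 then show "0 <= Re (ip (inner_tensor X Y) u u)" by (simp add: sum_nonneg)
 assume "ip (inner_tensor X Y) u u = 0"
 then have "(\<Sum>g\<in>G. (X.N (tcomp g u))\<^sup>2) = 0" unfolding e of_real_eq_0_iff .
 then have z: "tcomp g u = \<zero>\<^bsub>X\<^esub>" if "g \<in> G" for g using that GD u by (simp add: sum_nonneg_eq_0_iff X.N_eq_0_iff tcomp_closed)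
 have "tproj G u = \<zero>\<^bsub>AT\<^esub>" unfolding tproj_def
  by (rule A.M.add.finprod_one_eqI) (use z GD clinear_on_zero[OF X.cvec_axioms A.cvec_axioms temb_linear(1)] in auto)
 then show "u = \<zero>\<^bsub>inner_tensor X Y\<^esub>" using G by simp
qed (auto intro: inner_tensor_linear(1) inner_tensor_linear(2) inner_tensor_linear(3))

sublocale I: inner_space "inner_tensor X Y" by (rule inner_space_inner_tensor)

lemma N_temb: "h \<in> carrier Y ==> x \<in> carrier X ==> I.N (temb h x) = Y.N h * X.N x" proof -
 assume h: "h \<in> carrier Y" and x: "x \<in> carrier X"
 have "ip (inner_tensor X Y) (temb h x) (temb h x) = complex_of_real ((Y.N h * X.N x)\<^sup>2)" using ip_temb_right[OF temb_closed[OF h x] h x] h x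
  by (simp add: tcomp_temb X.inner_smult_left X.inner_self Y.inner_self power_mult_distrib)
 then have "(I.N (temb h x))\<^sup>2 = (Y.N h * X.N x)\<^sup>2" using temb_closed[OF h x] by (simp add: I.N_sq del: of_real_power)
 then show ?thesis using h x temb_closed[OF h x] by (simp add: power2_eq_iff_nonneg)
qed

lemma N_tcomp_le:
 assumes h: "h \<in> carrier Y" and u: "u \<in> carrier AT" shows "X.N (tcomp h u) <= Y.N h * I.N u" proof -
 note c = tcomp_closed[OF h u]
 have "X.N (tcomp h u) * X.N (tcomp h u) = cmod (ip (inner_tensor X Y) u (temb h (tcomp h u)))"
  unfolding ip_temb_right[OF u h c] using X.inner_self[OF c] by (simp add: power2_eq_square norm_mult c)
 also have "... <= I.N u * (Y.N h * X.N (tcomp h u))" using I.Cauchy_Schwarz[of u "temb h (tcomp h u)"] u temb_closed[OF h c] by (simp add: N_temb[OF h c])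
 finally have "X.N (tcomp h u) * X.N (tcomp h u) <= (Y.N h * I.N u) * X.N (tcomp h u)" by (simp only: mult_ac)
 then show ?thesis using h u X.N_nonneg[OF c] by (cases "X.N (tcomp h u) = 0") (simp_all add: mult_le_cancel_right)
qed

lemma tcomp_sum_temb:
 assumes G: "Y.onf G (%g. g)" and m: "m \<in> G \<rightarrow> carrier X" and h: "h \<in> G" shows "tcomp h (\<Oplus>\<^bsub>AT\<^esub>g\<in>G. temb g (m g)) = m h"
proof -
 note GD = Y.onfD[OF G]
 have mc: "m g \<in> carrier X" if "g \<in> G" for g using m that by auto
 have hc: "h \<in> carrier Y" by (rule GD(3)[OF h])
 have "tcomp h (\<Oplus>\<^bsub>AT\<^esub>g\<in>G. temb g (m g)) = (\<Oplus>\<^bsub>X\<^esub>g\<in>G. tcomp h (temb g (m g)))"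
  by (rule clinear_on_finsum[OF A.cvec_axioms X.cvec_axioms clinear_tcomp[OF hc] GD(1)]) (auto simp: temb_closed GD mc)
 also have "... = (\<Oplus>\<^bsub>X\<^esub>g\<in>G. if h = g then m g else \<zero>\<^bsub>X\<^esub>)"
  by (rule X.M.finsum_cong') (use GD(4)[OF _ h] in \<open>auto simp: tcomp_temb hc GD(3) mc\<close>)
 also have "... = m h" by (rule X.M.add.finprod_singleton[OF h GD(1)]) (use m in auto)
 finally show ?thesis .
qed

lemma N_sum_temb:
 assumes G: "Y.onf G (%g. g)" and m: "m \<in> G \<rightarrow> carrier X"
 shows "(I.N (\<Oplus>\<^bsub>AT\<^esub>g\<in>G. temb g (m g)))\<^sup>2 = (\<Sum>g\<in>G. (X.N (m g))\<^sup>2)" proof -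
 note GD = Y.onfD[OF G]
 let ?u = "\<Oplus>\<^bsub>AT\<^esub>g\<in>G. temb g (m g)"
 have mc: "m g \<in> carrier X" if "g \<in> G" for g using m that by auto
 have uc: "?u \<in> carrier AT" by (rule A.M.finsum_closed) (auto simp: temb_closed GD mc)
 have "tproj G ?u = ?u" unfolding tproj_def by (rule A.M.finsum_cong') (auto simp: tcomp_sum_temb[OF G m] temb_closed GD mc)
 then have "ip (inner_tensor X Y) ?u ?u = (\<Sum>g\<in>G. ip X (m g) (m g))" using ip_tproj[OF G uc uc] by (simp add: tcomp_sum_temb[OF G m])
 then show ?thesis using uc by (simp add: I.N_sq X.N_sq mc)
qed

text \<open>Bessel's inequality for components, from Cauchy-Schwarz for \<open>u\<close> and
  \<open>tproj G u\<close>, whose inner product is the squared norm of the latter.\<close>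

lemma sum_N_tcomp_le:
 assumes G: "Y.onf G (%g. g)" and u: "u \<in> carrier AT" shows "(\<Sum>g\<in>G. (X.N (tcomp g u))\<^sup>2) <= (I.N u)\<^sup>2" proof -
 note GD = Y.onfD[OF G]
 let ?s = "\<Sum>g\<in>G. (X.N (tcomp g u))\<^sup>2"
 have s0: "0 <= ?s" by (simp add: sum_nonneg)
 have pc: "tproj G u \<in> carrier AT" by (rule clinear_onD(1)[OF clinear_tproj[OF G] u])
 have ps: "(I.N (tproj G u))\<^sup>2 = ?s" unfolding tproj_def by (rule N_sum_temb[OF G]) (use tcomp_closed[OF _ u] GD in auto)
 have "ip (inner_tensor X Y) u (tproj G u) = complex_of_real ?s" unfolding ip_tproj[OF G u u] using GD u by (simp add: X.inner_self tcomp_closed)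
 then have "?s <= I.N u * I.N (tproj G u)" using I.Cauchy_Schwarz[of u "tproj G u"] u pc s0 by (simp only: norm_of_real inner_tensor_sel) simp
 then have "I.N (tproj G u) * I.N (tproj G u) <= I.N u * I.N (tproj G u)" using ps by (simp add: power2_eq_square)
 moreover have "0 <= I.N u" "0 <= I.N (tproj G u)" using u pc by simp_all
 ultimately have "I.N (tproj G u) <= I.N u" using mult_right_le_imp_le[of "I.N (tproj G u)" "I.N (tproj G u)" "I.N u"] by linarith
 then show ?thesis unfolding ps[symmetric] using pc by (intro power_mono) auto
qed

lemma tcomp_tensor_map:
 assumes a: "clinear_on X X a" and h: "h \<in> carrier Y" and u: "u \<in> carrier AT" shows "tcomp h (tensor_map X Y a (%y. y) u) = a (tcomp h u)" using u
proof (rule alg_tensor_cases)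
 fix p assume p: "pkeys p <= S" "u = tcls X Y p"
 note cl = X.cvec_axioms Y.cvec_axioms X.cvec_axioms Y.cvec_axioms a clinear_on_id
 note b = tcomp_bilinear[OF h]
 note mp = map_prod_closed[OF a clinear_on_id[of Y]]
 have "tcomp h (tensor_map X Y a (%y. y) u) = flift X (%k. ip Y (snd k) h \<odot>\<^bsub>X\<^esub> fst k) (fmap (map_prod a (%y. y)) p)"
  unfolding p(2) tensor_map_tcls[OF cl p(1)] tcomp_def by (rule tlift_tcls[OF X.cvec_axioms b fmap_keys[OF mp p(1)]])
 also have "... = flift X (%k. ip Y (snd (map_prod a (%y. y) k)) h \<odot>\<^bsub>X\<^esub> fst (map_prod a (%y. y) k)) p"
  by (rule flift_fmap[OF X.cvec_axioms mp bilinear_on_closed[OF b] p(1)])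
 also have "... = flift X (%k. a (ip Y (snd k) h \<odot>\<^bsub>X\<^esub> fst k)) p" by (rule flift_cong[OF _ _ X.cvec_axioms]) (use p(1) clinear_onD[OF a] in auto)
 also have "... = a (flift X (%k. ip Y (snd k) h \<odot>\<^bsub>X\<^esub> fst k) p)"
  by (rule flift_comp[OF X.cvec_axioms X.cvec_axioms a bilinear_on_closed[OF b] p(1), symmetric])
 also have "flift X (%k. ip Y (snd k) h \<odot>\<^bsub>X\<^esub> fst k) p = tcomp h u" unfolding p(2) tcomp_def by (rule tlift_tcls[OF X.cvec_axioms b p(1), symmetric])
 finally show ?thesis .
qed

text \<open>The operator acts on each component separately. \<open>G\<close> is adapted to the
  image, for which the equation of norms is needed; for \<open>u\<close> itself Bessel's inequality
  suffices.\<close>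

lemma bounded_tensor_map:
 assumes a: "a \<in> bounded_ops X" shows "bounded_map (normed_of (inner_tensor X Y)) (normed_of (inner_tensor X Y)) (tensor_map X Y a (%y. y)) (op_norm X a)"
 unfolding bounded_map_def proof (intro conjI ballI)
 note al = X.bounded_opsD(1)[OF a]
 have cl: "clinear_on AT AT (tensor_map X Y a (%y. y))" by (rule clinear_tensor_map[OF X.cvec_axioms Y.cvec_axioms X.cvec_axioms Y.cvec_axioms al clinear_on_id])
 then show "clinear_on (normed_of (inner_tensor X Y)) (normed_of (inner_tensor X Y)) (tensor_map X Y a (%y. y))" by (simp add: clinear_on_def)
 show "0 <= op_norm X a" by (rule X.op_norm_nonneg[OF a])
 fix u assume "u \<in> carrier (normed_of (inner_tensor X Y))"
 then have u: "u \<in> carrier AT" by simp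
 let ?v = "tensor_map X Y a (%y. y) u"
 have v: "?v \<in> carrier AT" by (rule clinear_onD(1)[OF cl u])
 obtain G where G: "Y.onf G (%g. g)" "tproj G ?v = ?v" using finite_tproj[of "{?v}"] v by auto
 note GD = Y.onfD[OF G(1)]
 have tc: "tcomp g u \<in> carrier X" if "g \<in> G" for g using tcomp_closed[OF GD(3)[OF that] u] .
 have "ip (inner_tensor X Y) ?v ?v = (\<Sum>g\<in>G. ip X (a (tcomp g u)) (a (tcomp g u)))" using ip_tproj[OF G(1) v v] GD by (simp add: G(2) tcomp_tensor_map[OF al _ u])
 then have "(I.N ?v)\<^sup>2 = (\<Sum>g\<in>G. (X.N (a (tcomp g u)))\<^sup>2)" using v X.bounded_opsD(3)[OF a tc] by (simp add: I.N_sq X.N_sq)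
 also have "... <= (\<Sum>g\<in>G. (op_norm X a)\<^sup>2 * (X.N (tcomp g u))\<^sup>2)" using X.op_norm_bound[OF a tc] X.bounded_opsD(3)[OF a tc]
  by (intro sum_mono) (auto simp flip: power_mult_distrib intro!: power_mono)
 also have "... <= (op_norm X a * I.N u)\<^sup>2" unfolding sum_distrib_left[symmetric] power_mult_distrib by (intro mult_left_mono sum_N_tcomp_le[OF G(1) u]) simp
 finally show "I.N ?v <= op_norm X a * I.N u" by (rule power2_le_imp_le) (intro mult_nonneg_nonneg X.op_norm_nonneg[OF a] I.N_nonneg, simp add: u)
qed

end

text \<open>\<open>finsum\<close> depends on the carrier of the record, so shrinking the carrier, as
  in \<open>alg_hilbert_tensor\<close>, has to be justified.\<close>

lemma finsum_subspace:
 assumes V: "cvec V" and C: "cvec.subsp V C" and A: "finite A" "f \<in> A \<rightarrow> C" shows "finsum (V\<lparr>carrier := C\<rparr>) f A = finsum V f A" proof -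
 interpret V: cvec V by fact
 note CD = V.subspD[OF C]
 have "cvec (V\<lparr>carrier := C\<rparr>)" by (rule cvecI) (simp_all add: CD V.smult_add_left V.smult_add_right V.smult_smult V.M.a_ac)
 moreover have "clinear_on (V\<lparr>carrier := C\<rparr>) V (%x. x)" by (rule clinear_onI) (simp_all add: CD)
 ultimately show ?thesis using clinear_on_finsum[OF _ V _ A(1), of "V\<lparr>carrier := C\<rparr>" "%x. x" f] A(2) by simp
qed

text \<open>The elements of \<open>M \<otimes> H\<close> have a component \<open>comp h x\<close> in \<open>M\<close> for every \<open>h\<close> in \<open>H\<close>, and \<open>emb h m\<close> stands
 for \<open>m \<otimes> h\<close>.\<close>

locale columns = M: hilbert_space M + H: inner_space H + X: complex_normed_space X
 for M :: "'m cinner_space" and H :: "'h cinner_space" and X :: "'x cnormed_space" +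
 fixes comp :: "'h => 'x => 'm" and emb :: "'h => 'm => 'x" and act :: "('m => 'm) => 'x => 'x"
 assumes comp_bounded: "h \<in> carrier H ==> bounded_map X (normed_of M) (comp h) (H.N h)"
  and emb_bounded: "h \<in> carrier H ==> bounded_map (normed_of M) X (emb h) (H.N h)"
  and comp_emb: "g \<in> carrier H ==> h \<in> carrier H ==> m \<in> carrier M ==> comp h (emb g m) = ip H g h \<odot>\<^bsub>M\<^esub> m"
  and clinear_act: "a \<in> bounded_ops M ==> clinear_on X X (act a)"
  and comp_act: "a \<in> bounded_ops M ==> h \<in> carrier H ==> x \<in> carrier X ==> comp h (act a x) = a (comp h x)"
  and nrm_sum_emb: "H.onf F (%h. h) ==> f \<in> F \<rightarrow> carrier M ==>
   (nrm X (\<Oplus>\<^bsub>X\<^esub>h\<in>F. emb h (f h)))\<^sup>2 = (\<Sum>h\<in>F. (M.N (f h))\<^sup>2)"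
  and sum_comp_le: "H.onf F (%h. h) ==> x \<in> carrier X ==> (\<Sum>h\<in>F. (M.N (comp h x))\<^sup>2) <= (nrm X x)\<^sup>2"
  and dense: "finite U ==> U <= carrier X ==> e > 0 ==>
   \<exists>F. H.onf F (%h. h) & (\<forall>x\<in>U. nrm X (x \<ominus>\<^bsub>X\<^esub> (\<Oplus>\<^bsub>X\<^esub>h\<in>F. emb h (comp h x))) < e)"

section \<open>Completed and algebraic Hilbert tensor products as columns\<close>

locale hilbert_pair = X: hilbert_space X + inner_pair X Y
 for X :: "'x cinner_space" and Y :: "'y cinner_space"
begin

abbreviation "T == normed_of (inner_tensor X Y)"

sublocale T: complex_normed_space T by (rule I.normed)

sublocale C: complex_normed_space "completion T" by (rule T.completion_normed)

lemma bounded_tcomp: "h \<in> carrier Y ==> bounded_map T (normed_of X) (tcomp h) (Y.N h)"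
 using clinear_tcomp[of h] N_tcomp_le[of h] by (auto simp: bounded_map_def clinear_on_def)

lemma bounded_temb: "h \<in> carrier Y ==> bounded_map (normed_of X) T (temb h) (Y.N h)"
 using temb_linear(1)[of h] N_temb[of h] by (auto simp: bounded_map_def clinear_on_def)

definition hcomp :: "'y => (nat => ('x \<times> 'y \<Rightarrow>\<^sub>0 complex) set) set => 'x" where
 "hcomp h = T.completion_ext (normed_of X) (tcomp h)"

definition hemb :: "'y => 'x => (nat => ('x \<times> 'y \<Rightarrow>\<^sub>0 complex) set) set" where
 "hemb h m = completion_embed T (temb h m)"

lemma bounded_hcomp: "h \<in> carrier Y ==> bounded_map (completion T) (normed_of X) (hcomp h) (Y.N h)"
 unfolding hcomp_def by (rule T.completion_ext_props(1)[OF X.normed X.complete bounded_tcomp])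

lemma hcomp_embed: "h \<in> carrier Y ==> u \<in> carrier AT ==> hcomp h (completion_embed T u) = tcomp h u"
 unfolding hcomp_def by (rule T.completion_ext_props(2)[OF X.normed X.complete bounded_tcomp]) simp_all

lemma bounded_completion_embed: "bounded_map T (completion T) (completion_embed T) 1" using T.clinear_completion_embed T.nrm_completion_embed by (simp add: bounded_map_def)

lemma bounded_hemb: "h \<in> carrier Y ==> bounded_map (normed_of X) (completion T) (hemb h) (Y.N h)" unfolding hemb_def[abs_def]
 using bounded_map_comp[OF bounded_temb bounded_completion_embed] by simp

lemma sum_hemb: "Y.onf F (%h. h) ==> m \<in> F \<rightarrow> carrier X ==>
  (\<Oplus>\<^bsub>completion T\<^esub>h\<in>F. hemb h (m h)) = completion_embed T (\<Oplus>\<^bsub>AT\<^esub>h\<in>F. temb h (m h))" proof -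
 assume F: "Y.onf F (%h. h)" and m: "m \<in> F \<rightarrow> carrier X"
 note FD = Y.onfD[OF F]
 have "finsum T f F = finsum AT f F" for f by (simp add: finsum_def finprod_def)
 then show ?thesis unfolding hemb_def using clinear_on_finsum[OF T.cvec_axioms C.cvec_axioms T.clinear_completion_embed FD(1), of "%h. temb h (m h)"] m FD
  by (auto simp: temb_closed Pi_iff)
qed

definition hproj :: "'y set => (nat => ('x \<times> 'y \<Rightarrow>\<^sub>0 complex) set) set => (nat => ('x \<times> 'y \<Rightarrow>\<^sub>0 complex) set) set" where
 "hproj F A = (\<Oplus>\<^bsub>completion T\<^esub>h\<in>F. hemb h (hcomp h A))"

lemma nrm_sum_hemb:
 assumes F: "Y.onf F (%h. h)" and m: "m \<in> F \<rightarrow> carrier X"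
 shows "(nrm (completion T) (\<Oplus>\<^bsub>completion T\<^esub>h\<in>F. hemb h (m h)))\<^sup>2 = (\<Sum>h\<in>F. (X.N (m h))\<^sup>2)" proof -
 have "(\<Oplus>\<^bsub>AT\<^esub>h\<in>F. temb h (m h)) \<in> carrier T" using m Y.onfD[OF F] by (auto intro!: A.M.finsum_closed temb_closed)
 then show ?thesis unfolding sum_hemb[OF F m] by (simp only: T.nrm_completion_embed N_sum_temb[OF F m])
qed

text \<open>Known for algebraic tensors by \<open>sum_N_tcomp_le\<close>; a representing Cauchy
  sequence carries it to the limit.\<close>

lemma sum_hcomp_le:
 assumes F: "Y.onf F (%h. h)" and A: "A \<in> carrier (completion T)" shows "(\<Sum>h\<in>F. (X.N (hcomp h A))\<^sup>2) <= (nrm (completion T) A)\<^sup>2" using A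
proof (rule T.completion_cases)
 fix s assume s: "s \<in> cauchy_seqs T" "A = T.ccls s"
 note FD = Y.onfD[OF F]
 note sc = T.cauchy_seqsD(1)[OF s(1)]
 let ?d = "%n. nrm (completion T) (A \<ominus>\<^bsub>completion T\<^esub> completion_embed T (s n))"
 have d0: "?d \<longlonglongrightarrow> 0" using T.completion_approx[OF s(1)] s(2) by simp
 have ec: "completion_embed T (s n) \<in> carrier (completion T)" for n by (rule T.completion_embed_closed[OF sc])
 have lim: "(%n. X.N (tcomp h (s n))) \<longlonglongrightarrow> X.N (hcomp h A)" if h: "h \<in> F" for h proof -
  note hc = FD(3)[OF h]
  note b = bounded_hcomp[OF hc]
  interpret NX: complex_normed_space "normed_of X" by (rule X.normed)
  have "(%n. X.N (tcomp h (s n)) - X.N (hcomp h A)) \<longlonglongrightarrow> 0" proof (rule tendsto_0_le[OF d0, of _ "Y.N h"], rule always_eventually, rule allI)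
   fix n
   have "\<bar>X.N (hcomp h A) - X.N (hcomp h (completion_embed T (s n)))\<bar> <= X.N (hcomp h A \<ominus>\<^bsub>normed_of X\<^esub> hcomp h (completion_embed T (s n)))"
    by (rule NX.nrm_diff_abs) (use bounded_mapD(4)[OF b] A ec in auto)
   also have "... = X.N (hcomp h (A \<ominus>\<^bsub>completion T\<^esub> completion_embed T (s n)))"
    using clinear_on_minus[OF C.cvec_axioms NX.cvec_axioms bounded_mapD(1)[OF b] A ec] by simp
   also have "... <= Y.N h * ?d n" by (rule bounded_mapD(3)[OF b]) (use A ec in simp)
   finally have "\<bar>X.N (hcomp h A) - X.N (tcomp h (s n))\<bar> <= Y.N h * ?d n" using hcomp_embed[OF hc, of "s n"] sc[of n] by simp
   then show "norm (X.N (tcomp h (s n)) - X.N (hcomp h A)) <= norm (?d n) * Y.N h" using A ec[of n] by (simp add: mult.commute abs_minus_commute)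
  qed
  then show ?thesis by (simp add: LIM_zero_iff)
 qed
 have "(%n. \<Sum>h\<in>F. (X.N (tcomp h (s n)))\<^sup>2) \<longlonglongrightarrow> (\<Sum>h\<in>F. (X.N (hcomp h A))\<^sup>2)" by (intro tendsto_sum tendsto_power lim)
 moreover have "(%n. (nrm T (s n))\<^sup>2) \<longlonglongrightarrow> (nrm (completion T) A)\<^sup>2"
  unfolding s(2) T.nrm_ccls[OF s(1)] by (intro tendsto_power T.cauchy_nrm_tendsto[OF s(1)])
 ultimately show ?thesis by (rule LIMSEQ_le) (use sum_N_tcomp_le[OF F] sc in auto)
qed

lemma hproj_contr:
 assumes F: "Y.onf F (%h. h)" and A: "A \<in> carrier (completion T)"
 shows "hproj F A \<in> carrier (completion T)" "nrm (completion T) (hproj F A) <= nrm (completion T) A" proof -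
 note FD = Y.onfD[OF F]
 have m: "(%h. hcomp h A) \<in> F \<rightarrow> carrier X" using bounded_mapD(4)[OF bounded_hcomp[OF FD(3)] A] by auto
 show c: "hproj F A \<in> carrier (completion T)" unfolding hproj_def using m bounded_mapD(4)[OF bounded_hemb[OF FD(3)]] by (intro C.M.finsum_closed) auto
 show "nrm (completion T) (hproj F A) <= nrm (completion T) A"
  by (rule power2_le_imp_le) (use nrm_sum_hemb[OF F m] sum_hcomp_le[OF F A] A in \<open>auto simp: hproj_def\<close>)
qed

lemma hproj_minus:
 assumes F: "Y.onf F (%h. h)" and A: "A \<in> carrier (completion T)" and B: "B \<in> carrier (completion T)"
 shows "hproj F (A \<ominus>\<^bsub>completion T\<^esub> B) = hproj F A \<ominus>\<^bsub>completion T\<^esub> hproj F B" proof -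
 note FD = Y.onfD[OF F]
 have c: "hemb h (hcomp h D) \<in> carrier (completion T)" if "h \<in> F" "D \<in> carrier (completion T)" for h D
  using bounded_mapD(4)[OF bounded_hemb[OF FD(3)[OF that(1)]]] bounded_mapD(4)[OF bounded_hcomp[OF FD(3)[OF that(1)]] that(2)] by simp
 have l: "clinear_on (completion T) (completion T) (%D. hemb h (hcomp h D))" if "h \<in> F" for h
  using bounded_mapD(1)[OF bounded_map_comp[OF bounded_hcomp[OF FD(3)[OF that]] bounded_hemb[OF FD(3)[OF that]]]] .
 have "hproj F (A \<oplus>\<^bsub>completion T\<^esub> (-1) \<odot>\<^bsub>completion T\<^esub> B)
   = (\<Oplus>\<^bsub>completion T\<^esub>h\<in>F. hemb h (hcomp h A) \<oplus>\<^bsub>completion T\<^esub> (-1) \<odot>\<^bsub>completion T\<^esub> hemb h (hcomp h B))"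
  unfolding hproj_def by (rule C.M.finsum_cong') (simp_all add: c A B clinear_onD(2)[OF l] clinear_onD(3)[OF l])
 also have "... = hproj F A \<oplus>\<^bsub>completion T\<^esub> (\<Oplus>\<^bsub>completion T\<^esub>h\<in>F. (-1) \<odot>\<^bsub>completion T\<^esub> hemb h (hcomp h B))"
  unfolding hproj_def by (rule C.M.finsum_addf) (use c A B in auto)
 also have "(\<Oplus>\<^bsub>completion T\<^esub>h\<in>F. (-1) \<odot>\<^bsub>completion T\<^esub> hemb h (hcomp h B)) = (-1) \<odot>\<^bsub>completion T\<^esub> hproj F B"
  unfolding hproj_def by (rule C.finsum_smult) (use c B FD in auto)
 finally show ?thesis using A B hproj_contr(1)[OF F] by (simp add: C.vminus_eq)
qed

text \<open>Algebraic approximants are fixed by \<open>hproj F\<close> for a suitable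
  \<open>F\<close>. Since \<open>hproj F\<close> is contractive, the distance of \<open>A\<close> to
  its projection is at most twice its distance to the approximant.\<close>

lemma hproj_dense:
 assumes U: "finite U" "U <= carrier (completion T)" and e: "e > 0"
 obtains F where "Y.onf F (%h. h)" "!!A. A \<in> U ==> nrm (completion T) (A \<ominus>\<^bsub>completion T\<^esub> hproj F A) < e" proof -
 have "\<exists>u. u \<in> carrier AT & nrm (completion T) (A \<ominus>\<^bsub>completion T\<^esub> completion_embed T u) < e / 2"
  if A: "A \<in> U" for A using T.completion_dense[OF subsetD[OF U(2) A] half_gt_zero[OF e]] by auto
 then obtain u where u: "!!A. A \<in> U ==> u A \<in> carrier AT"
  "!!A. A \<in> U ==> nrm (completion T) (A \<ominus>\<^bsub>completion T\<^esub> completion_embed T (u A)) < e / 2" by metis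
 obtain F where F: "Y.onf F (%h. h)" "!!v. v \<in> u ` U ==> tproj F v = v" using finite_tproj[of "u ` U"] U(1) u(1) by blast
 note FD = Y.onfD[OF F(1)]
 have "nrm (completion T) (A \<ominus>\<^bsub>completion T\<^esub> hproj F A) < e" if A: "A \<in> U" for A proof -
  let ?v = "completion_embed T (u A)"
  have Ac: "A \<in> carrier (completion T)" and vc: "?v \<in> carrier (completion T)" using A U u(1)[OF A] T.completion_embed_closed by auto
  have tc: "tcomp h (u A) \<in> carrier X" if "h \<in> F" for h by (rule tcomp_closed[OF FD(3)[OF that] u(1)[OF A]])
  have "hproj F ?v = (\<Oplus>\<^bsub>completion T\<^esub>h\<in>F. hemb h (tcomp h (u A)))" unfolding hproj_def proof (rule C.M.finsum_cong')
   show "(%h. hemb h (tcomp h (u A))) \<in> F \<rightarrow> carrier (completion T)" using bounded_mapD(4)[OF bounded_hemb[OF FD(3)]] tc by auto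
  qed (simp_all add: hcomp_embed FD u(1)[OF A])
  also have "... = completion_embed T (tproj F (u A))" unfolding tproj_def by (rule sum_hemb[OF F(1)]) (use tc in auto)
  finally have "hproj F ?v = completion_embed T (tproj F (u A))" .
  then have v: "hproj F ?v = ?v" using F(2)[of "u A"] A by simp
  have "A \<ominus>\<^bsub>completion T\<^esub> hproj F A = (A \<ominus>\<^bsub>completion T\<^esub> ?v) \<oplus>\<^bsub>completion T\<^esub> (?v \<ominus>\<^bsub>completion T\<^esub> hproj F A)"
   using Ac vc hproj_contr(1)[OF F(1) Ac] by (simp add: C.minus_minus_trans)
  also have "?v \<ominus>\<^bsub>completion T\<^esub> hproj F A = hproj F (?v \<ominus>\<^bsub>completion T\<^esub> A)" using hproj_minus[OF F(1) vc Ac] v by simp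
  finally have "nrm (completion T) (A \<ominus>\<^bsub>completion T\<^esub> hproj F A)
    <= nrm (completion T) (A \<ominus>\<^bsub>completion T\<^esub> ?v) + nrm (completion T) (hproj F (?v \<ominus>\<^bsub>completion T\<^esub> A))"
   using Ac vc hproj_contr(1)[OF F(1), of "?v \<ominus>\<^bsub>completion T\<^esub> A"] by (simp add: C.nrm_triangle)
  also have "nrm (completion T) (hproj F (?v \<ominus>\<^bsub>completion T\<^esub> A)) <= nrm (completion T) (?v \<ominus>\<^bsub>completion T\<^esub> A)"
   using Ac vc by (intro hproj_contr(2)[OF F(1)]) simp
  finally show ?thesis using u(2)[OF A] C.nrm_minus_commute[OF Ac vc] by simp
 qed
 with F(1) show ?thesis by (rule that)
qed

lemma columns_hilbert_tensor: "columns X Y (hilbert_tensor X Y) hcomp hemb (ampliation X Y)" unfolding hilbert_tensor_def proof (intro columns.intro columns_axioms.intro)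
 show "hilbert_space X" "inner_space Y" "complex_normed_space (completion T)" by unfold_locales
next
 fix g h m assume "g \<in> carrier Y" "h \<in> carrier Y" "m \<in> carrier X"
 then show "hcomp h (hemb g m) = ip Y g h \<odot>\<^bsub>X\<^esub> m" unfolding hemb_def by (simp add: hcomp_embed temb_closed tcomp_temb)
next
 fix a assume a: "a \<in> bounded_ops X"
 note m = T.bounded_completion_map[OF bounded_tensor_map[OF a]]
 show "clinear_on (completion T) (completion T) (ampliation X Y a)" unfolding ampliation_def by (rule bounded_mapD(1)[OF m(1)])
 fix h A assume h: "h \<in> carrier Y" and A: "A \<in> carrier (completion T)"
 have ba: "bounded_map (normed_of X) (normed_of X) a (op_norm X a)"
  using X.bounded_opsD(1)[OF a] X.op_norm_nonneg[OF a] X.op_norm_bound[OF a] by (simp add: bounded_map_def clinear_on_def)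
 \<comment> \<open>Both sides are bounded linear in \<open>A\<close>, so it suffices to compare them
   on the dense image of the algebraic tensors.\<close>
 show "hcomp h (ampliation X Y a A) = a (hcomp h A)" unfolding ampliation_def
 proof (rule bounded_map_eq_dense[OF C.complex_normed_space_axioms X.normed bounded_map_comp[OF m(1) bounded_hcomp[OF h]]
    bounded_map_comp[OF bounded_hcomp[OF h] ba] _ T.completion_dense _ A])
  show "completion_embed T ` carrier T <= carrier (completion T)" using T.completion_embed_closed by auto
  fix d assume "d \<in> completion_embed T ` carrier T"
  then obtain u where u: "u \<in> carrier AT" "d = completion_embed T u" by auto
  have tu: "tensor_map X Y a (%y. y) u \<in> carrier AT" using bounded_mapD(4)[OF bounded_tensor_map[OF a], of u] u by simp
  show "hcomp h (completion_map T (tensor_map X Y a (%y. y)) d) = a (hcomp h d)" using m(2)[of u] u(1) unfolding u(2)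
   by (simp add: hcomp_embed[OF h] tu tcomp_tensor_map[OF X.bounded_opsD(1)[OF a] h])
 qed
next
 fix U e assume U: "finite U" "U <= carrier (completion T)" and e: "(e::real) > 0"
 obtain F where "Y.onf F (%h. h)" "!!A. A \<in> U ==> nrm (completion T) (A \<ominus>\<^bsub>completion T\<^esub> hproj F A) < e"
  using hproj_dense[OF U e] by blast
 then show "\<exists>F. Y.onf F (%h. h) & (\<forall>x\<in>U. nrm (completion T) (x \<ominus>\<^bsub>completion T\<^esub> (\<Oplus>\<^bsub>completion T\<^esub>h\<in>F. hemb h (hcomp h x))) < e)"
  unfolding hproj_def by blast
qed (simp_all add: bounded_hcomp bounded_hemb nrm_sum_hemb sum_hcomp_le)

text \<open>All estimates are inherited from the completion. What remains is that embeddings, action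
  and projections stay within the algebraic part, and that sums, differences and norms are the same
  in both records.\<close>

lemma columns_alg_hilbert_tensor: "columns X Y (alg_hilbert_tensor X Y) hcomp hemb (ampliation X Y)" proof -
 interpret c: columns X Y "hilbert_tensor X Y" hcomp hemb "ampliation X Y" by (rule columns_hilbert_tensor)
 let ?D = "completion_embed T ` carrier AT"
 let ?X = "alg_hilbert_tensor X Y"
 have Xeq: "?X = (completion T)\<lparr>carrier := ?D\<rparr>" by (simp add: alg_hilbert_tensor_def hilbert_tensor_def)
 have D: "C.subsp ?D" unfolding C.subsp_def proof (intro conjI ballI allI)
  show "?D <= carrier (completion T)" using T.completion_embed_closed by auto
  show "\<zero>\<^bsub>completion T\<^esub> \<in> ?D"
   using clinear_on_zero[OF T.cvec_axioms C.cvec_axioms T.clinear_completion_embed] by (auto intro!: image_eqI[of _ _ "\<zero>\<^bsub>AT\<^esub>"])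
 next
  fix a b assume "a \<in> ?D" "b \<in> ?D"
  then obtain u v where uv: "u \<in> carrier T" "v \<in> carrier T" "a = completion_embed T u" "b = completion_embed T v" by auto
  then show "a \<oplus>\<^bsub>completion T\<^esub> b \<in> ?D" using clinear_onD(2)[OF T.clinear_completion_embed uv(1,2)] T.M.a_closed[OF uv(1,2)]
   by (intro image_eqI[of _ _ "u \<oplus>\<^bsub>T\<^esub> v"]) auto
 next
  fix c a assume "a \<in> ?D"
  then obtain u where u: "u \<in> carrier T" "a = completion_embed T u" by auto
  then show "c \<odot>\<^bsub>completion T\<^esub> a \<in> ?D" using clinear_onD(3)[OF T.clinear_completion_embed u(1), of c] T.smult_carrier[OF u(1), of c]
   by (intro image_eqI[of _ _ "c \<odot>\<^bsub>T\<^esub> u"]) auto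
 qed
 note DD = C.subspD[OF D]
 have cvX: "cvec ?X" unfolding Xeq by (rule cvecI) (simp_all add: DD C.smult_add_left C.smult_add_right C.smult_smult C.M.a_ac)
 interpret X': cvec ?X by (rule cvX)
 have nX: "complex_normed_space ?X" by (intro complex_normed_space.intro complex_normed_space_axioms.intro)
   (use cvX in \<open>simp_all add: cvec_def Xeq DD C.nrm_eq_0_iff C.nrm_triangle C.nrm_smult\<close>)
 have minus: "x \<ominus>\<^bsub>?X\<^esub> y = x \<ominus>\<^bsub>completion T\<^esub> y" if "x \<in> ?D" "y \<in> ?D" for x y proof -
  have "x \<in> carrier ?X" "y \<in> carrier ?X" using that by (simp_all add: Xeq)
  then show ?thesis using X'.vminus_eq[of x y] C.vminus_eq[OF DD(3)[OF that(1)] DD(3)[OF that(2)]] by (simp add: Xeq)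
 qed
 have hembD: "hemb h m \<in> ?D" if "h \<in> carrier Y" "m \<in> carrier X" for h m using that temb_closed unfolding hemb_def by auto
 have hcomp_closed: "hcomp h x \<in> carrier X" if "h \<in> carrier Y" "x \<in> ?D" for h x using bounded_mapD(4)[OF bounded_hcomp[OF that(1)] DD(3)[OF that(2)]] by simp
 have fs: "finsum ?X f F = finsum (completion T) f F" if "finite F" "f \<in> F \<rightarrow> ?D" for f and F :: "'y set"
  unfolding Xeq by (rule finsum_subspace[OF C.cvec_axioms D that])
 have sub: "f \<in> bounded_ops X ==> x \<in> ?D ==> ampliation X Y f x \<in> ?D" for f x proof -
  assume f: "f \<in> bounded_ops X" and "x \<in> ?D"
  then obtain u where u: "u \<in> carrier T" "x = completion_embed T u" by auto
  show "ampliation X Y f x \<in> ?D" using T.bounded_completion_map(2)[OF bounded_tensor_map[OF f] u(1)] bounded_mapD(4)[OF bounded_tensor_map[OF f] u(1)]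
   unfolding ampliation_def u(2) by auto
 qed show ?thesis proof (intro columns.intro columns_axioms.intro nX)
  show "hilbert_space X" "inner_space Y" by unfold_locales
 next
  fix h assume h: "h \<in> carrier Y"
  show "bounded_map ?X (normed_of X) (hcomp h) (Y.N h)" using bounded_hcomp[OF h] DD unfolding bounded_map_def clinear_on_def Xeq by auto
  show "bounded_map (normed_of X) ?X (hemb h) (Y.N h)" using bounded_hemb[OF h] hembD[OF h] unfolding bounded_map_def clinear_on_def Xeq by auto
 next
  fix a assume a: "a \<in> bounded_ops X"
  show "clinear_on ?X ?X (ampliation X Y a)" using c.clinear_act[OF a] sub[OF a] DD unfolding clinear_on_def Xeq hilbert_tensor_def by auto
  show "hcomp h (ampliation X Y a x) = a (hcomp h x)" if "h \<in> carrier Y" "x \<in> carrier ?X" for h x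
   using c.comp_act[OF a that(1), of x] that(2) DD unfolding Xeq hilbert_tensor_def by auto
 next
  fix F assume F: "Y.onf F (%h. h)"
  note FD = Y.onfD[OF F]
  show "(nrm ?X (\<Oplus>\<^bsub>?X\<^esub>h\<in>F. hemb h (m h)))\<^sup>2 = (\<Sum>h\<in>F. (X.N (m h))\<^sup>2)" if m: "m \<in> F \<rightarrow> carrier X" for m
   using nrm_sum_hemb[OF F m] fs[OF FD(1), of "%h. hemb h (m h)"] hembD FD m by (simp add: Xeq Pi_iff)
  show "(\<Sum>h\<in>F. (X.N (hcomp h x))\<^sup>2) <= (nrm ?X x)\<^sup>2" if "x \<in> carrier ?X" for x using sum_hcomp_le[OF F, of x] that DD by (simp add: Xeq)
 next
  fix U e assume U: "finite U" "U <= carrier ?X" and e: "(e::real) > 0"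
  have U': "U <= carrier (completion T)" using U DD by (auto simp: Xeq)
  obtain F where F: "Y.onf F (%h. h)" "!!A. A \<in> U ==> nrm (completion T) (A \<ominus>\<^bsub>completion T\<^esub> hproj F A) < e"
   using hproj_dense[OF U(1) U' e] by blast
  note FD = Y.onfD[OF F(1)]
  have "nrm ?X (x \<ominus>\<^bsub>?X\<^esub> (\<Oplus>\<^bsub>?X\<^esub>h\<in>F. hemb h (hcomp h x))) < e" if x: "x \<in> U" for x proof -
   have xD: "x \<in> ?D" using x U by (auto simp: Xeq)
   have k: "(%h. hemb h (hcomp h x)) \<in> F \<rightarrow> ?D" using hembD hcomp_closed[OF _ xD] FD by auto
   have "hproj F x \<in> ?D" unfolding hproj_def by (rule C.subsp_finsum[OF FD(1) D k])
   then show ?thesis using F(2)[OF x] minus[OF xD, of "hproj F x"] fs[OF FD(1) k] by (simp add: Xeq hproj_def)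
  qed
  with F(1) show "\<exists>F. Y.onf F (%h. h) & (\<forall>x\<in>U. nrm ?X (x \<ominus>\<^bsub>?X\<^esub> (\<Oplus>\<^bsub>?X\<^esub>h\<in>F. hemb h (hcomp h x))) < e)" by blast
 qed (use c.comp_emb in auto)
qed

end

section \<open>Modules of columns\<close>

context inner_space
begin

lemma fro_eqI:
 assumes "finite I" "u \<in> I \<rightarrow> carrier V" and "!!z. z \<in> carrier V ==> b z \<in> carrier V"
  and "!!z y. z \<in> carrier V ==> y \<in> carrier V ==> (\<Sum>i\<in>I. ip V z (v i) * ip V (u i) y) = ip V (b z) y"
 shows "fro I u v = (\<lambda>z\<in>carrier V. b z)" proof (rule extensionalityI[where A="carrier V"])
 fix z assume z: "z \<in> carrier V"
 show "fro I u v z = (\<lambda>z\<in>carrier V. b z) z" by (rule inner_eqI) (use z assms in \<open>auto simp: fro_apply inner_ocomb_left\<close>)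
qed (auto simp: fro_def)

lemma fro_add_left:
 assumes "finite I" "u \<in> I \<rightarrow> carrier V" "u' \<in> I \<rightarrow> carrier V" "v \<in> I \<rightarrow> carrier V"
 shows "fro I (%i. u i \<oplus> u' i) v = (\<lambda>z\<in>carrier V. fro I u v z \<oplus> fro I u' v z)"
 by (rule fro_eqI) (use assms in \<open>auto simp: fro_apply inner_add_left inner_ocomb_left ocomb_closed Pi_iff
  algebra_simps sum.distrib\<close>)

lemma fro_add_right:
 assumes "finite I" "u \<in> I \<rightarrow> carrier V" "v \<in> I \<rightarrow> carrier V" "v' \<in> I \<rightarrow> carrier V"
 shows "fro I u (%i. v i \<oplus> v' i) = (\<lambda>z\<in>carrier V. fro I u v z \<oplus> fro I u v' z)"
 by (rule fro_eqI) (use assms in \<open>auto simp: fro_apply inner_add_left inner_add_right inner_ocomb_left ocomb_closed Pi_iff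
  algebra_simps sum.distrib\<close>)

lemma fro_smult_left:
 assumes "finite I" "u \<in> I \<rightarrow> carrier V" "v \<in> I \<rightarrow> carrier V"
 shows "fro I (%i. c \<odot> u i) v = (\<lambda>z\<in>carrier V. c \<odot> fro I u v z)"
 by (rule fro_eqI) (use assms in \<open>auto simp: fro_apply inner_smult_left inner_ocomb_left ocomb_closed Pi_iff
  sum_distrib_left mult_ac\<close>)

lemma fro_smult_right:
 assumes "finite I" "u \<in> I \<rightarrow> carrier V" "v \<in> I \<rightarrow> carrier V"
 shows "fro I u (%i. c \<odot> v i) = (\<lambda>z\<in>carrier V. cnj c \<odot> fro I u v z)"
 by (rule fro_eqI) (use assms in \<open>auto simp: fro_apply inner_smult_left inner_smult_right inner_ocomb_left ocomb_closed Pi_iff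
  sum_distrib_left mult_ac\<close>)

end

section \<open>Columns as a contractive module\<close>

context columns
begin

lemmas comp_linear = bounded_mapD(1)[OF comp_bounded]
 and emb_linear = bounded_mapD(1)[OF emb_bounded]

lemma comp_closed: "h \<in> carrier H ==> x \<in> carrier X ==> comp h x \<in> carrier M" using bounded_mapD(4)[OF comp_bounded] by simp

lemma emb_closed: "h \<in> carrier H ==> m \<in> carrier M ==> emb h m \<in> carrier X" using bounded_mapD(4)[OF emb_bounded] by simp

lemma comp_add: "h \<in> carrier H ==> x \<in> carrier X ==> y \<in> carrier X ==> comp h (x \<oplus>\<^bsub>X\<^esub> y) = comp h x \<oplus>\<^bsub>M\<^esub> comp h y"
 using clinear_onD(2)[OF comp_linear] by simp

lemma comp_smult: "h \<in> carrier H ==> x \<in> carrier X ==> comp h (c \<odot>\<^bsub>X\<^esub> x) = c \<odot>\<^bsub>M\<^esub> comp h x"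
 using clinear_onD(3)[OF comp_linear] by simp

lemma act_closed: "a \<in> bounded_ops M ==> x \<in> carrier X ==> act a x \<in> carrier X" by (rule clinear_onD(1)[OF clinear_act])

text \<open>The column with entries \<open>f h\<close>. Applied to the components of
  \<open>x\<close> it is the compression \<open>rproj F x\<close> to \<open>F\<close>.\<close>

definition vec :: "'h set => ('h => 'm) => 'x" where
 "vec F f = (\<Oplus>\<^bsub>X\<^esub>h\<in>F. emb h (f h))"

abbreviation "rproj F x == vec F (%h. comp h x)"

lemma vec_closed: "H.onf F (%h. h) ==> f \<in> F \<rightarrow> carrier M ==> vec F f \<in> carrier X"
 unfolding vec_def using H.onfD(3)[of F "%h. h"] by (intro X.M.finsum_closed) (auto simp: emb_closed Pi_iff)

lemma vec_cong: "H.onf F (%h. h) ==> f \<in> F \<rightarrow> carrier M ==> (!!h. h \<in> F ==> g h = f h) ==> vec F g = vec F f"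
 unfolding vec_def using H.onfD(3)[of F "%h. h"] by (intro X.M.finsum_cong') (auto simp: emb_closed Pi_iff)

lemma rproj_closed: "H.onf F (%h. h) ==> x \<in> carrier X ==> rproj F x \<in> carrier X"
 using H.onfD(3)[of F "%h. h"] by (intro vec_closed) (auto simp: comp_closed)

lemma nrm_vec: "H.onf F (%h. h) ==> f \<in> F \<rightarrow> carrier M ==> (nrm X (vec F f))\<^sup>2 = (\<Sum>h\<in>F. (M.N (f h))\<^sup>2)"
 unfolding vec_def by (rule nrm_sum_emb)

lemma nrm_rproj_sq: "H.onf F (%h. h) ==> x \<in> carrier X ==> (nrm X (rproj F x))\<^sup>2 = (\<Sum>h\<in>F. (M.N (comp h x))\<^sup>2)"
 using H.onfD(3)[of F "%h. h"] by (intro nrm_vec) (auto simp: comp_closed)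

lemma nrm_rproj_le: "H.onf F (%h. h) ==> x \<in> carrier X ==> nrm X (rproj F x) <= nrm X x"
 by (rule power2_le_imp_le) (simp_all add: nrm_rproj_sq sum_comp_le)

lemma comp_vec:
 assumes F: "H.onf F (%h. h)" and f: "f \<in> F \<rightarrow> carrier M" and h: "h \<in> F" shows "comp h (vec F f) = f h" proof -
 note FD = H.onfD[OF F]
 have hc: "h \<in> carrier H" by (rule FD(3)[OF h])
 have fc: "f g \<in> carrier M" if "g \<in> F" for g using f that by auto
 have "comp h (vec F f) = (\<Oplus>\<^bsub>normed_of M\<^esub>g\<in>F. comp h (emb g (f g)))" unfolding vec_def
  by (rule clinear_on_finsum[OF X.cvec_axioms cvec_normed_of[OF M.cvec_axioms] comp_linear[OF hc] FD(1)])
   (auto simp: emb_closed FD fc)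
 also have "... = (\<Oplus>\<^bsub>M\<^esub>g\<in>F. comp h (emb g (f g)))" by (simp add: finsum_def finprod_def)
 also have "... = (\<Oplus>\<^bsub>M\<^esub>g\<in>F. if h = g then f g else \<zero>\<^bsub>M\<^esub>)"
  by (rule M.M.finsum_cong') (use FD(4)[OF _ h] in \<open>auto simp: comp_emb hc FD(3) fc\<close>)
 also have "... = f h" by (rule M.M.add.finprod_singleton[OF h FD(1)]) (use f in auto)
 finally show ?thesis .
qed

lemma approx:
 assumes "finite U" "U <= carrier X" "e > 0"
 obtains F where "H.onf F (%h. h)" "!!x. x \<in> U ==> nrm X (x \<ominus>\<^bsub>X\<^esub> rproj F x) < e"
 using dense[OF assms] unfolding vec_def by blast

lemma separating:
 assumes x: "x \<in> carrier X" and z: "!!h. h \<in> carrier H ==> comp h x = \<zero>\<^bsub>M\<^esub>" shows "x = \<zero>\<^bsub>X\<^esub>" proof -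
 have "nrm X x <= 0 + e" if e: "e > 0" for e proof -
  obtain F where F: "H.onf F (%h. h)" "nrm X (x \<ominus>\<^bsub>X\<^esub> rproj F x) < e" using approx[of "{x}" e] x e by auto
  have "(nrm X (rproj F x))\<^sup>2 = 0" using nrm_rproj_sq[OF F(1) x] z H.onfD(3)[OF F(1)] M.N_eq_0_iff[of "\<zero>\<^bsub>M\<^esub>"] by simp
  then show ?thesis using X.nrm_le_add_minus[OF x rproj_closed[OF F(1) x]] F(2) by simp
 qed
 then have "nrm X x <= 0" by (rule field_le_epsilon)
 then have "nrm X x = 0" by (rule antisym) (simp add: x)
 then show ?thesis using X.nrm_eq_0_iff[OF x] by simp
qed

text \<open>Components separate points because compressions approximate. This reduces the module
  axioms to identities between operators on \<open>M\<close>.\<close>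

lemma comp_eqI:
 assumes x: "x \<in> carrier X" "y \<in> carrier X" and e: "!!h. h \<in> carrier H ==> comp h x = comp h y" shows "x = y" proof -
 have "x \<ominus>\<^bsub>X\<^esub> y = \<zero>\<^bsub>X\<^esub>" proof (rule separating)
  fix h assume h: "h \<in> carrier H"
  show "comp h (x \<ominus>\<^bsub>X\<^esub> y) = \<zero>\<^bsub>M\<^esub>"
   using clinear_on_minus[OF X.cvec_axioms cvec_normed_of[OF M.cvec_axioms] comp_linear[OF h] x] e[OF h] comp_closed[OF h x(2)] by simp
 qed (use x in simp)
 then show ?thesis using X.minus_eq_zero_iff x by simp
qed

lemma act_emb:
 assumes a: "a \<in> bounded_ops M" and h: "h \<in> carrier H" and m: "m \<in> carrier M" shows "act a (emb h m) = emb h (a m)" proof (rule comp_eqI)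
 note am = M.bounded_opsD(3)[OF a m]
 show "act a (emb h m) \<in> carrier X" "emb h (a m) \<in> carrier X" using act_closed[OF a emb_closed[OF h m]] emb_closed[OF h am] by auto
 show "comp g (act a (emb h m)) = comp g (emb h (a m))" if g: "g \<in> carrier H" for g
  using comp_act[OF a g emb_closed[OF h m]] clinear_onD(3)[OF M.bounded_opsD(1)[OF a] m, of "ip H h g"] by (simp add: comp_emb h g m am)
qed

lemma act_vec:
 assumes a: "a \<in> bounded_ops M" and F: "H.onf F (%h. h)" and f: "f \<in> F \<rightarrow> carrier M" shows "act a (vec F f) = vec F (%h. a (f h))" proof -
 note FD = H.onfD[OF F]
 have fc: "f g \<in> carrier M" if "g \<in> F" for g using f that by auto
 have "act a (vec F f) = (\<Oplus>\<^bsub>X\<^esub>h\<in>F. act a (emb h (f h)))"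
  unfolding vec_def by (rule clinear_on_finsum[OF X.cvec_axioms X.cvec_axioms clinear_act[OF a] FD(1)])
   (auto simp: emb_closed FD fc)
 also have "... = vec F (%h. a (f h))" unfolding vec_def by (rule X.M.finsum_cong') (auto simp: act_emb a FD fc emb_closed M.bounded_opsD(3)[OF a])
 finally show ?thesis .
qed

text \<open>As in \<open>bounded_tensor_map\<close>, \<open>F\<close> is adapted to the image, here
  up to \<open>e\<close>, and Bessel's inequality is used for \<open>x\<close>.\<close>

lemma nrm_act_le:
 assumes a: "a \<in> bounded_ops M" and x: "x \<in> carrier X" shows "nrm X (act a x) <= op_norm M a * nrm X x" proof (rule field_le_epsilon)
 fix e :: real assume e: "e > 0"
 note ax = act_closed[OF a x]
 obtain F where F: "H.onf F (%h. h)" "nrm X (act a x \<ominus>\<^bsub>X\<^esub> rproj F (act a x)) < e" using approx[of "{act a x}" e] ax e by auto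
 note FD = H.onfD[OF F(1)]
 have "(nrm X (rproj F (act a x)))\<^sup>2 = (\<Sum>h\<in>F. (M.N (a (comp h x)))\<^sup>2)" using nrm_rproj_sq[OF F(1) ax] comp_act[OF a _ x] FD by simp
 also have "... <= (\<Sum>h\<in>F. (op_norm M a)\<^sup>2 * (M.N (comp h x))\<^sup>2)" proof (rule sum_mono)
  fix h assume "h \<in> F"
  then have c: "comp h x \<in> carrier M" using FD comp_closed x by auto
  show "(M.N (a (comp h x)))\<^sup>2 <= (op_norm M a)\<^sup>2 * (M.N (comp h x))\<^sup>2" unfolding power_mult_distrib[symmetric]
   by (rule power_mono[OF M.op_norm_bound[OF a c]]) (simp add: M.bounded_opsD(3)[OF a c])
 qed
 also have "... <= (op_norm M a * nrm X x)\<^sup>2" unfolding sum_distrib_left[symmetric] power_mult_distrib by (intro mult_left_mono sum_comp_le[OF F(1) x]) simp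
 finally have "nrm X (rproj F (act a x)) <= op_norm M a * nrm X x" by (rule power2_le_imp_le) (intro mult_nonneg_nonneg M.op_norm_nonneg[OF a] X.nrm_nonneg[OF x])
 then show "nrm X (act a x) <= op_norm M a * nrm X x + e" using X.nrm_le_add_minus[OF ax rproj_closed[OF F(1) ax]] F(2) by simp
qed

lemma act_add:
 assumes "a \<in> bounded_ops M" "b \<in> bounded_ops M" "x \<in> carrier X"
 shows "act (\<lambda>z\<in>carrier M. a z \<oplus>\<^bsub>M\<^esub> b z) x = act a x \<oplus>\<^bsub>X\<^esub> act b x" by (rule comp_eqI)
  (simp_all add: assms act_closed M.bounded_ops_add comp_act comp_add comp_closed)

lemma act_smult:
 assumes "a \<in> bounded_ops M" "x \<in> carrier X" shows "act (\<lambda>z\<in>carrier M. c \<odot>\<^bsub>M\<^esub> a z) x = c \<odot>\<^bsub>X\<^esub> act a x"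
 by (rule comp_eqI)
  (simp_all add: assms act_closed M.bounded_ops_smult comp_act comp_smult comp_closed)

lemma act_compose:
 assumes "a \<in> bounded_ops M" "b \<in> bounded_ops M" "x \<in> carrier X" shows "act (compose (carrier M) a b) x = act a (act b x)" proof (rule comp_eqI)
 show "comp h (act (compose (carrier M) a b) x) = comp h (act a (act b x))" if h: "h \<in> carrier H" for h proof -
  have "comp h (act (compose (carrier M) a b) x) = compose (carrier M) a b (comp h x)" by (rule comp_act[OF M.bounded_ops_compose[OF assms(1,2)] h assms(3)])
  then show ?thesis using comp_closed[OF h assms(3)] by (simp add: assms act_closed comp_act h compose_def)
 qed
qed (use assms M.bounded_ops_compose[OF assms(1,2)] in \<open>auto simp: act_closed\<close>)

lemma act_one: "x \<in> carrier X ==> act (\<lambda>z\<in>carrier M. z) x = x" by (rule comp_eqI) (simp_all add: act_closed M.bounded_ops_id comp_act comp_closed)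

lemma contractive_left: "contractive_left_module M X act" by (intro contractive_left_module.intro contractive_left_module_axioms.intro X.complex_normed_space_axioms)
  (simp_all add: clinear_act act_add act_smult act_compose act_one nrm_act_le)

text \<open>The bounded separating functionals for \<open>proj_tensor_normed\<close>; they stand in
  for the Hahn-Banach theorem.\<close>

definition functionals :: "('x => complex) set" where
 "functionals = {%x. ip M (comp h x) m | h m. h \<in> carrier H & m \<in> carrier M}"

lemma functionals_separating: "x \<in> carrier X ==> (!!f. f \<in> functionals ==> f x = 0) ==> x = \<zero>\<^bsub>X\<^esub>"
proof (rule separating)
 fix h assume x: "x \<in> carrier X" and f: "!!f. f \<in> functionals ==> f x = 0" and h: "h \<in> carrier H"
 have "(%x. ip M (comp h x) (comp h x')) \<in> functionals" if "x' \<in> carrier X" for x' unfolding functionals_def using h comp_closed[OF h that] by blast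
 from f[OF this[OF x]] show "comp h x = \<zero>\<^bsub>M\<^esub>" using M.inner_definite[OF comp_closed[OF h x]] by simp
qed

lemma functionals_linear: "f \<in> functionals ==> clinear_on X cscalars f"
 by (auto simp: functionals_def comp_add comp_smult comp_closed M.inner_add_left M.inner_smult_left intro!: clinear_onI)

lemma functionals_bounded: "f \<in> functionals ==> \<exists>C\<ge>0. \<forall>x\<in>carrier X. cmod (f x) <= C * nrm X x" proof -
 assume "f \<in> functionals"
 then obtain h m where hm: "h \<in> carrier H" "m \<in> carrier M" "f = (%x. ip M (comp h x) m)" by (auto simp: functionals_def)
 have "cmod (f x) <= (H.N h * M.N m) * nrm X x" if x: "x \<in> carrier X" for x proof -
  have "cmod (f x) <= M.N (comp h x) * M.N m" unfolding hm(3) by (rule M.Cauchy_Schwarz[OF comp_closed[OF hm(1) x] hm(2)])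
  also have "... <= (H.N h * nrm X x) * M.N m" by (intro mult_right_mono bounded_mapD(3)[OF comp_bounded[OF hm(1)] x] M.N_nonneg[OF hm(2)])
  finally show ?thesis by (simp only: mult_ac)
 qed
 then show ?thesis using hm by (intro exI[of _ "H.N h * M.N m"]) auto
qed

end

text \<open>Columns over the conjugate space. Read in \<open>L\<close>, the components of
  \<open>x\<close> are antilinear in \<open>x\<close>, so they can be used as bras in operators that
  depend linearly on \<open>x\<close>.\<close>

locale conj_columns = L: hilbert_space L + columns "conj_space L" H X comp emb act
 for L :: "'m cinner_space" and H :: "'h cinner_space" and X :: "'x cnormed_space" and comp emb act
begin

abbreviation "ract x a == act (adjoint_op L a) x"

lemma bops: "bounded_ops (conj_space L) = bounded_ops L" by (rule bounded_ops_conj_space[OF L.inner_space_axioms])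

lemma adj_bops: "a \<in> bounded_ops L ==> adjoint_op L a \<in> bounded_ops (conj_space L)" unfolding bops by (rule L.adjoint_bounded)

lemma ract_closed: "a \<in> bounded_ops L ==> x \<in> carrier X ==> ract x a \<in> carrier X" by (rule act_closed[OF adj_bops])

text \<open>The adjoint reverses products, which turns the left action into a right one; its
  antilinearity is absorbed by the conjugated scalars.\<close>

lemma contractive_right: "contractive_right_module L X ract" proof (intro contractive_right_module.intro contractive_right_module_axioms.intro X.complex_normed_space_axioms)
 fix a assume a: "a \<in> bounded_ops L"
 note a' = adj_bops[OF a]
 show "clinear_on X X (%u. ract u a)" by (rule clinear_act[OF a'])
 fix u assume u: "u \<in> carrier X"
 show "ract u (\<lambda>x\<in>carrier L. c \<odot>\<^bsub>L\<^esub> a x) = c \<odot>\<^bsub>X\<^esub> ract u a" for c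
  using act_smult[OF a' u, of c] by (simp add: L.adjoint_smult[OF a])
 have "nrm X (ract u a) <= op_norm L (adjoint_op L a) * nrm X u" using nrm_act_le[OF a' u] by (simp add: op_norm_conj_space)
 also have "... <= op_norm L a * nrm X u" by (intro mult_right_mono L.op_norm_adjoint_le[OF a] X.nrm_nonneg[OF u])
 finally show "nrm X (ract u a) <= nrm X u * op_norm L a" by (simp add: mult.commute)
 fix b assume b: "b \<in> bounded_ops L"
 note b' = adj_bops[OF b]
 show "ract u (\<lambda>x\<in>carrier L. a x \<oplus>\<^bsub>L\<^esub> b x) = ract u a \<oplus>\<^bsub>X\<^esub> ract u b"
  using act_add[OF a' b' u] by (simp add: L.adjoint_add[OF a b])
 show "ract u (compose (carrier L) a b) = ract (ract u a) b" using act_compose[OF b' a' u] by (simp add: L.adjoint_compose[OF a b])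
next
 fix u assume "u \<in> carrier X"
 then show "ract u (\<lambda>x\<in>carrier L. x) = u" using act_one[of u] by (simp add: L.adjoint_id)
qed

end

section \<open>Flatness of modules of columns\<close>

text \<open>\<open>P a u\<close> reads: \<open>u\<close> has gauge at most \<open>a\<close>. A
  subadditive and absolutely homogeneous gauge that is bounded by \<open>w\<close> on the generators
  is bounded by \<open>wsum w\<close> on formal sums. Seminorms, membership in \<open>K\<close> and
  the gauges of rows and sandwiches are all handled in this way.\<close>

lemma flift_gauge:
 assumes V: "cvec V" and f: "f \<in> S \<rightarrow> carrier V" and q: "pkeys q <= S"
  and "P 0 \<zero>\<^bsub>V\<^esub>" "!!a b u v. P a u ==> P b v ==> P (a + b) (u \<oplus>\<^bsub>V\<^esub> v)"
  and "!!a c u. P a u ==> P (cmod c * a) (c \<odot>\<^bsub>V\<^esub> u)" and "!!k. k \<in> S ==> P (w k) (f k)"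
 shows "P (wsum w q) (flift V f q)" using q proof (induction rule: free_induct)
 case zero
 then show ?case using assms(4) by (simp add: V)
next
 case (add k c p)
 have "flift V f (sng k c + p) = c \<odot>\<^bsub>V\<^esub> f k \<oplus>\<^bsub>V\<^esub> flift V f p"
  using flift_add[OF V f, of "sng k c" p] flift_single[of V f k c, OF V funcset_mem[OF f add(1)]] add by simp
 moreover have "wsum w (sng k c + p) = cmod c * w k + wsum w p" using add by (subst wsum_add_disjoint) auto
 ultimately show ?case using assms(5)[OF assms(6)[OF assms(7)[OF add(1)]] add.IH] by simp
qed

lemma (in weighted_relations) pn_flift_le:
 assumes "!!k. k \<in> A ==> pkeys (g k) \<subseteq> S" "pkeys p <= A" "!!k. k \<in> A ==> pn (g k) <= b k"
 shows "pn (flift (free_module S) g p) <= wsum b p" proof -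
 have g: "g \<in> A \<rightarrow> carrier (free_module S)" using assms(1) by auto
 have "pkeys (flift (free_module S) g p) \<subseteq> S & pn (flift (free_module S) g p) <= wsum b p"
  by (rule flift_gauge[OF cvec_free_module g assms(2), where P="%a u. pkeys u <= S & pn u <= a"])
   (use assms(1,3) pn_K[OF K_zero] pn_psc in \<open>auto simp: pkeys_subset intro!: mult_left_mono order_trans[OF pn_add] add_mono\<close>)
 then show ?thesis by blast
qed

lemma (in weighted_relations) K_flift:
 assumes "!!k. k \<in> A ==> g k \<in> K" "pkeys p <= A" shows "flift (free_module S) g p \<in> K"
 by (rule flift_gauge[OF cvec_free_module _ assms(2), where P="%a u. u \<in> K" and w="%_. 0"])
  (use assms(1) K_keys in \<open>auto simp: K_zero K_add K_psc\<close>)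

text \<open>Exchanging generators changes a formal sum by a combination of elementary differences,
  to which \<open>K_flift\<close> (for congruences) and \<open>pn_flift_le\<close> (for estimates)
  apply.\<close>

lemma flift_free_diff:
 assumes "f \<in> A \<rightarrow> S" "f' \<in> A \<rightarrow> S" "pkeys p <= A"
 shows "fmap f p - fmap f' p = flift (free_module S) (%k. sng (f k) 1 - sng (f' k) 1) p" proof (rule flift_unique[OF cvec_free_module _ assms(3)])
 show "clinear_on (free_module A) (free_module S) (%p. fmap f p - fmap f' p)" using fmap_keys[OF assms(1)] fmap_keys[OF assms(2)]
  by (intro clinear_onI) (simp_all add: pkeys_subset fmap_add fmap_psc psc_add)
qed (use assms in simp)

lemma fmap_id: "fmap (%k. k) p = p" proof -
 have "p = flift (free_module UNIV) (%k. sng k 1) p" by (rule flift_unique[OF cvec_free_module clinear_on_id]) auto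
 then show ?thesis by (subst fmap_eq_flift[of _ _ UNIV]) auto
qed

lemma (in normed_pair) pn_diff_left:
 assumes "R <= carrier (fmod X Y)" "x \<in> carrier X" "x' \<in> carrier X" "y \<in> carrier Y"
 shows "pnorm S w (rspan R) (sng (x, y) 1 - sng (x', y) 1) <= nrm X (x \<ominus>\<^bsub>X\<^esub> x') * nrm Y y" proof -
 interpret K: weighted_relations S w "rspan R" by (rule weighted_rspan[OF assms(1)])
 have m: "x \<ominus>\<^bsub>X\<^esub> x' \<in> carrier X" using assms by simp
 have "sng (x, y) 1 - sng (x \<ominus>\<^bsub>X\<^esub> x', y) 1 - sng (x', y) 1 \<in> rspan R"
  using bilinear_relation_mem(1)[OF m assms(3,4)] assms by (intro FM.cspan_inc) (simp add: X.minus_add_cancel)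
 then have "(sng (x \<ominus>\<^bsub>X\<^esub> x', y) 1) - (sng (x, y) 1 - sng (x', y) 1) \<in> rspan R"
  using K.K_psc[of "sng (x, y) 1 - sng (x \<ominus>\<^bsub>X\<^esub> x', y) 1 - sng (x', y) 1" "-1"] by (simp add: algebra_simps)
 then have "K.pn (sng (x, y) 1 - sng (x', y) 1) <= wsum w (sng (x \<ominus>\<^bsub>X\<^esub> x', y) 1)" using m assms by (intro K.pn_le) auto
 then show ?thesis by simp
qed

lemma (in normed_pair) pn_diff_right:
 assumes "R <= carrier (fmod X Y)" "x \<in> carrier X" "y \<in> carrier Y" "y' \<in> carrier Y"
 shows "pnorm S w (rspan R) (sng (x, y) 1 - sng (x, y') 1) <= nrm X x * nrm Y (y \<ominus>\<^bsub>Y\<^esub> y')" proof -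
 interpret K: weighted_relations S w "rspan R" by (rule weighted_rspan[OF assms(1)])
 have m: "y \<ominus>\<^bsub>Y\<^esub> y' \<in> carrier Y" using assms by simp
 have "sng (x, y) 1 - sng (x, y \<ominus>\<^bsub>Y\<^esub> y') 1 - sng (x, y') 1 \<in> rspan R"
  using bilinear_relation_mem(2)[OF assms(2) m assms(4)] assms by (intro FM.cspan_inc) (simp add: Y.minus_add_cancel)
 then have "(sng (x, y \<ominus>\<^bsub>Y\<^esub> y') 1) - (sng (x, y) 1 - sng (x, y') 1) \<in> rspan R"
  using K.K_psc[of "sng (x, y) 1 - sng (x, y \<ominus>\<^bsub>Y\<^esub> y') 1 - sng (x, y') 1" "-1"] by (simp add: algebra_simps)
 then have "K.pn (sng (x, y) 1 - sng (x, y') 1) <= wsum w (sng (x, y \<ominus>\<^bsub>Y\<^esub> y') 1)" using m assms by (intro K.pn_le) auto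
 then show ?thesis by simp
qed

lemma (in cvec_pair) elem_linear:
 "y \<in> carrier Y ==> clinear_on X (alg_tensor X Y) (%x. tcls X Y (sng (x, y) 1))"
 "x \<in> carrier X ==> clinear_on Y (alg_tensor X Y) (%y. tcls X Y (sng (x, y) 1))" using bilinear_elem by (simp_all add: bilinear_on_def)

text \<open>Linearity in the second factor gathers a formal sum with constant first factor into one
  elementary tensor.\<close>

lemma (in cvec_pair) collect_right:
 assumes x: "x \<in> carrier X" and f: "f \<in> A \<rightarrow> carrier Y" and p: "pkeys p <= A"
 shows "fmap (%k. (x, f k)) p - sng (x, flift Y f p) 1 \<in> tensor_kernel X Y" proof -
 have fy: "flift Y f p \<in> carrier Y" by (rule flift_closed[OF Y.cvec_axioms p f])
 have k: "pkeys (fmap (%k. (x, f k)) p) \<subseteq> S" by (rule fmap_keys[OF _ p]) (use x f in auto)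
 have "tcls X Y (fmap (%k. (x, f k)) p) = flift (alg_tensor X Y) (%k. tcls X Y (sng (x, f k) 1)) p"
  by (rule flift_unique[OF cvec_alg_tensor clinear_on_comp[OF clinear_fmap clinear_tcls] p]) (use x f in auto)
 also have "... = tcls X Y (sng (x, flift Y f p) 1)" by (rule flift_comp[OF Y.cvec_axioms cvec_alg_tensor elem_linear(2)[OF x] f p, symmetric])
 finally show ?thesis using tcls_eq_iff[OF k, of "sng (x, flift Y f p) 1"] x fy by simp
qed

lemma (in cvec_pair) collect_left:
 assumes y: "y \<in> carrier Y" and f: "f \<in> A \<rightarrow> carrier X" and p: "pkeys p <= A"
 shows "fmap (%k. (f k, y)) p - sng (flift X f p, y) 1 \<in> tensor_kernel X Y" proof -
 have fy: "flift X f p \<in> carrier X" by (rule flift_closed[OF X.cvec_axioms p f])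
 have k: "pkeys (fmap (%k. (f k, y)) p) \<subseteq> S" by (rule fmap_keys[OF _ p]) (use y f in auto)
 have "tcls X Y (fmap (%k. (f k, y)) p) = flift (alg_tensor X Y) (%k. tcls X Y (sng (f k, y) 1)) p"
  by (rule flift_unique[OF cvec_alg_tensor clinear_on_comp[OF clinear_fmap clinear_tcls] p]) (use y f in auto)
 also have "... = tcls X Y (sng (flift X f p, y) 1)" by (rule flift_comp[OF X.cvec_axioms cvec_alg_tensor elem_linear(1)[OF y] f p, symmetric])
 finally show ?thesis using tcls_eq_iff[OF k, of "sng (flift X f p, y) 1"] y fy by simp
qed

text \<open>The abstract form of the argument: \<open>W\<close> and \<open>W'\<close> collect a tensor \<open>p\<close> into one element, up to \<open>e\<close> it is
 determined by this element, and every element of \<open>Y\<close> that is collected from a tensor over \<open>Z\<close> of weight \<open>a\<close>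
 is collected from an elementary tensor \<open>s\<close> over \<open>Y\<close> of weight at most \<open>a + e\<close>.\<close>

lemma pnorm_le_pnorm_fmap:
 assumes "weighted_relations S w K" "weighted_relations S' w' K'" and p: "pkeys p <= S" and j: "j \<in> S \<rightarrow> S'"
  and Y: "cvec Y" "cvec Z" and \<alpha>: "clinear_on Y Z \<alpha>"
  and ex: "!!e. e > 0 ==> \<exists>W W'. W \<in> S \<rightarrow> carrier Y & W' \<in> S' \<rightarrow> carrier Z & (\<forall>s\<in>S. W' (j s) = \<alpha> (W s)) &
   (\<forall>r\<in>K'. flift Z W' r = \<zero>\<^bsub>Z\<^esub>) &
   (\<forall>q. pkeys q <= S' --> flift Z W' q = \<alpha> (flift Y W p) --> pnorm S w K p <= wsum w' q + e)"
 shows "pnorm S w K p <= pnorm S' w' K' (fmap j p)" proof -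
 interpret A: weighted_relations S w K by fact
 interpret B: weighted_relations S' w' K' by fact
 interpret Z: cvec Z by fact
 have jp: "pkeys (fmap j p) \<subseteq> S'" by (rule fmap_keys[OF j p]) show ?thesis proof (rule B.pn_greatest[OF jp])
  fix q assume q: "pkeys q <= S'" "q - fmap j p \<in> K'"
  show "A.pn p <= wsum w' q" proof (rule field_le_epsilon)
   fix e :: real assume "e > 0"
   from ex[OF this] obtain W W' where W: "W \<in> S \<rightarrow> carrier Y" "W' \<in> S' \<rightarrow> carrier Z"
    "\<forall>s\<in>S. W' (j s) = \<alpha> (W s)" "\<forall>r\<in>K'. flift Z W' r = \<zero>\<^bsub>Z\<^esub>"
    "\<forall>q. pkeys q <= S' --> flift Z W' q = \<alpha> (flift Y W p) --> A.pn p <= wsum w' q + e" by blast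
   have "flift Z W' q \<ominus>\<^bsub>Z\<^esub> flift Z W' (fmap j p) = \<zero>\<^bsub>Z\<^esub>" using flift_diff[OF Y(2) W(2) q(1) jp] W(4) q(2) by simp
   then have "flift Z W' q = flift Z W' (fmap j p)" using Z.minus_eq_zero_iff flift_closed[OF Y(2) q(1) W(2)] flift_closed[OF Y(2) jp W(2)] by blast
   also have "... = flift Z (%s. W' (j s)) p" by (rule flift_fmap[OF Y(2) j W(2) p])
   also have "... = flift Z (%s. \<alpha> (W s)) p" by (rule flift_cong[OF _ _ Y(2)]) (use W j p in auto)
   also have "... = \<alpha> (flift Y W p)" by (rule flift_comp[OF Y \<alpha> W(1) p, symmetric])
   finally show "A.pn p <= wsum w' q + e" using W(5) q(1) by blast
  qed
 qed
qed

definition balanced_relations ::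
 "'l cinner_space => ('x, 'm) cnormed_space_scheme => ('x => ('l => 'l) => 'x) =>
  ('y, 'n) cnormed_space_scheme => (('l => 'l) => 'y => 'y) => ('x \<times> 'y \<Rightarrow>\<^sub>0 complex) set" where
 "balanced_relations L X rX Y lY =
  {sng (rX x a, y) 1 - sng (x, lY a y) 1 | a x y. a \<in> bounded_ops L & x \<in> carrier X & y \<in> carrier Y}"

section \<open>Rows of operators\<close>

context conj_columns
begin

text \<open>The operator \<open>T(x)\<close>, a sum of terms |e h><x_h|. It is linear in
  \<open>x\<close> because the components are antilinear over \<open>L\<close>, and by
  \<open>rowop_ract\<close> right multiplication of \<open>x\<close> becomes right composition,
  which makes \<open>(x, z) -> T(x) z\<close> balanced.\<close>

definition rowop :: "'h set => ('h => 'm) => 'x => 'm => 'm" where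
 "rowop F e x = L.fro F e (%h. comp h x)"

lemma comp_closed': "h \<in> carrier H ==> x \<in> carrier X ==> comp h x \<in> carrier L" using comp_closed by simp

lemma rowop_bounded: "H.onf F (%h. h) ==> L.onf F e ==> x \<in> carrier X ==> rowop F e x \<in> bounded_ops L"
 unfolding rowop_def by (rule L.fro_bounded) (auto simp: H.onfD L.onfD intro!: comp_closed' dest: H.onfD(3))

lemma rowop_add:
 assumes "H.onf F (%h. h)" "L.onf F e" "x \<in> carrier X" "x' \<in> carrier X"
 shows "rowop F e (x \<oplus>\<^bsub>X\<^esub> x') = (\<lambda>z\<in>carrier L. rowop F e x z \<oplus>\<^bsub>L\<^esub> rowop F e x' z)" proof -
 note FD = H.onfD[OF assms(1)] and eD = L.onfD[OF assms(2)]
 have "rowop F e (x \<oplus>\<^bsub>X\<^esub> x') = L.fro F e (%h. comp h x \<oplus>\<^bsub>L\<^esub> comp h x')"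
  unfolding rowop_def using FD eD assms comp_add by (intro L.fro_cong) auto
 also have "... = (\<lambda>z\<in>carrier L. rowop F e x z \<oplus>\<^bsub>L\<^esub> rowop F e x' z)"
  unfolding rowop_def by (rule L.fro_add_right) (use FD eD assms comp_closed' in auto)
 finally show ?thesis .
qed

lemma rowop_smult:
 assumes "H.onf F (%h. h)" "L.onf F e" "x \<in> carrier X"
 shows "rowop F e (c \<odot>\<^bsub>X\<^esub> x) = (\<lambda>z\<in>carrier L. c \<odot>\<^bsub>L\<^esub> rowop F e x z)" proof -
 note FD = H.onfD[OF assms(1)] and eD = L.onfD[OF assms(2)]
 have "rowop F e (c \<odot>\<^bsub>X\<^esub> x) = L.fro F e (%h. cnj c \<odot>\<^bsub>L\<^esub> comp h x)"
  unfolding rowop_def using FD eD assms comp_smult by (intro L.fro_cong) auto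
 also have "... = (\<lambda>z\<in>carrier L. c \<odot>\<^bsub>L\<^esub> rowop F e x z)"
  unfolding rowop_def by (subst L.fro_smult_right) (use FD eD assms comp_closed' in auto)
 finally show ?thesis .
qed

lemma rowop_ract:
 assumes "H.onf F (%h. h)" "L.onf F e" "x \<in> carrier X" and a: "a \<in> bounded_ops L" shows "rowop F e (ract x a) = compose (carrier L) (rowop F e x) a" proof -
 note FD = H.onfD[OF assms(1)] and eD = L.onfD[OF assms(2)]
 have "compose (carrier L) (rowop F e x) a = L.fro F e (%h. adjoint_op L a (comp h x))"
  unfolding rowop_def by (rule L.compose_fro_right[OF a]) (use FD eD assms comp_closed' in auto)
 also have "... = rowop F e (ract x a)" unfolding rowop_def using FD eD assms(3) comp_act[OF adj_bops[OF a]] by (intro L.fro_cong) auto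
 finally show ?thesis ..
qed

text \<open>\<open>vec F e\<close> is the fixed vector zeta. The adjoint of \<open>T(x)\<close>
  sends \<open>e h\<close> to the component of \<open>x\<close> at \<open>h\<close>, and
  \<open>ract\<close> applies it to every entry of zeta.\<close>

lemma ract_zeta:
 assumes F: "H.onf F (%h. h)" and e: "L.onf F e" and x: "x \<in> carrier X" shows "ract (vec F e) (rowop F e x) = rproj F x" proof -
 note FD = H.onfD[OF F] and eD = L.onfD[OF e]
 have c: "(%h. comp h x) \<in> F \<rightarrow> carrier L" using FD comp_closed' x by auto
 have "adjoint_op L (rowop F e x) = L.fro F (%h. comp h x) e" unfolding rowop_def by (rule L.adjoint_fro) (use FD eD c in auto)
 note adj = this
 have "ract (vec F e) (rowop F e x) = vec F (%h. adjoint_op L (rowop F e x) (e h))" by (rule act_vec[OF adj_bops[OF rowop_bounded[OF F e x]] F]) (use eD in simp)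
 also have "... = rproj F x" by (rule vec_cong[OF F]) (use c in \<open>auto simp: adj L.fro_onf[OF e c]\<close>)
 finally show ?thesis .
qed

text \<open>Applying \<open>s\<close> to the components multiplies the row by the adjoint of
  \<open>s\<close> on the right; this prepares the cancellation in
  \<open>rowop_merge\<close>.\<close>

lemma rowop_vec_comb:
 assumes F: "H.onf F (%h. h)" and e: "L.onf F e" and x: "x \<in> carrier X" "x' \<in> carrier X" and st: "s \<in> bounded_ops L" "t \<in> bounded_ops L"
 defines "x'' == vec F (%h. s (comp h x) \<oplus>\<^bsub>L\<^esub> t (comp h x'))"
 shows "x'' \<in> carrier X"
  and "rowop F e x'' = (\<lambda>z\<in>carrier L. compose (carrier L) (rowop F e x) (adjoint_op L s) z \<oplus>\<^bsub>L\<^esub> compose (carrier L) (rowop F e x') (adjoint_op L t) z)"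
proof -
 note FD = H.onfD[OF F] and eD = L.onfD[OF e]
 have sc: "s (comp h x) \<in> carrier L" "t (comp h x') \<in> carrier L" if "h \<in> F" for h using st[THEN L.bounded_opsD(3)] comp_closed' x FD(3)[OF that] by auto
 have f: "(%h. s (comp h x) \<oplus>\<^bsub>L\<^esub> t (comp h x')) \<in> F \<rightarrow> carrier (conj_space L)" using sc by auto
 show "x'' \<in> carrier X" unfolding x''_def by (rule vec_closed[OF F f])
 have c: "(%h. comp h y) \<in> F \<rightarrow> carrier L" if "y \<in> carrier X" for y using FD comp_closed' that by auto
 have "rowop F e x'' = L.fro F e (%h. s (comp h x) \<oplus>\<^bsub>L\<^esub> t (comp h x'))"
  unfolding rowop_def x''_def using comp_vec[OF F f] eD by (intro L.fro_cong) auto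
 also have "... = (\<lambda>z\<in>carrier L. L.fro F e (%h. s (comp h x)) z \<oplus>\<^bsub>L\<^esub> L.fro F e (%h. t (comp h x')) z)"
  by (rule L.fro_add_right) (use FD eD sc in auto)
 also have "L.fro F e (%h. s (comp h x)) = compose (carrier L) (rowop F e x) (adjoint_op L s)"
  unfolding rowop_def using L.compose_fro_right[OF L.adjoint_bounded[OF st(1)] FD(1) eD(2) c[OF x(1)]] by (simp add: L.adjoint_adjoint[OF st(1)])
 also have "L.fro F e (%h. t (comp h x')) = compose (carrier L) (rowop F e x') (adjoint_op L t)"
  unfolding rowop_def using L.compose_fro_right[OF L.adjoint_bounded[OF st(2)] FD(1) eD(2) c[OF x(2)]] by (simp add: L.adjoint_adjoint[OF st(2)])
 finally show "rowop F e x'' = (\<lambda>z\<in>carrier L. compose (carrier L) (rowop F e x) (adjoint_op L s) z \<oplus>\<^bsub>L\<^esub> compose (carrier L) (rowop F e x') (adjoint_op L t) z)" .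
qed

lemma rowop_splitting:
 assumes F: "H.onf F (%h. h)" and e: "L.onf F e" and x: "x \<in> carrier X"
  and p: "p \<in> bounded_ops L" "adjoint_op L p = p" "!!h. h \<in> F ==> p (comp h x) = comp h x" shows "compose (carrier L) (rowop F e x) p = rowop F e x"
proof -
 note FD = H.onfD[OF F] and eD = L.onfD[OF e]
 have c: "(%h. comp h x) \<in> F \<rightarrow> carrier L" using FD comp_closed' x by auto show ?thesis
  unfolding rowop_def using L.compose_fro_right[OF p(1) FD(1) eD(2) c] L.fro_cong[of F e e "%h. p (comp h x)" "%h. comp h x"] eD p by simp
qed

lemma nrm_vec_splitting:
 assumes F: "H.onf F (%h. h)" and x: "x \<in> carrier X" "x' \<in> carrier X"
  and sp: "L.splitting A s t p" and A: "!!h. h \<in> F ==> comp h x \<in> A" "!!h. h \<in> F ==> comp h x' \<in> A"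
 shows "nrm X (vec F (%h. s (comp h x) \<oplus>\<^bsub>L\<^esub> t (comp h x'))) <= sqrt ((nrm X x)\<^sup>2 + (nrm X x')\<^sup>2)" proof (rule real_le_rsqrt)
 note FD = H.onfD[OF F]
 have st: "s \<in> bounded_ops L" "t \<in> bounded_ops L" using sp by (auto simp: L.splitting_def)
 have c: "comp h x \<in> carrier L" "comp h x' \<in> carrier L" if "h \<in> F" for h using comp_closed' x FD(3)[OF that] by auto
 have f: "(%h. s (comp h x) \<oplus>\<^bsub>L\<^esub> t (comp h x')) \<in> F \<rightarrow> carrier (conj_space L)" using st[THEN L.bounded_opsD(3)] c by auto
 have "(nrm X (vec F (%h. s (comp h x) \<oplus>\<^bsub>L\<^esub> t (comp h x'))))\<^sup>2 = (\<Sum>h\<in>F. (L.N (comp h x))\<^sup>2 + (L.N (comp h x'))\<^sup>2)"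
  unfolding nrm_vec[OF F f] nrm_conj_space using L.splitting_N[OF sp] A c by (intro sum.cong) auto
 also have "... <= (nrm X x)\<^sup>2 + (nrm X x')\<^sup>2" using sum_comp_le[OF F x(1)] sum_comp_le[OF F x(2)] by (simp add: sum.distrib)
 finally show "(nrm X (vec F (%h. s (comp h x) \<oplus>\<^bsub>L\<^esub> t (comp h x'))))\<^sup>2 <= (nrm X x)\<^sup>2 + (nrm X x')\<^sup>2" .
qed

end

lemma image_Collect3:
 assumes "!!a x y. P a x y ==> f a x y = g (h a x y)" shows "g ` {h a x y | a x y. P a x y} = {f a x y | a x y. P a x y}"
 using assms by (auto 0 4 simp: image_iff) metis

context normed_pair
begin

lemma balanced_relations_subset:
 assumes "!!a x. a \<in> bounded_ops L ==> x \<in> carrier X ==> r x a \<in> carrier X"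
  "!!a y. a \<in> bounded_ops L ==> y \<in> carrier Y ==> l a y \<in> carrier Y"
 shows "balanced_relations L X r Y l <= carrier (fmod X Y)" unfolding balanced_relations_def
 by (intro subsetI, elim CollectE exE conjE; hypsubst; simp only: free_module_sel mem_Collect_eq;
   intro pkeys_subset; simp add: assms)

lemma tcls_balanced_relations:
 assumes "!!a x. a \<in> bounded_ops L ==> x \<in> carrier X ==> r x a \<in> carrier X"
  "!!a y. a \<in> bounded_ops L ==> y \<in> carrier Y ==> l a y \<in> carrier Y"
 shows "tcls X Y ` balanced_relations L X r Y l =
  {elem_tensor X Y (r x a) y \<ominus>\<^bsub>PT\<^esub> elem_tensor X Y x (l a y)
    | a x y. a \<in> bounded_ops L & x \<in> carrier X & y \<in> carrier Y}" unfolding balanced_relations_def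
 by (rule image_Collect3) (simp add: elem_tensor_eq tcls_diff' assms)

end

context contractive_left_module
begin

lemmas lact_closed = clinear_onD(1)[OF lact_linear]
 and lact_vadd = clinear_onD(2)[OF lact_linear]
 and lact_vsmult = clinear_onD(3)[OF lact_linear]

lemma lact_zero:
 assumes L: "hilbert_space L" and u: "u \<in> carrier V" shows "l (\<lambda>x\<in>carrier L. \<zero>\<^bsub>L\<^esub>) u = \<zero>" proof -
 interpret L: hilbert_space L by fact
 have "(\<lambda>x\<in>carrier L. 0 \<odot>\<^bsub>L\<^esub> (\<lambda>x\<in>carrier L. x) x) = (\<lambda>x\<in>carrier L. \<zero>\<^bsub>L\<^esub>)" by (rule restrict_ext) simp
 then show ?thesis using lact_smult[OF L.bounded_ops_id u, of 0] lact_closed[OF L.bounded_ops_id u] by simp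
qed

lemma lact_contraction:
 assumes "a \<in> bounded_ops L" "op_norm L a <= 1" "u \<in> carrier V" shows "nrm V (l a u) <= nrm V u"
 using lact_contractive[OF assms(1,3)] mult_right_mono[OF assms(2) nrm_nonneg[OF assms(3)]] by simp

end

section \<open>The gauge of rows, and ESR-flatness\<close>

context conj_columns
begin

lemma bilinear_rowop:
 assumes Z: "contractive_left_module L Z l" and F: "H.onf F (%h. h)" and e: "L.onf F e" shows "bilinear_on X Z Z (%(x, z). l (rowop F e x) z)" proof -
 interpret Z: contractive_left_module L Z l by fact
 note b = rowop_bounded[OF F e] show ?thesis by (intro bilinear_onI clinear_onI)
   (simp_all add: rowop_add[OF F e] rowop_smult[OF F e] Z.lact_add Z.lact_smult Z.lact_closed
    Z.lact_vadd Z.lact_vsmult b)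
qed

text \<open>A scalar may be moved between \<open>x\<close> and \<open>z\<close>. With equal norms
  the two square roots in \<open>rowop_merge\<close> coincide, and their product does not exceed the
  sum of the weights. If a norm vanishes, both elements are replaced by zero to keep the norms
  equal.\<close>

lemma rowop_rescale:
 assumes Z: "contractive_left_module L Z l" and F: "H.onf F (%h. h)" and e: "L.onf F e" and x: "x \<in> carrier X" and z: "z \<in> carrier Z"
 obtains x1 z1 where "x1 \<in> carrier X" "z1 \<in> carrier Z" "l (rowop F e x1) z1 = l (rowop F e x) z"
  "nrm X x1 = nrm Z z1" "(nrm X x1)\<^sup>2 = nrm X x * nrm Z z" proof -
 interpret Z: contractive_left_module L Z l by fact
 note bil = bilinear_rowop[OF Z F e]
 have l1: "clinear_on X Z (%x. l (rowop F e x) z)" if "z \<in> carrier Z" for z using bil that by (simp add: bilinear_on_def)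
 have l2: "clinear_on Z Z (%z. l (rowop F e x) z)" if "x \<in> carrier X" for x using bil that by (simp add: bilinear_on_def) show ?thesis
 proof (cases "nrm X x * nrm Z z = 0")
  case True
  then have "x = \<zero>\<^bsub>X\<^esub> \<or> z = \<zero>\<^bsub>Z\<^esub>" using X.nrm_eq_0_iff[OF x] Z.nrm_eq_0_iff[OF z] by auto
  then have "l (rowop F e x) z = \<zero>\<^bsub>Z\<^esub>"
   using clinear_on_zero[OF X.cvec_axioms Z.cvec_axioms l1[OF z]] clinear_on_zero[OF Z.cvec_axioms Z.cvec_axioms l2[OF x]] by auto
  moreover have "l (rowop F e \<zero>\<^bsub>X\<^esub>) \<zero>\<^bsub>Z\<^esub> = \<zero>\<^bsub>Z\<^esub>" by (rule clinear_on_zero[OF X.cvec_axioms Z.cvec_axioms l1]) simp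
  ultimately show ?thesis using True by (intro that[of "\<zero>\<^bsub>X\<^esub>" "\<zero>\<^bsub>Z\<^esub>"]) auto
 next
  case False
  define a where "a = nrm X x"
  define b where "b = nrm Z z"
  have "0 <= a" "0 <= b" using x z by (simp_all add: a_def b_def)
  then have ab: "a > 0" "b > 0" using False by (auto simp: a_def b_def less_le)
  \<comment> \<open>The solution of \<open>c a = b / c\<close>, the equality of the new
    norms.\<close>
  define c where "c = sqrt (b / a)"
  have c: "c > 0" using ab by (simp add: c_def)
  have c2: "c * c = b / a" unfolding c_def using ab by simp
  let ?x = "complex_of_real c \<odot>\<^bsub>X\<^esub> x" and ?z = "complex_of_real (1 / c) \<odot>\<^bsub>Z\<^esub> z"
  have nx: "nrm X ?x = c * a" using X.nrm_smult[OF x, of "complex_of_real c"] c by (simp add: a_def)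
  have nz: "nrm Z ?z = b / c" unfolding Z.nrm_smult[OF z] norm_of_real using c by (simp add: b_def)
  have "l (rowop F e ?x) ?z = complex_of_real c \<odot>\<^bsub>Z\<^esub> (complex_of_real (1 / c) \<odot>\<^bsub>Z\<^esub> l (rowop F e x) z)"
   using clinear_onD(3)[OF l1[of ?z] x, of "complex_of_real c"] clinear_onD(3)[OF l2[OF x] z, of "complex_of_real (1/c)"] z by simp
  also have "... = l (rowop F e x) z" using c clinear_onD(1)[OF l2[OF x] z] by (simp add: Z.smult_smult)
  finally show ?thesis proof (intro that[of ?x ?z])
   have "b = (c * c) * a" using c2 ab by simp
   then show "nrm X ?x = nrm Z ?z" unfolding nx nz using c by (simp add: field_simps)
   show "(nrm X ?x)\<^sup>2 = nrm X x * nrm Z z" unfolding nx power2_eq_square using \<open>b = (c * c) * a\<close> by (simp add: a_def[symmetric] b_def[symmetric])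
  qed (use x z in simp_all)
 qed
qed

text \<open>The two terms of a sum are moved to orthogonal supports by partial isometries \<open>s\<close> and \<open>t\<close>.\<close>

lemma rowop_merge:
 assumes inf: "infinite_dimensional L" and Z: "left_semi_ruan_module L Z l" and F: "H.onf F (%h. h)" and e: "L.onf F e"
  and x: "x \<in> carrier X" "x' \<in> carrier X" and z: "z \<in> carrier Z" "z' \<in> carrier Z" obtains x'' z'' where "x'' \<in> carrier X" "z'' \<in> carrier Z"
  "l (rowop F e x'') z'' = l (rowop F e x) z \<oplus>\<^bsub>Z\<^esub> l (rowop F e x') z'"
  "nrm X x'' * nrm Z z'' <= sqrt ((nrm X x)\<^sup>2 + (nrm X x')\<^sup>2) * sqrt ((nrm Z z)\<^sup>2 + (nrm Z z')\<^sup>2)" proof -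
 interpret Z: left_semi_ruan_module L Z l by fact
 note FD = H.onfD[OF F]
 let ?A = "(%h. comp h x) ` F \<union> (%h. comp h x') ` F"
 have A: "finite ?A" "?A <= carrier L" using FD comp_closed' x by auto
 obtain s t p where sp: "L.splitting ?A s t p" using L.splitting_exists[OF inf A] by blast
 then have st: "s \<in> bounded_ops L" "t \<in> bounded_ops L" "p \<in> bounded_ops L"
  and pA: "!!x. x \<in> ?A ==> p x = x" and ap: "adjoint_op L p = p"
  and ss: "compose (carrier L) (adjoint_op L s) s = p" "compose (carrier L) (adjoint_op L t) t = p"
   "compose (carrier L) (adjoint_op L s) t = (\<lambda>x\<in>carrier L. \<zero>\<^bsub>L\<^esub>)"
   "compose (carrier L) (adjoint_op L t) s = (\<lambda>x\<in>carrier L. \<zero>\<^bsub>L\<^esub>)"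
  and pr: "compose (carrier L) s (adjoint_op L s) \<in> projections L"
   "compose (carrier L) t (adjoint_op L t) \<in> projections L"
   "orthogonal_ops L (compose (carrier L) s (adjoint_op L s)) (compose (carrier L) t (adjoint_op L t))"
   "compose (carrier L) (compose (carrier L) s (adjoint_op L s)) s = s"
   "compose (carrier L) (compose (carrier L) t (adjoint_op L t)) t = t"
  and no: "op_norm L s <= 1" "op_norm L t <= 1" unfolding L.splitting_def by blast+
 note as = L.adjoint_bounded[OF st(1)] and at = L.adjoint_bounded[OF st(2)]
 define z'' where "z'' = l s z \<oplus>\<^bsub>Z\<^esub> l t z'"
 define x'' where "x'' = vec F (%h. s (comp h x) \<oplus>\<^bsub>L\<^esub> t (comp h x'))"
 note x'' = rowop_vec_comb[OF F e x st(1,2), folded x''_def]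
 note Tx = rowop_bounded[OF F e x(1)] and Tx' = rowop_bounded[OF F e x(2)]
 have sz: "l s z \<in> carrier Z" "l t z' \<in> carrier Z" using Z.lact_closed st z by auto
 have z'': "z'' \<in> carrier Z" using sz by (simp add: z''_def)
 \<comment> \<open>The adjoint of \<open>s\<close> undoes \<open>s\<close> and annihilates the range
   of \<open>t\<close>, so it returns \<open>z\<close> up to \<open>p\<close>; the row of
   \<open>x\<close> absorbs \<open>p\<close>, which fixes the components of
   \<open>x\<close>.\<close>
 have a1: "l (adjoint_op L s) z'' = l p z" unfolding z''_def Z.lact_vadd[OF as sz] Z.lact_compose[OF as st(1) z(1), symmetric] Z.lact_compose[OF as st(2) z(2), symmetric] ss
  using Z.lact_zero[OF L.hilbert_space_axioms z(2)] Z.lact_closed[OF st(3) z(1)] by simp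
 have a2: "l (adjoint_op L t) z'' = l p z'" unfolding z''_def Z.lact_vadd[OF at sz] Z.lact_compose[OF at st(1) z(1), symmetric] Z.lact_compose[OF at st(2) z(2), symmetric] ss
  using Z.lact_zero[OF L.hilbert_space_axioms z(1)] Z.lact_closed[OF st(3) z(2)] by simp
 have p1: "compose (carrier L) (rowop F e x) p = rowop F e x" "compose (carrier L) (rowop F e x') p = rowop F e x'"
  by (rule rowop_splitting[OF F e _ st(3) ap]; use x pA in auto)+
 have "l (rowop F e x'') z'' = l (compose (carrier L) (rowop F e x) (adjoint_op L s)) z'' \<oplus>\<^bsub>Z\<^esub>
   l (compose (carrier L) (rowop F e x') (adjoint_op L t)) z''" unfolding x''(2) by (rule Z.lact_add[OF L.bounded_ops_compose[OF Tx as] L.bounded_ops_compose[OF Tx' at] z''])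
 also have "... = l (rowop F e x) (l p z) \<oplus>\<^bsub>Z\<^esub> l (rowop F e x') (l p z')"
  by (simp only: Z.lact_compose[OF Tx as z''] Z.lact_compose[OF Tx' at z''] a1 a2)
 also have "... = l (rowop F e x) z \<oplus>\<^bsub>Z\<^esub> l (rowop F e x') z'"
  by (simp only: Z.lact_compose[OF Tx st(3) z(1), symmetric] Z.lact_compose[OF Tx' st(3) z(2), symmetric] p1)
 finally have eq: "l (rowop F e x'') z'' = l (rowop F e x) z \<oplus>\<^bsub>Z\<^esub> l (rowop F e x') z'" .
 \<comment> \<open>The orthogonal supports demanded by the semi-Ruan axiom are the final projections
   of \<open>s\<close> and \<open>t\<close>.\<close>
 have "nrm Z z'' <= sqrt ((nrm Z (l s z))\<^sup>2 + (nrm Z (l t z'))\<^sup>2)" unfolding z''_def by (rule Z.semi_ruan[OF sz pr(1-3)])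
   (simp_all add: pr(4,5) Z.lact_compose[OF L.projection_bounded[OF pr(1)] st(1) z(1), symmetric]
    Z.lact_compose[OF L.projection_bounded[OF pr(2)] st(2) z(2), symmetric])
 also have "... <= sqrt ((nrm Z z)\<^sup>2 + (nrm Z z')\<^sup>2)" using Z.lact_contraction[OF st(1) no(1) z(1)] Z.lact_contraction[OF st(2) no(2) z(2)] sz
  by (intro real_sqrt_le_mono add_mono power_mono) auto
 finally have nz: "nrm Z z'' <= sqrt ((nrm Z z)\<^sup>2 + (nrm Z z')\<^sup>2)" .
 have nx: "nrm X x'' <= sqrt ((nrm X x)\<^sup>2 + (nrm X x')\<^sup>2)" unfolding x''_def by (rule nrm_vec_splitting[OF F x sp]) auto show ?thesis
  by (rule that[OF x''(1) z'' eq mult_mono[OF nx nz]]) (simp_all add: z'')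
qed

text \<open>A relation and not an infimum: the merged sum meets its bound, so no slack
  accumulates.\<close>

definition row_gauge :: "'h set => ('h => 'm) => 'z cnormed_space => (('m => 'm) => 'z => 'z) => real => 'z => bool" where
 "row_gauge F e Z l a v \<longleftrightarrow> (\<exists>x z. x \<in> carrier X & z \<in> carrier Z & l (rowop F e x) z = v & nrm X x * nrm Z z <= a)"

lemma row_gauge_add:
 assumes inf: "infinite_dimensional L" and Z: "left_semi_ruan_module L Z l" and F: "H.onf F (%h. h)" and e: "L.onf F e"
  and "row_gauge F e Z l a u" "row_gauge F e Z l b v" shows "row_gauge F e Z l (a + b) (u \<oplus>\<^bsub>Z\<^esub> v)" proof -
 interpret Z: left_semi_ruan_module L Z l by fact
 note Z' = Z.contractive_left_module_axioms
 obtain x z where x: "x \<in> carrier X" "z \<in> carrier Z" "l (rowop F e x) z = u" "nrm X x * nrm Z z <= a" using assms(5) by (auto simp: row_gauge_def)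
 obtain x' z' where x': "x' \<in> carrier X" "z' \<in> carrier Z" "l (rowop F e x') z' = v" "nrm X x' * nrm Z z' <= b" using assms(6) by (auto simp: row_gauge_def)
 obtain x1 z1 where x1: "x1 \<in> carrier X" "z1 \<in> carrier Z" "l (rowop F e x1) z1 = l (rowop F e x) z"
  "nrm X x1 = nrm Z z1" "(nrm X x1)\<^sup>2 = nrm X x * nrm Z z" using rowop_rescale[OF Z' F e x(1,2)] by blast
 obtain x2 z2 where x2: "x2 \<in> carrier X" "z2 \<in> carrier Z" "l (rowop F e x2) z2 = l (rowop F e x') z'"
  "nrm X x2 = nrm Z z2" "(nrm X x2)\<^sup>2 = nrm X x' * nrm Z z'" using rowop_rescale[OF Z' F e x'(1,2)] by blast
 obtain x3 z3 where x3: "x3 \<in> carrier X" "z3 \<in> carrier Z"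
  "l (rowop F e x3) z3 = l (rowop F e x1) z1 \<oplus>\<^bsub>Z\<^esub> l (rowop F e x2) z2"
  "nrm X x3 * nrm Z z3 <= sqrt ((nrm X x1)\<^sup>2 + (nrm X x2)\<^sup>2) * sqrt ((nrm Z z1)\<^sup>2 + (nrm Z z2)\<^sup>2)"
  using rowop_merge[OF inf Z F e x1(1) x2(1) x1(2) x2(2)] by blast
 \<comment> \<open>After rescaling both radicands agree, and each square is the weight of one
   summand.\<close>
 have "sqrt ((nrm X x1)\<^sup>2 + (nrm X x2)\<^sup>2) * sqrt ((nrm Z z1)\<^sup>2 + (nrm Z z2)\<^sup>2) = (nrm X x1)\<^sup>2 + (nrm X x2)\<^sup>2" by (simp flip: x1(4) x2(4))
 with x3(4) x1(5) x2(5) x(4) x'(4) have "nrm X x3 * nrm Z z3 <= a + b" by simp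
 with x3 x1(3) x2(3) x(3) x'(3) show ?thesis unfolding row_gauge_def by auto
qed

lemma row_gauge_flift:
 assumes inf: "infinite_dimensional L" and Z: "left_semi_ruan_module L Z l"
  and F: "H.onf F (%h. h)" and e: "L.onf F e" and q: "pkeys q <= carrier X \<times> carrier Z"
 shows "row_gauge F e Z l (wsum (%k. nrm X (fst k) * nrm Z (snd k)) q) (flift Z (%(x, z). l (rowop F e x) z) q)" proof -
 interpret Z: left_semi_ruan_module L Z l by fact
 interpret cvec_pair X Z by unfold_locales
 note bil = bilinear_rowop[OF Z.contractive_left_module_axioms F e] show ?thesis proof (rule flift_gauge[OF Z.cvec_axioms bilinear_on_closed[OF bil] q])
  have "l (rowop F e \<zero>\<^bsub>X\<^esub>) \<zero>\<^bsub>Z\<^esub> = \<zero>\<^bsub>Z\<^esub>"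
   by (rule clinear_on_zero[OF Z.cvec_axioms Z.cvec_axioms Z.lact_linear[OF rowop_bounded[OF F e X.M.zero_closed]]])
  then show "row_gauge F e Z l 0 \<zero>\<^bsub>Z\<^esub>" unfolding row_gauge_def by (intro exI[of _ "\<zero>\<^bsub>X\<^esub>"] exI[of _ "\<zero>\<^bsub>Z\<^esub>"]) simp
  fix a c u assume "row_gauge F e Z l a u"
  then obtain x z where x: "x \<in> carrier X" "z \<in> carrier Z" "l (rowop F e x) z = u" "nrm X x * nrm Z z <= a" by (auto simp: row_gauge_def)
  have "nrm X x * nrm Z (c \<odot>\<^bsub>Z\<^esub> z) <= cmod c * a" using mult_left_mono[OF x(4), of "cmod c"] x by (simp add: Z.nrm_smult mult_ac)
  then show "row_gauge F e Z l (cmod c * a) (c \<odot>\<^bsub>Z\<^esub> u)" unfolding row_gauge_def using x Z.lact_vsmult[OF rowop_bounded[OF F e x(1)] x(2), of c]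
   by (intro exI[of _ x] exI[of _ "c \<odot>\<^bsub>Z\<^esub> z"]) auto
 next
  fix k assume "k \<in> carrier X \<times> carrier Z"
  then show "row_gauge F e Z l (nrm X (fst k) * nrm Z (snd k)) (case k of (x, z) => l (rowop F e x) z)"
   unfolding row_gauge_def by (intro exI[of _ "fst k"] exI[of _ "snd k"]) (auto simp: split_beta)
 qed (rule row_gauge_add[OF inf Z F e])
qed

text \<open>If \<open>\<alpha> w\<close> is in the range of a row over \<open>Z\<close>, then a pseudo-inverse of the row finds a preimage of \<open>w\<close> in \<open>Y\<close>.\<close>

lemma row_gauge_isometric:
 assumes Y: "contractive_left_module L Y lY" and Z: "contractive_left_module L Z lZ" and \<alpha>: "left_morphism L Y lY Z lZ \<alpha>" "isometric_on Y Z \<alpha>"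
  and F: "H.onf F (%h. h)" and e: "L.onf F e" and w: "w \<in> carrier Y" and g: "row_gauge F e Z lZ a (\<alpha> w)" shows "row_gauge F e Y lY a w" proof -
 interpret Y: contractive_left_module L Y lY by fact
 interpret Z: contractive_left_module L Z lZ by fact
 have al: "clinear_on Y Z \<alpha>" and am: "!!a u. a \<in> bounded_ops L ==> u \<in> carrier Y ==> \<alpha> (lY a u) = lZ a (\<alpha> u)"
  and ai: "!!u. u \<in> carrier Y ==> nrm Z (\<alpha> u) = nrm Y u" using \<alpha> by (auto simp: left_morphism_def isometric_on_def)
 obtain x z where x: "x \<in> carrier X" "z \<in> carrier Z" "lZ (rowop F e x) z = \<alpha> w" "nrm X x * nrm Z z <= a" using g by (auto simp: row_gauge_def)
 note FD = H.onfD[OF F]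
 note T = rowop_bounded[OF F e x(1)]
 have c: "(%h. comp h x) \<in> F \<rightarrow> carrier L" using FD comp_closed' x by auto
 obtain s p where s: "s \<in> bounded_ops L" "p \<in> projections L"
  "compose (carrier L) s (rowop F e x) = p" "compose (carrier L) (rowop F e x) p = rowop F e x" using L.pseudo_inverse[OF e c] unfolding rowop_def by blast
 note p = L.projection_bounded[OF s(2)]
 define y where "y = lY s w"
 have y: "y \<in> carrier Y" unfolding y_def by (rule Y.lact_closed[OF s(1) w])
 \<comment> \<open>\<open>s\<close> applied to \<open>T(x) z\<close> is \<open>p z\<close>, so
   \<open>y\<close> has the image \<open>p z\<close> in \<open>Z\<close>, and its norm is at most
   that of \<open>z\<close>.\<close>
 have ay: "\<alpha> y = lZ p z" unfolding y_def am[OF s(1) w] x(3)[symmetric] Z.lact_compose[OF s(1) T x(2), symmetric] s(3) ..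
 have ny: "nrm Y y <= nrm Z z" using Z.lact_contraction[OF p L.projection_contr[OF s(2)] x(2)] ai[OF y] ay by simp
 have "\<alpha> (lY (rowop F e x) y) = \<alpha> w" unfolding am[OF T y] ay Z.lact_compose[OF T p x(2), symmetric] s(4) by (rule x(3))
 then have "nrm Z (\<alpha> (lY (rowop F e x) y \<ominus>\<^bsub>Y\<^esub> w)) = 0"
  using clinear_on_minus[OF Y.cvec_axioms Z.cvec_axioms al Y.lact_closed[OF T y] w] clinear_onD(1)[OF al w] by simp
 then have "lY (rowop F e x) y \<ominus>\<^bsub>Y\<^esub> w = \<zero>\<^bsub>Y\<^esub>" using ai Y.nrm_eq_0_iff Y.lact_closed[OF T y] w by simp
 then have "lY (rowop F e x) y = w" using Y.minus_eq_zero_iff Y.lact_closed[OF T y] w by simp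
 moreover have "nrm X x * nrm Y y <= a" using mult_left_mono[OF ny X.nrm_nonneg[OF x(1)]] x(4) by linarith
 ultimately show ?thesis unfolding row_gauge_def using x(1) y by blast
qed

text \<open>\<open>a\<close> and \<open>d\<close> are the compressions of the given formal sum and
  of the new elementary tensor; \<open>b\<close> is the collected form of \<open>a\<close>, and
  \<open>c\<close> the elementary tensor with zeta to which both lead.\<close>

lemma collect_chain:
 assumes "weighted_relations S w K" "a - b \<in> K" "b - c \<in> K" "d - c \<in> K" shows "a - d \<in> K" proof -
 interpret weighted_relations S w K by fact
 have "a - d = (a - b) + (b - c) - (d - c)" by simp
 then show ?thesis using K_diff[OF K_add[OF assms(2,3)] assms(4)] by simp
qed

theorem ESR_flat_columns:
 assumes inf: "infinite_dimensional L" shows "ESR_flat L X (%x a. ract x a) TYPE('y) TYPE('z)" unfolding ESR_flat_def proof (intro conjI allI impI contractive_right)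
 fix Y :: "'y cnormed_space" and lY and Z :: "'z cnormed_space" and lZ \<alpha>
 assume Y: "left_semi_ruan_module L Y lY" and Z: "left_semi_ruan_module L Z lZ"
  and \<alpha>: "left_morphism L Y lY Z lZ \<alpha>" "isometric_on Y Z \<alpha>"
 interpret Y: left_semi_ruan_module L Y lY by fact
 interpret Z: left_semi_ruan_module L Z lZ by fact
 interpret A: normed_pair X Y by unfold_locales
 interpret B: normed_pair X Z by unfold_locales
 have al: "clinear_on Y Z \<alpha>" and am: "!!a u. a \<in> bounded_ops L ==> u \<in> carrier Y ==> \<alpha> (lY a u) = lZ a (\<alpha> u)"
  and ai: "!!u. u \<in> carrier Y ==> nrm Z (\<alpha> u) = nrm Y u" using \<alpha> by (auto simp: left_morphism_def isometric_on_def)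
 let ?r = "%x a. ract x a"
 let ?R = "balanced_relations L X ?r Y lY" and ?R' = "balanced_relations L X ?r Z lZ"
 have R: "?R <= carrier (fmod X Y)" by (rule A.balanced_relations_subset) (simp_all add: ract_closed Y.lact_closed)
 have R': "?R' <= carrier (fmod X Z)" by (rule B.balanced_relations_subset) (simp_all add: ract_closed Z.lact_closed)
 have kA: "balanced_kernel L X ?r Y lY = A.rker ?R" unfolding balanced_kernel_def by (subst A.tcls_balanced_relations) (simp_all add: ract_closed Y.lact_closed)
 have kB: "balanced_kernel L X ?r Z lZ = B.rker ?R'" unfolding balanced_kernel_def by (subst B.tcls_balanced_relations) (simp_all add: ract_closed Z.lact_closed)
 interpret KA: weighted_relations A.S A.w "A.rspan ?R" by (rule A.weighted_rspan[OF R])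
 interpret KB: weighted_relations B.S B.w "B.rspan ?R'" by (rule B.weighted_rspan[OF R'])
 let ?j = "map_prod (%x. x) \<alpha>"
 have j: "?j \<in> A.S \<rightarrow> B.S" using clinear_onD(1)[OF al] by auto
 show "isometric_on (balanced_tensor L X ?r Y lY) (balanced_tensor L X ?r Z lZ)
   (quotient_map (proj_tensor X Z) (balanced_kernel L X ?r Z lZ) (tensor_map X Z (%x. x) \<alpha>))" unfolding balanced_tensor_def kA kB
 proof (rule isometric_on_quotient_proj[OF A.normed_pair_axioms B.normed_pair_axioms clinear_on_id al _ _ R R'])
  fix r assume "r \<in> ?R"
  then obtain a x y where r: "a \<in> bounded_ops L" "x \<in> carrier X" "y \<in> carrier Y"
   "r = sng (ract x a, y) 1 - sng (x, lY a y) 1" by (auto simp: balanced_relations_def)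
  have "fmap ?j r = sng (ract x a, \<alpha> y) 1 - sng (x, lZ a (\<alpha> y)) 1" unfolding r(4) fmap_diff fmap_single using am[OF r(1,3)] by simp
  then show "fmap ?j r \<in> ?R'" using r clinear_onD(1)[OF al r(3)] by (auto simp: balanced_relations_def)
 next
  fix p :: "'x \<times> 'y \<Rightarrow>\<^sub>0 complex" assume p: "pkeys p <= A.S"
  show "KA.pn p <= KB.pn (fmap ?j p)" proof (rule pnorm_le_pnorm_fmap[OF KA.weighted_relations_axioms KB.weighted_relations_axioms p j Y.cvec_axioms Z.cvec_axioms al])
   fix d :: real assume d: "d > 0"
   \<comment> \<open>If every first factor of \<open>p\<close> is moved by at most
     \<open>d / (c + 1)\<close>, the total error is at most \<open>d\<close>; the summand 1 covers
     \<open>c = 0\<close>.\<close>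
   define c where "c = wsum (%k. nrm Y (snd k)) p"
   have c: "c \<ge> 0" unfolding c_def using p by (intro wsum_nonneg) auto
   \<comment> \<open>\<open>F\<close> is adapted to the finitely many first factors of
     \<open>p\<close>, before any representation over \<open>Z\<close> is considered.\<close>
   obtain F where F: "H.onf F (%h. h)" "!!x. x \<in> fst ` pkeys p ==> nrm X (x \<ominus>\<^bsub>X\<^esub> rproj F x) < d / (c + 1)" proof -
    have "fst ` pkeys p <= carrier X" "0 < d / (c + 1)" using p d c by auto
    from approx[OF finite_imageI[OF finite_keys] this] show ?thesis using that by blast
   qed
   obtain e where e: "L.onf F e" using L.exists_onf_family[OF inf H.onfD(1)[OF F(1)]] by blast
   let ?W = "%(x, y). lY (rowop F e x) y" and ?W' = "%(x, z). lZ (rowop F e x) z"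
   note bilY = bilinear_rowop[OF Y.contractive_left_module_axioms F(1) e]
   note bilZ = bilinear_rowop[OF Z.contractive_left_module_axioms F(1) e]
   note WY = A.bilinear_on_closed[OF bilY] and WZ = B.bilinear_on_closed[OF bilZ]
   note T = rowop_bounded[OF F(1) e]
   let ?\<zeta> = "vec F e"
   have \<zeta>: "?\<zeta> \<in> carrier X" using L.onfD(2)[OF e] by (intro vec_closed[OF F(1)]) auto
   \<comment> \<open>The compression of \<open>x\<close> is zeta times \<open>T(x)\<close>, and a
     balanced relation moves \<open>T(x)\<close> to \<open>y\<close>.\<close>
   have collect: "sng (rproj F x, y) 1 - sng (?\<zeta>, lY (rowop F e x) y) 1 \<in> A.rspan ?R"
    if "x \<in> carrier X" "y \<in> carrier Y" for x y using that T[OF that(1)] \<zeta> ract_zeta[OF F(1) e that(1)]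
    by (intro FM.cspan_inc UnI2) (auto simp: balanced_relations_def intro!: exI[of _ "rowop F e x"] exI[of _ ?\<zeta>] exI[of _ y])
   \<comment> \<open>The relations hold exactly under \<open>?W'\<close>, although it involves a
     compression: rows turn right multiplication into composition.\<close>
   have WZr: "flift Z ?W' r = \<zero>\<^bsub>Z\<^esub>" if r: "r \<in> B.rspan ?R'" for r proof (rule B.flift_cspan_relations[OF Z.cvec_axioms bilZ R' _ r])
    fix r assume "r \<in> ?R'"
    then obtain a x z where r: "a \<in> bounded_ops L" "x \<in> carrier X" "z \<in> carrier Z"
     "r = sng (ract x a, z) 1 - sng (x, lZ a z) 1" by (auto simp: balanced_relations_def)
    have k: "(ract x a, z) \<in> B.S" "(x, lZ a z) \<in> B.S" using r ract_closed Z.lact_closed by auto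
    have "lZ (rowop F e (ract x a)) z = lZ (rowop F e x) (lZ a z)" unfolding rowop_ract[OF F(1) e r(2,1)] by (rule Z.lact_compose[OF T[OF r(2)] r(1,3)])
    then show "flift Z ?W' r = \<zero>\<^bsub>Z\<^esub>" unfolding r(4) flift_diff[OF Z.cvec_axioms WZ pkeys_sng_subset[OF k(1)] pkeys_sng_subset[OF k(2)]]
     using funcset_mem[OF WZ k(1)] funcset_mem[OF WZ k(2)] by (simp add: flift_single[OF Z.cvec_axioms])
   qed
   have main: "KA.pn p <= wsum B.w q + d"
    if q: "pkeys q <= B.S" "flift Z ?W' q = \<alpha> (flift Y ?W p)" for q proof -
    let ?w = "flift Y ?W p"
    have w: "?w \<in> carrier Y" by (rule flift_closed[OF Y.cvec_axioms p WY])
    have "row_gauge F e Z lZ (wsum B.w q) (\<alpha> ?w)" using row_gauge_flift[OF inf Z F(1) e q(1)] q(2) by simp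
    then have "row_gauge F e Y lY (wsum B.w q) ?w" by (rule row_gauge_isometric[OF Y.contractive_left_module_axioms Z.contractive_left_module_axioms \<alpha> F(1) e w])
    then obtain x y where x: "x \<in> carrier X" "y \<in> carrier Y" "lY (rowop F e x) y = ?w" "nrm X x * nrm Y y <= wsum B.w q"
     unfolding row_gauge_def by (elim exE conjE) (rule that)
    \<comment> \<open>\<open>fmap ?f p\<close> is the compression of \<open>p\<close>. It is
      congruent to \<open>fmap ?g p\<close>, whose first factor is constantly zeta, hence to the
      tensor of zeta and \<open>?w\<close>, and so to the compression of \<open>x\<close> tensored
      with \<open>y\<close>, which has small enough weight.\<close>
    let ?f = "%k. (rproj F (fst k), snd k)" and ?g = "%k. (?\<zeta>, ?W k)"
    have f: "?f \<in> A.S \<rightarrow> A.S" using rproj_closed[OF F(1)] by (simp add: Pi_iff mem_Times_iff)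
    have g: "?g \<in> A.S \<rightarrow> A.S" using WY \<zeta> by (simp add: Pi_iff mem_Times_iff)
    have fp: "pkeys (fmap ?f p) \<subseteq> A.S" and gp: "pkeys (fmap ?g p) \<subseteq> A.S" by (rule fmap_keys[OF f p], rule fmap_keys[OF g p])
    have "fmap ?f p - fmap ?g p \<in> A.rspan ?R"
     unfolding flift_free_diff[OF f g p] by (rule KA.K_flift[OF _ p]) (use collect in \<open>simp add: mem_Times_iff case_prod_beta\<close>)
    moreover have "fmap ?g p - sng (?\<zeta>, ?w) 1 \<in> A.rspan ?R" using A.collect_right[OF \<zeta> WY p] A.tensor_kernel_rspan by (rule rev_subsetD)
    moreover have "sng (rproj F x, y) 1 - sng (?\<zeta>, ?w) 1 \<in> A.rspan ?R" using collect[OF x(1,2)] x(3) by simp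
    ultimately have "fmap ?f p - sng (rproj F x, y) 1 \<in> A.rspan ?R" by (rule collect_chain[OF KA.weighted_relations_axioms])
    then have "KA.pn (fmap ?f p) = KA.pn (sng (rproj F x, y) 1)" by (rule KA.pn_cong)
    also have "... <= nrm X (rproj F x) * nrm Y y" using KA.pn_le_wsum[of "sng (rproj F x, y) 1"] rproj_closed[OF F(1) x(1)] x(2) by simp
    also have "... <= nrm X x * nrm Y y" using nrm_rproj_le[OF F(1) x(1)] x(2) by (intro mult_right_mono) auto
    finally have 1: "KA.pn (fmap ?f p) <= wsum B.w q" using x(4) by simp
    have "KA.pn (p - fmap ?f p) <= wsum (%k. d / (c + 1) * nrm Y (snd k)) p" proof -
     have "p - fmap ?f p = flift (free_module A.S) (%k. sng k 1 - sng (?f k) 1) p" using flift_free_diff[of "%k. k" A.S A.S ?f p] f p by (simp add: fmap_id)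
     also have "KA.pn ... <= wsum (%k. d / (c + 1) * nrm Y (snd k)) p" proof (rule KA.pn_flift_le[of "pkeys p"])
      fix k assume k: "k \<in> pkeys p"
      then have kk: "fst k \<in> carrier X" "snd k \<in> carrier Y" "k = (fst k, snd k)" using p by auto
      show "pkeys (sng k 1 - sng (?f k) 1) \<subseteq> A.S" using k p f by (intro pkeys_subset) auto
      have "KA.pn (sng k 1 - sng (?f k) 1) <= nrm X (fst k \<ominus>\<^bsub>X\<^esub> rproj F (fst k)) * nrm Y (snd k)"
       using A.pn_diff_left[OF R kk(1) rproj_closed[OF F(1) kk(1)] kk(2)] by simp
      also have "... <= d / (c + 1) * nrm Y (snd k)" using F(2)[of "fst k"] k kk(2) by (intro mult_right_mono) auto
      finally show "KA.pn (sng k 1 - sng (?f k) 1) <= d / (c + 1) * nrm Y (snd k)" .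
     qed simp
     finally show ?thesis .
    qed
    also have "... = d / (c + 1) * c" unfolding c_def wsum_def sum_distrib_left by (intro sum.cong) auto
    also have "... <= d" using c d by (simp add: field_simps)
    finally have "KA.pn (p - fmap ?f p) <= d" .
    with 1 KA.pn_triangle[OF p fp] show ?thesis by simp
   qed
   show "\<exists>W W'. W \<in> A.S \<rightarrow> carrier Y & W' \<in> B.S \<rightarrow> carrier Z & (\<forall>s\<in>A.S. W' (?j s) = \<alpha> (W s)) &
    (\<forall>r\<in>B.rspan ?R'. flift Z W' r = \<zero>\<^bsub>Z\<^esub>) &
    (\<forall>q. pkeys q <= B.S --> flift Z W' q = \<alpha> (flift Y W p) --> KA.pn p <= wsum B.w q + d)"
    using WY WZ WZr main am T by (intro exI[of _ ?W] exI[of _ ?W'] conjI) auto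
  qed
 qed (use ai in auto)
qed

end

section \<open>Bimodules of tensors of columns\<close>

context columns
begin

text \<open>The mirror image of \<open>rowop\<close>: a sum of terms |x_h><e h|. Left multiplication
  of \<open>x\<close> becomes left composition, and the operator sends zeta to the compression of
  \<open>x\<close>.\<close>

definition colop :: "'h set => ('h => 'm) => 'x => 'm => 'm" where
 "colop F e x = M.fro F (%h. comp h x) e"

lemma comp_funcset: "H.onf F (%h. h) ==> x \<in> carrier X ==> (%h. comp h x) \<in> F \<rightarrow> carrier M"
 using H.onfD(3)[of F "%h. h"] comp_closed by auto

lemma colop_bounded: "H.onf F (%h. h) ==> M.onf F e ==> x \<in> carrier X ==> colop F e x \<in> bounded_ops M"
 unfolding colop_def by (rule M.fro_bounded) (simp_all add: H.onfD(1) M.onfD(2) comp_funcset)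

lemma colop_add:
 assumes "H.onf F (%h. h)" "M.onf F e" "x \<in> carrier X" "x' \<in> carrier X"
 shows "colop F e (x \<oplus>\<^bsub>X\<^esub> x') = (\<lambda>z\<in>carrier M. colop F e x z \<oplus>\<^bsub>M\<^esub> colop F e x' z)" proof -
 note FD = H.onfD[OF assms(1)] and eD = M.onfD[OF assms(2)]
 note c = comp_funcset[OF assms(1)]
 have "colop F e (x \<oplus>\<^bsub>X\<^esub> x') = M.fro F (%h. comp h x \<oplus>\<^bsub>M\<^esub> comp h x') e"
  unfolding colop_def using FD assms comp_add comp_closed by (intro M.fro_cong) auto
 also have "... = (\<lambda>z\<in>carrier M. colop F e x z \<oplus>\<^bsub>M\<^esub> colop F e x' z)"
  unfolding colop_def by (rule M.fro_add_left[OF FD(1) c[OF assms(3)] c[OF assms(4)] eD(2)])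
 finally show ?thesis .
qed

lemma colop_smult:
 assumes "H.onf F (%h. h)" "M.onf F e" "x \<in> carrier X"
 shows "colop F e (c \<odot>\<^bsub>X\<^esub> x) = (\<lambda>z\<in>carrier M. c \<odot>\<^bsub>M\<^esub> colop F e x z)" proof -
 note FD = H.onfD[OF assms(1)] and eD = M.onfD[OF assms(2)]
 have "colop F e (c \<odot>\<^bsub>X\<^esub> x) = M.fro F (%h. c \<odot>\<^bsub>M\<^esub> comp h x) e"
  unfolding colop_def using FD assms comp_smult comp_closed by (intro M.fro_cong) auto
 also have "... = (\<lambda>z\<in>carrier M. c \<odot>\<^bsub>M\<^esub> colop F e x z)"
  unfolding colop_def by (rule M.fro_smult_left[OF FD(1) comp_funcset[OF assms(1,3)] eD(2)])
 finally show ?thesis .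
qed

lemma colop_act:
 assumes "H.onf F (%h. h)" "M.onf F e" "x \<in> carrier X" and a: "a \<in> bounded_ops M" shows "colop F e (act a x) = compose (carrier M) a (colop F e x)" proof -
 note FD = H.onfD[OF assms(1)] and eD = M.onfD[OF assms(2)]
 have "compose (carrier M) a (colop F e x) = M.fro F (%h. a (comp h x)) e" unfolding colop_def by (rule M.compose_fro_left[OF a FD(1) comp_funcset[OF assms(1,3)] eD(2)])
 also have "... = colop F e (act a x)" unfolding colop_def
  by (rule M.fro_cong) (simp_all add: FD(3) assms(3) comp_act[OF a] comp_funcset[OF assms(1) act_closed[OF a assms(3)]])
 finally show ?thesis ..
qed

lemma act_zeta:
 assumes F: "H.onf F (%h. h)" and e: "M.onf F e" and x: "x \<in> carrier X" shows "act (colop F e x) (vec F e) = rproj F x" proof -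
 note eD = M.onfD[OF e]
 note c = comp_funcset[OF F x]
 have "act (colop F e x) (vec F e) = vec F (%h. colop F e x (e h))" by (rule act_vec[OF colop_bounded[OF F e x] F eD(2)])
 also have "... = rproj F x" by (rule vec_cong[OF F c]) (simp add: colop_def M.fro_onf[OF e c])
 finally show ?thesis .
qed

lemma colop_vec_comb:
 assumes F: "H.onf F (%h. h)" and e: "M.onf F e" and x: "x \<in> carrier X" "x' \<in> carrier X" and st: "s \<in> bounded_ops M" "t \<in> bounded_ops M"
 defines "x'' == vec F (%h. s (comp h x) \<oplus>\<^bsub>M\<^esub> t (comp h x'))"
 shows "x'' \<in> carrier X"
  and "colop F e x'' = (\<lambda>z\<in>carrier M. compose (carrier M) s (colop F e x) z \<oplus>\<^bsub>M\<^esub> compose (carrier M) t (colop F e x') z)" proof -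
 note FD = H.onfD[OF F] and eD = M.onfD[OF e]
 note c = comp_funcset[OF F]
 have sc: "(%h. s (comp h x)) \<in> F \<rightarrow> carrier M" "(%h. t (comp h x')) \<in> F \<rightarrow> carrier M"
  using st[THEN M.bounded_opsD(3)] c[OF x(1)] c[OF x(2)] by (auto simp: Pi_iff)
 then have f: "(%h. s (comp h x) \<oplus>\<^bsub>M\<^esub> t (comp h x')) \<in> F \<rightarrow> carrier M" by (auto simp: Pi_iff)
 show "x'' \<in> carrier X" unfolding x''_def by (rule vec_closed[OF F f])
 have "colop F e x'' = M.fro F (%h. s (comp h x) \<oplus>\<^bsub>M\<^esub> t (comp h x')) e"
  unfolding colop_def x''_def by (rule M.fro_cong[OF _ _ f]) (simp_all add: comp_vec[OF F f])
 also have "... = (\<lambda>z\<in>carrier M. M.fro F (%h. s (comp h x)) e z \<oplus>\<^bsub>M\<^esub> M.fro F (%h. t (comp h x')) e z)"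
  by (rule M.fro_add_left[OF FD(1) sc eD(2)])
 finally show "colop F e x'' = (\<lambda>z\<in>carrier M. compose (carrier M) s (colop F e x) z \<oplus>\<^bsub>M\<^esub> compose (carrier M) t (colop F e x') z)"
  unfolding colop_def M.compose_fro_left[OF st(1) FD(1) c[OF x(1)] eD(2)] M.compose_fro_left[OF st(2) FD(1) c[OF x(2)] eD(2)] .
qed

lemma colop_splitting:
 assumes F: "H.onf F (%h. h)" and e: "M.onf F e" and x: "x \<in> carrier X" and p: "p \<in> bounded_ops M" "!!h. h \<in> F ==> p (comp h x) = comp h x"
 shows "compose (carrier M) p (colop F e x) = colop F e x" unfolding colop_def M.compose_fro_left[OF p(1) H.onfD(1)[OF F] comp_funcset[OF F x] M.onfD(2)[OF e]]
 by (rule M.fro_cong[OF _ _ comp_funcset[OF F x]]) (simp_all add: p)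

lemma nrm_vec_splitting':
 assumes F: "H.onf F (%h. h)" and x: "x \<in> carrier X" "x' \<in> carrier X"
  and sp: "M.splitting A s t p" and A: "!!h. h \<in> F ==> comp h x \<in> A" "!!h. h \<in> F ==> comp h x' \<in> A"
 shows "nrm X (vec F (%h. s (comp h x) \<oplus>\<^bsub>M\<^esub> t (comp h x'))) <= sqrt ((nrm X x)\<^sup>2 + (nrm X x')\<^sup>2)" proof (rule real_le_rsqrt)
 note c = comp_funcset[OF F]
 have st: "s \<in> bounded_ops M" "t \<in> bounded_ops M" using sp by (auto simp: M.splitting_def)
 have f: "(%h. s (comp h x) \<oplus>\<^bsub>M\<^esub> t (comp h x')) \<in> F \<rightarrow> carrier M"
  using st[THEN M.bounded_opsD(3)] c[OF x(1)] c[OF x(2)] by (auto simp: Pi_iff)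
 have "(nrm X (vec F (%h. s (comp h x) \<oplus>\<^bsub>M\<^esub> t (comp h x'))))\<^sup>2 = (\<Sum>h\<in>F. (M.N (comp h x))\<^sup>2 + (M.N (comp h x'))\<^sup>2)"
  unfolding nrm_vec[OF F f] using M.splitting_N[OF sp] A c[OF x(1)] c[OF x(2)] by (intro sum.cong) (auto simp: Pi_iff)
 also have "... <= (nrm X x)\<^sup>2 + (nrm X x')\<^sup>2" using sum_comp_le[OF F x(1)] sum_comp_le[OF F x(2)] by (simp add: sum.distrib)
 finally show "(nrm X (vec F (%h. s (comp h x) \<oplus>\<^bsub>M\<^esub> t (comp h x'))))\<^sup>2 <= (nrm X x)\<^sup>2 + (nrm X x')\<^sup>2" .
qed

text \<open>The adjoint of the statement for rows; products are reversed and the projection is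
  unchanged.\<close>

lemma colop_pseudo_inverse:
 assumes F: "H.onf F (%h. h)" and e: "M.onf F e" and x: "x \<in> carrier X" obtains s p where "s \<in> bounded_ops M" "p \<in> projections M"
  "compose (carrier M) (colop F e x) s = p" "compose (carrier M) p (colop F e x) = colop F e x" proof -
 note FD = H.onfD[OF F] and eD = M.onfD[OF e]
 note c = comp_funcset[OF F x]
 let ?t = "M.fro F e (%h. comp h x)"
 have t: "?t \<in> bounded_ops M" by (rule M.fro_bounded[OF FD(1) eD(2) c])
 have at: "adjoint_op M ?t = colop F e x" unfolding colop_def by (rule M.adjoint_fro[OF FD(1) eD(2) c])
 obtain s p where s: "s \<in> bounded_ops M" "p \<in> projections M"
  "compose (carrier M) s ?t = p" "compose (carrier M) ?t p = ?t" using M.pseudo_inverse[OF e c] by blast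
 have ap: "adjoint_op M p = p" using s(2) by (simp add: projections_def) show ?thesis proof (rule that[OF M.adjoint_bounded[OF s(1)] s(2)])
  show "compose (carrier M) (colop F e x) (adjoint_op M s) = p" using M.adjoint_compose[OF s(1) t] unfolding s(3) at ap by simp
  show "compose (carrier M) p (colop F e x) = colop F e x" using M.adjoint_compose[OF t M.projection_bounded[OF s(2)]] unfolding s(4) at ap by simp
 qed
qed

lemma clinear_rproj:
 assumes F: "H.onf F (%h. h)" shows "clinear_on X X (%x. rproj F x)" proof (rule clinear_onI)
 note FD = H.onfD[OF F]
 have c: "emb h (comp h x) \<in> carrier X" if "h \<in> F" "x \<in> carrier X" for h x using emb_closed comp_closed FD(3) that by simp
 have l: "clinear_on X X (%x. emb h (comp h x))" if "h \<in> F" for h by (rule clinear_on_comp[OF comp_linear[OF FD(3)[OF that]] emb_linear[OF FD(3)[OF that]]])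
 fix x assume x: "x \<in> carrier X"
 show "rproj F x \<in> carrier X" by (rule rproj_closed[OF F x])
 have "rproj F (a \<odot>\<^bsub>X\<^esub> x) = (\<Oplus>\<^bsub>X\<^esub>h\<in>F. a \<odot>\<^bsub>X\<^esub> emb h (comp h x))" for a
  unfolding vec_def by (rule X.M.finsum_cong') (simp_all add: c x clinear_onD(3)[OF l])
 then show "rproj F (a \<odot>\<^bsub>X\<^esub> x) = a \<odot>\<^bsub>X\<^esub> rproj F x" for a
  using X.finsum_smult[OF FD(1), of "%h. emb h (comp h x)" a] c x by (auto simp: vec_def)
 fix y assume y: "y \<in> carrier X"
 have "rproj F (x \<oplus>\<^bsub>X\<^esub> y) = (\<Oplus>\<^bsub>X\<^esub>h\<in>F. emb h (comp h x) \<oplus>\<^bsub>X\<^esub> emb h (comp h y))"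
  unfolding vec_def by (rule X.M.finsum_cong') (simp_all add: c x y clinear_onD(2)[OF l])
 also have "... = rproj F x \<oplus>\<^bsub>X\<^esub> rproj F y" unfolding vec_def by (rule X.M.finsum_addf) (use c x y in auto)
 finally show "rproj F (x \<oplus>\<^bsub>X\<^esub> y) = rproj F x \<oplus>\<^bsub>X\<^esub> rproj F y" .
qed

end

lemma (in cvec_pair) alg_tensor_eqI:
 assumes V: "cvec V" and f: "clinear_on (alg_tensor X Y) V f" and g: "clinear_on (alg_tensor X Y) V g"
  and eq: "!!x y. x \<in> carrier X ==> y \<in> carrier Y ==> f (tcls X Y (sng (x, y) 1)) = g (tcls X Y (sng (x, y) 1))"
  and u: "u \<in> carrier (alg_tensor X Y)" shows "f u = g u" proof -
 obtain p where p: "pkeys p <= S" "u = tcls X Y p" using u by (rule alg_tensor_cases)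
 have "f (tcls X Y p) = flift V (%k. g (tcls X Y (sng k 1))) p" by (rule flift_unique[OF V clinear_on_comp[OF clinear_tcls f] p(1)]) (use eq in auto)
 moreover have "g (tcls X Y p) = flift V (%k. g (tcls X Y (sng k 1))) p" by (rule flift_unique[OF V clinear_on_comp[OF clinear_tcls g] p(1)]) simp
 ultimately show ?thesis using p(2) by simp
qed

lemma clinear_on_add_fun:
 assumes "cvec W" "clinear_on V W f" "clinear_on V W g" shows "clinear_on V W (%u. f u \<oplus>\<^bsub>W\<^esub> g u)" proof -
 interpret W: cvec W by fact
 note f = clinear_onD[OF assms(2)] and g = clinear_onD[OF assms(3)] show ?thesis by (rule clinear_onI) (simp_all add: f g W.smult_add_right W.M.a_ac)
qed

lemma clinear_on_smult_fun:
 assumes "cvec W" "clinear_on V W f" shows "clinear_on V W (%u. c \<odot>\<^bsub>W\<^esub> f u)" proof -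
 interpret W: cvec W by fact
 note f = clinear_onD[OF assms(2)] show ?thesis by (rule clinear_onI) (simp_all add: f W.smult_add_right W.smult_smult mult.commute)
qed

lemma (in cvec_pair) tensor_map_elem:
 assumes "clinear_on X X f" "clinear_on Y Y g" "x \<in> carrier X" "y \<in> carrier Y" shows "tensor_map X Y f g (tcls X Y (sng (x, y) 1)) = tcls X Y (sng (f x, g y) 1)"
 using tensor_map_tcls[OF X.cvec_axioms Y.cvec_axioms X.cvec_axioms Y.cvec_axioms assms(1,2), of "sng (x, y) 1"] assms(3,4) by simp

text \<open>The algebraic axioms are checked on elementary tensors. Definiteness of the projective
  norm enters as the hypothesis \<open>n\<close>; for columns it comes from
  \<open>proj_tensor_normed\<close>.\<close>

lemma proj_contractive_bimodule:
 fixes X :: "'x cnormed_space" and Y :: "'y cnormed_space" assumes L: "hilbert_space L" and X: "contractive_left_module L X l" and Y: "contractive_right_module L Y r"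
  and n: "complex_normed_space (proj_tensor X Y)" shows "contractive_bimodule L (proj_tensor X Y) (proj_lact X l Y) (proj_ract X Y r)" proof -
 interpret L: hilbert_space L by fact
 interpret X: contractive_left_module L X l by fact
 interpret Y: contractive_right_module L Y r by fact
 interpret A: normed_pair X Y by unfold_locales
 interpret P: complex_normed_space "proj_tensor X Y" by fact
 note cv = X.cvec_axioms Y.cvec_axioms X.cvec_axioms Y.cvec_axioms
 note id = clinear_on_id
 have l: "clinear_on (alg_tensor X Y) (alg_tensor X Y) (proj_lact X l Y a)" if "a \<in> bounded_ops L" for a
  unfolding proj_lact_def by (rule clinear_tensor_map[OF cv X.lact_linear[OF that] id])
 have r: "clinear_on (alg_tensor X Y) (alg_tensor X Y) (%u. proj_ract X Y r u a)" if "a \<in> bounded_ops L" for a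
  unfolding proj_ract_def by (rule clinear_tensor_map[OF cv id Y.ract_linear[OF that]])
 have le: "proj_lact X l Y a (tcls X Y (sng (x, y) 1)) = tcls X Y (sng (l a x, y) 1)"
  if "a \<in> bounded_ops L" "x \<in> carrier X" "y \<in> carrier Y" for a x y unfolding proj_lact_def by (rule A.tensor_map_elem[OF X.lact_linear[OF that(1)] id that(2,3)])
 have re: "proj_ract X Y r (tcls X Y (sng (x, y) 1)) a = tcls X Y (sng (x, r y a) 1)"
  if "a \<in> bounded_ops L" "x \<in> carrier X" "y \<in> carrier Y" for a x y unfolding proj_ract_def by (rule A.tensor_map_elem[OF id Y.ract_linear[OF that(1)] that(2,3)])
 have lc: "l a x \<in> carrier X" if "a \<in> bounded_ops L" "x \<in> carrier X" for a x by (rule clinear_onD(1)[OF X.lact_linear[OF that(1)] that(2)])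
 have rc: "r y a \<in> carrier Y" if "a \<in> bounded_ops L" "y \<in> carrier Y" for a y by (rule clinear_onD(1)[OF Y.ract_linear[OF that(1)] that(2)])
 note cA = A.cvec_alg_tensor
 note eqI = A.alg_tensor_eqI[OF cA]
 note e1 = clinear_onD[OF A.elem_linear(1)] and e2 = clinear_onD[OF A.elem_linear(2)] show ?thesis
 proof (intro contractive_bimodule.intro contractive_left_module.intro contractive_right_module.intro
   contractive_left_module_axioms.intro contractive_right_module_axioms.intro contractive_bimodule_axioms.intro n)
  fix a assume a: "a \<in> bounded_ops L"
  show "clinear_on (proj_tensor X Y) (proj_tensor X Y) (proj_lact X l Y a)"
   "clinear_on (proj_tensor X Y) (proj_tensor X Y) (%u. proj_ract X Y r u a)" using l[OF a] r[OF a] by (simp_all add: clinear_on_def)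
  fix u assume "u \<in> carrier (proj_tensor X Y)"
  then have u: "u \<in> carrier (alg_tensor X Y)" by simp
  show "proj_lact X l Y (\<lambda>x\<in>carrier L. c \<odot>\<^bsub>L\<^esub> a x) u = c \<odot>\<^bsub>proj_tensor X Y\<^esub> proj_lact X l Y a u" for c
   unfolding proj_tensor_sel by (rule eqI[OF l[OF L.bounded_ops_smult[OF a]] clinear_on_smult_fun[OF cA l[OF a]] _ u])
    (simp add: le a L.bounded_ops_smult X.lact_smult e1(3) lc)
  show "proj_ract X Y r u (\<lambda>x\<in>carrier L. c \<odot>\<^bsub>L\<^esub> a x) = c \<odot>\<^bsub>proj_tensor X Y\<^esub> proj_ract X Y r u a" for c
   unfolding proj_tensor_sel by (rule eqI[OF r[OF L.bounded_ops_smult[OF a]] clinear_on_smult_fun[OF cA r[OF a]] _ u])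
    (simp add: re a L.bounded_ops_smult Y.ract_smult e2(3) rc)
  show "nrm (proj_tensor X Y) (proj_lact X l Y a u) <= op_norm L a * nrm (proj_tensor X Y) u" unfolding proj_lact_def proj_tensor_sel
   using proj_norm_tensor_map_le[OF A.normed_pair_axioms A.normed_pair_axioms X.lact_linear[OF a] id, of "op_norm L a" 1 u]
    X.lact_contractive[OF a] L.op_norm_nonneg[OF a] u by simp
  show "nrm (proj_tensor X Y) (proj_ract X Y r u a) <= nrm (proj_tensor X Y) u * op_norm L a" unfolding proj_ract_def proj_tensor_sel
   using proj_norm_tensor_map_le[OF A.normed_pair_axioms A.normed_pair_axioms id Y.ract_linear[OF a], of 1 "op_norm L a" u]
    Y.ract_contractive[OF a] L.op_norm_nonneg[OF a] u by (simp add: mult.commute)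
  fix b assume b: "b \<in> bounded_ops L"
  note ab = L.bounded_ops_add[OF a b] and ac = L.bounded_ops_compose[OF a b]
  show "proj_lact X l Y (\<lambda>x\<in>carrier L. a x \<oplus>\<^bsub>L\<^esub> b x) u = proj_lact X l Y a u \<oplus>\<^bsub>proj_tensor X Y\<^esub> proj_lact X l Y b u"
   unfolding proj_tensor_sel by (rule eqI[OF l[OF ab] clinear_on_add_fun[OF cA l[OF a] l[OF b]] _ u])
    (simp add: le a b ab X.lact_add e1(2) lc)
  show "proj_ract X Y r u (\<lambda>x\<in>carrier L. a x \<oplus>\<^bsub>L\<^esub> b x) = proj_ract X Y r u a \<oplus>\<^bsub>proj_tensor X Y\<^esub> proj_ract X Y r u b"
   unfolding proj_tensor_sel by (rule eqI[OF r[OF ab] clinear_on_add_fun[OF cA r[OF a] r[OF b]] _ u])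
    (simp add: re a b ab Y.ract_add e2(2) rc)
  show "proj_lact X l Y (compose (carrier L) a b) u = proj_lact X l Y a (proj_lact X l Y b u)" by (rule eqI[OF l[OF ac] clinear_on_comp[OF l[OF b] l[OF a]] _ u])
    (simp add: le a b ac X.lact_compose lc)
  show "proj_ract X Y r u (compose (carrier L) a b) = proj_ract X Y r (proj_ract X Y r u a) b" by (rule eqI[OF r[OF ac] clinear_on_comp[OF r[OF a] r[OF b]] _ u])
    (simp add: re a b ac Y.ract_compose rc)
  show "proj_ract X Y r (proj_lact X l Y a u) b = proj_lact X l Y a (proj_ract X Y r u b)"
   by (rule eqI[OF clinear_on_comp[OF l[OF a] r[OF b]] clinear_on_comp[OF r[OF b] l[OF a]] _ u])
    (simp add: re le a b lc rc)
 next
  fix u assume "u \<in> carrier (proj_tensor X Y)"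
  then have u: "u \<in> carrier (alg_tensor X Y)" by simp
  show "proj_lact X l Y (\<lambda>x\<in>carrier L. x) u = u" by (rule eqI[OF l[OF L.bounded_ops_id] id _ u]) (simp add: le L.bounded_ops_id X.lact_one)
  show "proj_ract X Y r u (\<lambda>x\<in>carrier L. x) = u" by (rule eqI[OF r[OF L.bounded_ops_id] id _ u]) (simp add: re L.bounded_ops_id Y.ract_one)
 qed
qed

context contractive_right_module
begin

lemmas ract_closed = clinear_onD(1)[OF ract_linear]
 and ract_vadd = clinear_onD(2)[OF ract_linear]
 and ract_vsmult = clinear_onD(3)[OF ract_linear]

lemma ract_zero:
 assumes L: "hilbert_space L" and u: "u \<in> carrier V" shows "r u (\<lambda>x\<in>carrier L. \<zero>\<^bsub>L\<^esub>) = \<zero>" proof -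
 interpret L: hilbert_space L by fact
 have "(\<lambda>x\<in>carrier L. 0 \<odot>\<^bsub>L\<^esub> (\<lambda>x\<in>carrier L. x) x) = (\<lambda>x\<in>carrier L. \<zero>\<^bsub>L\<^esub>)" by (rule restrict_ext) simp
 then show ?thesis using ract_smult[OF L.bounded_ops_id u, of 0] ract_closed[OF L.bounded_ops_id u] by simp
qed

lemma ract_contraction:
 assumes "a \<in> bounded_ops L" "op_norm L a <= 1" "u \<in> carrier V" shows "nrm V (r u a) <= nrm V u"
 using ract_contractive[OF assms(1,3)] mult_left_mono[OF assms(2) nrm_nonneg[OF assms(3)]] by simp

end

section \<open>Sandwiches: collecting from both sides\<close>

locale bicolumns = L: hilbert_space L + A: columns L H X1 comp1 emb1 act1 + B: conj_columns L K X2 comp2 emb2 act2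
 for L :: "'l cinner_space" and H :: "'h cinner_space" and X1 :: "'x cnormed_space" and comp1 emb1 act1
  and K :: "'k cinner_space" and X2 :: "'y cnormed_space" and comp2 emb2 act2
begin

sublocale P: normed_pair X1 X2 by unfold_locales

abbreviation "P == proj_tensor X1 X2"

sublocale PN: complex_normed_space P by (rule P.proj_tensor_normed[OF A.functionals_separating B.functionals_separating A.functionals_linear
    B.functionals_linear A.functionals_bounded B.functionals_bounded])

abbreviation "lP == proj_lact X1 act1 X2"
abbreviation "rP == proj_ract X1 X2 (%x a. B.ract x a)"

lemma bimodule_P: "contractive_bimodule L P lP rP"
 by (rule proj_contractive_bimodule[OF L.hilbert_space_axioms A.contractive_left B.contractive_right PN.complex_normed_space_axioms])

end

text \<open>A fixed pair of compressions: orthonormal sets \<open>F\<close> in \<open>H\<close> and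
  \<open>G\<close> in \<open>K\<close>, with copies \<open>e\<close> and \<open>e'\<close> of them
  in \<open>L\<close>.\<close>

locale bicolumns_frame = bicolumns L H X1 comp1 emb1 act1 K X2 comp2 emb2 act2
 for L :: "'l cinner_space" and H :: "'h cinner_space" and X1 :: "'x cnormed_space" and comp1 emb1 act1
  and K :: "'k cinner_space" and X2 :: "'y cnormed_space" and comp2 emb2 act2 +
 fixes F e G e'
 assumes F: "A.H.onf F (%h. h)" and e: "L.onf F e" and G: "B.H.onf G (%h. h)" and e': "L.onf G e'"
begin

abbreviation "T1 == A.colop F e"
abbreviation "T2 == B.rowop G e'"

lemmas T1_bounded = A.colop_bounded[OF F e]
 and T2_bounded = B.rowop_bounded[OF G e']

text \<open>The sides are crossed because the bibalanced relations are: an operator to the left of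
  the tensor \<open>x1 (x) x2\<close> passes to the right of \<open>z\<close>, and conversely. So
  \<open>x1\<close>, which carries the left action, stands on the right of \<open>z\<close>.\<close>

definition sandwich :: "(('l => 'l) => 'z => 'z) => ('z => ('l => 'l) => 'z) => 'z => 'x => 'y => 'z" where
 "sandwich l r z x1 x2 = l (T2 x2) (r z (T1 x1))"

context
 fixes Z :: "'z cnormed_space" and l r
 assumes Z: "contractive_bimodule L Z l r"
begin

interpretation Z: contractive_bimodule L Z l r by (rule Z)

lemma sandwich_closed:
 "z \<in> carrier Z ==> x1 \<in> carrier X1 ==> x2 \<in> carrier X2 ==> sandwich l r z x1 x2 \<in> carrier Z"
 by (simp add: sandwich_def Z.lact_closed Z.ract_closed T1_bounded T2_bounded)

lemma bilinear_sandwich: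
 "z \<in> carrier Z ==> bilinear_on X1 X2 Z (%(x1, x2). sandwich l r z x1 x2)" unfolding sandwich_def by (intro bilinear_onI clinear_onI)
  (simp_all add: Z.lact_closed Z.ract_closed T1_bounded T2_bounded A.colop_add[OF F e] A.colop_smult[OF F e]
   B.rowop_add[OF G e'] B.rowop_smult[OF G e'] Z.ract_add Z.ract_smult Z.lact_vadd Z.lact_vsmult Z.lact_add Z.lact_smult)

lemma clinear_sandwich:
 assumes "x1 \<in> carrier X1" "x2 \<in> carrier X2" shows "clinear_on Z Z (%z. sandwich l r z x1 x2)" unfolding sandwich_def
 by (rule clinear_on_comp[OF Z.ract_linear[OF T1_bounded[OF assms(1)]] Z.lact_linear[OF T2_bounded[OF assms(2)]]])

lemma sandwich_lact:
 assumes a: "a \<in> bounded_ops L" and z: "z \<in> carrier Z" and x: "x1 \<in> carrier X1" "x2 \<in> carrier X2"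
 shows "sandwich l r (l a z) x1 x2 = sandwich l r z x1 (B.ract x2 a)" unfolding sandwich_def B.rowop_ract[OF G e' x(2) a] Z.act_assoc[OF a T1_bounded[OF x(1)] z]
 by (rule Z.lact_compose[OF T2_bounded[OF x(2)] a Z.ract_closed[OF T1_bounded[OF x(1)] z], symmetric])

lemma sandwich_ract:
 assumes a: "a \<in> bounded_ops L" and z: "z \<in> carrier Z" and x: "x1 \<in> carrier X1" "x2 \<in> carrier X2"
 shows "sandwich l r (r z a) x1 x2 = sandwich l r z (act1 a x1) x2" unfolding sandwich_def A.colop_act[OF F e x(1) a] Z.ract_compose[OF a T1_bounded[OF x(1)] z] ..

text \<open>Homogeneity in the three arguments at once; the vanishing and the rescaling of
  sandwiches are read off from it.\<close>

lemma sandwich_smult: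
 assumes z: "z \<in> carrier Z" and x: "x1 \<in> carrier X1" "x2 \<in> carrier X2"
 shows "sandwich l r (k \<odot>\<^bsub>Z\<^esub> z) (s \<odot>\<^bsub>X1\<^esub> x1) (t \<odot>\<^bsub>X2\<^esub> x2) = (k * s * t) \<odot>\<^bsub>Z\<^esub> sandwich l r z x1 x2"
proof -
 have b: "clinear_on X1 Z (%x. sandwich l r z x y)" "clinear_on X2 Z (%x. sandwich l r z y' x)"
  if "y \<in> carrier X2" "y' \<in> carrier X1" for y y' using bilinear_sandwich[OF z] that by (simp_all add: bilinear_on_def)
 have "sandwich l r (k \<odot>\<^bsub>Z\<^esub> z) (s \<odot>\<^bsub>X1\<^esub> x1) (t \<odot>\<^bsub>X2\<^esub> x2) = k \<odot>\<^bsub>Z\<^esub> sandwich l r z (s \<odot>\<^bsub>X1\<^esub> x1) (t \<odot>\<^bsub>X2\<^esub> x2)"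
  by (rule clinear_onD(3)[OF clinear_sandwich z]) (simp_all add: x)
 also have "... = k \<odot>\<^bsub>Z\<^esub> (s \<odot>\<^bsub>Z\<^esub> (t \<odot>\<^bsub>Z\<^esub> sandwich l r z x1 x2))"
  using clinear_onD(3)[OF b(1)[of "t \<odot>\<^bsub>X2\<^esub> x2" x1] x(1), of s] clinear_onD(3)[OF b(2)[OF x(2) x(1)] x(2), of t] x by simp
 also have "... = (k * s * t) \<odot>\<^bsub>Z\<^esub> sandwich l r z x1 x2" using sandwich_closed[OF z x] by (simp add: Z.smult_smult mult.assoc)
 finally show ?thesis .
qed

lemma sandwich_zero:
 assumes z: "z \<in> carrier Z" and x: "x1 \<in> carrier X1" "x2 \<in> carrier X2" and 0: "z = \<zero>\<^bsub>Z\<^esub> \<or> x1 = \<zero>\<^bsub>X1\<^esub> \<or> x2 = \<zero>\<^bsub>X2\<^esub>"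
 shows "sandwich l r z x1 x2 = \<zero>\<^bsub>Z\<^esub>" using sandwich_smult[OF z x, of 0 1 1] sandwich_smult[OF z x, of 1 0 1] sandwich_smult[OF z x, of 1 1 0] 0 z x
  sandwich_closed[OF z x] by auto

text \<open>In the merge below the norms of the middle factors combine by a maximum and those of the
  outer ones by a sum of squares. The whole weight is therefore moved to the outer factors, in equal
  parts.\<close>

lemma sandwich_rescale:
 assumes z: "z \<in> carrier Z" and x: "x1 \<in> carrier X1" "x2 \<in> carrier X2" obtains z' y1 y2 where "z' \<in> carrier Z" "y1 \<in> carrier X1" "y2 \<in> carrier X2"
  "sandwich l r z' y1 y2 = sandwich l r z x1 x2" "nrm Z z' <= 1"
  "nrm X1 y1 = nrm X2 y2" "(nrm X1 y1)\<^sup>2 = nrm Z z * nrm X1 x1 * nrm X2 x2" proof (cases "nrm Z z * nrm X1 x1 * nrm X2 x2 = 0")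
 case True
 then have "sandwich l r z x1 x2 = \<zero>\<^bsub>Z\<^esub>" by (intro sandwich_zero z x) (simp add: Z.nrm_eq_0_iff[OF z] A.X.nrm_eq_0_iff[OF x(1)] B.X.nrm_eq_0_iff[OF x(2)])
 then show ?thesis using True by (intro that[of "\<zero>\<^bsub>Z\<^esub>" "\<zero>\<^bsub>X1\<^esub>" "\<zero>\<^bsub>X2\<^esub>"]) (simp_all add: sandwich_zero)
next
 case False
 define a where "a = nrm X1 x1"
 define b where "b = nrm X2 x2"
 define c where "c = nrm Z z"
 have "0 <= a" "0 <= b" "0 <= c" using x z by (simp_all add: a_def b_def c_def)
 then have p: "a > 0" "b > 0" "c > 0" using False by (auto simp: a_def b_def c_def less_le)
 \<comment> \<open>The common norm of the new outer factors, such that its square is the total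
   weight.\<close>
 define m where "m = sqrt (c * a * b)"
 have m: "m > 0" and m2: "m * m = c * a * b" using p by (simp_all add: m_def)
 let ?z = "complex_of_real (1 / c) \<odot>\<^bsub>Z\<^esub> z" and ?y1 = "complex_of_real (m / a) \<odot>\<^bsub>X1\<^esub> x1" and ?y2 = "complex_of_real (m / b) \<odot>\<^bsub>X2\<^esub> x2"
 have nz: "nrm Z ?z = 1" unfolding Z.nrm_smult[OF z] norm_of_real using p by (simp add: c_def)
 have n1: "nrm X1 ?y1 = m" unfolding A.X.nrm_smult[OF x(1)] norm_of_real using p m by (simp add: a_def)
 have n2: "nrm X2 ?y2 = m" unfolding B.X.nrm_smult[OF x(2)] norm_of_real using p m by (simp add: b_def)
 have "1 / c * (m / a) * (m / b) = (m * m) / (c * a * b)" by simp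
 also have "... = 1" unfolding m2 using p by simp
 finally have "1 / c * (m / a) * (m / b) = 1" .
 then have "complex_of_real (1 / c) * complex_of_real (m / a) * complex_of_real (m / b) = 1" by (simp only: of_real_mult[symmetric] of_real_1)
 then have "sandwich l r ?z ?y1 ?y2 = sandwich l r z x1 x2" unfolding sandwich_smult[OF z x] using sandwich_closed[OF z x] by simp
 then show ?thesis using nz n1 n2 m2 z x by (intro that[of ?z ?y1 ?y2]) (simp_all add: a_def b_def c_def power2_eq_square)
qed

definition sandwich_gauge :: "real => 'z => bool" where
 "sandwich_gauge a v \<longleftrightarrow> (\<exists>z x1 x2. z \<in> carrier Z & x1 \<in> carrier X1 & x2 \<in> carrier X2 &
  sandwich l r z x1 x2 = v & nrm Z z * nrm X1 x1 * nrm X2 x2 <= a)"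

lemma sandwich_gaugeI:
 "z \<in> carrier Z ==> x1 \<in> carrier X1 ==> x2 \<in> carrier X2 ==> sandwich l r z x1 x2 = v ==>
  nrm Z z * nrm X1 x1 * nrm X2 x2 <= a ==> sandwich_gauge a v" unfolding sandwich_gauge_def by blast

lemma sandwich_gaugeE:
 assumes "sandwich_gauge a v" obtains z x1 x2 where "z \<in> carrier Z" "x1 \<in> carrier X1" "x2 \<in> carrier X2" "sandwich l r z x1 x2 = v"
  "nrm Z z * nrm X1 x1 * nrm X2 x2 <= a" using assms unfolding sandwich_gauge_def by blast

lemma sandwich_gauge_mono: "sandwich_gauge a v ==> a <= b ==> sandwich_gauge b v"
 by (erule sandwich_gaugeE) (rule sandwich_gaugeI, assumption+, simp)

lemma sandwich_gauge_zero: "sandwich_gauge 0 \<zero>\<^bsub>Z\<^esub>"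
 by (rule sandwich_gaugeI[of "\<zero>\<^bsub>Z\<^esub>" "\<zero>\<^bsub>X1\<^esub>" "\<zero>\<^bsub>X2\<^esub>"]) (simp_all add: sandwich_zero)

lemma sandwich_gauge_smult:
 assumes "sandwich_gauge a v" shows "sandwich_gauge (cmod c * a) (c \<odot>\<^bsub>Z\<^esub> v)" proof -
 obtain z x1 x2 where z: "z \<in> carrier Z" "x1 \<in> carrier X1" "x2 \<in> carrier X2" "sandwich l r z x1 x2 = v"
  "nrm Z z * nrm X1 x1 * nrm X2 x2 <= a" using assms by (rule sandwich_gaugeE) show ?thesis proof (rule sandwich_gaugeI[of "c \<odot>\<^bsub>Z\<^esub> z" x1 x2])
  show "sandwich l r (c \<odot>\<^bsub>Z\<^esub> z) x1 x2 = c \<odot>\<^bsub>Z\<^esub> v" using clinear_onD(3)[OF clinear_sandwich[OF z(2,3)] z(1)] z(4) by simp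
  show "nrm Z (c \<odot>\<^bsub>Z\<^esub> z) * nrm X1 x1 * nrm X2 x2 <= cmod c * a" using mult_left_mono[OF z(5), of "cmod c"] z(1) by (simp add: Z.nrm_smult mult_ac)
 qed (use z in simp_all)
qed

end

text \<open>The middle factors are conjugated by \<open>s\<close> and \<open>t\<close> and thereby
  acquire orthogonal supports on both sides, so the Ruan axiom bounds their sum by the maximum. The
  outer operators are composed with \<open>s\<close>, \<open>t\<close> and their adjoints to undo
  this.\<close>

lemma sandwich_merge:
 fixes Z :: "'z cnormed_space" assumes inf: "infinite_dimensional L" and Z: "ruan_bimodule L Z l r"
  and z: "z \<in> carrier Z" "z' \<in> carrier Z" and x: "x1 \<in> carrier X1" "x1' \<in> carrier X1" and y: "x2 \<in> carrier X2" "x2' \<in> carrier X2"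
 obtains z'' x1'' x2'' where "z'' \<in> carrier Z" "x1'' \<in> carrier X1" "x2'' \<in> carrier X2"
  "sandwich l r z'' x1'' x2'' = sandwich l r z x1 x2 \<oplus>\<^bsub>Z\<^esub> sandwich l r z' x1' x2'"
  "nrm Z z'' <= max (nrm Z z) (nrm Z z')"
  "nrm X1 x1'' <= sqrt ((nrm X1 x1)\<^sup>2 + (nrm X1 x1')\<^sup>2)" "nrm X2 x2'' <= sqrt ((nrm X2 x2)\<^sup>2 + (nrm X2 x2')\<^sup>2)" proof -
 interpret Z: ruan_bimodule L Z l r by fact
 \<comment> \<open>One splitting has to serve the components of all four outer elements: the same
   \<open>s\<close> and \<open>t\<close> occur on both sides of the middle factor, as a support in a
   bimodule is two-sided.\<close>
 let ?A = "((%h. comp1 h x1) ` F \<union> (%h. comp1 h x1') ` F) \<union> ((%h. comp2 h x2) ` G \<union> (%h. comp2 h x2') ` G)"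
 note FD = A.H.onfD[OF F] and GD = B.H.onfD[OF G]
 have A: "finite ?A" using FD(1) GD(1) by simp
 have A': "?A <= carrier L" using A.comp_closed[OF FD(3)] B.comp_closed'[OF GD(3)] x y by blast
 obtain s t p where sp: "L.splitting ?A s t p" using L.splitting_exists[OF inf A A'] by blast
 then have st: "s \<in> bounded_ops L" "t \<in> bounded_ops L" "p \<in> bounded_ops L"
  and pA: "!!x. x \<in> ?A ==> p x = x" and ap: "adjoint_op L p = p"
  and ss: "compose (carrier L) (adjoint_op L s) s = p" "compose (carrier L) (adjoint_op L t) t = p"
   "compose (carrier L) (adjoint_op L s) t = (\<lambda>x\<in>carrier L. \<zero>\<^bsub>L\<^esub>)"
   "compose (carrier L) (adjoint_op L t) s = (\<lambda>x\<in>carrier L. \<zero>\<^bsub>L\<^esub>)"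
  and pr: "compose (carrier L) s (adjoint_op L s) \<in> projections L"
   "compose (carrier L) t (adjoint_op L t) \<in> projections L"
   "orthogonal_ops L (compose (carrier L) s (adjoint_op L s)) (compose (carrier L) t (adjoint_op L t))"
   "compose (carrier L) (compose (carrier L) s (adjoint_op L s)) s = s"
   "compose (carrier L) (compose (carrier L) t (adjoint_op L t)) t = t"
  and no: "op_norm L s <= 1" "op_norm L t <= 1" unfolding L.splitting_def by blast+
 let ?s = "adjoint_op L s" and ?t = "adjoint_op L t"
 let ?P = "compose (carrier L) s ?s" and ?Q = "compose (carrier L) t ?t"
 note as = L.adjoint_bounded[OF st(1)] and at = L.adjoint_bounded[OF st(2)]
 note P = L.projection_bounded[OF pr(1)] and Q = L.projection_bounded[OF pr(2)]
 have aP: "adjoint_op L ?P = ?P" "adjoint_op L ?Q = ?Q" using pr(1,2) by (simp_all add: projections_def)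
 \<comment> \<open>The adjoints of the left support identities; they show that the final projections
   are right supports as well.\<close>
 have sP: "compose (carrier L) ?s ?P = ?s" "compose (carrier L) ?t ?Q = ?t" using L.adjoint_compose[OF P st(1)] L.adjoint_compose[OF Q st(2)] unfolding pr(4,5) aP by simp_all
 have zs: "r z ?s \<in> carrier Z" "r z' ?t \<in> carrier Z" using Z.ract_closed as at z by auto
 have lz: "l s (r z ?s) \<in> carrier Z" "l t (r z' ?t) \<in> carrier Z" using Z.lact_closed st zs by auto
 define z'' where "z'' = l s (r z ?s) \<oplus>\<^bsub>Z\<^esub> l t (r z' ?t)"
 have z'': "z'' \<in> carrier Z" using lz by (simp add: z''_def)
 define x1'' where "x1'' = A.vec F (%h. s (comp1 h x1) \<oplus>\<^bsub>L\<^esub> t (comp1 h x1'))"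
 define x2'' where "x2'' = B.vec G (%h. s (comp2 h x2) \<oplus>\<^bsub>L\<^esub> t (comp2 h x2'))"
 note x1'' = A.colop_vec_comb[OF F e x st(1,2), folded x1''_def]
 note x2'' = B.rowop_vec_comb[OF G e' y st(1,2), folded x2''_def]
 note T1x = T1_bounded[OF x(1)] T1_bounded[OF x(2)] and T2x = T2_bounded[OF y(1)] T2_bounded[OF y(2)]
 have p1: "compose (carrier L) p (T1 x1) = T1 x1" "compose (carrier L) p (T1 x1') = T1 x1'" by (rule A.colop_splitting[OF F e _ st(3)]; use x pA in auto)+
 have p2: "compose (carrier L) (T2 x2) p = T2 x2" "compose (carrier L) (T2 x2') p = T2 x2'" by (rule B.rowop_splitting[OF G e' _ st(3) ap]; use y pA in auto)+
 let ?u = "r z (T1 x1)" and ?u' = "r z' (T1 x1')"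
 have u: "?u \<in> carrier Z" "?u' \<in> carrier Z" using Z.ract_closed T1x z by auto
 \<comment> \<open>The cross term disappears because the adjoint of \<open>t\<close> annihilates the
   range of \<open>s\<close>.\<close>
 have rs: "r z'' s = l s (r z p)" unfolding z''_def Z.ract_vadd[OF st(1) lz] Z.act_assoc[OF st(1) st(1) zs(1)] Z.act_assoc[OF st(2) st(1) zs(2)]
   Z.ract_compose[OF as st(1) z(1), symmetric] Z.ract_compose[OF at st(1) z(2), symmetric] ss
   Z.ract_zero[OF L.hilbert_space_axioms z(2)] using clinear_on_zero[OF Z.cvec_axioms Z.cvec_axioms Z.lact_linear[OF st(2)]]
   Z.lact_closed[OF st(1) Z.ract_closed[OF st(3) z(1)]] by simp
 have rt: "r z'' t = l t (r z' p)" unfolding z''_def Z.ract_vadd[OF st(2) lz] Z.act_assoc[OF st(1) st(2) zs(1)] Z.act_assoc[OF st(2) st(2) zs(2)]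
   Z.ract_compose[OF as st(2) z(1), symmetric] Z.ract_compose[OF at st(2) z(2), symmetric] ss
   Z.ract_zero[OF L.hilbert_space_axioms z(1)] using clinear_on_zero[OF Z.cvec_axioms Z.cvec_axioms Z.lact_linear[OF st(1)]]
   Z.lact_closed[OF st(2) Z.ract_closed[OF st(3) z(2)]] by simp
 have ru: "r (r z'' s) (T1 x1) = l s ?u" "r (r z'' t) (T1 x1') = l t ?u'"
  unfolding rs rt Z.act_assoc[OF st(1) T1x(1) Z.ract_closed[OF st(3) z(1)]] Z.act_assoc[OF st(2) T1x(2) Z.ract_closed[OF st(3) z(2)]]
   Z.ract_compose[OF st(3) T1x(1) z(1), symmetric] Z.ract_compose[OF st(3) T1x(2) z(2), symmetric] p1 by simp_all
 have v: "r z'' (T1 x1'') = l s ?u \<oplus>\<^bsub>Z\<^esub> l t ?u'"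
  unfolding x1''(2) Z.ract_add[OF L.bounded_ops_compose[OF st(1) T1x(1)] L.bounded_ops_compose[OF st(2) T1x(2)] z'']
   Z.ract_compose[OF st(1) T1x(1) z''] Z.ract_compose[OF st(2) T1x(2) z''] ru ..
 have lu: "l s ?u \<in> carrier Z" "l t ?u' \<in> carrier Z" using Z.lact_closed st u by auto
 have a1: "l ?s (l s ?u \<oplus>\<^bsub>Z\<^esub> l t ?u') = l p ?u"
  unfolding Z.lact_vadd[OF as lu] Z.lact_compose[OF as st(1) u(1), symmetric] Z.lact_compose[OF as st(2) u(2), symmetric] ss
  using Z.lact_zero[OF L.hilbert_space_axioms u(2)] Z.lact_closed[OF st(3) u(1)] by simp
 have a2: "l ?t (l s ?u \<oplus>\<^bsub>Z\<^esub> l t ?u') = l p ?u'"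
  unfolding Z.lact_vadd[OF at lu] Z.lact_compose[OF at st(1) u(1), symmetric] Z.lact_compose[OF at st(2) u(2), symmetric] ss
  using Z.lact_zero[OF L.hilbert_space_axioms u(1)] Z.lact_closed[OF st(3) u(2)] by simp
 have vc: "l s ?u \<oplus>\<^bsub>Z\<^esub> l t ?u' \<in> carrier Z" using lu by simp
 have eq: "sandwich l r z'' x1'' x2'' = sandwich l r z x1 x2 \<oplus>\<^bsub>Z\<^esub> sandwich l r z' x1' x2'"
  unfolding sandwich_def v x2''(2) Z.lact_add[OF L.bounded_ops_compose[OF T2x(1) as] L.bounded_ops_compose[OF T2x(2) at] vc]
   Z.lact_compose[OF T2x(1) as vc] Z.lact_compose[OF T2x(2) at vc] a1 a2
   Z.lact_compose[OF T2x(1) st(3) u(1), symmetric] Z.lact_compose[OF T2x(2) st(3) u(2), symmetric] p2 ..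
 have nz: "nrm Z z'' <= max (nrm Z z) (nrm Z z')" proof -
  have "nrm Z z'' = max (nrm Z (l s (r z ?s))) (nrm Z (l t (r z' ?t)))" unfolding z''_def by (rule Z.ruan[OF lz pr(1-3)])
    (simp_all add: Z.lact_compose[OF P st(1) zs(1), symmetric] Z.lact_compose[OF Q st(2) zs(2), symmetric] pr(4,5)
     Z.act_assoc[OF st(1) P zs(1)] Z.act_assoc[OF st(2) Q zs(2)]
     Z.ract_compose[OF as P z(1), symmetric] Z.ract_compose[OF at Q z(2), symmetric] sP)
  moreover have "nrm Z (l s (r z ?s)) <= nrm Z z"
   using Z.lact_contraction[OF st(1) no(1) zs(1)] Z.ract_contraction[OF as _ z(1)] no(1) L.op_norm_adjoint_le[OF st(1)] by simp
  moreover have "nrm Z (l t (r z' ?t)) <= nrm Z z'"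
   using Z.lact_contraction[OF st(2) no(2) zs(2)] Z.ract_contraction[OF at _ z(2)] no(2) L.op_norm_adjoint_le[OF st(2)] by simp
  ultimately show ?thesis by (simp add: max.coboundedI1 max.coboundedI2)
 qed
 have n1: "nrm X1 x1'' <= sqrt ((nrm X1 x1)\<^sup>2 + (nrm X1 x1')\<^sup>2)" unfolding x1''_def by (rule A.nrm_vec_splitting'[OF F x sp]) auto
 have n2: "nrm X2 x2'' <= sqrt ((nrm X2 x2)\<^sup>2 + (nrm X2 x2')\<^sup>2)" unfolding x2''_def by (rule B.nrm_vec_splitting[OF G y sp]) auto
 show ?thesis by (rule that[OF z'' x1''(1) x2''(1) eq nz n1 n2])
qed

lemma sandwich_gauge_add:
 fixes Z :: "'z cnormed_space" assumes inf: "infinite_dimensional L" and Z: "ruan_bimodule L Z l r" and g: "sandwich_gauge Z l r a u" "sandwich_gauge Z l r b v"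
 shows "sandwich_gauge Z l r (a + b) (u \<oplus>\<^bsub>Z\<^esub> v)" proof -
 interpret Z: ruan_bimodule L Z l r by fact
 note bm = Z.contractive_bimodule_axioms
 obtain z x1 x2 where z: "z \<in> carrier Z" "x1 \<in> carrier X1" "x2 \<in> carrier X2" "sandwich l r z x1 x2 = u"
  "nrm Z z * nrm X1 x1 * nrm X2 x2 <= a" using sandwich_gaugeE[OF bm g(1)] .
 obtain z' x1' x2' where z': "z' \<in> carrier Z" "x1' \<in> carrier X1" "x2' \<in> carrier X2" "sandwich l r z' x1' x2' = v"
  "nrm Z z' * nrm X1 x1' * nrm X2 x2' <= b" using sandwich_gaugeE[OF bm g(2)] .
 obtain w y1 y2 where w: "w \<in> carrier Z" "y1 \<in> carrier X1" "y2 \<in> carrier X2" "sandwich l r w y1 y2 = sandwich l r z x1 x2"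
  "nrm Z w <= 1" "nrm X1 y1 = nrm X2 y2" "(nrm X1 y1)\<^sup>2 = nrm Z z * nrm X1 x1 * nrm X2 x2" using sandwich_rescale[OF bm z(1-3)] .
 obtain w' y1' y2' where w': "w' \<in> carrier Z" "y1' \<in> carrier X1" "y2' \<in> carrier X2" "sandwich l r w' y1' y2' = sandwich l r z' x1' x2'"
  "nrm Z w' <= 1" "nrm X1 y1' = nrm X2 y2'" "(nrm X1 y1')\<^sup>2 = nrm Z z' * nrm X1 x1' * nrm X2 x2'" using sandwich_rescale[OF bm z'(1-3)] .
 obtain z'' x1'' x2'' where m: "z'' \<in> carrier Z" "x1'' \<in> carrier X1" "x2'' \<in> carrier X2"
  "sandwich l r z'' x1'' x2'' = sandwich l r w y1 y2 \<oplus>\<^bsub>Z\<^esub> sandwich l r w' y1' y2'"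
  "nrm Z z'' <= max (nrm Z w) (nrm Z w')"
  "nrm X1 x1'' <= sqrt ((nrm X1 y1)\<^sup>2 + (nrm X1 y1')\<^sup>2)" "nrm X2 x2'' <= sqrt ((nrm X2 y2)\<^sup>2 + (nrm X2 y2')\<^sup>2)"
  using sandwich_merge[OF inf Z w(1) w'(1) w(2) w'(2) w(3) w'(3)] .
 let ?q = "(nrm X1 y1)\<^sup>2 + (nrm X1 y1')\<^sup>2"
 \<comment> \<open>Equal norms of the outer factors make both square roots agree, and the middle
   factor contributes at most 1.\<close>
 have "nrm X1 x1'' * nrm X2 x2'' <= sqrt ?q * sqrt ?q" using mult_mono[OF m(6,7)] m(3) w(6) w'(6) by simp
 also have "... = ?q" by simp
 also have "... <= a + b" using w(7) w'(7) z(5) z'(5) by simp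
 finally have 1: "nrm X1 x1'' * nrm X2 x2'' <= a + b" .
 have "nrm Z z'' <= 1" using m(5) w(5) w'(5) by simp
 then have "nrm Z z'' * (nrm X1 x1'' * nrm X2 x2'') <= 1 * (nrm X1 x1'' * nrm X2 x2'')" using m(2,3) by (intro mult_right_mono) simp_all
 with 1 have "nrm Z z'' * nrm X1 x1'' * nrm X2 x2'' <= a + b" by (simp add: mult.assoc)
 moreover have "sandwich l r z'' x1'' x2'' = u \<oplus>\<^bsub>Z\<^esub> v" using m(4) w(4) w'(4) z(4) z'(4) by simp
 ultimately show ?thesis by (intro sandwich_gaugeI[OF bm m(1-3)])
qed

text \<open>The two-sided analogue of \<open>row_gauge_isometric\<close>: pseudo-inverses on both
  sides of \<open>w\<close> give an element of \<open>Y\<close>, with image \<open>p2 z p1\<close>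
  in \<open>Z\<close> and hence with norm at most that of \<open>z\<close>.\<close>

lemma sandwich_gauge_isometric:
 fixes Y :: "'v cnormed_space" and Z :: "'z cnormed_space" assumes Y: "contractive_bimodule L Y lY rY" and Z: "contractive_bimodule L Z lZ rZ"
  and \<alpha>: "left_morphism L Y lY Z lZ \<alpha>" "right_morphism L Y rY Z rZ \<alpha>" "isometric_on Y Z \<alpha>"
  and w: "w \<in> carrier Y" and g: "sandwich_gauge Z lZ rZ a (\<alpha> w)" shows "sandwich_gauge Y lY rY a w" proof -
 interpret Y: contractive_bimodule L Y lY rY by fact
 interpret Z: contractive_bimodule L Z lZ rZ by fact
 have al: "clinear_on Y Z \<alpha>" and am: "!!a u. a \<in> bounded_ops L ==> u \<in> carrier Y ==> \<alpha> (lY a u) = lZ a (\<alpha> u)"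
  and ar: "!!a u. a \<in> bounded_ops L ==> u \<in> carrier Y ==> \<alpha> (rY u a) = rZ (\<alpha> u) a"
  and ai: "!!u. u \<in> carrier Y ==> nrm Z (\<alpha> u) = nrm Y u" using \<alpha> by (auto simp: left_morphism_def right_morphism_def isometric_on_def)
 obtain z x1 x2 where z: "z \<in> carrier Z" "x1 \<in> carrier X1" "x2 \<in> carrier X2" "sandwich lZ rZ z x1 x2 = \<alpha> w"
  "nrm Z z * nrm X1 x1 * nrm X2 x2 <= a" using sandwich_gaugeE[OF Z g] .
 note T1 = T1_bounded[OF z(2)] and T2 = T2_bounded[OF z(3)]
 obtain s1 p1 where s1: "s1 \<in> bounded_ops L" "p1 \<in> projections L"
  "compose (carrier L) (T1 x1) s1 = p1" "compose (carrier L) p1 (T1 x1) = T1 x1" using A.colop_pseudo_inverse[OF F e z(2)] .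
 have c: "(%h. comp2 h x2) \<in> G \<rightarrow> carrier L" using B.comp_closed'[OF B.H.onfD(3)[OF G]] z(3) by blast
 obtain s2 p2 where s2: "s2 \<in> bounded_ops L" "p2 \<in> projections L"
  "compose (carrier L) s2 (T2 x2) = p2" "compose (carrier L) (T2 x2) p2 = T2 x2" using L.pseudo_inverse[OF e' c] unfolding B.rowop_def by blast
 note p1 = L.projection_bounded[OF s1(2)] and p2 = L.projection_bounded[OF s2(2)]
 note zp = Z.ract_closed[OF p1 z(1)] and zT = Z.ract_closed[OF T1 z(1)]
 define y where "y = lY s2 (rY w s1)"
 have ws: "rY w s1 \<in> carrier Y" by (rule Y.ract_closed[OF s1(1) w])
 have y: "y \<in> carrier Y" unfolding y_def by (rule Y.lact_closed[OF s2(1) ws])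
 have ay: "\<alpha> y = lZ p2 (rZ z p1)" unfolding y_def am[OF s2(1) ws] ar[OF s1(1) w] z(4)[symmetric] sandwich_def
   Z.act_assoc[OF T2 s1(1) zT] Z.ract_compose[OF T1 s1(1) z(1), symmetric] s1(3)
   Z.lact_compose[OF s2(1) T2 zp, symmetric] s2(3) ..
 have ny: "nrm Y y <= nrm Z z" using Z.lact_contraction[OF p2 L.projection_contr[OF s2(2)] zp] Z.ract_contraction[OF p1 L.projection_contr[OF s1(2)] z(1)]
   ai[OF y] ay by simp
 note yT = Y.ract_closed[OF T1 y]
 have sc: "sandwich lY rY y x1 x2 \<in> carrier Y" by (rule sandwich_closed[OF Y y z(2,3)])
 have "\<alpha> (sandwich lY rY y x1 x2) = \<alpha> w" unfolding sandwich_def am[OF T2 yT] ar[OF T1 y] ay Z.act_assoc[OF p2 T1 zp]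
   Z.ract_compose[OF p1 T1 z(1), symmetric] s1(4) Z.lact_compose[OF T2 p2 zT, symmetric] s2(4) using z(4) by (simp add: sandwich_def)
 then have "nrm Z (\<alpha> (sandwich lY rY y x1 x2 \<ominus>\<^bsub>Y\<^esub> w)) = 0"
  using clinear_on_minus[OF Y.cvec_axioms Z.cvec_axioms al sc w] clinear_onD(1)[OF al w] by simp
 then have "sandwich lY rY y x1 x2 \<ominus>\<^bsub>Y\<^esub> w = \<zero>\<^bsub>Y\<^esub>" using ai Y.nrm_eq_0_iff sc w by simp
 then have eq: "sandwich lY rY y x1 x2 = w" using Y.minus_eq_zero_iff sc w by simp
 have "nrm Y y * nrm X1 x1 * nrm X2 x2 <= nrm Z z * nrm X1 x1 * nrm X2 x2" using ny z(2,3) by (intro mult_right_mono) simp_all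
 with z(5) have "nrm Y y * nrm X1 x1 * nrm X2 x2 <= a" by simp
 then show ?thesis by (rule sandwich_gaugeI[OF Y y z(2,3) eq])
qed

end

section \<open>Bibalanced relations and the criterion for ER-flatness\<close>

definition bibalanced_relations ::
 "'l cinner_space => ('x, 'm) cnormed_space_scheme => (('l => 'l) => 'x => 'x) => ('x => ('l => 'l) => 'x) =>
  ('y, 'n) cnormed_space_scheme => (('l => 'l) => 'y => 'y) => ('y => ('l => 'l) => 'y) => ('x \<times> 'y \<Rightarrow>\<^sub>0 complex) set" where
 "bibalanced_relations L X lX rX Y lY rY =
  {sng (lX a x, y) 1 - sng (x, rY y a) 1 | a x y. a \<in> bounded_ops L & x \<in> carrier X & y \<in> carrier Y} \<union>
  balanced_relations L X rX Y lY"

lemma bibalanced_relationsI: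
 assumes "a \<in> bounded_ops L" "x \<in> carrier X" "y \<in> carrier Y" shows "sng (lX a x, y) 1 - sng (x, rY y a) 1 \<in> bibalanced_relations L X lX rX Y lY rY"
  and "sng (rX x a, y) 1 - sng (x, lY a y) 1 \<in> bibalanced_relations L X lX rX Y lY rY" unfolding bibalanced_relations_def balanced_relations_def using assms by blast+

lemma bibalanced_relationsE:
 assumes "r \<in> bibalanced_relations L X lX rX Y lY rY"
 obtains a x y where "a \<in> bounded_ops L" "x \<in> carrier X" "y \<in> carrier Y" "r = sng (lX a x, y) 1 - sng (x, rY y a) 1"
  | a x y where "a \<in> bounded_ops L" "x \<in> carrier X" "y \<in> carrier Y" "r = sng (rX x a, y) 1 - sng (x, lY a y) 1"
 using assms unfolding bibalanced_relations_def balanced_relations_def by blast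

lemma bibalanced_relations_subset:
 assumes "contractive_bimodule L X lX rX" "contractive_bimodule L Y lY rY" shows "bibalanced_relations L X lX rX Y lY rY <= carrier (fmod X Y)" proof
 interpret X: contractive_bimodule L X lX rX by fact
 interpret Y: contractive_bimodule L Y lY rY by fact
 fix r assume "r \<in> bibalanced_relations L X lX rX Y lY rY"
 then show "r \<in> carrier (fmod X Y)" by (cases rule: bibalanced_relationsE)
   (simp_all add: pkeys_subset X.lact_closed X.ract_closed Y.lact_closed Y.ract_closed)
qed

lemma bibalanced_kernel_eq:
 fixes X :: "'x cnormed_space" and Y :: "'y cnormed_space" assumes "contractive_bimodule L X lX rX" "contractive_bimodule L Y lY rY"
 shows "bibalanced_kernel L X lX rX Y lY rY = nclosure (proj_tensor X Y)
  (cspan (proj_tensor X Y) (tcls X Y ` bibalanced_relations L X lX rX Y lY rY))" proof -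
 interpret X: contractive_bimodule L X lX rX by fact
 interpret Y: contractive_bimodule L Y lY rY by fact
 interpret A: normed_pair X Y by unfold_locales
 have 1: "tcls X Y ` {sng (lX a x, y) 1 - sng (x, rY y a) 1 | a x y. a \<in> bounded_ops L & x \<in> carrier X & y \<in> carrier Y} =
  {elem_tensor X Y (lX a x) y \<ominus>\<^bsub>proj_tensor X Y\<^esub> elem_tensor X Y x (rY y a)
    | a x y. a \<in> bounded_ops L & x \<in> carrier X & y \<in> carrier Y}"
  by (rule image_Collect3) (simp add: A.elem_tensor_eq A.tcls_diff' X.lact_closed Y.ract_closed)
 have 2: "tcls X Y ` balanced_relations L X rX Y lY =
  {elem_tensor X Y (rX x a) y \<ominus>\<^bsub>proj_tensor X Y\<^esub> elem_tensor X Y x (lY a y)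
    | a x y. a \<in> bounded_ops L & x \<in> carrier X & y \<in> carrier Y}" by (rule A.tcls_balanced_relations) (simp_all add: X.ract_closed Y.lact_closed)
 show ?thesis unfolding bibalanced_kernel_def bibalanced_relations_def image_Un 1 2 ..
qed

text \<open>Reduces ER-flatness to an inequality between seminorms of formal sums, both for the
  projective tensor product of columns and for its completion.\<close>

lemma ER_flatI:
 fixes X :: "'x cnormed_space" assumes X: "contractive_bimodule L X lX rX" and le: "!!(Y :: 'y cnormed_space) lY rY (Z :: 'z cnormed_space) lZ rZ \<alpha> p.
   ruan_bimodule L Y lY rY ==> ruan_bimodule L Z lZ rZ ==>
   left_morphism L Y lY Z lZ \<alpha> ==> right_morphism L Y rY Z rZ \<alpha> ==> isometric_on Y Z \<alpha> ==>
   pkeys p <= carrier Y \<times> carrier X ==>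
   pnorm (carrier Y \<times> carrier X) (%k. nrm Y (fst k) * nrm X (snd k))
    (cspan (fmod Y X) (bilinear_relations Y X \<union> bibalanced_relations L Y lY rY X lX rX)) p
   <= pnorm (carrier Z \<times> carrier X) (%k. nrm Z (fst k) * nrm X (snd k))
    (cspan (fmod Z X) (bilinear_relations Z X \<union> bibalanced_relations L Z lZ rZ X lX rX)) (fmap (map_prod \<alpha> (%x. x)) p)"
 shows "ER_flat L X lX rX TYPE('y) TYPE('z)" unfolding ER_flat_def proof (intro conjI allI impI X)
 fix Y :: "'y cnormed_space" and lY rY and Z :: "'z cnormed_space" and lZ rZ \<alpha>
 assume Y: "ruan_bimodule L Y lY rY" and Z: "ruan_bimodule L Z lZ rZ"
  and \<alpha>: "left_morphism L Y lY Z lZ \<alpha>" "right_morphism L Y rY Z rZ \<alpha>" "isometric_on Y Z \<alpha>"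
 interpret X: contractive_bimodule L X lX rX by fact
 interpret Y: ruan_bimodule L Y lY rY by fact
 interpret Z: ruan_bimodule L Z lZ rZ by fact
 have al: "clinear_on Y Z \<alpha>" and am: "!!a u. a \<in> bounded_ops L ==> u \<in> carrier Y ==> \<alpha> (lY a u) = lZ a (\<alpha> u)"
  and ar: "!!a u. a \<in> bounded_ops L ==> u \<in> carrier Y ==> \<alpha> (rY u a) = rZ (\<alpha> u) a"
  and ai: "!!u. u \<in> carrier Y ==> nrm Z (\<alpha> u) = nrm Y u" using \<alpha> by (auto simp: left_morphism_def right_morphism_def isometric_on_def)
 note Y' = Y.contractive_bimodule_axioms and Z' = Z.contractive_bimodule_axioms
 have np: "normed_pair Y X" "normed_pair Z X" by unfold_locales
 show "isometric_on (bibalanced_tensor L Y lY rY X lX rX) (bibalanced_tensor L Z lZ rZ X lX rX)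
   (quotient_map (proj_tensor Z X) (bibalanced_kernel L Z lZ rZ X lX rX) (tensor_map Z X \<alpha> (%x. x)))"
  unfolding bibalanced_tensor_def bibalanced_kernel_eq[OF Y' X] bibalanced_kernel_eq[OF Z' X]
 proof (rule isometric_on_quotient_proj[OF np al clinear_on_id _ _ bibalanced_relations_subset[OF Y' X]
    bibalanced_relations_subset[OF Z' X]])
  fix r assume "r \<in> bibalanced_relations L Y lY rY X lX rX"
  then show "fmap (map_prod \<alpha> (%x. x)) r \<in> bibalanced_relations L Z lZ rZ X lX rX" proof (cases rule: bibalanced_relationsE)
   case (1 a y x)
   then show ?thesis using bibalanced_relationsI(1)[OF 1(1) clinear_onD(1)[OF al 1(2)], of x X lZ rX rZ lX] am[OF 1(1,2)] by (simp add: fmap_diff)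
  next
   case (2 a y x)
   then show ?thesis using bibalanced_relationsI(2)[OF 2(1) clinear_onD(1)[OF al 2(2)], of x X rZ lX lZ rX] ar[OF 2(1,2)] by (simp add: fmap_diff)
  qed
 qed (use ai le[OF Y Z \<alpha>] in auto)
qed

section \<open>Collecting formal sums over the tensor product of columns\<close>

context bicolumns_frame
begin

text \<open>The linear extension of \<open>sandwich\<close> from elementary tensors to all tensors
  of the two kinds of columns.\<close>

definition sandw :: "'z cnormed_space => (('l => 'l) => 'z => 'z) => ('z => ('l => 'l) => 'z) => 'z => ('x \<times> 'y \<Rightarrow>\<^sub>0 complex) set => 'z" where
 "sandw Z l r z = P.tlift Z (%(x1, x2). sandwich l r z x1 x2)"

text \<open>The compression of both factors.\<close>

definition compr :: "('x \<times> 'y \<Rightarrow>\<^sub>0 complex) set => ('x \<times> 'y \<Rightarrow>\<^sub>0 complex) set" where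
 "compr = tensor_map X1 X2 (%x. A.rproj F x) (%x. B.rproj G x)"

lemmas cvP = A.X.cvec_axioms B.X.cvec_axioms A.X.cvec_axioms B.X.cvec_axioms
 and rlin = A.clinear_rproj[OF F] B.clinear_rproj[OF G]

lemma clinear_compr: "clinear_on P P compr" using clinear_tensor_map[OF cvP rlin] unfolding compr_def by (simp add: clinear_on_def)

lemma compr_elem: "x1 \<in> carrier X1 ==> x2 \<in> carrier X2 ==>
  compr (tcls X1 X2 (sng (x1, x2) 1)) = tcls X1 X2 (sng (A.rproj F x1, B.rproj G x2) 1)" unfolding compr_def by (rule P.tensor_map_elem[OF rlin])

context
 fixes Z :: "'z cnormed_space" and l r
 assumes Z: "contractive_bimodule L Z l r"
begin

interpretation Z: contractive_bimodule L Z l r by (rule Z)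

lemma sandw_linear: "z \<in> carrier Z ==> clinear_on (alg_tensor X1 X2) Z (sandw Z l r z)"
 unfolding sandw_def by (rule P.clinear_tlift[OF Z.cvec_axioms bilinear_sandwich[OF Z]])

lemma sandw_tcls: "z \<in> carrier Z ==> pkeys p <= P.S ==>
  sandw Z l r z (tcls X1 X2 p) = flift Z (%(x1, x2). sandwich l r z x1 x2) p" unfolding sandw_def by (rule P.tlift_tcls[OF Z.cvec_axioms bilinear_sandwich[OF Z]])

lemma sandw_elem:
 assumes "z \<in> carrier Z" "x1 \<in> carrier X1" "x2 \<in> carrier X2" shows "sandw Z l r z (tcls X1 X2 (sng (x1, x2) 1)) = sandwich l r z x1 x2" proof -
 have c: "sandwich l r z x1 x2 \<in> carrier Z" by (rule sandwich_closed[OF Z assms])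
 have "sandw Z l r z (tcls X1 X2 (sng (x1, x2) 1)) = flift Z (%(x1, x2). sandwich l r z x1 x2) (sng (x1, x2) 1)" by (rule sandw_tcls[OF assms(1)]) (simp add: assms)
 also have "... = sandwich l r z x1 x2" using flift_single[of Z "%(x1, x2). sandwich l r z x1 x2" "(x1, x2)" 1, OF Z.cvec_axioms] c by simp
 finally show ?thesis .
qed

lemma sandw_linear_left:
 assumes u: "u \<in> carrier (alg_tensor X1 X2)" shows "clinear_on Z Z (%z. sandw Z l r z u)" proof (rule clinear_onI)
 fix z assume z: "z \<in> carrier Z"
 show "sandw Z l r z u \<in> carrier Z" by (rule clinear_onD(1)[OF sandw_linear[OF z] u])
 have cz: "c \<odot>\<^bsub>Z\<^esub> z \<in> carrier Z" for c using z by simp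
 show "sandw Z l r (c \<odot>\<^bsub>Z\<^esub> z) u = c \<odot>\<^bsub>Z\<^esub> sandw Z l r z u" for c
  by (rule P.alg_tensor_eqI[OF Z.cvec_axioms sandw_linear[OF cz] clinear_on_smult_fun[OF Z.cvec_axioms sandw_linear[OF z]] _ u])
   (simp add: sandw_elem z clinear_onD(3)[OF clinear_sandwich[OF Z]])
 fix z' assume z': "z' \<in> carrier Z"
 have zz: "z \<oplus>\<^bsub>Z\<^esub> z' \<in> carrier Z" using z z' by simp
 show "sandw Z l r (z \<oplus>\<^bsub>Z\<^esub> z') u = sandw Z l r z u \<oplus>\<^bsub>Z\<^esub> sandw Z l r z' u"
  by (rule P.alg_tensor_eqI[OF Z.cvec_axioms sandw_linear[OF zz] clinear_on_add_fun[OF Z.cvec_axioms sandw_linear[OF z] sandw_linear[OF z']] _ u])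
   (simp add: sandw_elem z z' clinear_onD(2)[OF clinear_sandwich[OF Z]])
qed

lemma bilinear_sandw: "bilinear_on Z P Z (%(z, u). sandw Z l r z u)" using sandw_linear sandw_linear_left by (simp add: bilinear_on_def clinear_on_def)

lemma sandw_lact:
 assumes a: "a \<in> bounded_ops L" and z: "z \<in> carrier Z" and u: "u \<in> carrier (alg_tensor X1 X2)" shows "sandw Z l r (l a z) u = sandw Z l r z (rP u a)"
proof (rule P.alg_tensor_eqI[OF Z.cvec_axioms sandw_linear[OF Z.lact_closed[OF a z]] _ _ u])
 note R = contractive_right_module.ract_linear[OF B.contractive_right a]
 show "clinear_on (alg_tensor X1 X2) Z (%u. sandw Z l r z (rP u a))" unfolding proj_ract_def
  by (rule clinear_on_comp[OF clinear_tensor_map[OF cvP clinear_on_id R] sandw_linear[OF z]])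
 fix x1 x2 assume x: "x1 \<in> carrier X1" "x2 \<in> carrier X2"
 show "sandw Z l r (l a z) (tcls X1 X2 (sng (x1, x2) 1)) = sandw Z l r z (rP (tcls X1 X2 (sng (x1, x2) 1)) a)"
  unfolding proj_ract_def P.tensor_map_elem[OF clinear_on_id R x] sandw_elem[OF Z.lact_closed[OF a z] x]
   sandw_elem[OF z x(1) clinear_onD(1)[OF R x(2)]] by (rule sandwich_lact[OF Z a z x])
qed

lemma sandw_ract:
 assumes a: "a \<in> bounded_ops L" and z: "z \<in> carrier Z" and u: "u \<in> carrier (alg_tensor X1 X2)" shows "sandw Z l r (r z a) u = sandw Z l r z (lP a u)"
proof (rule P.alg_tensor_eqI[OF Z.cvec_axioms sandw_linear[OF Z.ract_closed[OF a z]] _ _ u])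
 note R = contractive_left_module.lact_linear[OF A.contractive_left a]
 show "clinear_on (alg_tensor X1 X2) Z (%u. sandw Z l r z (lP a u))" unfolding proj_lact_def
  by (rule clinear_on_comp[OF clinear_tensor_map[OF cvP R clinear_on_id] sandw_linear[OF z]])
 fix x1 x2 assume x: "x1 \<in> carrier X1" "x2 \<in> carrier X2"
 show "sandw Z l r (r z a) (tcls X1 X2 (sng (x1, x2) 1)) = sandw Z l r z (lP a (tcls X1 X2 (sng (x1, x2) 1)))"
  unfolding proj_lact_def P.tensor_map_elem[OF R clinear_on_id x] sandw_elem[OF Z.ract_closed[OF a z] x]
   sandw_elem[OF z clinear_onD(1)[OF R x(1)] x(2)] by (rule sandwich_ract[OF Z a z x])
qed

abbreviation "zeta == tcls X1 X2 (sng (A.vec F e, B.vec G e') 1)"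

lemma vec_e_closed: "A.vec F e \<in> carrier X1" "B.vec G e' \<in> carrier X2" using L.onfD(2)[OF e] L.onfD(2)[OF e'] by (auto intro!: A.vec_closed[OF F] B.vec_closed[OF G])

lemma zeta_closed: "zeta \<in> carrier P" using vec_e_closed by (simp add: P.tcls_closed)

text \<open>On elementary tensors the compression is \<open>zeta\<close> with \<open>T1 x1\<close>
  on its left and \<open>T2 x2\<close> on its right. One bibalanced relation moves the first
  operator to the right of \<open>z\<close>, another moves the second to the left. Linearity extends
  this to all \<open>u\<close>.\<close>

lemma collect_zeta:
 assumes z: "z \<in> carrier Z" and u: "u \<in> carrier P" shows "sng (z, compr u) 1 - sng (sandw Z l r z u, zeta) 1 \<in>
  cspan (fmod Z P) (bilinear_relations Z P \<union> bibalanced_relations L Z l r P lP rP)" proof -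
 interpret P': contractive_bimodule L P lP rP by (rule bimodule_P)
 interpret D: normed_pair Z P by unfold_locales
 let ?R = "bibalanced_relations L Z l r P lP rP"
 note R = bibalanced_relations_subset[OF Z bimodule_P]
 interpret K: weighted_relations D.S D.w "D.rspan ?R" by (rule D.weighted_rspan[OF R])
 have el: "sng (z, compr (tcls X1 X2 (sng (x1, x2) 1))) 1 - sng (sandwich l r z x1 x2, zeta) 1 \<in> D.rspan ?R"
  if x: "x1 \<in> carrier X1" "x2 \<in> carrier X2" for x1 x2 proof -
  note T1 = T1_bounded[OF x(1)] and T2 = T2_bounded[OF x(2)]
  note lR = contractive_left_module.lact_linear[OF A.contractive_left T1]
  note rR = contractive_right_module.ract_linear[OF B.contractive_right T2]
  have "lP (T1 x1) (rP zeta (T2 x2)) = tcls X1 X2 (sng (act1 (T1 x1) (A.vec F e), B.ract (B.vec G e') (T2 x2)) 1)"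
   unfolding proj_lact_def proj_ract_def P.tensor_map_elem[OF clinear_on_id rR vec_e_closed]
   by (rule P.tensor_map_elem[OF lR clinear_on_id vec_e_closed(1) clinear_onD(1)[OF rR vec_e_closed(2)]])
  also have "... = compr (tcls X1 X2 (sng (x1, x2) 1))" unfolding A.act_zeta[OF F e x(1)] B.ract_zeta[OF G e' x(2)] compr_elem[OF x] ..
  finally have c: "lP (T1 x1) (rP zeta (T2 x2)) = compr (tcls X1 X2 (sng (x1, x2) 1))" .
  have "sng (r z (T1 x1), rP zeta (T2 x2)) 1 - sng (z, lP (T1 x1) (rP zeta (T2 x2))) 1 \<in> D.rspan ?R"
   by (intro FM.cspan_inc UnI2 bibalanced_relationsI(2)[OF T1 z P'.ract_closed[OF T2 zeta_closed]])
  moreover have "sng (l (T2 x2) (r z (T1 x1)), zeta) 1 - sng (r z (T1 x1), rP zeta (T2 x2)) 1 \<in> D.rspan ?R"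
   by (intro FM.cspan_inc UnI2 bibalanced_relationsI(1)[OF T2 Z.ract_closed[OF T1 z] zeta_closed])
  ultimately have "sng (sandwich l r z x1 x2, zeta) 1 - sng (z, compr (tcls X1 X2 (sng (x1, x2) 1))) 1 \<in> D.rspan ?R" unfolding c sandwich_def using K.K_add by fastforce
  then show ?thesis by (rule K.K_uminus)
 qed
 obtain p where p: "pkeys p <= P.S" "u = tcls X1 X2 p" using u by (auto elim: P.alg_tensor_cases)
 let ?f = "%k. compr (tcls X1 X2 (sng k 1))" and ?g = "%(x1, x2). sandwich l r z x1 x2"
 have f: "?f \<in> P.S \<rightarrow> carrier P" using clinear_onD(1)[OF clinear_compr] P.tcls_closed by (simp add: Pi_iff)
 have g: "?g \<in> P.S \<rightarrow> carrier Z" by (rule P.bilinear_on_closed[OF bilinear_sandwich[OF Z z]])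
 \<comment> \<open>Written as a lift over a representative of \<open>u\<close>, the compression is
   collected in its second factor and the sandwich in its first; generator by generator they are
   congruent by \<open>el\<close>.\<close>
 have cu: "compr u = flift P ?f p" unfolding p(2) by (rule flift_unique[OF P.cvec_proj_tensor clinear_on_comp[OF P.clinear_tcls' clinear_compr] p(1)]) simp
 have 1: "fmap (%k. (z, ?f k)) p - sng (z, compr u) 1 \<in> D.rspan ?R" unfolding cu using D.collect_right[OF z f p(1)] D.tensor_kernel_rspan by (rule rev_subsetD)
 have 2: "fmap (%k. (?g k, zeta)) p - sng (sandw Z l r z u, zeta) 1 \<in> D.rspan ?R"
  unfolding p(2) sandw_tcls[OF z p(1)] using D.collect_left[OF zeta_closed g p(1)] D.tensor_kernel_rspan by (rule rev_subsetD)
 have fS: "(%k. (z, ?f k)) \<in> P.S \<rightarrow> D.S" using f z by (simp add: Pi_iff)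
 have gS: "(%k. (?g k, zeta)) \<in> P.S \<rightarrow> D.S" using g zeta_closed by (simp add: Pi_iff)
 have 3: "fmap (%k. (z, ?f k)) p - fmap (%k. (?g k, zeta)) p \<in> D.rspan ?R" unfolding flift_free_diff[OF fS gS p(1)] proof (rule K.K_flift[OF _ p(1)])
  fix k assume "k \<in> P.S"
  then show "sng (z, ?f k) 1 - sng (?g k, zeta) 1 \<in> D.rspan ?R" using el[of "fst k" "snd k"] by (cases k) simp
 qed
 from K.K_add[OF K.K_uminus[OF 1] K.K_add[OF 3 2]] show ?thesis by simp
qed

end

text \<open>A tensor is a sum of elementary tensors with weight close to its projective norm, and
  the sandwiches of this sum merge. The slack \<open>d\<close> is due to the infimum in the
  projective norm.\<close>

lemma sandw_gauge:
 fixes Z :: "'z cnormed_space" assumes inf: "infinite_dimensional L" and Z: "ruan_bimodule L Z l r" and z: "z \<in> carrier Z" and u: "u \<in> carrier P" and d: "d > 0"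
 shows "sandwich_gauge Z l r (nrm Z z * nrm P u + d) (sandw Z l r z u)" proof -
 interpret Z: ruan_bimodule L Z l r by fact
 note bm = Z.contractive_bimodule_axioms
 obtain p where p: "pkeys p <= P.S" "u = tcls X1 X2 p" using u by (auto elim: P.alg_tensor_cases)
 have nz: "nrm Z z \<ge> 0" using z by simp
 then have "d / (nrm Z z + 1) > 0" using d by simp
 then obtain q where q: "pkeys q <= P.S" "q - p \<in> tensor_kernel X1 X2" "wsum P.w q < P.T.pn p + d / (nrm Z z + 1)" using P.T.pn_approx[OF p(1)] by blast
 have uq: "u = tcls X1 X2 q" using q(2) P.tcls_eq_iff[OF q(1) p(1)] p(2) by simp
 have "nrm P u = P.T.pn p" using P.proj_norm_tcls[OF p(1)] p(2) by simp
 have "sandwich_gauge Z l r (wsum (%k. nrm Z z * P.w k) q) (flift Z (%(x1, x2). sandwich l r z x1 x2) q)"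
 proof (rule flift_gauge[OF Z.cvec_axioms P.bilinear_on_closed[OF bilinear_sandwich[OF bm z]] q(1)])
  fix k assume "k \<in> P.S"
  then show "sandwich_gauge Z l r (nrm Z z * P.w k) (case k of (x1, x2) => sandwich l r z x1 x2)"
   by (intro sandwich_gaugeI[OF bm z, of "fst k" "snd k"]) (auto simp: mult.assoc)
 qed (simp_all add: sandwich_gauge_zero[OF bm] sandwich_gauge_add[OF inf Z] sandwich_gauge_smult[OF bm])
 then have g: "sandwich_gauge Z l r (wsum (%k. nrm Z z * P.w k) q) (sandw Z l r z u)" unfolding uq sandw_tcls[OF bm z q(1)] .
 have 1: "wsum (%k. nrm Z z * P.w k) q = nrm Z z * wsum P.w q" unfolding wsum_def sum_distrib_left by (simp add: mult_ac)
 have 2: "nrm Z z * wsum P.w q <= nrm Z z * (nrm P u + d / (nrm Z z + 1))" using q(3) \<open>nrm P u = P.T.pn p\<close> nz by (intro mult_left_mono) simp_all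
 have 3: "nrm Z z * (d / (nrm Z z + 1)) <= d" using nz d by (simp add: field_simps) show ?thesis
  by (rule sandwich_gauge_mono[OF bm g]) (use 1 2 3 in \<open>unfold distrib_left, linarith\<close>)
qed

lemma sandw_gauge_flift:
 fixes Z :: "'z cnormed_space" assumes inf: "infinite_dimensional L" and Z: "ruan_bimodule L Z l r" and q: "pkeys q <= carrier Z \<times> carrier P" and d: "d > 0"
 shows "sandwich_gauge Z l r (wsum (%k. nrm Z (fst k) * nrm P (snd k)) q + d) (flift Z (%(z, u). sandw Z l r z u) q)" proof -
 interpret Z: ruan_bimodule L Z l r by fact
 note bm = Z.contractive_bimodule_axioms
 interpret D: cvec_pair Z P by unfold_locales
 \<comment> \<open>The slack is quantified inside the gauge: a property with one fixed slack would
   not be stable under sums and scalar multiples.\<close>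
 let ?G = "%a v. \<forall>d>0. sandwich_gauge Z l r (a + d) v"
 have "?G (wsum (%k. nrm Z (fst k) * nrm P (snd k)) q) (flift Z (%(z, u). sandw Z l r z u) q)"
 proof (rule flift_gauge[OF Z.cvec_axioms D.bilinear_on_closed[OF bilinear_sandw[OF bm]] q, where P="?G"])
  show "?G 0 \<zero>\<^bsub>Z\<^esub>" using sandwich_gauge_mono[OF bm sandwich_gauge_zero[OF bm]] by simp
  fix a b u v assume g: "?G a u" "?G b v"
  show "?G (a + b) (u \<oplus>\<^bsub>Z\<^esub> v)" proof (intro allI impI)
   fix d :: real assume "d > 0"
   then have "sandwich_gauge Z l r (a + d / 2) u" "sandwich_gauge Z l r (b + d / 2) v" using g by simp_all
   from sandwich_gauge_add[OF inf Z this] show "sandwich_gauge Z l r (a + b + d) (u \<oplus>\<^bsub>Z\<^esub> v)" by (rule sandwich_gauge_mono[OF bm]) (simp add: field_simps)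
  qed
 next
  fix a c u assume g: "?G a u"
  show "?G (cmod c * a) (c \<odot>\<^bsub>Z\<^esub> u)" proof (intro allI impI)
   fix d :: real assume d: "d > 0"
   then have "d / (cmod c + 1) > 0" by (simp add: add_nonneg_pos)
   with g have "sandwich_gauge Z l r (a + d / (cmod c + 1)) u" by blast
   from sandwich_gauge_smult[OF bm this, of c] show "sandwich_gauge Z l r (cmod c * a + d) (c \<odot>\<^bsub>Z\<^esub> u)" proof (rule sandwich_gauge_mono[OF bm])
    have "cmod c * d <= d * (cmod c + 1)" using d by (simp add: algebra_simps)
    then have "cmod c * d / (cmod c + 1) <= d" by (subst pos_divide_le_eq) (simp_all add: add_nonneg_pos)
    then show "cmod c * (a + d / (cmod c + 1)) <= cmod c * a + d" by (simp add: distrib_left)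
   qed
  qed
 next
  fix k assume "k \<in> carrier Z \<times> carrier P"
  then show "?G (nrm Z (fst k) * nrm P (snd k)) (case k of (z, u) => sandw Z l r z u)" using sandw_gauge[OF inf Z, of "fst k" "snd k"] by (auto simp: case_prod_beta)
 qed
 then show ?thesis using d by blast
qed

end

text \<open>Every \<open>u\<close> is fixed as a finite formal sum, so only finitely many vectors of
  each factor have to be approximated.\<close>

lemma (in bicolumns) compr_approx:
 assumes U: "finite U" "U <= carrier P" and d: "d > 0" obtains F G where "A.H.onf F (%h. h)" "B.H.onf G (%h. h)"
  "!!u. u \<in> U ==> nrm P (u \<ominus>\<^bsub>P\<^esub> tensor_map X1 X2 (%x. A.rproj F x) (%x. B.rproj G x) u) < d" proof -
 have "\<forall>u\<in>U. \<exists>p. pkeys p <= P.S & u = tcls X1 X2 p" using U(2) by (auto elim: P.alg_tensor_cases)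
 then obtain pp where pp: "!!u. u \<in> U ==> pkeys (pp u) \<subseteq> P.S" "!!u. u \<in> U ==> u = tcls X1 X2 (pp u)" by metis
 let ?m = "%k. nrm X1 (fst k) + nrm X2 (snd k)"
 \<comment> \<open>A pair whose factors move by at most delta changes by at most delta times the sum
   of its norms. \<open>M\<close> bounds these sums, taken with coefficients, for all of
   \<open>U\<close>.\<close>
 define M where "M = (\<Sum>u\<in>U. wsum ?m (pp u))"
 have m: "wsum ?m (pp u) \<ge> 0" if "u \<in> U" for u using pp(1)[OF that] by (intro wsum_nonneg) auto
 have M: "wsum ?m (pp u) <= M" if "u \<in> U" for u unfolding M_def using m U(1) that by (intro member_le_sum) auto
 have M0: "M \<ge> 0" unfolding M_def using m by (intro sum_nonneg)
 define \<delta> where "\<delta> = d / (M + 1)"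
 have \<delta>: "\<delta> > 0" using d M0 by (simp add: \<delta>_def)
 have fin: "finite (\<Union>u\<in>U. fst ` pkeys (pp u))" "finite (\<Union>u\<in>U. snd ` pkeys (pp u))" using U(1) by simp_all
 have sub: "(\<Union>u\<in>U. fst ` pkeys (pp u)) <= carrier X1" "(\<Union>u\<in>U. snd ` pkeys (pp u)) <= carrier X2" using pp(1) by force+
 obtain F where F: "A.H.onf F (%h. h)" "!!x. x \<in> (\<Union>u\<in>U. fst ` pkeys (pp u)) ==> nrm X1 (x \<ominus>\<^bsub>X1\<^esub> A.rproj F x) < \<delta>"
  using A.approx[OF fin(1) sub(1) \<delta>] by blast
 obtain G where G: "B.H.onf G (%h. h)" "!!x. x \<in> (\<Union>u\<in>U. snd ` pkeys (pp u)) ==> nrm X2 (x \<ominus>\<^bsub>X2\<^esub> B.rproj G x) < \<delta>"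
  using B.approx[OF fin(2) sub(2) \<delta>] by blast
 let ?f = "map_prod (%x. A.rproj F x) (%x. B.rproj G x)"
 have f: "?f \<in> P.S \<rightarrow> P.S" using A.rproj_closed[OF F(1)] B.rproj_closed[OF G(1)] by (auto simp: map_prod_def)
 note cvP = A.X.cvec_axioms B.X.cvec_axioms A.X.cvec_axioms B.X.cvec_axioms
  and rlin = A.clinear_rproj[OF F(1)] B.clinear_rproj[OF G(1)] show ?thesis proof (rule that[OF F(1) G(1)])
  fix u assume u: "u \<in> U"
  note p = pp(1)[OF u]
  have fp: "pkeys (fmap ?f (pp u)) \<subseteq> P.S" by (rule fmap_keys[OF f p])
  have tu: "tensor_map X1 X2 (%x. A.rproj F x) (%x. B.rproj G x) u = tcls X1 X2 (fmap ?f (pp u))" using tensor_map_tcls[OF cvP rlin p] pp(2)[OF u] by simp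
  have "u \<ominus>\<^bsub>P\<^esub> tensor_map X1 X2 (%x. A.rproj F x) (%x. B.rproj G x) u = tcls X1 X2 (pp u - fmap ?f (pp u))"
   unfolding tu by (subst (1) pp(2)[OF u]) (simp only: P.tcls_diff'[OF p fp])
  then have "nrm P (u \<ominus>\<^bsub>P\<^esub> tensor_map X1 X2 (%x. A.rproj F x) (%x. B.rproj G x) u) = P.T.pn (pp u - fmap ?f (pp u))"
   using P.proj_norm_tcls[OF pkeys_diff_subset[OF p fp]] by simp
  also have "pp u - fmap ?f (pp u) = flift (free_module P.S) (%k. sng k 1 - sng (?f k) 1) (pp u)"
   using flift_free_diff[of "%k. k" P.S P.S ?f "pp u"] f p by (simp add: fmap_id)
  also have "P.T.pn ... <= wsum (%k. \<delta> * ?m k) (pp u)" proof (rule P.T.pn_flift_le[of "pkeys (pp u)"])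
   fix k assume k: "k \<in> pkeys (pp u)"
   define x y where "x = fst k" and "y = snd k"
   have kk: "k = (x, y)" and xy: "x \<in> carrier X1" "y \<in> carrier X2" using k p by (auto simp: x_def y_def)
   have fk: "?f k = (A.rproj F x, B.rproj G y)" by (simp add: kk)
   note rx = A.rproj_closed[OF F(1) xy(1)] and ry = B.rproj_closed[OF G(1) xy(2)]
   show "pkeys (sng k 1 - sng (?f k) 1) \<subseteq> P.S" unfolding fk unfolding kk by (intro pkeys_subset) (simp_all add: xy rx ry)
   have lt: "nrm X1 (x \<ominus>\<^bsub>X1\<^esub> A.rproj F x) <= \<delta>" "nrm X2 (y \<ominus>\<^bsub>X2\<^esub> B.rproj G y) <= \<delta>"
    using F(2)[of x] G(2)[of y] k u by (fastforce simp: x_def y_def)+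
   \<comment> \<open>A telescoping difference: first the first factor is compressed, then the
     second.\<close>
   have "P.T.pn ((sng (x, y) 1 - sng (A.rproj F x, y) 1) + (sng (A.rproj F x, y) 1 - sng (A.rproj F x, B.rproj G y) 1))
    <= P.T.pn (sng (x, y) 1 - sng (A.rproj F x, y) 1) + P.T.pn (sng (A.rproj F x, y) 1 - sng (A.rproj F x, B.rproj G y) 1)"
    by (rule P.T.pn_add) (simp_all add: pkeys_subset xy rx ry)
   also have "... <= nrm X1 (x \<ominus>\<^bsub>X1\<^esub> A.rproj F x) * nrm X2 y + nrm X1 (A.rproj F x) * nrm X2 (y \<ominus>\<^bsub>X2\<^esub> B.rproj G y)"
    using P.pn_diff_left[of "{}" x "A.rproj F x" y] P.pn_diff_right[of "{}" "A.rproj F x" y "B.rproj G y"] xy rx ry by (simp add: tensor_kernel_def)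
   also have "... <= \<delta> * nrm X2 y + nrm X1 x * \<delta>"
    using lt xy rx ry A.nrm_rproj_le[OF F(1) xy(1)] less_imp_le[OF \<delta>] by (intro add_mono mult_mono) simp_all
   finally show "P.T.pn (sng k 1 - sng (?f k) 1) <= \<delta> * ?m k" unfolding fk unfolding kk by (simp add: algebra_simps)
  qed simp
  also have "... = \<delta> * wsum ?m (pp u)" unfolding wsum_def sum_distrib_left by (simp add: mult_ac)
  also have "... <= \<delta> * M" using M[OF u] \<delta> by simp
  also have "... < d" using d M0 by (simp add: \<delta>_def field_simps)
  finally show "nrm P (u \<ominus>\<^bsub>P\<^esub> tensor_map X1 X2 (%x. A.rproj F x) (%x. B.rproj G x) u) < d" .
 qed
qed

section \<open>ER-flatness of the projective tensor product of columns\<close>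

context bicolumns
begin

text \<open>Kept as an inequality of seminorms, the form that \<open>pnorm_fmap_completion\<close>
  takes as its hypothesis.\<close>

lemma pnorm_fmap_bicolumns:
 fixes Y :: "'v cnormed_space" and Z :: "'z cnormed_space" assumes inf: "infinite_dimensional L" and Y: "ruan_bimodule L Y lY rY" and Z: "ruan_bimodule L Z lZ rZ"
  and \<alpha>: "left_morphism L Y lY Z lZ \<alpha>" "right_morphism L Y rY Z rZ \<alpha>" "isometric_on Y Z \<alpha>" and p: "pkeys p <= carrier Y \<times> carrier P"
 shows "pnorm (carrier Y \<times> carrier P) (%k. nrm Y (fst k) * nrm P (snd k))
    (cspan (fmod Y P) (bilinear_relations Y P \<union> bibalanced_relations L Y lY rY P lP rP)) p
   <= pnorm (carrier Z \<times> carrier P) (%k. nrm Z (fst k) * nrm P (snd k))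
    (cspan (fmod Z P) (bilinear_relations Z P \<union> bibalanced_relations L Z lZ rZ P lP rP)) (fmap (map_prod \<alpha> (%x. x)) p)" proof -
 interpret Y: ruan_bimodule L Y lY rY by fact
 interpret Z: ruan_bimodule L Z lZ rZ by fact
 interpret P': contractive_bimodule L P lP rP by (rule bimodule_P)
 interpret C: normed_pair Y P by unfold_locales
 interpret D: normed_pair Z P by unfold_locales
 note Y' = Y.contractive_bimodule_axioms and Z' = Z.contractive_bimodule_axioms
 have al: "clinear_on Y Z \<alpha>" and am: "!!a u. a \<in> bounded_ops L ==> u \<in> carrier Y ==> \<alpha> (lY a u) = lZ a (\<alpha> u)"
  and ar: "!!a u. a \<in> bounded_ops L ==> u \<in> carrier Y ==> \<alpha> (rY u a) = rZ (\<alpha> u) a"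
  using \<alpha> by (auto simp: left_morphism_def right_morphism_def)
 let ?R = "bibalanced_relations L Y lY rY P lP rP" and ?R' = "bibalanced_relations L Z lZ rZ P lP rP"
 note R = bibalanced_relations_subset[OF Y' bimodule_P] and R' = bibalanced_relations_subset[OF Z' bimodule_P]
 interpret KC: weighted_relations C.S C.w "C.rspan ?R" by (rule C.weighted_rspan[OF R])
 interpret KD: weighted_relations D.S D.w "D.rspan ?R'" by (rule D.weighted_rspan[OF R'])
 let ?j = "map_prod \<alpha> (%x. x)"
 have j: "?j \<in> C.S \<rightarrow> D.S" using clinear_onD(1)[OF al] by auto show ?thesis
 proof (rule pnorm_le_pnorm_fmap[OF KC.weighted_relations_axioms KD.weighted_relations_axioms p j Y.cvec_axioms Z.cvec_axioms al])
  fix d :: real assume d: "d > 0"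
  define c where "c = wsum (%k. nrm Y (fst k)) p"
  have c: "c \<ge> 0" unfolding c_def using p by (intro wsum_nonneg) auto
  \<comment> \<open>One half of the error is spent on the compression of \<open>p\<close>, the other
    on the infimum in the projective norm.\<close>
  have d': "d / 2 / (c + 1) > 0" "d / 2 > 0" using c d by simp_all
  have U: "finite (snd ` pkeys p)" "snd ` pkeys p <= carrier P" using p by auto
  obtain F G where F: "A.H.onf F (%h. h)" and G: "B.H.onf G (%h. h)"
   and FG: "!!u. u \<in> snd ` pkeys p ==>
    nrm P (u \<ominus>\<^bsub>P\<^esub> tensor_map X1 X2 (%x. A.rproj F x) (%x. B.rproj G x) u) < d / 2 / (c + 1)" using compr_approx[OF U d'(1)] by blast
  obtain e where e: "L.onf F e" using L.exists_onf_family[OF inf A.H.onfD(1)[OF F]] by blast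
  obtain e' where e': "L.onf G e'" using L.exists_onf_family[OF inf B.H.onfD(1)[OF G]] by blast
  interpret Q: bicolumns_frame L H X1 comp1 emb1 act1 K X2 comp2 emb2 act2 F e G e' by unfold_locales (rule F e G e')+
  let ?W = "%(y, u). Q.sandw Y lY rY y u" and ?W' = "%(z, u). Q.sandw Z lZ rZ z u"
  note bilY = Q.bilinear_sandw[OF Y'] and bilZ = Q.bilinear_sandw[OF Z']
  note WY = C.bilinear_on_closed[OF bilY] and WZ = D.bilinear_on_closed[OF bilZ]
  \<comment> \<open>A sandwich is made of module operations only, so every bimodule morphism
    commutes with it.\<close>
  have W\<alpha>: "Q.sandw Z lZ rZ (\<alpha> y) u = \<alpha> (Q.sandw Y lY rY y u)" if y: "y \<in> carrier Y" and u: "u \<in> carrier P" for y u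
  proof (rule P.alg_tensor_eqI[OF Z.cvec_axioms Q.sandw_linear[OF Z' clinear_onD(1)[OF al y]]
     clinear_on_comp[OF Q.sandw_linear[OF Y' y] al]])
   fix x1 x2 assume x: "x1 \<in> carrier X1" "x2 \<in> carrier X2"
   note T1 = Q.T1_bounded[OF x(1)] and T2 = Q.T2_bounded[OF x(2)]
   show "Q.sandw Z lZ rZ (\<alpha> y) (tcls X1 X2 (sng (x1, x2) 1)) = \<alpha> (Q.sandw Y lY rY y (tcls X1 X2 (sng (x1, x2) 1)))"
    unfolding Q.sandw_elem[OF Z' clinear_onD(1)[OF al y] x] Q.sandw_elem[OF Y' y x] Q.sandwich_def
     am[OF T2 Y.ract_closed[OF T1 y]] ar[OF T1 y] ..
  qed (use u in simp)
  have WZr: "flift Z ?W' r = \<zero>\<^bsub>Z\<^esub>" if r: "r \<in> D.rspan ?R'" for r proof (rule D.flift_cspan_relations[OF Z.cvec_axioms bilZ R' _ r])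
   fix r assume r: "r \<in> ?R'"
   have eq: "flift Z ?W' (sng k 1 - sng k' 1) = \<zero>\<^bsub>Z\<^esub>" if "k \<in> D.S" "k' \<in> D.S" "?W' k = ?W' k'" for k k'
    unfolding flift_diff[OF Z.cvec_axioms WZ pkeys_sng_subset[OF that(1)] pkeys_sng_subset[OF that(2)]] using funcset_mem[OF WZ that(1)] funcset_mem[OF WZ that(2)] that(3)
    by (simp add: flift_single[OF Z.cvec_axioms])
   from r show "flift Z ?W' r = \<zero>\<^bsub>Z\<^esub>" proof (cases rule: bibalanced_relationsE)
    case (1 a z u) show ?thesis unfolding 1(4) proof (rule eq)
     show "(lZ a z, u) \<in> D.S" "(z, rP u a) \<in> D.S"
      using Z.lact_closed[OF 1(1,2)] P'.ract_closed[OF 1(1,3)] 1(2,3) by (simp_all only: mem_Times_iff fst_conv snd_conv simp_thms)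
     show "?W' (lZ a z, u) = ?W' (z, rP u a)" using Q.sandw_lact[OF Z' 1(1,2)] 1(3) by simp
    qed
   next
    case (2 a z u) show ?thesis unfolding 2(4) proof (rule eq)
     show "(rZ z a, u) \<in> D.S" "(z, lP a u) \<in> D.S"
      using Z.ract_closed[OF 2(1,2)] P'.lact_closed[OF 2(1,3)] 2(2,3) by (simp_all only: mem_Times_iff fst_conv snd_conv simp_thms)
     show "?W' (rZ z a, u) = ?W' (z, lP a u)" using Q.sandw_ract[OF Z' 2(1,2)] 2(3) by simp
    qed
   qed
  qed
  let ?\<zeta> = "Q.zeta"
  note \<zeta> = Q.zeta_closed[OF Y']
  have main: "KC.pn p <= wsum D.w q + d"
   if q: "pkeys q <= D.S" "flift Z ?W' q = \<alpha> (flift Y ?W p)" for q proof -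
   let ?w = "flift Y ?W p"
   have w: "?w \<in> carrier Y" by (rule flift_closed[OF Y.cvec_axioms p WY])
   \<comment> \<open>The representation \<open>q\<close> over \<open>Z\<close> merges to a single
     sandwich with value \<open>\<alpha> ?w\<close>, and the pseudo-inverses bring it back to
     \<open>Y\<close> at no cost.\<close>
   have "Q.sandwich_gauge Z lZ rZ (wsum D.w q + d / 2) (\<alpha> ?w)" using Q.sandw_gauge_flift[OF inf Z q(1) d'(2)] unfolding q(2) .
   then have g: "Q.sandwich_gauge Y lY rY (wsum D.w q + d / 2) ?w" by (rule Q.sandwich_gauge_isometric[OF Y' Z' \<alpha> w])
   obtain y x1 x2 where y: "y \<in> carrier Y" "x1 \<in> carrier X1" "x2 \<in> carrier X2" "Q.sandwich lY rY y x1 x2 = ?w"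
    "nrm Y y * nrm X1 x1 * nrm X2 x2 <= wsum D.w q + d / 2" using Q.sandwich_gaugeE[OF Y' g] .
   \<comment> \<open>The elementary tensor of the new outer factors; its compression with
     \<open>y\<close> represents the compression of \<open>p\<close>.\<close>
   define t where "t = tcls X1 X2 (sng (x1, x2) 1)"
   have t: "t \<in> carrier P" unfolding t_def using y(2,3) by (simp add: P.tcls_closed)
   have cl: "Q.compr u \<in> carrier P" if "u \<in> carrier P" for u by (rule clinear_onD(1)[OF Q.clinear_compr that])
   let ?f = "%k. (fst k, Q.compr (snd k))" and ?g = "%k. (?W k, ?\<zeta>)"
   have f: "?f \<in> C.S \<rightarrow> C.S"  proof (rule Pi_I)
    fix k assume "k \<in> C.S"
    then show "?f k \<in> C.S" using cl[of "snd k"] by (simp only: mem_Times_iff fst_conv snd_conv simp_thms)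
   qed
   have g: "?g \<in> C.S \<rightarrow> C.S"  proof (rule Pi_I)
    fix k assume "k \<in> C.S"
    then show "?g k \<in> C.S" using funcset_mem[OF WY] \<zeta> by (simp only: mem_Times_iff fst_conv snd_conv simp_thms)
   qed
   have fp: "pkeys (fmap ?f p) \<subseteq> C.S" by (rule fmap_keys[OF f p])
   have "fmap ?f p - fmap ?g p \<in> C.rspan ?R" unfolding flift_free_diff[OF f g p] proof (rule KC.K_flift[OF _ p])
    fix k assume "k \<in> C.S"
    then show "sng (?f k) 1 - sng (?g k) 1 \<in> C.rspan ?R" using Q.collect_zeta[OF Y', of "fst k" "snd k"] by (simp only: mem_Times_iff case_prod_beta)
   qed
   moreover have "fmap ?g p - sng (?w, ?\<zeta>) 1 \<in> C.rspan ?R" using C.collect_left[OF \<zeta> WY p] C.tensor_kernel_rspan by (rule rev_subsetD)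
   moreover have "sng (y, Q.compr t) 1 - sng (?w, ?\<zeta>) 1 \<in> C.rspan ?R" using Q.collect_zeta[OF Y' y(1) t] unfolding t_def Q.sandw_elem[OF Y' y(1-3)] y(4) .
   ultimately have "fmap ?f p - sng (y, Q.compr t) 1 \<in> C.rspan ?R" by (rule B.collect_chain[OF KC.weighted_relations_axioms])
   then have "KC.pn (fmap ?f p) = KC.pn (sng (y, Q.compr t) 1)" by (rule KC.pn_cong)
   also have "... <= nrm Y y * nrm P (Q.compr t)" using KC.pn_le_wsum[of "sng (y, Q.compr t) 1"] y(1) cl[OF t] by simp
   also have "... <= nrm Y y * (nrm X1 x1 * nrm X2 x2)" proof (rule mult_left_mono)
    note rx = A.rproj_closed[OF F y(2)] B.rproj_closed[OF G y(3)]
    have "nrm P (Q.compr t) <= nrm X1 (A.rproj F x1) * nrm X2 (B.rproj G x2)" unfolding t_def Q.compr_elem[OF y(2,3)] using P.proj_norm_elem_le[OF rx] by simp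
    also have "... <= nrm X1 x1 * nrm X2 x2" using A.nrm_rproj_le[OF F y(2)] B.nrm_rproj_le[OF G y(3)] rx y(2,3) by (intro mult_mono) simp_all
    finally show "nrm P (Q.compr t) <= nrm X1 x1 * nrm X2 x2" .
   qed (use y in simp)
   finally have 1: "KC.pn (fmap ?f p) <= wsum D.w q + d / 2" using y(5) by (simp add: mult.assoc)
   have "p - fmap ?f p = flift (free_module C.S) (%k. sng k 1 - sng (?f k) 1) p" using flift_free_diff[of "%k. k" C.S C.S ?f p] f p by (simp add: fmap_id)
   also have "KC.pn ... <= wsum (%k. d / 2 / (c + 1) * nrm Y (fst k)) p" proof (rule KC.pn_flift_le[of "pkeys p"])
    fix k assume k: "k \<in> pkeys p"
    then have kS: "k \<in> C.S" using p by blast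
    then have kk: "fst k \<in> carrier Y" "snd k \<in> carrier P" "k = (fst k, snd k)" by (simp_all only: mem_Times_iff prod.collapse)
    show "pkeys (sng k 1 - sng (?f k) 1) \<subseteq> C.S" by (rule pkeys_diff_subset[OF pkeys_sng_subset[OF kS] pkeys_sng_subset[OF funcset_mem[OF f kS]]])
    have "KC.pn (sng k 1 - sng (?f k) 1) <= nrm Y (fst k) * nrm P (snd k \<ominus>\<^bsub>P\<^esub> Q.compr (snd k))"
     using C.pn_diff_right[OF R kk(1,2) cl[OF kk(2)]] kk(3) by simp
    also have "... <= nrm Y (fst k) * (d / 2 / (c + 1))" using FG[of "snd k"] k kk(1) unfolding Q.compr_def by (intro mult_left_mono) simp_all
    finally show "KC.pn (sng k 1 - sng (?f k) 1) <= d / 2 / (c + 1) * nrm Y (fst k)" by (simp only: mult.commute)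
   qed simp
   also have "... = d / 2 / (c + 1) * c" unfolding c_def wsum_def sum_distrib_left by (intro sum.cong) auto
   also have "... <= d / 2" using c d by (simp add: field_simps)
   finally have "KC.pn (p - fmap ?f p) <= d / 2" .
   with 1 KC.pn_triangle[OF p fp] show ?thesis by simp
  qed
  show "\<exists>W W'. W \<in> C.S \<rightarrow> carrier Y & W' \<in> D.S \<rightarrow> carrier Z & (\<forall>s\<in>C.S. W' (?j s) = \<alpha> (W s)) &
   (\<forall>r\<in>D.rspan ?R'. flift Z W' r = \<zero>\<^bsub>Z\<^esub>) &
   (\<forall>q. pkeys q <= D.S --> flift Z W' q = \<alpha> (flift Y W p) --> KC.pn p <= wsum D.w q + d)"
  proof (intro exI[of _ ?W] exI[of _ ?W'] conjI WY WZ ballI allI impI)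
   fix s assume "s \<in> C.S"
   then show "?W' (?j s) = \<alpha> (?W s)" using W\<alpha>[of "fst s" "snd s"] by (simp only: mem_Times_iff case_prod_beta fst_map_prod snd_map_prod)
  qed (rule WZr main; assumption)+
 qed
qed

theorem ER_flat_bicolumns:
 assumes "infinite_dimensional L" shows "ER_flat L P lP rP TYPE('v) TYPE('z)" by (rule ER_flatI[OF bimodule_P pnorm_fmap_bicolumns[OF assms]])

end

section \<open>Completions of flat bimodules\<close>

text \<open>Functoriality, used below to interchange approximation in one factor with a morphism in
  the other.\<close>

lemma fmap_fmap: "fmap g (fmap f p) = fmap (%k. g (f k)) p" proof -
 have "fmap g (fmap f p) = flift (free_module UNIV) (%s. sng (g s) 1) (fmap f p)" by (rule fmap_eq_flift) simp
 also have "... = flift (free_module UNIV) (%s. sng (g (f s)) 1) p" by (rule flift_fmap[OF cvec_free_module, of f UNIV UNIV]) simp_all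
 also have "... = fmap (%k. g (f k)) p" by (rule fmap_eq_flift[symmetric]) simp
 finally show ?thesis .
qed

context
 fixes L :: "'l cinner_space" and X :: "'x cnormed_space" and lX rX
 assumes L: "hilbert_space L" and X: "contractive_bimodule L X lX rX"
begin

interpretation L: hilbert_space L by (rule L)
interpretation X: contractive_bimodule L X lX rX by (rule X)
interpretation C: complex_normed_space "completion X" by (rule X.completion_normed)

abbreviation "Xc == completion X"
abbreviation "emb == completion_embed X"
abbreviation "lC == %a. completion_map X (lX a)"
abbreviation "rC == %u a. completion_map X (%v. rX v a) u"

lemma bounded_lX: "a \<in> bounded_ops L ==> bounded_map X X (lX a) (op_norm L a)"
 using X.lact_linear X.lact_contractive L.op_norm_nonneg by (simp add: bounded_map_def)

lemma bounded_rX: "a \<in> bounded_ops L ==> bounded_map X X (%v. rX v a) (op_norm L a)"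
 using X.ract_linear X.ract_contractive L.op_norm_nonneg by (simp add: bounded_map_def mult.commute)

lemmas lC_ccls = X.completion_map_ccls[OF bounded_lX]
 and rC_ccls = X.completion_map_ccls[OF bounded_rX]
 and lC_bounded = X.bounded_completion_map(1)[OF bounded_lX]
 and rC_bounded = X.bounded_completion_map(1)[OF bounded_rX]
 and cauchy_lX = X.cauchy_map[OF X.complex_normed_space_axioms bounded_lX]
 and cauchy_rX = X.cauchy_map[OF X.complex_normed_space_axioms bounded_rX]

text \<open>Every axiom holds term by term along a Cauchy sequence representing the element.\<close>

lemma completion_bimodule: "contractive_bimodule L Xc lC rC" proof (intro contractive_bimodule.intro contractive_left_module.intro contractive_right_module.intro
  contractive_left_module_axioms.intro contractive_right_module_axioms.intro contractive_bimodule_axioms.intro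
  C.complex_normed_space_axioms)
 fix a assume a: "a \<in> bounded_ops L"
 show "clinear_on Xc Xc (lC a)" "clinear_on Xc Xc (%u. rC u a)" using bounded_mapD(1)[OF lC_bounded[OF a]] bounded_mapD(1)[OF rC_bounded[OF a]] by simp_all
 fix u assume u: "u \<in> carrier Xc"
 show "nrm Xc (lC a u) <= op_norm L a * nrm Xc u"
  "nrm Xc (rC u a) <= nrm Xc u * op_norm L a" using bounded_mapD(3)[OF lC_bounded[OF a] u] bounded_mapD(3)[OF rC_bounded[OF a] u] by (simp_all add: mult.commute)
 obtain s where s: "s \<in> cauchy_seqs X" "u = X.ccls s" using u by (rule X.completion_cases)
 note sn = X.cauchy_seqsD(1)[OF s(1)]
 note ls = cauchy_lX[OF _ s(1)] and rs = cauchy_rX[OF _ s(1)]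
 note smu = L.bounded_ops_smult[OF a]
 show "lC (\<lambda>x\<in>carrier L. c \<odot>\<^bsub>L\<^esub> a x) u = c \<odot>\<^bsub>Xc\<^esub> lC a u" for c
  unfolding s(2) lC_ccls[OF smu s(1)] lC_ccls[OF a s(1)] X.ccls_smult[OF ls[OF a]] X.lact_smult[OF a sn] ..
 show "rC u (\<lambda>x\<in>carrier L. c \<odot>\<^bsub>L\<^esub> a x) = c \<odot>\<^bsub>Xc\<^esub> rC u a" for c
  unfolding s(2) rC_ccls[OF smu s(1)] rC_ccls[OF a s(1)] X.ccls_smult[OF rs[OF a]] X.ract_smult[OF a sn] ..
 fix b assume b: "b \<in> bounded_ops L"
 note ab = L.bounded_ops_add[OF a b] and ac = L.bounded_ops_compose[OF a b]
 show "lC (\<lambda>x\<in>carrier L. a x \<oplus>\<^bsub>L\<^esub> b x) u = lC a u \<oplus>\<^bsub>Xc\<^esub> lC b u"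
  unfolding s(2) lC_ccls[OF ab s(1)] lC_ccls[OF a s(1)] lC_ccls[OF b s(1)] X.ccls_add[OF ls[OF a] ls[OF b]] X.lact_add[OF a b sn] ..
 show "rC u (\<lambda>x\<in>carrier L. a x \<oplus>\<^bsub>L\<^esub> b x) = rC u a \<oplus>\<^bsub>Xc\<^esub> rC u b"
  unfolding s(2) rC_ccls[OF ab s(1)] rC_ccls[OF a s(1)] rC_ccls[OF b s(1)] X.ccls_add[OF rs[OF a] rs[OF b]] X.ract_add[OF a b sn] ..
 show "lC (compose (carrier L) a b) u = lC a (lC b u)" unfolding s(2) lC_ccls[OF ac s(1)] lC_ccls[OF b s(1)] lC_ccls[OF a ls[OF b]] X.lact_compose[OF a b sn] ..
 show "rC u (compose (carrier L) a b) = rC (rC u a) b" unfolding s(2) rC_ccls[OF ac s(1)] rC_ccls[OF a s(1)] rC_ccls[OF b rs[OF a]] X.ract_compose[OF a b sn] ..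
 show "rC (lC a u) b = lC a (rC u b)" unfolding s(2) lC_ccls[OF a s(1)] rC_ccls[OF b s(1)] rC_ccls[OF b ls[OF a]] lC_ccls[OF a rs[OF b]] X.act_assoc[OF a b sn] ..
next
 fix u assume "u \<in> carrier Xc"
 then obtain s where s: "s \<in> cauchy_seqs X" "u = X.ccls s" by (rule X.completion_cases)
 note sn = X.cauchy_seqsD(1)[OF s(1)]
 show "lC (\<lambda>x\<in>carrier L. x) u = u" unfolding s(2) lC_ccls[OF L.bounded_ops_id s(1)] X.lact_one[OF sn] ..
 show "rC u (\<lambda>x\<in>carrier L. x) = u" unfolding s(2) rC_ccls[OF L.bounded_ops_id s(1)] X.ract_one[OF sn] ..
qed

text \<open>An arbitrary approximant within \<open>1 / (n + 1)\<close>. The choice is not linear in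
  \<open>u\<close>, so relations involving \<open>u\<close> are preserved only up to an error of
  this order.\<close>

definition appr :: "nat => (nat => 'x) set => 'x" where
 "appr n u = (SOME x. x \<in> carrier X & nrm Xc (u \<ominus>\<^bsub>Xc\<^esub> emb x) <= 1 / Suc n)"

lemma appr:
 assumes u: "u \<in> carrier Xc" shows "appr n u \<in> carrier X" "nrm Xc (u \<ominus>\<^bsub>Xc\<^esub> emb (appr n u)) <= 1 / Suc n" proof -
 have "\<exists>x. x \<in> carrier X & nrm Xc (u \<ominus>\<^bsub>Xc\<^esub> emb x) <= 1 / Suc n"
  using X.completion_dense[OF u, of "1 / Suc n"] by (auto intro: less_imp_le)
 from someI_ex[OF this] show "appr n u \<in> carrier X"
  "nrm Xc (u \<ominus>\<^bsub>Xc\<^esub> emb (appr n u)) <= 1 / Suc n" unfolding appr_def by blast+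
qed

text \<open>Allows the chosen approximant of a sum, a multiple or a product to be exchanged for the
  one computed from the approximants of its parts, which is also close to it.\<close>

lemma nrm_appr_minus:
 assumes u: "u \<in> carrier Xc" and x: "x \<in> carrier X" and le: "nrm Xc (u \<ominus>\<^bsub>Xc\<^esub> emb x) <= D / Suc n"
 shows "nrm X (appr n u \<ominus>\<^bsub>X\<^esub> x) <= (1 + D) / Suc n" proof -
 note e = X.completion_embed_closed
 have "nrm X (appr n u \<ominus>\<^bsub>X\<^esub> x) = nrm Xc (emb (appr n u) \<ominus>\<^bsub>Xc\<^esub> emb x)"
  using X.nrm_completion_embed[of "appr n u \<ominus>\<^bsub>X\<^esub> x"] appr(1)[OF u] x
   clinear_on_minus[OF X.cvec_axioms C.cvec_axioms X.clinear_completion_embed] by simp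
 also have "... <= nrm Xc (emb (appr n u) \<ominus>\<^bsub>Xc\<^esub> u) + nrm Xc (u \<ominus>\<^bsub>Xc\<^esub> emb x)"
  by (rule C.nrm_minus_triangle) (simp_all add: e appr(1)[OF u] x u)
 also have "... <= 1 / Suc n + D / Suc n" using appr(2)[OF u, of n] le C.nrm_minus_commute[OF u e[OF appr(1)[OF u, of n]]] by (intro add_mono) simp_all
 finally show ?thesis by (simp add: add_divide_distrib)
qed

lemma appr_add:
 assumes u: "u \<in> carrier Xc" and v: "v \<in> carrier Xc"
 shows "nrm Xc ((u \<oplus>\<^bsub>Xc\<^esub> v) \<ominus>\<^bsub>Xc\<^esub> emb (appr n u \<oplus>\<^bsub>X\<^esub> appr n v)) <= 2 / Suc n" proof -
 note e = X.completion_embed_closed[OF appr(1)[OF u, of n]] X.completion_embed_closed[OF appr(1)[OF v, of n]]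
 have "(u \<oplus>\<^bsub>Xc\<^esub> v) \<ominus>\<^bsub>Xc\<^esub> emb (appr n u \<oplus>\<^bsub>X\<^esub> appr n v) =
  (u \<ominus>\<^bsub>Xc\<^esub> emb (appr n u)) \<oplus>\<^bsub>Xc\<^esub> (v \<ominus>\<^bsub>Xc\<^esub> emb (appr n v))"
  unfolding clinear_onD(2)[OF X.clinear_completion_embed appr(1)[OF u] appr(1)[OF v]] using u v e by (simp add: a_minus_def C.M.minus_add C.M.a_ac)
 also have "nrm Xc ... <= 1 / Suc n + 1 / Suc n" using u v e appr(2)[OF u, of n] appr(2)[OF v, of n] by (intro order_trans[OF C.nrm_triangle] add_mono) simp_all
 finally show ?thesis by simp
qed

lemma appr_map:
 assumes f: "bounded_map X X f D" and u: "u \<in> carrier Xc" shows "nrm Xc (completion_map X f u \<ominus>\<^bsub>Xc\<^esub> emb (f (appr n u))) <= D / Suc n" proof -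
 note b = X.bounded_completion_map[OF f]
 note e = X.completion_embed_closed[OF appr(1)[OF u, of n]]
 have "completion_map X f u \<ominus>\<^bsub>Xc\<^esub> emb (f (appr n u)) =
  completion_map X f (u \<ominus>\<^bsub>Xc\<^esub> emb (appr n u))"
  using clinear_on_minus[OF C.cvec_axioms C.cvec_axioms bounded_mapD(1)[OF b(1)] u e] b(2)[OF appr(1)[OF u]] by simp
 also have "nrm Xc ... <= D * nrm Xc (u \<ominus>\<^bsub>Xc\<^esub> emb (appr n u))" by (rule bounded_mapD(3)[OF b(1)]) (simp add: u e)
 also have "... <= D * (1 / Suc n)" by (rule mult_left_mono[OF appr(2)[OF u] bounded_mapD(2)[OF f]])
 finally show ?thesis by simp
qed

lemma appr_smult:
 assumes u: "u \<in> carrier Xc" shows "nrm Xc ((c \<odot>\<^bsub>Xc\<^esub> u) \<ominus>\<^bsub>Xc\<^esub> emb (c \<odot>\<^bsub>X\<^esub> appr n u)) <= cmod c / Suc n"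
proof -
 obtain s where s: "s \<in> cauchy_seqs X" "u = X.ccls s" using u by (rule X.completion_cases)
 have "c \<odot>\<^bsub>Xc\<^esub> u = completion_map X (%x. c \<odot>\<^bsub>X\<^esub> x) u"
  unfolding s(2) X.completion_map_ccls[OF X.bounded_map_smult s(1)] by (rule X.ccls_smult[OF s(1)])
 then show ?thesis using appr_map[OF X.bounded_map_smult u] by simp
qed

abbreviation "apprm n == fmap (map_prod (%z. z) (appr n))"

context
 fixes Z :: "'z cnormed_space" and lZ rZ
 assumes Z: "contractive_bimodule L Z lZ rZ"
begin

interpretation Z: contractive_bimodule L Z lZ rZ by (rule Z)
interpretation A: normed_pair Z X by unfold_locales
interpretation B: normed_pair Z "Xc" by unfold_locales
interpretation K: weighted_relations A.S A.w "A.rspan (bibalanced_relations L Z lZ rZ X lX rX)" by (rule A.weighted_rspan[OF bibalanced_relations_subset[OF Z X]])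

lemma apprm_keys: "pkeys p <= B.S ==> pkeys (apprm n p) \<subseteq> A.S" by (rule fmap_keys[of _ B.S]) (auto simp: appr(1))

text \<open>The pattern of all approximate relations: modulo the exact relations over
  \<open>X\<close>, the approximated relation is a difference of two elementary tensors whose second
  factors approximate the same \<open>u\<close>.\<close>

lemma apprm_near:
 assumes z: "z \<in> carrier Z" and u: "u \<in> carrier Xc" and x: "!!n. x n \<in> carrier X"
  and le: "!!n. nrm Xc (u \<ominus>\<^bsub>Xc\<^esub> emb (x n)) <= D / Suc n"
  and eq: "!!n. K.pn (apprm n r) = K.pn (sng (z, appr n u) 1 - sng (z, x n) 1)" and r: "pkeys r <= B.S"
 shows "(%n. K.pn (apprm n r)) \<longlonglongrightarrow> 0" proof (rule real_tendsto_0_iff_nonneg_bound)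
 show "0 <= K.pn (apprm n r)" for n by (rule K.pn_nonneg[OF apprm_keys[OF r]])
 show "K.pn (apprm n r) <= nrm Z z * (1 + D) * inverse (real (Suc n))" for n proof -
  have "K.pn (apprm n r) <= nrm Z z * nrm X (appr n u \<ominus>\<^bsub>X\<^esub> x n)"
   unfolding eq by (rule A.pn_diff_right[OF bibalanced_relations_subset[OF Z X] z appr(1)[OF u] x])
  also have "... <= nrm Z z * ((1 + D) / Suc n)" by (rule mult_left_mono[OF nrm_appr_minus[OF u x le]]) (simp add: z)
  finally show ?thesis by (simp add: divide_inverse mult.assoc)
 qed
 show "(%n. nrm Z z * (1 + D) * inverse (real (Suc n))) \<longlonglongrightarrow> 0" using tendsto_mult[OF tendsto_const LIMSEQ_inverse_real_of_nat] by simp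
qed

text \<open>Relations of linearity in the first factor are mapped to exact relations, as
  \<open>appr\<close> does not touch that factor; the others become exact in the limit.\<close>

lemma apprm_relations:
 assumes r: "r \<in> bilinear_relations Z Xc \<union> bibalanced_relations L Z lZ rZ Xc lC rC" shows "(%n. K.pn (apprm n r)) \<longlonglongrightarrow> 0" proof -
 interpret C': contractive_bimodule L "Xc" lC rC by (rule completion_bimodule)
 have zero: ?thesis if "!!n. apprm n r \<in> A.rspan (bibalanced_relations L Z lZ rZ X lX rX)" using K.pn_K[OF that] by simp
 have rB: "pkeys r <= B.S" using r B.bilinear_relations_subset bibalanced_relations_subset[OF Z completion_bimodule] by auto
 note cong = K.pn_cong
 note inc = FM.cspan_inc[OF UnI1] and inc' = FM.cspan_inc[OF UnI2]
 from r show ?thesis proof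
  assume "r \<in> bilinear_relations Z Xc"
  then show ?thesis proof (cases rule: bilinear_relationsE)
   case (a z z' u) show ?thesis by (rule zero, rule inc) (simp add: a fmap_diff A.bilinear_relation_mem(1) appr(1))
  next
   case (c c z u) show ?thesis by (rule zero, rule inc) (simp add: c fmap_diff A.bilinear_relation_mem(3) appr(1))
  next
   case (b z u v)
   note au = appr(1)[OF b(2)] and av = appr(1)[OF b(3)] show ?thesis proof (rule apprm_near[OF b(1) C.M.a_closed[OF b(2,3)] X.M.a_closed[OF au av] appr_add[OF b(2,3)] _ rB])
    fix n
    have "sng (z, appr n u \<oplus>\<^bsub>X\<^esub> appr n v) 1 - sng (z, appr n u) 1 - sng (z, appr n v) 1 \<in> A.rspan (bibalanced_relations L Z lZ rZ X lX rX)"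
     by (rule inc[OF A.bilinear_relation_mem(2)[OF b(1) au av]])
    then show "K.pn (apprm n r) = K.pn (sng (z, appr n (u \<oplus>\<^bsub>Xc\<^esub> v)) 1 - sng (z, appr n u \<oplus>\<^bsub>X\<^esub> appr n v) 1)"
     by (intro cong) (simp add: b(4) fmap_diff fmap_add algebra_simps)
   qed
  next
   case (d c z u)
   note au = appr(1)[OF d(2)]
   have cu: "c \<odot>\<^bsub>Xc\<^esub> u \<in> carrier Xc" "c \<odot>\<^bsub>X\<^esub> appr n u \<in> carrier X" for n using d(2) au by simp_all show ?thesis
   proof (rule apprm_near[OF d(1) cu appr_smult[OF d(2)] _ rB])
    fix n
    have "sng (z, c \<odot>\<^bsub>X\<^esub> appr n u) 1 - sng (z, appr n u) c \<in> A.rspan (bibalanced_relations L Z lZ rZ X lX rX)"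
     by (rule inc[OF A.bilinear_relation_mem(4)[OF d(1) au]])
    then show "K.pn (apprm n r) = K.pn (sng (z, appr n (c \<odot>\<^bsub>Xc\<^esub> u)) 1 - sng (z, c \<odot>\<^bsub>X\<^esub> appr n u) 1)"
     by (intro cong) (simp add: d(3) fmap_diff fmap_add algebra_simps)
   qed
  qed
 next
  assume "r \<in> bibalanced_relations L Z lZ rZ Xc lC rC"
  then show ?thesis proof (cases rule: bibalanced_relationsE)
   case (1 a z u)
   note au = appr(1)[OF 1(3)] and ru = C'.ract_closed[OF 1(1,3)] show ?thesis
   proof (rule apprm_near[OF 1(2) ru X.ract_closed[OF 1(1) au] appr_map[OF bounded_rX[OF 1(1)] 1(3)] _ rB])
    fix n
    have "sng (lZ a z, appr n u) 1 - sng (z, rX (appr n u) a) 1 \<in> A.rspan (bibalanced_relations L Z lZ rZ X lX rX)"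
     by (rule inc'[OF bibalanced_relationsI(1)[OF 1(1,2) au]])
    then have "K.pn (apprm n r) = K.pn (sng (z, rX (appr n u) a) 1 - sng (z, appr n (rC u a)) 1)" by (intro cong) (simp add: 1(4) fmap_diff fmap_add algebra_simps)
    also have "... = K.pn (sng (z, appr n (rC u a)) 1 - sng (z, rX (appr n u) a) 1)"
     by (rule K.pn_minus_commute) (simp_all add: 1(2) appr(1)[OF ru] X.ract_closed[OF 1(1) au])
    finally show "K.pn (apprm n r) = K.pn (sng (z, appr n (rC u a)) 1 - sng (z, rX (appr n u) a) 1)" .
   qed
  next
   case (2 a z u)
   note au = appr(1)[OF 2(3)] and lu = C'.lact_closed[OF 2(1,3)] show ?thesis
   proof (rule apprm_near[OF 2(2) lu X.lact_closed[OF 2(1) au] appr_map[OF bounded_lX[OF 2(1)] 2(3)] _ rB])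
    fix n
    have "sng (rZ z a, appr n u) 1 - sng (z, lX a (appr n u)) 1 \<in> A.rspan (bibalanced_relations L Z lZ rZ X lX rX)"
     by (rule inc'[OF bibalanced_relationsI(2)[OF 2(1,2) au]])
    then have "K.pn (apprm n r) = K.pn (sng (z, lX a (appr n u)) 1 - sng (z, appr n (lC a u)) 1)" by (intro cong) (simp add: 2(4) fmap_diff fmap_add algebra_simps)
    also have "... = K.pn (sng (z, appr n (lC a u)) 1 - sng (z, lX a (appr n u)) 1)"
     by (rule K.pn_minus_commute) (simp_all add: 2(2) appr(1)[OF lu] X.lact_closed[OF 2(1) au])
    finally show "K.pn (apprm n r) = K.pn (sng (z, appr n (lC a u)) 1 - sng (z, lX a (appr n u)) 1)" .
   qed
  qed
 qed
qed

text \<open>The formal sums with this property form a subspace, and it contains the generating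
  relations.\<close>

lemma apprm_tendsto_0:
 assumes k: "k \<in> B.rspan (bibalanced_relations L Z lZ rZ Xc lC rC)" shows "(%n. K.pn (apprm n k)) \<longlonglongrightarrow> 0" proof -
 let ?R = "bilinear_relations Z Xc \<union> bibalanced_relations L Z lZ rZ Xc lC rC"
 let ?N = "{k. pkeys k <= B.S & (%n. K.pn (apprm n k)) \<longlonglongrightarrow> 0}"
 have R: "?R \<subseteq> ?N" using apprm_relations B.bilinear_relations_subset bibalanced_relations_subset[OF Z completion_bimodule] by auto
 have "FM.subsp B.S ?N" unfolding FM.subsp_def proof (intro conjI ballI allI)
  show "?N <= carrier (free_module B.S)" by auto
  show "\<zero>\<^bsub>free_module B.S\<^esub> \<in> ?N" using K.pn_K[OF K.K_zero] by simp
  fix k assume k: "k \<in> ?N"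
  have "(%n. cmod c * K.pn (apprm n k)) \<longlonglongrightarrow> cmod c * 0" for c using k by (intro tendsto_mult tendsto_const) simp
  then show "c \<odot>\<^bsub>free_module B.S\<^esub> k \<in> ?N" for c using k by (simp add: fmap_psc K.pn_psc apprm_keys pkeys_subset)
  fix k' assume k': "k' \<in> ?N"
  have "(%n. K.pn (apprm n (k + k'))) \<longlonglongrightarrow> 0" proof (rule real_tendsto_0_iff_nonneg_bound)
   show "(%n. K.pn (apprm n k) + K.pn (apprm n k')) \<longlonglongrightarrow> 0" using k k' tendsto_add[of _ 0 _ _ 0] by fastforce
   show "0 <= K.pn (apprm n (k + k'))" for n using k k' by (intro K.pn_nonneg apprm_keys pkeys_add_subset) simp_all
   show "K.pn (apprm n (k + k')) <= K.pn (apprm n k) + K.pn (apprm n k')" for n unfolding fmap_add using k k' by (intro K.pn_add apprm_keys) simp_all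
  qed
  then show "k \<oplus>\<^bsub>free_module B.S\<^esub> k' \<in> ?N" using k k' by (simp add: pkeys_subset)
 qed
 then have "B.rspan (bibalanced_relations L Z lZ rZ Xc lC rC) \<subseteq> ?N" by (rule FM.cspan_minimal[OF R])
 with k show ?thesis by blast
qed

text \<open>Approximation raises the norm of a second factor by at most \<open>1 / (n + 1)\<close>,
  which is weighted with the norm of the first factor.\<close>

lemma pn_apprm_le:
 assumes q: "pkeys q <= B.S" shows "K.pn (apprm n q) <= wsum B.w q + wsum (%k. nrm Z (fst k)) q * (1 / Suc n)" proof -
 have n: "nrm X (appr n u) <= nrm Xc u + 1 / Suc n" if u: "u \<in> carrier Xc" for u proof -
  note e = X.completion_embed_closed[OF appr(1)[OF u, of n]]
  have "nrm X (appr n u) = nrm Xc (emb (appr n u))" by (rule X.nrm_completion_embed[OF appr(1)[OF u], symmetric])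
  also have "... <= nrm Xc u + nrm Xc (emb (appr n u) \<ominus>\<^bsub>Xc\<^esub> u)" using C.nrm_triangle[of u "emb (appr n u) \<ominus>\<^bsub>Xc\<^esub> u"] u e
   by (simp add: a_minus_def C.M.a_ac C.M.r_neg1 C.M.r_neg2)
  also have "... <= nrm Xc u + 1 / Suc n" using appr(2)[OF u, of n] C.nrm_minus_commute[OF u e] by simp
  finally show ?thesis .
 qed
 let ?v = "%k. B.w k + nrm Z (fst k) * (1 / Suc n)"
 have "wsum A.w (apprm n q) <= 1 * wsum ?v q" proof (rule wsum_fmap[OF q, of _ A.S])
  show "map_prod (%z. z) (appr n) \<in> B.S \<rightarrow> A.S" using appr(1) by auto
  fix s assume "s \<in> B.S"
  then have s: "fst s \<in> carrier Z" "snd s \<in> carrier Xc" by auto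
  show "A.w (map_prod (%z. z) (appr n) s) <= 1 * ?v s" using mult_left_mono[OF n[OF s(2)] Z.nrm_nonneg[OF s(1)]] by (simp add: distrib_left)
 qed auto
 moreover have "wsum ?v q = wsum B.w q + wsum (%k. nrm Z (fst k)) q * (1 / Suc n)"
  unfolding wsum_def sum_distrib_right sum.distrib[symmetric] by (simp add: distrib_left mult.assoc)
 ultimately show ?thesis using K.pn_le_wsum[OF apprm_keys[OF q, of n]] by linarith
qed

text \<open>The embedding of \<open>X\<close> into its completion respects norms and relations, so
  it does not increase the seminorm. Embedding the approximants gives a formal sum close to
  \<open>p\<close>.\<close>

lemma pn_le_pn_apprm:
 assumes p: "pkeys p <= B.S" shows "pnorm B.S B.w (B.rspan (bibalanced_relations L Z lZ rZ Xc lC rC)) p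
  <= K.pn (apprm n p) + wsum (%k. nrm Z (fst k)) p * (1 / Suc n)" proof -
 let ?R = "bibalanced_relations L Z lZ rZ X lX rX" and ?R' = "bibalanced_relations L Z lZ rZ Xc lC rC"
 note R = bibalanced_relations_subset[OF Z X] and R' = bibalanced_relations_subset[OF Z completion_bimodule]
 interpret KB: weighted_relations B.S B.w "B.rspan ?R'" by (rule B.weighted_rspan[OF R'])
 note em = X.clinear_completion_embed and ec = X.completion_embed_closed
 let ?i = "map_prod (%z. z) (emb)" and ?f = "map_prod (%z. z) (%u. emb (appr n u))"
 have i: "?i \<in> A.S \<rightarrow> B.S" using ec by auto
 have f: "?f \<in> B.S \<rightarrow> B.S" using ec appr(1) by auto
 have fp: "pkeys (fmap ?f p) \<subseteq> B.S" by (rule fmap_keys[OF f p])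
 have RR: "fmap ?i r \<in> ?R'" if "r \<in> ?R" for r using that proof (cases rule: bibalanced_relationsE)
  case (1 a z x)
  then show ?thesis using bibalanced_relationsI(1)[OF 1(1,2) ec[OF 1(3)], where lX=lZ and rY=rC and rX=rZ and lY=lC]
    X.bounded_completion_map(2)[OF bounded_rX[OF 1(1)] 1(3)] by (simp add: fmap_diff)
 next
  case (2 a z x)
  then show ?thesis using bibalanced_relationsI(2)[OF 2(1,2) ec[OF 2(3)], where lX=lZ and rY=rC and rX=rZ and lY=lC]
    X.bounded_completion_map(2)[OF bounded_lX[OF 2(1)] 2(3)] by (simp add: fmap_diff)
 qed
 have "fmap ?i (apprm n p) = fmap ?f p" unfolding fmap_fmap by (simp add: map_prod_def case_prod_unfold)
 moreover have "KB.pn (fmap ?i (apprm n p)) <= 1 * K.pn (apprm n p)"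
 proof (rule pnorm_map_le[OF K.weighted_relations_axioms KB.weighted_relations_axioms clinear_fmap[OF i] _ _ _ apprm_keys[OF p]])
  show "fmap ?i k \<in> B.rspan ?R'" if "k \<in> A.rspan ?R" for k
   by (rule fmap_cspan_relations[OF Z.cvec_axioms X.cvec_axioms Z.cvec_axioms C.cvec_axioms clinear_on_id em R R' _ that])
    (rule FM.cspan_inc[OF UnI2[OF RR]])
  fix s assume "s \<in> A.S"
  then show "KB.pn (fmap ?i (sng s 1)) <= 1 * A.w s" using KB.pn_le_wsum[of "sng (?i s) 1"] ec by (auto simp: X.nrm_completion_embed)
 qed simp
 ultimately have 1: "KB.pn (fmap ?f p) <= K.pn (apprm n p)" by simp
 have "p - fmap ?f p = flift (free_module B.S) (%k. sng k 1 - sng (?f k) 1) p" using flift_free_diff[of "%k. k" B.S B.S ?f p] f p by (simp add: fmap_id)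
 also have "KB.pn ... <= wsum (%k. nrm Z (fst k) * (1 / Suc n)) p" proof (rule KB.pn_flift_le[of B.S, OF _ p])
  fix k assume k: "k \<in> B.S"
  obtain z u where kk: "k = (z, u)" "z \<in> carrier Z" "u \<in> carrier Xc" using k by auto
  show "pkeys (sng k 1 - sng (?f k) 1) \<subseteq> B.S" by (rule pkeys_diff_subset[OF pkeys_sng_subset[OF k] pkeys_sng_subset[OF funcset_mem[OF f k]]])
  have "KB.pn (sng k 1 - sng (?f k) 1) <= nrm Z z * nrm Xc (u \<ominus>\<^bsub>Xc\<^esub> emb (appr n u))"
   using B.pn_diff_right[OF R' kk(2,3) ec[OF appr(1)[OF kk(3)]]] kk(1) by simp
  also have "... <= nrm Z z * (1 / Suc n)" by (rule mult_left_mono[OF appr(2)[OF kk(3)] Z.nrm_nonneg[OF kk(2)]])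
  finally show "KB.pn (sng k 1 - sng (?f k) 1) <= nrm Z (fst k) * (1 / Suc n)" by (simp add: kk(1))
 qed
 also have "... = wsum (%k. nrm Z (fst k)) p * (1 / Suc n)" unfolding wsum_def sum_distrib_right by (simp add: mult.assoc)
 finally have "KB.pn (p - fmap ?f p) <= wsum (%k. nrm Z (fst k)) p * (1 / Suc n)" .
 with 1 KB.pn_triangle[OF p fp] show ?thesis by linarith
qed

end

text \<open>Both \<open>p\<close> and its competitor \<open>q\<close> are finite formal sums over
  the completion. They are replaced by approximants over \<open>X\<close>, where the inequality is
  known, and all errors vanish as \<open>n\<close> grows with \<open>p\<close> and \<open>q\<close>
  fixed.\<close>

lemma pnorm_fmap_completion:
 fixes Y :: "'y cnormed_space" and Z :: "'z cnormed_space"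
 assumes Y: "contractive_bimodule L Y lY rY" and Z: "contractive_bimodule L Z lZ rZ" and \<alpha>: "clinear_on Y Z \<alpha>"
  and le: "!!p. pkeys p <= carrier Y \<times> carrier X ==>
   pnorm (carrier Y \<times> carrier X) (%k. nrm Y (fst k) * nrm X (snd k))
    (cspan (fmod Y X) (bilinear_relations Y X \<union> bibalanced_relations L Y lY rY X lX rX)) p
   <= pnorm (carrier Z \<times> carrier X) (%k. nrm Z (fst k) * nrm X (snd k))
    (cspan (fmod Z X) (bilinear_relations Z X \<union> bibalanced_relations L Z lZ rZ X lX rX)) (fmap (map_prod \<alpha> (%x. x)) p)"
  and p: "pkeys p <= carrier Y \<times> carrier Xc" shows "pnorm (carrier Y \<times> carrier Xc) (%k. nrm Y (fst k) * nrm Xc (snd k))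
    (cspan (fmod Y Xc) (bilinear_relations Y Xc \<union> bibalanced_relations L Y lY rY Xc lC rC)) p
   <= pnorm (carrier Z \<times> carrier Xc) (%k. nrm Z (fst k) * nrm Xc (snd k))
    (cspan (fmod Z Xc) (bilinear_relations Z Xc \<union> bibalanced_relations L Z lZ rZ Xc lC rC))
    (fmap (map_prod \<alpha> (%x. x)) p)" proof -
 interpret Y: contractive_bimodule L Y lY rY by (rule Y)
 interpret Z: contractive_bimodule L Z lZ rZ by (rule Z)
 interpret A: normed_pair Z X by unfold_locales
 interpret B: normed_pair Z "Xc" by unfold_locales
 let ?R = "bibalanced_relations L Z lZ rZ X lX rX" and ?R' = "bibalanced_relations L Z lZ rZ Xc lC rC"
 interpret K: weighted_relations A.S A.w "A.rspan ?R" by (rule A.weighted_rspan[OF bibalanced_relations_subset[OF Z X]])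
 interpret KB: weighted_relations B.S B.w "B.rspan ?R'" by (rule B.weighted_rspan[OF bibalanced_relations_subset[OF Z completion_bimodule]])
 let ?j = "map_prod \<alpha> (%u. u)"
 have j: "?j \<in> carrier Y \<times> carrier Xc \<rightarrow> B.S" using clinear_onD(1)[OF \<alpha>] by auto
 have jp: "pkeys (fmap ?j p) \<subseteq> B.S" by (rule fmap_keys[OF j p]) show ?thesis proof (rule KB.pn_greatest[OF jp])
  fix q assume q: "pkeys q <= B.S" "q - fmap ?j p \<in> B.rspan ?R'"
  define c where "c = wsum (%k. nrm Y (fst k)) p"
  define c' where "c' = wsum (%k. nrm Z (fst k)) q"
  let ?pn = "pnorm (carrier Y \<times> carrier Xc) (%k. nrm Y (fst k) * nrm Xc (snd k))
    (cspan (fmod Y Xc) (bilinear_relations Y Xc \<union> bibalanced_relations L Y lY rY Xc lC rC)) p"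
  \<comment> \<open>From left to right: \<open>p\<close> against its approximation, the known
    inequality over \<open>X\<close>, the approximation of \<open>q\<close>, and the relation
    \<open>q - fmap ?j p\<close>, which holds only approximately after approximation.\<close>
  have bound: "?pn <= wsum B.w q + (c' + c) * (1 / Suc n) + K.pn (apprm n (q - fmap ?j p))" for n proof -
   note ak = apprm_keys[OF Z q(1), of n] apprm_keys[OF Z jp, of n]
   have kp: "pkeys (apprm n p) <= carrier Y \<times> carrier X" by (rule apprm_keys[OF Y p])
   \<comment> \<open>The morphism acts on the first factor and the approximation on the second, so
     they commute although \<open>appr\<close> is not linear.\<close>
   have eq: "fmap (map_prod \<alpha> (%x. x)) (apprm n p) = apprm n (fmap ?j p)" unfolding fmap_fmap by (simp add: map_prod_def case_prod_unfold)
   have "K.pn (apprm n (fmap ?j p)) <= K.pn (apprm n q) + K.pn (apprm n (fmap ?j p) - apprm n q)" by (rule K.pn_triangle[OF ak(2,1)])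
   also have "K.pn (apprm n (fmap ?j p) - apprm n q) = K.pn (apprm n (q - fmap ?j p))" unfolding fmap_diff by (rule K.pn_minus_commute[OF ak(2,1)])
   finally have "K.pn (apprm n (fmap ?j p)) <= K.pn (apprm n q) + K.pn (apprm n (q - fmap ?j p))" .
   with pn_le_pn_apprm[OF Y p, of n] pn_apprm_le[OF Z q(1), of n] le[OF kp] show ?thesis unfolding eq c_def[symmetric] c'_def[symmetric] distrib_right by linarith
  qed
  have "(%n. wsum B.w q + (c' + c) * inverse (real (Suc n)) + K.pn (apprm n (q - fmap ?j p))) \<longlonglongrightarrow> wsum B.w q + (c' + c) * 0 + 0"
   by (intro tendsto_add tendsto_mult tendsto_const LIMSEQ_inverse_real_of_nat apprm_tendsto_0[OF Z q(2)])
  then show "?pn <= wsum B.w q" using bound by (intro LIMSEQ_le_const[of _ "wsum B.w q"]) (auto simp: divide_inverse)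
 qed
qed

end

context bicolumns
begin

theorem ER_flat_completion_bicolumns:
 assumes "infinite_dimensional L"
 shows "ER_flat L (completion P) (%a. completion_map P (lP a)) (%u a. completion_map P (%v. rP v a) u) TYPE('v) TYPE('z)"
proof (rule ER_flatI[OF completion_bimodule[OF L.hilbert_space_axioms bimodule_P]])
 fix Y :: "'v cnormed_space" and lY rY and Z :: "'z cnormed_space" and lZ rZ \<alpha>
  and p :: "'v \<times> (nat => ('x \<times> 'y \<Rightarrow>\<^sub>0 complex) set) set \<Rightarrow>\<^sub>0 complex"
 assume Y: "ruan_bimodule L Y lY rY" and Z: "ruan_bimodule L Z lZ rZ"
  and \<alpha>: "left_morphism L Y lY Z lZ \<alpha>" "right_morphism L Y rY Z rZ \<alpha>" "isometric_on Y Z \<alpha>"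
  and p: "pkeys p <= carrier Y \<times> carrier (completion P)"
 have al: "clinear_on Y Z \<alpha>" using \<alpha>(1) by (simp add: left_morphism_def)
 note b = ruan_bimodule.axioms(1)
 show "pnorm (carrier Y \<times> carrier (completion P)) (%k. nrm Y (fst k) * nrm (completion P) (snd k))
    (cspan (fmod Y (completion P)) (bilinear_relations Y (completion P) \<union>
     bibalanced_relations L Y lY rY (completion P) (%a. completion_map P (lP a)) (%u a. completion_map P (%v. rP v a) u))) p
   <= pnorm (carrier Z \<times> carrier (completion P)) (%k. nrm Z (fst k) * nrm (completion P) (snd k))
    (cspan (fmod Z (completion P)) (bilinear_relations Z (completion P) \<union>
     bibalanced_relations L Z lZ rZ (completion P) (%a. completion_map P (lP a)) (%u a. completion_map P (%v. rP v a) u)))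
    (fmap (map_prod \<alpha> (%x. x)) p)"
  by (rule pnorm_fmap_completion[OF L.hilbert_space_axioms bimodule_P b[OF Y] b[OF Z] al pnorm_fmap_bicolumns[OF assms Y Z \<alpha>] p])
qed

end

theorem theorem2:
  fixes L :: "'l cinner_space" and H :: "'h cinner_space" and K :: "'k cinner_space"
  assumes "hilbert_space L" and "separable_normed (normed_of L)" and "infinite_dimensional L"
    and "hilbert_space H" and "hilbert_space K"
  shows
    "ESR_flat L (alg_hilbert_tensor (conj_space L) H) (hilbert_ract L H) TYPE('y) TYPE('z) \<and>
     ESR_flat L (hilbert_tensor (conj_space L) H) (hilbert_ract L H) TYPE('y) TYPE('z) \<and>
     (let X = alg_hilbert_tensor L H; Y = alg_hilbert_tensor (conj_space L) K in
       ER_flat L (proj_tensor X Y)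
         (proj_lact X (ampliation L H) Y) (proj_ract X Y (hilbert_ract L K))
         TYPE('y) TYPE('z)) \<and>
     (let X = hilbert_tensor L H; Y = hilbert_tensor (conj_space L) K in
       ER_flat L (proj_tensor X Y)
         (proj_lact X (ampliation L H) Y) (proj_ract X Y (hilbert_ract L K))
         TYPE('y) TYPE('z) \<and>
       ER_flat L (completion (proj_tensor X Y))
         (\<lambda>a. completion_map (proj_tensor X Y) (proj_lact X (ampliation L H) Y a))
         (\<lambda>u a. completion_map (proj_tensor X Y) (\<lambda>v. proj_ract X Y (hilbert_ract L K) v a) u)
         TYPE('y) TYPE('z))"
proof -
  note L = \<open>hilbert_space L\<close> and inf = \<open>infinite_dimensional L\<close>
  note H = \<open>hilbert_space H\<close> and K = \<open>hilbert_space K\<close>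
  have pair: "hilbert_pair M N" if "hilbert_space M" "hilbert_space N" for M :: "'l cinner_space" and N :: "'n cinner_space"
  proof -
    interpret M: hilbert_space M by fact
    interpret N: hilbert_space N by fact
    show ?thesis by unfold_locales
  qed
  note c = hilbert_space_conj_space[OF L]
  \<comment> \<open>Brings the right multiplication into the form \<open>ract\<close> of
    \<open>conj_columns\<close>, for which the flatness theorems are stated.\<close>
  have r: "hilbert_ract L N = (\<lambda>\<zeta> a. ampliation (conj_space L) N (adjoint_op L a) \<zeta>)" for N :: "'n cinner_space"
    by (intro ext) (simp add: hilbert_ract_def)
  \<comment> \<open>The completed and the algebraic tensor products enter as two instances, in this
    order, of the same locale.\<close>
  note col = hilbert_pair.columns_hilbert_tensor[OF pair[OF L H]] hilbert_pair.columns_alg_hilbert_tensor[OF pair[OF L H]]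
  note conjH = conj_columns.intro[OF L hilbert_pair.columns_hilbert_tensor[OF pair[OF c H]]]
    conj_columns.intro[OF L hilbert_pair.columns_alg_hilbert_tensor[OF pair[OF c H]]]
  note conjK = conj_columns.intro[OF L hilbert_pair.columns_hilbert_tensor[OF pair[OF c K]]]
    conj_columns.intro[OF L hilbert_pair.columns_alg_hilbert_tensor[OF pair[OF c K]]]
  note bi = bicolumns.intro[OF L col(1) conjK(1)] bicolumns.intro[OF L col(2) conjK(2)]
  show ?thesis
    unfolding Let_def r
    by (intro conjI conj_columns.ESR_flat_columns[OF conjH(1) inf] conj_columns.ESR_flat_columns[OF conjH(2) inf]
        bicolumns.ER_flat_bicolumns[OF bi(1) inf] bicolumns.ER_flat_bicolumns[OF bi(2) inf]
        bicolumns.ER_flat_completion_bicolumns[OF bi(1) inf])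
qed

end
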